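(* Let $G$ be a connected $d$-regular Lichnerowicz-sharp graph, and let $m_2(G)$ be the multiplicity of the eigenvalue $2$ of $-L$ on $G$. (i) If $m_2(G)\ge d-1$, then $G\cong H_d$. (ii) If $m_2(G)=d-2$, then $G\cong H_{d-2}\,\square\,K_3$. (iii) If $m_2(G)=d-3$, then $G\cong H_{d-3}\,\square\,K_4$ or $G\cong H_{d-3}\,\square\,K_{3,3}$.
   Context: All graphs are simple, finite, connected and unweighted. For $f:V(G)\to\mathbb{R}$ put $Lf(x)=\sum_{y\sim x}(f(y)-f(x))$. The eigenvalues of $-L$ are $0=\lambda_0<\lambda_1\le\lambda_2\le\cdots$, counted with multiplicity. The Bakry--Émery operators are $2\Gamma(f,g)=L(fg)-fLg-gLf$ and $2\Gamma_2(f,g)=L\Gamma(f,g)-\Gamma(f,Lg)-\Gamma(g,Lf)$, with $\Gamma(f)=\Gamma(f,f)$ and $\Gamma_2(f)=\Gamma_2(f,f)$. $G$ satisfies $\mathrm{CD}(K,\infty)$ if $\Gamma_2(f)(x)\ge K\,\Gamma(f)(x)$ for all $f:V(G)\to\mathbb{R}$ and all $x\in V(G)$. $G$ is Lichnerowicz-sharp if, for some $K>0$, it satisfies $\mathrm{CD}(K,\infty)$ and $\lambda_1(G)=K$. $H_r$ is the $r$-dimensional hypercube: vertex set $\mathbb{F}_2^r$, two vertices adjacent iff they differ in exactly one coordinate ($H_0$ is the one-vertex graph). $\square$ denotes the Cartesian product of graphs, $K_n$ the complete graph and $K_{3,3}$ the complete bipartite graph. *)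

theory Defs
  imports
    Complex_Main
    "HOL-Library.Function_Algebras"
    "HOL-Library.FuncSet"
    "HOL-Library.Multiset"
    "HOL-Library.Z2"
    "Graph_Theory.Pair_Digraph"
    "Graph_Theory.Digraph_Isomorphism"
    "Graph_Theory.Kuratowski"
begin

text \<open>
  A finite simple graph is a \<^locale>\<open>pair_graph\<close>: a finite vertex set with a finite symmetric
  irreflexive set of arcs, each undirected edge being present as both of its orientations.
  In particular the degree of a vertex is its out-degree. A function on the vertex set is
  represented by a total function; the operators below, evaluated at a vertex, depend only on
  its values on the vertex set.
\<close>

section \<open>Laplacian and Bakry-Emery curvature\<close>

definition laplacian :: "'a pair_pre_digraph \<Rightarrow> ('a \<Rightarrow> real) \<Rightarrow> 'a \<Rightarrow> real" where
  "laplacian G f x = (\<Sum>y | (x, y) \<in> parcs G. f y - f x)"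

definition Gam :: "'a pair_pre_digraph \<Rightarrow> ('a \<Rightarrow> real) \<Rightarrow> ('a \<Rightarrow> real) \<Rightarrow> 'a \<Rightarrow> real" where
  "Gam G f g x =
    (laplacian G (\<lambda>y. f y * g y) x - f x * laplacian G g x - g x * laplacian G f x) / 2"

definition Gam2 :: "'a pair_pre_digraph \<Rightarrow> ('a \<Rightarrow> real) \<Rightarrow> ('a \<Rightarrow> real) \<Rightarrow> 'a \<Rightarrow> real" where
  "Gam2 G f g x =
    (laplacian G (Gam G f g) x - Gam G f (laplacian G g) x - Gam G g (laplacian G f) x) / 2"

definition CD_inf :: "'a pair_pre_digraph \<Rightarrow> real \<Rightarrow> bool" where
  "CD_inf G K \<longleftrightarrow> (\<forall>f. \<forall>x \<in> pverts G. Gam2 G f f x \<ge> K * Gam G f f x)"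

section \<open>Spectrum\<close>

global_interpretation fun_space: vector_space "\<lambda>(c :: real) (f :: 'a \<Rightarrow> real) x. c * f x"
  by unfold_locales (auto simp: fun_eq_iff algebra_simps)

text \<open>
  Functions on the vertex set are identified with functions vanishing outside it, so that
  the dimension of an eigenspace is not distorted by irrelevant values.
\<close>

definition eigenspace :: "'a pair_pre_digraph \<Rightarrow> real \<Rightarrow> ('a \<Rightarrow> real) set" where
  "eigenspace G \<mu> =
    {f. (\<forall>x. x \<notin> pverts G \<longrightarrow> f x = 0) \<and> (\<forall>x \<in> pverts G. - laplacian G f x = \<mu> * f x)}"

definition eigenvalues :: "'a pair_pre_digraph \<Rightarrow> real set" where
  "eigenvalues G = {\<mu>. \<exists>f \<in> eigenspace G \<mu>. f \<noteq> 0}"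

definition eigenvalue_mult :: "'a pair_pre_digraph \<Rightarrow> real \<Rightarrow> nat" where
  "eigenvalue_mult G \<mu> = fun_space.dim (eigenspace G \<mu>)"

definition spectrum :: "'a pair_pre_digraph \<Rightarrow> real list" where
  "spectrum G =
    sorted_list_of_multiset (\<Sum>\<mu> \<in> eigenvalues G. replicate_mset (eigenvalue_mult G \<mu>) \<mu>)"

text \<open>
  The eigenvalue of index 1 exists only if there are at least two vertices; the length condition
  makes this explicit, so the one-vertex graph is not Lichnerowicz-sharp.
\<close>

definition lichnerowicz_sharp :: "'a pair_pre_digraph \<Rightarrow> bool" where
  "lichnerowicz_sharp G \<longleftrightarrow>
    (\<exists>K > 0. CD_inf G K \<and> 1 < length (spectrum G) \<and> spectrum G ! 1 = K)"

section \<open>Model graphs\<close>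

definition hypercube :: "nat \<Rightarrow> (nat \<Rightarrow> bit) pair_pre_digraph" where
  "hypercube r =
    \<lparr> pverts = {..<r} \<rightarrow>\<^sub>E UNIV,
      parcs = {(x, y). x \<in> {..<r} \<rightarrow>\<^sub>E UNIV \<and> y \<in> {..<r} \<rightarrow>\<^sub>E UNIV
                       \<and> card {i. i < r \<and> x i \<noteq> y i} = 1} \<rparr>"

definition complete_graph :: "nat \<Rightarrow> nat pair_pre_digraph" where
  "complete_graph n =
    \<lparr> pverts = {..<n}, parcs = {(x, y). x < n \<and> y < n \<and> x \<noteq> y} \<rparr>"

definition complete_bipartite_graph :: "nat \<Rightarrow> nat \<Rightarrow> (nat + nat) pair_pre_digraph" where
  "complete_bipartite_graph m n =
    \<lparr> pverts = {..<m} <+> {..<n},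
      parcs = Inl ` {..<m} \<times> Inr ` {..<n} \<union> Inr ` {..<n} \<times> Inl ` {..<m} \<rparr>"

definition cart_prod ::
    "'a pair_pre_digraph \<Rightarrow> 'b pair_pre_digraph \<Rightarrow> ('a \<times> 'b) pair_pre_digraph"
    (infixr \<open>\<box>\<close> 70) where
  "G \<box> H =
    \<lparr> pverts = pverts G \<times> pverts H,
      parcs = {((a, b), (a', b')). a = a' \<and> a \<in> pverts G \<and> (b, b') \<in> parcs H
                                 \<or> (a, a') \<in> parcs G \<and> b = b' \<and> b \<in> pverts H} \<rparr>"

abbreviation graph_iso :: "'a pair_pre_digraph \<Rightarrow> 'b pair_pre_digraph \<Rightarrow> bool"
    (infix \<open>\<cong>\<close> 50) where
  "G \<cong> H \<equiv> digraph_iso (with_proj G) (with_proj H)"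

section \<open>The model graphs are the ones of the library\<close>

lemma complete_graph_complete_digraph:
  "complete_digraph n (with_proj (complete_graph n))"
  by (auto simp: complete_digraph_pair_def complete_graph_def)

lemma complete_bipartite_graph_complete_bipartite_digraph:
  "complete_bipartite_digraph m n (with_proj (complete_bipartite_graph m n))"
  unfolding complete_bipartite_digraph_pair_def complete_bipartite_graph_def
  by (simp, intro exI[of _ "Inl ` {..<m}"] exI[of _ "Inr ` {..<n}"])
    (auto simp: Plus_def card_image)

lemma pair_graph_hypercube: "pair_graph (hypercube r)"
proof -
  have "b \<in> {0, 1}" for b :: bit
    by (cases b) simp_all
  then have "(UNIV :: bit set) \<subseteq> {0, 1}"
    by blast
  then have "finite (UNIV :: bit set)"
    by (rule finite_subset) simp
  then have fin: "finite ({..<r} \<rightarrow>\<^sub>E (UNIV :: bit set))"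
    by (intro finite_PiE) auto
  have "parcs (hypercube r) \<subseteq> ({..<r} \<rightarrow>\<^sub>E UNIV) \<times> ({..<r} \<rightarrow>\<^sub>E UNIV)"
    by (auto simp: hypercube_def)
  then have "finite (parcs (hypercube r))"
    using fin by (meson finite_SigmaI finite_subset)
  moreover have "sym (parcs (hypercube r))"
  proof (rule symI)
    fix x y assume "(x, y) \<in> parcs (hypercube r)"
    moreover have "{i. i < r \<and> x i \<noteq> y i} = {i. i < r \<and> y i \<noteq> x i}"
      by auto
    ultimately show "(y, x) \<in> parcs (hypercube r)"
      by (simp add: hypercube_def)
  qed
  moreover have "finite (pverts (hypercube r))"
    using fin by (simp add: hypercube_def)
  moreover have "x \<in> pverts (hypercube r) \<and> y \<in> pverts (hypercube r) \<and> x \<noteq> y"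
    if "(x, y) \<in> parcs (hypercube r)" for x y
  proof -
    have "card {i. i < r \<and> x i \<noteq> y i} = 1"
      using that by (simp add: hypercube_def)
    then have "{i. i < r \<and> x i \<noteq> y i} \<noteq> {}"
      by (metis card.empty zero_neq_one)
    then have "x \<noteq> y"
      by blast
    moreover have "x \<in> pverts (hypercube r)" "y \<in> pverts (hypercube r)"
      using that by (simp_all add: hypercube_def)
    ultimately show ?thesis
      by blast
  qed
  then have "fst e \<in> pverts (hypercube r) \<and> snd e \<in> pverts (hypercube r) \<and> fst e \<noteq> snd e"
    if "e \<in> parcs (hypercube r)" for e
    using that by (cases e) simp
  ultimately show ?thesis
    by unfold_locales (simp_all add: symmetric_def)
qed

lemma pair_graph_cart_prod:
  assumes "pair_graph G" "pair_graph H"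
  shows "pair_graph (G \<box> H)"
proof -
  interpret G: pair_graph G by fact
  interpret H: pair_graph H by fact
  have "sym (parcs G)" "sym (parcs H)"
    using G.sym_arcs H.sym_arcs by (auto simp: symmetric_def)
  then have "sym (parcs (G \<box> H))"
    unfolding sym_def cart_prod_def by auto
  moreover have "finite (pverts (G \<box> H))"
    using G.pair_finite_verts H.pair_finite_verts by (simp add: cart_prod_def)
  moreover have arcs: "fst e \<in> pverts (G \<box> H) \<and> snd e \<in> pverts (G \<box> H) \<and> fst e \<noteq> snd e"
    if "e \<in> parcs (G \<box> H)" for e
    using that by (auto simp: cart_prod_def dest: G.wellformed' H.wellformed' G.pair_no_loops H.pair_no_loops)
  moreover have "finite (parcs (G \<box> H))"
    by (rule finite_subset[of _ "pverts (G \<box> H) \<times> pverts (G \<box> H)"])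
      (use arcs in force, use \<open>finite (pverts (G \<box> H))\<close> in simp)
  ultimately show ?thesis
    by unfold_locales (simp_all add: symmetric_def)
qed

text \<open>Isomorphism of simple graphs in terms of vertices only.\<close>

lemma graph_iso_iff:
  assumes "pair_wf_digraph G" "pair_wf_digraph H"
  shows "G \<cong> H \<longleftrightarrow>
    (\<exists>f. bij_betw f (pverts G) (pverts H) \<and>
      (\<forall>x \<in> pverts G. \<forall>y \<in> pverts G. (x, y) \<in> parcs G \<longleftrightarrow> (f x, f y) \<in> parcs H))"
    (is "?L \<longleftrightarrow> ?R")
proof
  interpret G: pair_wf_digraph G by fact
  interpret H: pair_wf_digraph H by fact
  {
    assume ?L
    then obtain h where h: "G.digraph_isomorphism h" and H: "with_proj H = app_iso h (with_proj G)"
      by (auto simp: digraph_iso_def)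
    have eqs: "pverts H = iso_verts h ` pverts G" "parcs H = iso_arcs h ` parcs G"
      "iso_tail h = fst" "iso_head h = snd"
      using arg_cong[OF H, of verts] arg_cong[OF H, of arcs] arg_cong[OF H, of tail]
        arg_cong[OF H, of head] by simp_all
    let ?f = "iso_verts h"
    have inj: "inj_on ?f (pverts G)"
      using h by (simp add: G.digraph_isomorphism_def)
    have arc: "iso_arcs h e = (?f (fst e), ?f (snd e))" if "e \<in> parcs G" for e
      using h that eqs(3,4) by (simp add: G.digraph_isomorphism_def prod_eq_iff)
    have "(x, y) \<in> parcs G \<longleftrightarrow> (?f x, ?f y) \<in> parcs H" if "x \<in> pverts G" "y \<in> pverts G" for x y
    proof
      assume "(x, y) \<in> parcs G"
      then show "(?f x, ?f y) \<in> parcs H" using arc[of "(x, y)"] eqs(2) by force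
    next
      assume "(?f x, ?f y) \<in> parcs H"
      then obtain u v where uv: "(u, v) \<in> parcs G" "(?f x, ?f y) = (?f u, ?f v)"
        using eqs(2) arc by force
      then have "x = u" "y = v"
        using inj that G.wellformed'[of u v] by (auto dest: inj_onD)
      with uv show "(x, y) \<in> parcs G" by simp
    qed
    with inj eqs(1) show ?R by (auto simp: bij_betw_def intro!: exI[of _ ?f])
  }
  {
    assume ?R
    then obtain f where f: "inj_on f (pverts G)" "pverts H = f ` pverts G"
      and adj: "\<And>x y. x \<in> pverts G \<Longrightarrow> y \<in> pverts G \<Longrightarrow> (x, y) \<in> parcs G \<longleftrightarrow> (f x, f y) \<in> parcs H"
      by (auto simp: bij_betw_def)
    let ?h = "\<lparr> iso_verts = f, iso_arcs = map_prod f f, iso_head = snd, iso_tail = fst \<rparr>"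
    have inj2: "inj_on (map_prod f f) (parcs G)"
      by (rule inj_on_subset[OF map_prod_inj_on[OF f(1) f(1)]]) (auto dest: G.wellformed')
    have "parcs H = map_prod f f ` parcs G"
    proof (intro equalityI subsetI)
      fix e assume e: "e \<in> parcs H"
      then have "fst e \<in> f ` pverts G" "snd e \<in> f ` pverts G"
        using H.wellformed'[of "fst e" "snd e"] f(2) by auto
      then obtain x y where "x \<in> pverts G" "y \<in> pverts G" "e = (f x, f y)"
        by (metis imageE prod.collapse)
      then show "e \<in> map_prod f f ` parcs G" using adj e by force
    next
      fix e assume "e \<in> map_prod f f ` parcs G"
      then show "e \<in> parcs H" using adj by (auto dest: G.wellformed')
    qed
    then have "with_proj H = app_iso ?h (with_proj G)"
      using f(2) by (simp add: app_iso_def with_proj_def)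
    moreover have "G.digraph_isomorphism ?h"
      using f(1) inj2 by (auto simp: G.digraph_isomorphism_def G.wf_digraph)
    ultimately show ?L by (auto simp: digraph_iso_def)
  }
qed

end

theory Submission
  imports Defs
begin

text \<open>
  Testing the curvature form of an extremal eigenfunction against a truncated distance function
  shows that its maximum would vanish if the curvature were below 2; so a sharp graph has curvature
  at least 2, and only this is used of the sharpness. Let \<open>E\<close> be the eigenspace of 2.

  Equality in the curvature inequality makes \<open>E\<close> rigid. At a local maximum \<open>x\<close> of \<open>f \<in> E\<close>, the
  block of those neighbours of \<open>x\<close> at which \<open>f\<close> is smaller is matched perfectly with the
  corresponding block of every vertex of the level component of \<open>x\<close>, and \<open>E\<close> is closed under
  a symmetric triple product. If a block has a single vertex, the graph is the product of an edge
  and a level component, which has degree \<open>d - 1\<close> and an eigenspace of dimension one less.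
  It remains to find such a block while \<open>0 < dim E\<close> and \<open>d \<le> dim E + 3\<close>. If the minimal blocks have
  size two, the bottom vertices of the squares over a level component, and the two-fold cover
  formed by the blocks, either produce a cut meeting every vertex in one edge, or lead
  to a graph of the same kind and degree \<open>d - 2\<close> that has twice as many vertices as another one,
  which contradicts the sizes known by induction. Larger minimal blocks force
  \<open>dim E = 1\<close> and \<open>d \<le> 4\<close>, and then the graph is determined closely enough to exhibit a cut.

  Splitting off edges as long as possible leaves a graph of degree \<open>k \<le> 3\<close> with \<open>E = 0\<close>: a point,
  a triangle, \<open>K\<^sub>4\<close> or \<open>K\<^sub>3\<^sub>,\<^sub>3\<close>.
\<close>

section \<open>Regular graphs with curvature at least 2\<close>

text \<open>The rigidity has one source. A function at which a positive semidefinite form vanishes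
  lies in the radical of the form, so an element of \<open>E\<close> may be tested against the
  indicator of any vertex \<open>w\<close>; the outcome is a linear relation on the common
  neighbours of \<open>x\<close> and \<open>w\<close>, and nearly every structural step is this
  relation read at a suitable pair of vertices. The hypercube is the model: its coordinate functions
  have eigenvalue 2 and span \<open>E\<close>, the block of a function at a maximum collects the
  directions in which it descends, and functions with minimal blocks ought to be coordinate
  functions. The obstacle is that nothing linear forces a minimal block to be a single vertex.
  Squares may be glued over a level component so that a closed walk exchanges their two middle
  vertices, and then neither coordinate of the square exists globally; hence the two-fold cover, and
  hence a count of vertices instead of a dimension estimate to finish that case. The bound
  \<open>d \<le> dim E + 3\<close> confines larger blocks to degree at most four, where the graph
  can be rebuilt from cubes.\<close>

definition lap :: "('a \<Rightarrow> 'a set) \<Rightarrow> ('a \<Rightarrow> real) \<Rightarrow> 'a \<Rightarrow> real" where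
  "lap nb f x = (\<Sum>y\<in>nb x. f y - f x)"

definition grad :: "('a \<Rightarrow> 'a set) \<Rightarrow> ('a \<Rightarrow> real) \<Rightarrow> ('a \<Rightarrow> real) \<Rightarrow> 'a \<Rightarrow> real" where
  "grad nb f g x = (\<Sum>y\<in>nb x. (f y - f x) * (g y - g x))"

definition bform :: "('a \<Rightarrow> 'a set) \<Rightarrow> nat \<Rightarrow> 'a \<Rightarrow> ('a \<Rightarrow> real) \<Rightarrow> ('a \<Rightarrow> real) \<Rightarrow> real" where
  "bform nb d x f g =
    (\<Sum>y\<in>nb x. \<Sum>z\<in>nb y. (f z - 2 * f y + f x) * (g z - 2 * g y + g x))
      + 2 * lap nb f x * lap nb g x - (2 * d + 4) * grad nb f g x"

definition eig2 :: "'a set \<Rightarrow> ('a \<Rightarrow> 'a set) \<Rightarrow> ('a \<Rightarrow> real) set" where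
  "eig2 V nb = {f. (\<forall>x. x \<notin> V \<longrightarrow> f x = 0) \<and> (\<forall>x\<in>V. lap nb f x = - 2 * f x)}"

text \<open>A nonnegative polynomial in \<open>t\<close> that vanishes at 0 has a minimum there, so
  its derivative at 0 is zero.\<close>

lemma quadratic_nonneg_linear_zero:
  fixes b c :: real
  assumes "\<And>t. 0 \<le> 2 * t * b + t^2 * c"
  shows "b = 0"
proof (rule ccontr)
  assume b: "b \<noteq> 0"
  have c: "c \<ge> 0" using assms[of 1] assms[of "-1"] by simp
  \<comment> \<open>Dividing by \<open>c + 1\<close> instead of \<open>c\<close> covers the
    degenerate case \<open>c = 0\<close>.\<close>
  have "2 * (- b / (c + 1)) * b + (- b / (c + 1))^2 * c = - (b^2 * (c + 2)) / (c + 1)^2"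
    using c by (simp add: divide_simps) (simp add: power2_eq_square algebra_simps)
  moreover have "\<dots> < 0" using b c by (simp add: divide_neg_pos)
  ultimately show False using assms[of "- b / (c + 1)"] by simp
qed

text \<open>Connectivity is the absence of a proper nonempty set closed under neighbours. In this
  form it serves directly both for maximum principles and for showing that an explicit list of
  vertices exhausts \<open>V\<close>. By \<open>adjV\<close> the neighbourhood of a point outside
  \<open>V\<close> is empty.\<close>

locale regular_graph =
  fixes V :: "'a set" and nb :: "'a \<Rightarrow> 'a set" and d :: nat
  assumes finV: "finite V"
    and V_ne: "V \<noteq> {}"
    and adjV: "y \<in> nb x \<Longrightarrow> x \<in> V \<and> y \<in> V"
    and adj_sym: "y \<in> nb x \<Longrightarrow> x \<in> nb y"
    and adj_irr: "x \<notin> nb x"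
    and reg: "x \<in> V \<Longrightarrow> card (nb x) = d"
    and conn: "S \<subseteq> V \<Longrightarrow> S \<noteq> {} \<Longrightarrow> (\<And>x y. x \<in> S \<Longrightarrow> y \<in> nb x \<Longrightarrow> y \<in> S) \<Longrightarrow> S = V"
begin

lemma fin_nb [simp, intro]: "finite (nb x)"
  by (rule finite_subset[OF _ finV]) (auto dest: adjV)

lemma adj_comm: "y \<in> nb x \<longleftrightarrow> x \<in> nb y"
  using adj_sym by blast

lemma inner_sum:
  fixes f u :: "'a \<Rightarrow> real"
  assumes "y \<in> V"
  shows "(\<Sum>z\<in>nb y. (f z - 2 * f y + f x) * (u z - 2 * u y + u x)) =
    grad nb f u y - (u y - u x) * lap nb f y - (f y - f x) * lap nb u y
      + d * ((f y - f x) * (u y - u x))"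
proof -
  have "(\<Sum>z\<in>nb y. (f z - 2 * f y + f x) * (u z - 2 * u y + u x)) =
    (\<Sum>z\<in>nb y. (f z - f y) * (u z - u y) - (u y - u x) * (f z - f y)
      - (f y - f x) * (u z - u y) + (f y - f x) * (u y - u x))"
    by (rule sum.cong) (auto simp: algebra_simps)
  then show ?thesis
    using reg[OF assms]
    by (simp only: sum.distrib sum_subtractf sum_distrib_left[symmetric] grad_def lap_def sum_constant)
      (simp add: algebra_simps)
qed

text \<open>The products of second differences in the curvature form are expanded at
  \<open>y\<close> by \<open>inner_sum\<close>. The coefficient \<open>2 * d\<close> of the form is
  made up of the degree of \<open>x\<close> and the degree of \<open>y\<close>, which agree by
  regularity.\<close>

lemma bochner:
  fixes f u :: "'a \<Rightarrow> real"
  assumes x: "x \<in> V"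
  shows "lap nb (grad nb f u) x - grad nb f (lap nb u) x - grad nb u (lap nb f) x =
    bform nb d x f u + 4 * grad nb f u x"
proof -
  let ?L = "lap nb"
  have "?L (grad nb f u) x - grad nb f (?L u) x - grad nb u (?L f) x =
    (\<Sum>y\<in>nb x. grad nb f u y - grad nb f u x - (f y - f x) * (?L u y - ?L u x)
      - (u y - u x) * (?L f y - ?L f x))"
    unfolding lap_def[of nb "grad nb f u" x] grad_def[of nb _ "lap nb _" x] sum_subtractf ..
  also have "\<dots> = (\<Sum>y\<in>nb x. (\<Sum>z\<in>nb y. (f z - 2 * f y + f x) * (u z - 2 * u y + u x))
      - grad nb f u x + (f y - f x) * ?L u x + (u y - u x) * ?L f x
      - d * ((f y - f x) * (u y - u x)))"
  proof (rule sum.cong[OF refl])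
    fix y assume "y \<in> nb x"
    then have y: "y \<in> V" using adjV by blast
    show "grad nb f u y - grad nb f u x - (f y - f x) * (?L u y - ?L u x)
        - (u y - u x) * (?L f y - ?L f x) =
      (\<Sum>z\<in>nb y. (f z - 2 * f y + f x) * (u z - 2 * u y + u x))
        - grad nb f u x + (f y - f x) * ?L u x + (u y - u x) * ?L f x
        - d * ((f y - f x) * (u y - u x))"
      unfolding inner_sum[OF y] by (simp add: right_diff_distrib)
  qed
  also have "\<dots> = (\<Sum>y\<in>nb x. \<Sum>z\<in>nb y. (f z - 2 * f y + f x) * (u z - 2 * u y + u x))
      - d * grad nb f u x + ?L f x * ?L u x + ?L u x * ?L f x - d * grad nb f u x"
    using reg[OF x]
    by (simp only: sum.distrib sum_subtractf sum_distrib_left[symmetric] sum_distrib_right[symmetric]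
        sum_constant lap_def[of nb _ x, symmetric] grad_def[of nb _ _ x, symmetric])
      (simp add: lap_def[of nb _ x] sum_subtractf algebra_simps)
  finally show ?thesis by (simp add: bform_def algebra_simps)
qed

text \<open>Maximum principle: at a maximum all increments are nonpositive while their sum is
  nonnegative, so the set where the maximum is attained is closed under neighbours.\<close>

lemma subharmonic_const:
  assumes "\<And>x. x \<in> V \<Longrightarrow> lap nb h x \<ge> 0" "x \<in> V" "y \<in> V"
  shows "h x = h y"
proof -
  define M where "M = Max (h ` V)"
  have le: "h u \<le> M" if "u \<in> V" for u
    unfolding M_def using that finV by simp
  have "M \<in> h ` V"
    unfolding M_def using finV V_ne by (intro Max_in) auto
  then have nonempty: "{u \<in> V. h u = M} \<noteq> {}" by auto
  have closed: "v \<in> {u \<in> V. h u = M}" if "u \<in> {u \<in> V. h u = M}" "v \<in> nb u" for u v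
  proof -
    have "\<And>w. w \<in> nb u \<Longrightarrow> h w - h u \<le> 0"
      using that le adjV by fastforce
    moreover have "(\<Sum>w\<in>nb u. h w - h u) \<ge> 0"
      using assms(1) that by (auto simp: lap_def)
    ultimately have "(\<Sum>w\<in>nb u. h w - h u) = 0"
      using sum_nonpos[of "nb u" "\<lambda>w. h w - h u"] by simp
    then have "(\<Sum>w\<in>nb u. - (h w - h u)) = 0"
      unfolding sum_negf by simp
    then have "h v - h u = 0"
      using that \<open>\<And>w. w \<in> nb u \<Longrightarrow> h w - h u \<le> 0\<close>
      by (subst (asm) sum_nonneg_eq_0_iff) auto
    then show ?thesis using that adjV by auto
  qed
  have "{u \<in> V. h u = M} = V"
    by (rule conn, blast, rule nonempty, erule closed)
  then have "h u = M" if "u \<in> V" for u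
    using that by blast
  then show ?thesis using assms(2,3) by simp
qed

lemma lap_add: "lap nb (\<lambda>x. f x + c * g x) x = lap nb f x + c * lap nb g x"
  unfolding lap_def sum_distrib_left sum.distrib[symmetric]
  by (intro sum.cong refl) (simp add: algebra_simps)

lemma grad_comm: "grad nb f g x = grad nb g f x"
  by (simp add: grad_def mult.commute)

lemma grad_add: "grad nb (\<lambda>x. f x + c * g x) h x = grad nb f h x + c * grad nb g h x"
  unfolding grad_def sum_distrib_left sum.distrib[symmetric]
  by (intro sum.cong refl) (simp add: algebra_simps)

lemma bform_comm: "bform nb d x f g = bform nb d x g f"
  unfolding bform_def by (simp add: grad_comm mult.commute mult.left_commute)

lemma bform_add: "bform nb d x (\<lambda>x. f x + c * g x) h = bform nb d x f h + c * bform nb d x g h"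
proof -
  have "(\<Sum>y\<in>nb x. \<Sum>z\<in>nb y. (f z + c * g z - 2 * (f y + c * g y) + (f x + c * g x)) * (h z - 2 * h y + h x))
    = (\<Sum>y\<in>nb x. \<Sum>z\<in>nb y. (f z - 2 * f y + f x) * (h z - 2 * h y + h x))
      + c * (\<Sum>y\<in>nb x. \<Sum>z\<in>nb y. (g z - 2 * g y + g x) * (h z - 2 * h y + h x))"
    unfolding sum_distrib_left sum.distrib[symmetric]
    by (intro sum.cong refl) (simp add: algebra_simps)
  then show ?thesis
    unfolding bform_def grad_add lap_add by (simp add: algebra_simps)
qed

end

text \<open>
  For a regular graph of degree \<open>d\<close> the form \<open>bform\<close> is \<open>4 \<Gamma>\<^sub>2 - 8 \<Gamma>\<close>,
  so the axiom is the curvature condition with constant 2.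
\<close>

locale cd_graph = regular_graph +
  assumes cd: "x \<in> V \<Longrightarrow> 0 \<le> bform nb d x f f"
begin

section \<open>Rigidity of the eigenspace of 2\<close>

abbreviation "E \<equiv> eig2 V nb"

lemma E_lap: "f \<in> E \<Longrightarrow> x \<in> V \<Longrightarrow> lap nb f x = - 2 * f x"
  by (simp add: eig2_def)

lemma bform_E:
  fixes f u :: "'a \<Rightarrow> real"
  assumes f: "f \<in> E" and x: "x \<in> V"
  shows "bform nb d x f u = lap nb (grad nb f u) x - 2 * grad nb f u x - grad nb f (lap nb u) x"
proof -
  have "grad nb u (lap nb f) x = - 2 * grad nb f u x"
    unfolding grad_def sum_distrib_left
    using x adjV by (intro sum.cong) (auto simp: E_lap[OF f] algebra_simps)
  then show ?thesis using bochner[OF x, of f u] by simp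
qed

lemma E_add: "f \<in> E \<Longrightarrow> g \<in> E \<Longrightarrow> (\<lambda>x. f x + c * g x) \<in> E"
proof -
  assume "f \<in> E" "g \<in> E"
  then show ?thesis
    by (auto simp: eig2_def lap_add algebra_simps)
qed

lemma E_0: "(\<lambda>x. 0) \<in> E"
  by (auto simp: eig2_def lap_def)

lemma E_scale: "f \<in> E \<Longrightarrow> (\<lambda>x. c * f x) \<in> E"
  using E_add[OF E_0, of f c] by simp

text \<open>The eigenvalue equation turns the curvature form at \<open>f\<close> into the Laplacian
  of the squared gradient. Nonnegativity of the form makes the squared gradient subharmonic, hence
  constant.\<close>

lemma grad_self_const:
  assumes f: "f \<in> E" and "x \<in> V" "y \<in> V"
  shows "grad nb f f x = grad nb f f y"
proof (rule subharmonic_const)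
  fix x assume x: "x \<in> V"
  have "grad nb f (lap nb f) x = - 2 * grad nb f f x"
    unfolding grad_def sum_distrib_left
    using x adjV by (intro sum.cong) (auto simp: E_lap[OF f] algebra_simps)
  then have "bform nb d x f f = lap nb (grad nb f f) x"
    using bform_E[OF f x] by simp
  then show "lap nb (grad nb f f) x \<ge> 0"
    using cd[OF x] by metis
qed fact+

lemma grad_const:
  assumes "f \<in> E" "g \<in> E" "x \<in> V" "y \<in> V"
  shows "grad nb f g x = grad nb f g y"
proof -
  define h where "h = (\<lambda>x. f x + 1 * g x)"
  have h: "h \<in> E" unfolding h_def by (rule E_add) fact+
  have "grad nb h h u = grad nb f f u + 2 * grad nb f g u + grad nb g g u" for u
  proof -
    have "grad nb h h u = grad nb f h u + 1 * grad nb g h u"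
      unfolding h_def by (subst grad_add) simp
    moreover have "grad nb h k u = grad nb f k u + 1 * grad nb g k u" for k
      unfolding h_def by (rule grad_add)
    ultimately show ?thesis by (simp add: grad_comm)
  qed
  from this[of x] this[of y] show ?thesis
    using grad_self_const[OF h assms(3,4)] grad_self_const[OF assms(1,3,4)]
      grad_self_const[OF assms(2,3,4)] by simp
qed

lemma bform_E_self: 
  assumes f: "f \<in> E" and x: "x \<in> V"
  shows "bform nb d x f f = 0"
proof -
  have "grad nb f (lap nb f) x = - 2 * grad nb f f x"
    unfolding grad_def sum_distrib_left
    using x adjV by (intro sum.cong) (auto simp: E_lap[OF f] algebra_simps)
  then have "bform nb d x f f = lap nb (grad nb f f) x"
    using bform_E[OF f x] by simp
  also have "\<dots> = 0"
    unfolding lap_def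
  proof (intro sum.neutral ballI)
    fix y assume "y \<in> nb x"
    then have "grad nb f f y = grad nb f f x"
      using adjV by (intro grad_self_const[OF f _ x]) blast
    then show "grad nb f f y - grad nb f f x = 0" by simp
  qed
  finally show ?thesis .
qed

text \<open>Since its squared gradient is constant, \<open>f\<close> is a null vector of the form,
  and a null vector of a positive semidefinite form is orthogonal to everything.\<close>

lemma bform_E_zero:
  assumes f: "f \<in> E" and x: "x \<in> V"
  shows "bform nb d x f g = 0"
proof (rule quadratic_nonneg_linear_zero)
  fix t :: real
  define h where "h = (\<lambda>x. f x + t * g x)"
  have *: "bform nb d x h k = bform nb d x f k + t * bform nb d x g k" for k
    unfolding h_def by (rule bform_add)
  have "bform nb d x f h = bform nb d x f f + t * bform nb d x f g"
    using *[of f] bform_comm[of x f h] bform_comm[of x f g] by simp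
  moreover have "bform nb d x g h = bform nb d x f g + t * bform nb d x g g"
    using *[of g] bform_comm[of x g h] by simp
  ultimately have "bform nb d x h h =
      bform nb d x f f + 2 * t * bform nb d x f g + t^2 * bform nb d x g g"
    using *[of h] by (simp add: power2_eq_square algebra_simps)
  then show "0 \<le> 2 * t * bform nb d x f g + t^2 * bform nb d x g g"
    using cd[OF x, of h] bform_E_self[OF f x] by simp
qed

text \<open>The form is tested against the indicator of \<open>w\<close>. If \<open>w\<close> is
  adjacent to \<open>x\<close>, Laplacian and gradient terms appear as well, but they cancel by the
  eigenvalue equation at \<open>x\<close> and at \<open>w\<close>; only the paths of length two from
  \<open>x\<close> to \<open>w\<close> remain.\<close>

lemma common_sum:
  assumes f: "f \<in> E" and x: "x \<in> V" and w: "w \<in> V" "w \<noteq> x"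
  shows "(\<Sum>y\<in>nb x \<inter> nb w. f w - 2 * f y + f x) = 0"
proof -
  define g where "g = (\<lambda>u. if u = w then 1 else (0::real))"
  have gx: "g x = 0" using w by (simp add: g_def)
  let ?F = "\<lambda>y z. f z - 2 * f y + f x"
  have inner: "(\<Sum>z\<in>nb y. ?F y z * (g z - 2 * g y + g x)) =
      (if y \<in> nb w then ?F y w else 0) - (if y = w then 2 * (\<Sum>z\<in>nb y. ?F y z) else 0)" for y
  proof -
    have "(\<Sum>z\<in>nb y. ?F y z * (g z - 2 * g y + g x)) =
      (\<Sum>z\<in>nb y. (if z = w then ?F y z else 0)) - 2 * g y * (\<Sum>z\<in>nb y. ?F y z)"
      unfolding sum_distrib_left sum_subtractf[symmetric]
      using w by (intro sum.cong refl) (auto simp: g_def algebra_simps)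
    also have "(\<Sum>z\<in>nb y. (if z = w then ?F y z else 0)) = (if w \<in> nb y then ?F y w else 0)"
      by (simp add: sum.delta)
    finally show ?thesis by (auto simp: g_def adj_comm[of w y])
  qed
  have "0 = bform nb d x f g" using bform_E_zero[OF f x] by simp
  also have "\<dots> = (\<Sum>y\<in>nb x. if y \<in> nb w then ?F y w else 0)
      - (\<Sum>y\<in>nb x. if y = w then 2 * (\<Sum>z\<in>nb y. ?F y z) else 0)
      + 2 * lap nb f x * lap nb g x - (2 * d + 4) * grad nb f g x"
    by (simp add: bform_def inner sum_subtractf)
  also have "(\<Sum>y\<in>nb x. if y \<in> nb w then ?F y w else 0) = (\<Sum>y\<in>nb x \<inter> nb w. ?F y w)"
    by (simp add: sum.inter_restrict)
  also have "(\<Sum>y\<in>nb x. if y = w then 2 * (\<Sum>z\<in>nb y. ?F y z) else 0) =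
      (if w \<in> nb x then 2 * (\<Sum>z\<in>nb w. ?F w z) else 0)"
    by (simp add: sum.delta)
  also have "lap nb g x = (if w \<in> nb x then 1 else 0)"
    by (simp add: lap_def gx) (simp add: g_def)
  also have "grad nb f g x = (if w \<in> nb x then f w - f x else 0)"
  proof -
    have "grad nb f g x = (\<Sum>y\<in>nb x. if y = w then f y - f x else 0)"
      unfolding grad_def using w by (intro sum.cong refl) (auto simp: g_def)
    then show ?thesis by (simp add: sum.delta)
  qed
  also have "(\<Sum>z\<in>nb w. ?F w z) = lap nb f w - d * (f w - f x)"
  proof -
    have "(\<Sum>z\<in>nb w. ?F w z) = (\<Sum>z\<in>nb w. (f z - f w) - (f w - f x))"
      by (rule sum.cong) auto
    then show ?thesis using reg[OF w(1)]
      by (simp add: sum_subtractf sum.distrib lap_def algebra_simps)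
  qed
  finally show ?thesis
    using E_lap[OF f x] E_lap[OF f w(1)] by (auto split: if_splits simp: algebra_simps)
qed

text \<open>A lowering rule: if \<open>lap nb u = - \<mu> * u\<close>, then
  \<open>grad nb f u\<close> satisfies the eigenvalue equation for \<open>\<mu> - 2\<close>.\<close>

lemma lap_grad:
  assumes f: "f \<in> E" and x: "x \<in> V"
  shows "lap nb (grad nb f u) x = grad nb f (lap nb u) x + 2 * grad nb f u x"
  using bform_E[OF f x, of u] bform_E_zero[OF f x, of u] by simp

text \<open>
  The eigenspace carries a symmetric triple product: for the hypercube, it is the componentwise
  product of the coefficients with respect to the coordinate functions.
\<close>

definition tri :: "('a \<Rightarrow> real) \<Rightarrow> ('a \<Rightarrow> real) \<Rightarrow> ('a \<Rightarrow> real) \<Rightarrow> 'a \<Rightarrow> real" where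
  "tri f g h x = (\<Sum>y\<in>nb x. (f y - f x) * (g y - g x) * (h y - h x))"

lemma nb_outside: "x \<notin> V \<Longrightarrow> nb x = {}"
  using adjV by blast

text \<open>By the product rule and the constancy of gradients, \<open>g * h\<close> belongs up to a
  constant to the eigenvalue 4. Pairing with \<open>f\<close> lowers this to 2 by
  \<open>lap_grad\<close>, and the result differs from \<open>tri f g h\<close> only by multiples of
  \<open>g\<close> and \<open>h\<close>.\<close>

lemma tri_E:
  assumes f: "f \<in> E" and g: "g \<in> E" and h: "h \<in> E"
  shows "tri f g h \<in> E"
proof -
  obtain x0 where x0: "x0 \<in> V" using V_ne by blast
  define a b c where "a = grad nb g h x0" and "b = grad nb f h x0" and "c = grad nb f g x0"
  have abc: "grad nb g h x = a" "grad nb f h x = b" "grad nb f g x = c" if "x \<in> V" for x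
    unfolding a_def b_def c_def
    using grad_const[OF g h that x0] grad_const[OF f h that x0] grad_const[OF f g that x0]
    by blast+
  let ?u = "\<lambda>x. g x * h x"
  have 1: "grad nb f ?u x = g x * grad nb f h x + h x * grad nb f g x + tri f g h x" for x
    unfolding grad_def tri_def sum_distrib_left sum.distrib[symmetric]
    by (rule sum.cong) (auto simp: algebra_simps)
  have 2: "lap nb ?u x = grad nb g h x + g x * lap nb h x + h x * lap nb g x" for x
    unfolding grad_def lap_def sum_distrib_left sum.distrib[symmetric]
    by (rule sum.cong) (auto simp: algebra_simps)
  have lapu: "lap nb ?u x = a - 4 * ?u x" if "x \<in> V" for x
    using 2[of x] abc(1)[OF that] E_lap[OF g that] E_lap[OF h that] by simp
  have 3: "grad nb f (lap nb ?u) x = - 4 * grad nb f ?u x" if "x \<in> V" for x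
    unfolding grad_def sum_distrib_left
    using that adjV by (intro sum.cong refl) (auto simp: lapu algebra_simps)
  have 4: "lap nb (grad nb f ?u) x = - 2 * grad nb f ?u x" if "x \<in> V" for x
    using lap_grad[OF f that, of ?u] 3[OF that] by simp
  have t: "tri f g h x = grad nb f ?u x - b * g x - c * h x" if "x \<in> V" for x
    using 1[of x] abc that by simp
  have "lap nb (tri f g h) x = - 2 * tri f g h x" if x: "x \<in> V" for x
  proof -
    have "lap nb (tri f g h) x =
        lap nb (grad nb f ?u) x - b * lap nb g x - c * lap nb h x"
      unfolding lap_def sum_distrib_left sum_subtractf[symmetric]
      using x adjV by (intro sum.cong refl) (auto simp: t algebra_simps)
    then show ?thesis
      using 4[OF x] t[OF x] E_lap[OF g x] E_lap[OF h x] by (simp add: algebra_simps)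
  qed
  moreover have "tri f g h x = 0" if "x \<notin> V" for x
    using nb_outside[OF that] by (simp add: tri_def)
  ultimately show ?thesis by (auto simp: eig2_def)
qed

section \<open>The invariant bilinear form\<close>

definition ip :: "('a \<Rightarrow> real) \<Rightarrow> ('a \<Rightarrow> real) \<Rightarrow> real" where
  "ip f g = (\<Sum>x\<in>V. f x * g x)"

lemma double_sum_swap:
  "(\<Sum>x\<in>V. \<Sum>y\<in>nb x. F x y) = (\<Sum>x\<in>V. \<Sum>y\<in>nb x. F y x)" for F :: "'a \<Rightarrow> 'a \<Rightarrow> real"
proof -
  have *: "(\<Sum>x\<in>V. \<Sum>y\<in>nb x. H x y) = (\<Sum>x\<in>V. \<Sum>y\<in>V. if y \<in> nb x then H x y else 0)"
    for H :: "'a \<Rightarrow> 'a \<Rightarrow> real"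
  proof (rule sum.cong)
    fix x assume "x \<in> V"
    have "nb x = V \<inter> nb x" using adjV by blast
    then show "(\<Sum>y\<in>nb x. H x y) = (\<Sum>y\<in>V. if y \<in> nb x then H x y else 0)"
      by (metis sum.inter_restrict finV)
  qed simp
  have "(\<Sum>x\<in>V. \<Sum>y\<in>nb x. F x y) = (\<Sum>y\<in>V. \<Sum>x\<in>V. if y \<in> nb x then F x y else 0)"
    unfolding * by (rule sum.swap)
  also have "\<dots> = (\<Sum>y\<in>V. \<Sum>x\<in>V. if x \<in> nb y then F x y else 0)"
    by (simp add: adj_comm)
  also have "\<dots> = (\<Sum>x\<in>V. \<Sum>y\<in>nb x. F y x)"
    by (simp add: *)
  finally show ?thesis .
qed

text \<open>Summation by parts over oriented edges: reversing an edge changes the sign of the cubic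
  factor, and averaging the two expressions leaves a quartic form symmetric in all four
  arguments.\<close>

lemma ip_tri: "ip (tri a b c) e = - (\<Sum>x\<in>V. \<Sum>y\<in>nb x. (a y - a x) * (b y - b x) * (c y - c x) * (e y - e x)) / 2"
proof -
  let ?P = "\<lambda>x y. (a y - a x) * (b y - b x) * (c y - c x)"
  have 1: "ip (tri a b c) e = (\<Sum>x\<in>V. \<Sum>y\<in>nb x. ?P x y * e x)"
    by (simp add: ip_def tri_def sum_distrib_right)
  have 2: "ip (tri a b c) e = (\<Sum>x\<in>V. \<Sum>y\<in>nb x. ?P y x * e y)"
    unfolding 1 by (rule double_sum_swap)
  have "2 * ip (tri a b c) e = (\<Sum>x\<in>V. \<Sum>y\<in>nb x. ?P x y * e x + ?P y x * e y)"
    using 1 2 by (simp add: sum.distrib)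
  also have "\<dots> = - (\<Sum>x\<in>V. \<Sum>y\<in>nb x. ?P x y * (e y - e x))"
    unfolding sum_negf[symmetric] by (intro sum.cong refl) (simp add: algebra_simps)
  finally show ?thesis by simp
qed

lemma ip_tri_swap: "ip (tri a b c) e = ip (tri a b e) c"
  unfolding ip_tri by (simp add: mult_ac)

lemma ip_scale: "ip (\<lambda>x. c * f x) g = c * ip f g"
  by (simp add: ip_def sum_distrib_left mult.assoc)

lemma ip_pos: "f \<in> E \<Longrightarrow> f \<noteq> (\<lambda>x. 0) \<Longrightarrow> ip f f > 0"
proof -
  assume f: "f \<in> E" "f \<noteq> (\<lambda>x. 0)"
  then obtain x where "f x \<noteq> 0" by auto
  moreover then have "x \<in> V" using f by (auto simp: eig2_def)
  ultimately have "(\<Sum>x\<in>V. f x * f x) > 0"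
    using finV by (intro sum_pos2[of _ x]) (auto simp: zero_less_mult_iff)
  then show ?thesis by (simp add: ip_def)
qed

text \<open>A squared gradient that vanishes at one vertex vanishes everywhere, which makes
  \<open>g\<close> harmonic and hence zero. An element of \<open>E\<close> is therefore determined
  by its increments at any single vertex.\<close>

lemma E_eq_zero_if_flat:
  assumes g: "g \<in> E" and x: "x \<in> V" and "\<And>y. y \<in> nb x \<Longrightarrow> g y = g x"
  shows "g = (\<lambda>x. 0)"
proof
  fix y
  show "g y = 0"
  proof (cases "y \<in> V")
    case True
    have "grad nb g g x = 0" using assms(3) by (simp add: grad_def)
    then have "grad nb g g y = 0" using grad_self_const[OF g x True] by simp
    then have "\<forall>z\<in>nb y. (g z - g y) * (g z - g y) = 0"
      unfolding grad_def by (subst (asm) sum_nonneg_eq_0_iff) auto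
    then have "lap nb g y = 0" by (simp add: lap_def)
    then show ?thesis using E_lap[OF g True] by simp
  qed (use g in \<open>auto simp: eig2_def\<close>)
qed

end

section \<open>Dimension counts in spaces of functions\<close>

definition lin_closed :: "('a \<Rightarrow> real) set \<Rightarrow> bool" where
  "lin_closed W \<longleftrightarrow> (\<lambda>x. 0) \<in> W \<and> (\<forall>f\<in>W. \<forall>g\<in>W. \<forall>c. (\<lambda>x. f x + c * g x) \<in> W)"

definition lin_fun :: "(('a \<Rightarrow> real) \<Rightarrow> real) \<Rightarrow> bool" where
  "lin_fun l \<longleftrightarrow> (\<forall>f g c. l (\<lambda>x. f x + c * g x) = l f + c * l g)"

text \<open>A bound on \<open>fun_space.dim\<close> alone carries no finiteness, since that
  dimension is 0 for an infinite-dimensional set; this predicate keeps a finite spanning set at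
  hand.\<close>

definition spans_le :: "('a \<Rightarrow> real) set \<Rightarrow> nat \<Rightarrow> bool" where
  "spans_le W n \<longleftrightarrow> (\<exists>T. finite T \<and> card T \<le> n \<and> W \<subseteq> fun_space.span T)"

lemma lin_closedD: "lin_closed W \<Longrightarrow> f \<in> W \<Longrightarrow> g \<in> W \<Longrightarrow> (\<lambda>x. f x + c * g x) \<in> W"
  by (simp add: lin_closed_def)

lemma lin_closed_subspace: "lin_closed W \<Longrightarrow> fun_space.subspace W"
proof (unfold fun_space.subspace_def, intro conjI ballI allI)
  assume W: "lin_closed W"
  show "0 \<in> W" using W by (simp add: lin_closed_def zero_fun_def)
  fix f g assume f: "f \<in> W" and g: "g \<in> W"
  have "(\<lambda>x. f x + 1 * g x) \<in> W" by (rule lin_closedD[OF W f g])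
  then show "f + g \<in> W" by (simp add: plus_fun_def)
next
  assume W: "lin_closed W"
  fix f c assume f: "f \<in> W"
  have "(\<lambda>x. 0) \<in> W" using W by (simp add: lin_closed_def)
  from lin_closedD[OF W this f, of c] show "(\<lambda>x. c * f x) \<in> W" by simp
qed

lemma spans_le_dim: "spans_le W n \<Longrightarrow> fun_space.dim W \<le> n"
  unfolding spans_le_def using fun_space.dim_le_card le_trans by blast

lemma spans_le_mono: "W \<subseteq> W' \<Longrightarrow> spans_le W' n \<Longrightarrow> spans_le W n"
  unfolding spans_le_def by blast

lemma span_comb:
  assumes "f \<in> fun_space.span T" "g \<in> fun_space.span T"
  shows "(\<lambda>x. f x + c * g x) \<in> fun_space.span T"
  using fun_space.span_add[OF assms(1) fun_space.span_scale[OF assms(2), of c]]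
  by (simp add: plus_fun_def)

text \<open>Any \<open>g\<close> in \<open>W\<close> with \<open>l g \<noteq> 0\<close> spans
  \<open>W\<close> together with the kernel.\<close>

lemma spans_le_kernel:
  assumes W: "lin_closed W" and l: "lin_fun l" and k: "spans_le {f \<in> W. l f = 0} n"
  shows "spans_le W (Suc n)"
proof (cases "\<exists>g\<in>W. l g \<noteq> 0")
  case False
  then have "{f \<in> W. l f = 0} = W" by auto
  then show ?thesis using k by (auto simp: spans_le_def intro: le_SucI)
next
  case True
  then obtain g where g: "g \<in> W" "l g \<noteq> 0" by blast
  obtain T where T: "finite T" "card T \<le> n" "{f \<in> W. l f = 0} \<subseteq> fun_space.span T"
    using k by (auto simp: spans_le_def)
  have "f \<in> fun_space.span (insert g T)" if f: "f \<in> W" for f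
  proof -
    define h where "h = (\<lambda>x. f x + (- l f / l g) * g x)"
    have "h \<in> W" unfolding h_def by (rule lin_closedD[OF W f g(1)])
    moreover have "l h = 0"
      unfolding h_def using g(2) by (subst l[unfolded lin_fun_def, rule_format]) simp
    ultimately have "h \<in> fun_space.span T" using T(3) by blast
    then have "h \<in> fun_space.span (insert g T)"
      using fun_space.span_mono[of T "insert g T"] by blast
    moreover have "g \<in> fun_space.span (insert g T)"
      by (rule fun_space.span_base) simp
    ultimately have "(\<lambda>x. h x + (l f / l g) * g x) \<in> fun_space.span (insert g T)"
      by (rule span_comb)
    then show ?thesis by (simp add: h_def)
  qed
  moreover have "card (insert g T) \<le> Suc n"
    using T by (simp add: card_insert_if)
  ultimately show ?thesis
    unfolding spans_le_def using T(1) by (intro exI[of _ "insert g T"]) auto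
qed

lemma spans_le_kernels:
  assumes "finite J" "lin_closed W" "\<And>j. j \<in> J \<Longrightarrow> lin_fun (l j)"
    and "spans_le {f \<in> W. \<forall>j\<in>J. l j f = 0} n"
  shows "spans_le W (n + card J)"
  using assms
proof (induction J arbitrary: W)
  case empty
  then show ?case by simp
next
  case (insert j J)
  let ?W = "{f \<in> W. l j f = 0}"
  have lj: "lin_fun (l j)" using insert.prems by simp
  have l0: "l j (\<lambda>x. 0) = 0"
    using lj[unfolded lin_fun_def, rule_format, of "\<lambda>x. 0" 0 "\<lambda>x. 0"] 
      lj[unfolded lin_fun_def, rule_format, of "\<lambda>x. 0" 1 "\<lambda>x. 0"] by simp
  have "lin_closed ?W"
    using insert.prems(1) lj l0 by (auto simp: lin_closed_def lin_fun_def)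
  moreover have "{f \<in> ?W. \<forall>j\<in>J. l j f = 0} = {f \<in> W. \<forall>i\<in>insert j J. l i f = 0}"
    by auto
  ultimately have "spans_le ?W (n + card J)"
    using insert.IH[of ?W] insert.prems by simp
  then have "spans_le W (Suc (n + card J))"
    by (rule spans_le_kernel[OF insert.prems(1) lj])
  then show ?case using insert.hyps by simp
qed

lemma finite_basis:
  assumes "spans_le W n"
  obtains B where "B \<subseteq> W" "fun_space.independent B" "W \<subseteq> fun_space.span B"
    "finite B" "card B = fun_space.dim W"
proof -
  obtain B where B: "B \<subseteq> W" "fun_space.independent B" "W \<subseteq> fun_space.span B"
    "card B = fun_space.dim W"
    by (rule fun_space.basis_exists)
  obtain T where T: "finite T" "W \<subseteq> fun_space.span T"
    using assms by (auto simp: spans_le_def)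
  have "finite B"
    using fun_space.independent_span_bound[OF T(1) B(2)] B(1) T(2) by blast
  with B show ?thesis using that by blast
qed

lemma independent_card_le_dim:
  assumes "spans_le W n" "fun_space.independent B" "B \<subseteq> W"
  shows "card B \<le> fun_space.dim W"
proof -
  obtain C where C: "W \<subseteq> fun_space.span C" "finite C" "card C = fun_space.dim W"
    using finite_basis[OF assms(1)] by metis
  show ?thesis
    using fun_space.independent_span_bound[OF C(2) assms(2)] assms(3) C by auto
qed

definition lin_map :: "(('a \<Rightarrow> real) \<Rightarrow> ('a \<Rightarrow> real)) \<Rightarrow> bool" where
  "lin_map \<phi> \<longleftrightarrow> (\<forall>f g c. \<phi> (\<lambda>x. f x + c * g x) = (\<lambda>x. \<phi> f x + c * \<phi> g x))"

lemma lin_map_hom: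
  fixes \<phi> :: "('a \<Rightarrow> real) \<Rightarrow> ('a \<Rightarrow> real)"
  assumes "lin_map \<phi>"
  shows "module_hom (\<lambda>(c :: real) (f :: 'a \<Rightarrow> real) x. c * f x) (\<lambda>(c :: real) (f :: 'a \<Rightarrow> real) x. c * f x) \<phi>"
proof -
  have *: "\<phi> (\<lambda>x. f x + c * g x) = (\<lambda>x. \<phi> f x + c * \<phi> g x)" for f g c
    using assms by (simp add: lin_map_def)
  have z: "\<phi> (\<lambda>x. 0) = (\<lambda>x. 0)"
    using *[of "\<lambda>x. 0" "-1" "\<lambda>x. 0"] by simp
  show ?thesis
  proof unfold_locales
    show "\<phi> (f + g) = \<phi> f + \<phi> g" for f g
      using *[of f 1 g] by (simp add: plus_fun_def)
    show "\<phi> (\<lambda>x. c * f x) = (\<lambda>x. c * \<phi> f x)" for c f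
      using *[of "\<lambda>x. 0" c f] z by simp
  qed
qed

lemma lin_map_independent:
  assumes \<phi>: "lin_map \<phi>" and W: "lin_closed W" and inj: "\<And>f. f \<in> W \<Longrightarrow> \<phi> f = (\<lambda>x. 0) \<Longrightarrow> f = (\<lambda>x. 0)"
    and B: "B \<subseteq> W" "fun_space.independent B"
  shows "fun_space.independent (\<phi> ` B)" "inj_on \<phi> B"
proof -
  have sp: "fun_space.span B \<subseteq> W"
    by (rule fun_space.span_minimal[OF B(1) lin_closed_subspace[OF W]])
  have "inj_on \<phi> (fun_space.span B)"
  proof (rule inj_onI)
    fix f g assume f: "f \<in> fun_space.span B" and g: "g \<in> fun_space.span B" and eq: "\<phi> f = \<phi> g"
    have "(\<lambda>x. f x + (-1) * g x) \<in> W"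
      using span_comb[OF f g] sp by blast
    moreover have "\<phi> (\<lambda>x. f x + (-1) * g x) = (\<lambda>x. 0)"
      using \<phi>[unfolded lin_map_def, rule_format, of f "-1" g] eq by simp
    ultimately have "(\<lambda>x. f x + (-1) * g x) = (\<lambda>x. 0)" by (rule inj)
    then show "f = g" by (auto simp: fun_eq_iff)
  qed
  then show "fun_space.independent (\<phi> ` B)"
    by (rule module_hom.independent_injective_image[OF lin_map_hom[OF \<phi>] B(2)])
  show "inj_on \<phi> B"
    using \<open>inj_on \<phi> (fun_space.span B)\<close> fun_space.span_superset inj_on_subset by blast
qed

lemma dim_le_inj:
  assumes \<phi>: "lin_map \<phi>" and W: "lin_closed W" and inj: "\<And>f. f \<in> W \<Longrightarrow> \<phi> f = (\<lambda>x. 0) \<Longrightarrow> f = (\<lambda>x. 0)"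
    and im: "\<And>f. f \<in> W \<Longrightarrow> \<phi> f \<in> W'" and fin: "spans_le W n" "spans_le W' n'"
  shows "fun_space.dim W \<le> fun_space.dim W'"
proof -
  obtain B where B: "B \<subseteq> W" "fun_space.independent B" "card B = fun_space.dim W"
    using finite_basis[OF fin(1)] by metis
  note ind = lin_map_independent[OF \<phi> W inj B(1,2)]
  have "card (\<phi> ` B) \<le> fun_space.dim W'"
    by (rule independent_card_le_dim[OF fin(2) ind(1)]) (use B im in auto)
  then show ?thesis using card_image[OF ind(2)] B(3) by simp
qed

text \<open>The image of a basis stays in the kernel of \<open>l\<close>, so \<open>g\<close> can be
  added to it without losing independence.\<close>

lemma dim_Suc_le_inj:
  assumes \<phi>: "lin_map \<phi>" and W: "lin_closed W" and inj: "\<And>f. f \<in> W \<Longrightarrow> \<phi> f = (\<lambda>x. 0) \<Longrightarrow> f = (\<lambda>x. 0)"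
    and im: "\<And>f. f \<in> W \<Longrightarrow> \<phi> f \<in> W'" and fin: "spans_le W n" "spans_le W' n'"
    and l: "lin_fun l" "\<And>f. f \<in> W \<Longrightarrow> l (\<phi> f) = 0" and g: "g \<in> W'" "l g \<noteq> 0"
  shows "Suc (fun_space.dim W) \<le> fun_space.dim W'"
proof -
  obtain B where B: "B \<subseteq> W" "fun_space.independent B" "card B = fun_space.dim W" "finite B"
    using finite_basis[OF fin(1)] by metis
  note ind = lin_map_independent[OF \<phi> W inj B(1,2)]
  have l0: "l (\<lambda>x. 0) = 0"
    using l(1)[unfolded lin_fun_def, rule_format, of "\<lambda>x. 0" "-1" "\<lambda>x. 0"] by simp
  have "lin_closed {f. l f = 0}"
    using l(1) l0 by (auto simp: lin_closed_def lin_fun_def)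
  then have "fun_space.span (\<phi> ` B) \<subseteq> {f. l f = 0}"
    using l(2) B(1) by (intro fun_space.span_minimal lin_closed_subspace) auto
  then have gn: "g \<notin> fun_space.span (\<phi> ` B)" using g(2) by blast
  have "card (insert g (\<phi> ` B)) \<le> fun_space.dim W'"
    by (rule independent_card_le_dim[OF fin(2)])
      (use fun_space.independent_insertI[OF gn ind(1)] B im g in auto)
  moreover have "g \<notin> \<phi> ` B" using gn fun_space.span_base by blast
  ultimately show ?thesis using card_image[OF ind(2)] B(3,4) by simp
qed

section \<open>Local maxima of eigenfunctions\<close>

context cd_graph
begin

lemma E_closed: "lin_closed E"
  using E_add E_0 by (auto simp: lin_closed_def)

lemma spans_zero: "spans_le {f. f = (\<lambda>x. 0)} 0"
  unfolding spans_le_def by (intro exI[of _ "{}"]) (auto simp: zero_fun_def)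

lemma spans_single: "(\<And>h. h \<in> W \<Longrightarrow> \<exists>c. h = (\<lambda>x. c * f x)) \<Longrightarrow> spans_le W 1"
proof -
  assume *: "\<And>h. h \<in> W \<Longrightarrow> \<exists>c. h = (\<lambda>x. c * f x)"
  have "W \<subseteq> fun_space.span {f}"
    using * fun_space.span_scale[OF fun_space.span_base[of f "{f}"]] by blast
  then show ?thesis unfolding spans_le_def by (intro exI[of _ "{f}"]) auto
qed

lemma spans_double: "(\<And>h. h \<in> W \<Longrightarrow> \<exists>c c'. h = (\<lambda>x. c * f x + c' * g x)) \<Longrightarrow> spans_le W 2"
proof -
  assume *: "\<And>h. h \<in> W \<Longrightarrow> \<exists>c c'. h = (\<lambda>x. c * f x + c' * g x)"
  have "h \<in> fun_space.span {f, g}" if hW: "h \<in> W" for h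
  proof -
    obtain c c' where h: "h = (\<lambda>x. c * f x + c' * g x)" using *[OF hW] by blast
    have "(\<lambda>x. c * f x) \<in> fun_space.span {f, g}"
      by (intro fun_space.span_scale fun_space.span_base) simp
    moreover have "g \<in> fun_space.span {f, g}"
      by (intro fun_space.span_base) simp
    ultimately show ?thesis unfolding h by (rule span_comb)
  qed
  moreover have "card {f, g} \<le> 2" by (simp add: card_insert_if)
  ultimately show ?thesis unfolding spans_le_def by (intro exI[of _ "{f, g}"]) auto
qed

text \<open>Each condition \<open>f y = f x\<close> is one linear functional and costs at most one
  dimension.\<close>

lemma spans_E_flat:
  assumes "x \<in> V" "J \<subseteq> nb x" "spans_le {f \<in> E. \<forall>y\<in>J. f y = f x} n"
  shows "spans_le E (n + card J)"
proof (rule spans_le_kernels[where l = "\<lambda>y f. f y - f x"])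
  show "finite J" using assms(2) finite_subset by blast
qed (use E_closed assms(3) in \<open>auto simp: lin_fun_def algebra_simps\<close>)

lemma spans_E: "spans_le E d"
proof -
  obtain x where x: "x \<in> V" using V_ne by blast
  have "spans_le {f \<in> E. \<forall>y\<in>nb x. f y = f x} 0"
    by (rule spans_le_mono[OF _ spans_zero]) (use E_eq_zero_if_flat[OF _ x] in auto)
  from spans_E_flat[OF x order.refl this] show ?thesis
    using reg[OF x] by simp
qed

lemma dim_E_le: "fun_space.dim E \<le> d"
  by (rule spans_le_dim[OF spans_E])

section \<open>Blocks and their matching along a level\<close>

definition locmax :: "('a \<Rightarrow> real) \<Rightarrow> 'a \<Rightarrow> bool" where
  "locmax f x \<longleftrightarrow> f \<in> E \<and> x \<in> V \<and> (\<forall>y\<in>nb x. f y \<le> f x)"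

definition down :: "('a \<Rightarrow> real) \<Rightarrow> 'a \<Rightarrow> 'a set" where
  "down f x = {y \<in> nb x. f y < f x}"

lemma down_nb: "y \<in> down f x \<Longrightarrow> y \<in> nb x" and down_less: "y \<in> down f x \<Longrightarrow> f y < f x"
  and fin_down [simp, intro]: "finite (down f x)"
  by (auto simp: down_def)

lemma locmaxD: "locmax f x \<Longrightarrow> f \<in> E" "locmax f x \<Longrightarrow> x \<in> V"
  "locmax f x \<Longrightarrow> y \<in> nb x \<Longrightarrow> f y \<le> f x"
  by (auto simp: locmax_def)

text \<open>This is \<open>common_sum\<close> in terms of the drops from \<open>x\<close>, which are
  nonnegative at a local maximum: the drop to \<open>z\<close> is twice the mean drop to the common
  neighbours.\<close>

lemma card_common:
  assumes f: "f \<in> E" and x: "x \<in> V" and z: "z \<in> V" "z \<noteq> x"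
  shows "real (card (nb x \<inter> nb z)) * (f x - f z) = 2 * (\<Sum>y\<in>nb x \<inter> nb z. f x - f y)"
proof -
  have "0 = (\<Sum>y\<in>nb x \<inter> nb z. f z - 2 * f y + f x)"
    using common_sum[OF assms] by simp
  also have "\<dots> = (\<Sum>y\<in>nb x \<inter> nb z. 2 * (f x - f y) - (f x - f z))"
    by (rule sum.cong) auto
  also have "\<dots> = 2 * (\<Sum>y\<in>nb x \<inter> nb z. f x - f y) - card (nb x \<inter> nb z) * (f x - f z)"
    by (simp only: sum_subtractf sum_distrib_left[symmetric] sum_constant) (simp add: algebra_simps)
  finally show ?thesis by simp
qed

lemma sum_down:
  assumes "locmax f x"
  shows "(\<Sum>y\<in>down f x. f x - f y) = 2 * f x"
proof -
  have "(\<Sum>y\<in>down f x. f x - f y) = (\<Sum>y\<in>nb x. f x - f y)"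
    by (rule sum.mono_neutral_left) (auto simp: down_def dest: locmaxD(3)[OF assms])
  also have "\<dots> = - lap nb f x"
    unfolding lap_def sum_negf[symmetric] by simp
  finally show ?thesis using E_lap[OF locmaxD(1,2)[OF assms]] by simp
qed

text \<open>By \<open>card_common\<close> the drop to a vertex reached in two steps is twice a mean
  of drops to neighbours of \<open>x\<close>, so it is nonnegative, and positive as soon as one of
  these is.\<close>

lemma locmax_le2:
  assumes m: "locmax f x" and y: "y \<in> nb x" and z: "z \<in> nb y"
  shows "f z \<le> f x" and "y \<in> down f x \<Longrightarrow> z \<noteq> x \<Longrightarrow> f z < f x"
proof -
  have *: "(f z \<le> f x) \<and> (y \<in> down f x \<longrightarrow> f z < f x)" if zx: "z \<noteq> x"
  proof -
    have zV: "z \<in> V" using z adjV by blast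
    have yc: "y \<in> nb x \<inter> nb z" using y z adj_sym by blast
    then have c: "card (nb x \<inter> nb z) > 0" by (metis card_gt_0_iff empty_iff fin_nb finite_Int)
    note eq = card_common[OF locmaxD(1,2)[OF m] zV zx]
    have nn: "\<forall>u\<in>nb x \<inter> nb z. f x - f u \<ge> 0" using locmaxD(3)[OF m] by auto
    then have "(\<Sum>u\<in>nb x \<inter> nb z. f x - f u) \<ge> 0" by (intro sum_nonneg) auto
    then have "card (nb x \<inter> nb z) * (f x - f z) \<ge> 0" using eq by simp
    then have 1: "f z \<le> f x" using c by (auto simp: zero_le_mult_iff)
    have 2: "f z < f x" if "y \<in> down f x"
    proof -
      have "(\<Sum>u\<in>nb x \<inter> nb z. f x - f u) > 0"
        by (rule sum_pos2[OF _ yc]) (use that nn in \<open>auto simp: down_def\<close>)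
      then have "card (nb x \<inter> nb z) * (f x - f z) > 0" using eq by simp
      then show ?thesis using c by (auto simp: zero_less_mult_iff)
    qed
    from 1 2 show ?thesis by blast
  qed
  show "f z \<le> f x" using * by (cases "z = x") auto
  show "f z < f x" if "y \<in> down f x" "z \<noteq> x" using * that by blast
qed

text \<open>Summed over all neighbours of \<open>x\<close>, the relation \<open>card_common\<close>
  equates the sum of the drops, weighted by the numbers of triangles on the edges, with twice
  itself. So that sum is zero, and its terms are nonnegative.\<close>

lemma down_no_common:
  assumes m: "locmax f x" and y: "y \<in> down f x"
  shows "nb x \<inter> nb y = {}"
proof -
  let ?T = "\<lambda>y. real (card (nb x \<inter> nb y))"
  have yV: "y \<in> V \<and> y \<noteq> x" if "y \<in> nb x" for y
    using that adjV adj_irr by blast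
  have "(\<Sum>y\<in>nb x. ?T y * (f x - f y)) = (\<Sum>y\<in>nb x. 2 * (\<Sum>u\<in>{u \<in> nb x. u \<in> nb y}. f x - f u))"
  proof (intro sum.cong refl)
    fix y assume "y \<in> nb x"
    moreover have "{u \<in> nb x. u \<in> nb y} = nb x \<inter> nb y" by auto
    ultimately show "?T y * (f x - f y) = 2 * (\<Sum>u\<in>{u \<in> nb x. u \<in> nb y}. f x - f u)"
      using card_common[OF locmaxD(1,2)[OF m]] yV by simp
  qed
  also have "\<dots> = 2 * (\<Sum>u\<in>nb x. \<Sum>y\<in>{y \<in> nb x. u \<in> nb y}. f x - f u)"
    unfolding sum_distrib_left[symmetric] by (subst sum.swap_restrict) auto
  also have "\<dots> = 2 * (\<Sum>u\<in>nb x. ?T u * (f x - f u))"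
  proof -
    have "{y \<in> nb x. u \<in> nb y} = nb x \<inter> nb u" for u
      by (auto dest: adj_sym)
    then show ?thesis by simp
  qed
  finally have "(\<Sum>u\<in>nb x. ?T u * (f x - f u)) = 0" by simp
  then have "?T y * (f x - f y) = 0"
    using y locmaxD(3)[OF m]
    by (subst (asm) sum_nonneg_eq_0_iff) (auto simp: down_def)
  then have "card (nb x \<inter> nb y) = 0" using y by (simp add: down_def)
  then show ?thesis by simp
qed

lemma level_locmax:
  assumes "locmax f x" "u \<in> nb x" "f u = f x"
  shows "locmax f u"
  using assms locmax_le2(1)[OF assms(1,2)] adjV by (auto simp: locmax_def)

lemma down_unique_up:
  assumes "locmax f x" "y \<in> down f x" "u \<in> nb y" "f u = f x"
  shows "u = x"
  using locmax_le2(2)[OF assms(1) down_nb[OF assms(2)] assms(3,2)] assms(4) by force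

lemma common_level:
  assumes m: "locmax f x" and u: "u \<in> nb x" "f u = f x" and z: "z \<in> down f u"
  shows "nb x \<inter> nb z = insert u (nb z \<inter> down f x)"
proof (intro equalityI subsetI)
  fix v assume v: "v \<in> nb x \<inter> nb z"
  show "v \<in> insert u (nb z \<inter> down f x)"
  proof (cases "f v = f x")
    case True
    then show ?thesis
      using down_unique_up[OF level_locmax[OF m u] z, of v] v u by simp
  next
    case False
    then show ?thesis using v locmaxD(3)[OF m, of v] by (auto simp: down_def)
  qed
next
  fix v assume "v \<in> insert u (nb z \<inter> down f x)"
  then show "v \<in> nb x \<inter> nb z"
    using u z by (auto simp: down_def dest: adj_sym)
qed

text \<open>Here \<open>u\<close> is a common neighbour without drop, so it counts on the left only.
  Were it the only one, the drop to \<open>z\<close> would have to vanish.\<close>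

lemma card_level:
  assumes m: "locmax f x" and u: "u \<in> nb x" "f u = f x" and z: "z \<in> down f u"
  shows "(1 + real (card (nb z \<inter> down f x))) * (f x - f z) = 2 * (\<Sum>y\<in>nb z \<inter> down f x. f x - f y)"
    and "card (nb z \<inter> down f x) \<ge> 1"
proof -
  have zV: "z \<in> V" and zx: "z \<noteq> x"
    using z u adjV by (auto simp: down_def)
  have un: "u \<notin> nb z \<inter> down f x" using u by (auto simp: down_def)
  show eq: "(1 + real (card (nb z \<inter> down f x))) * (f x - f z) = 2 * (\<Sum>y\<in>nb z \<inter> down f x. f x - f y)"
    using card_common[OF locmaxD(1,2)[OF m] zV zx] un u(2)
    unfolding common_level[OF assms] by simp
  show "card (nb z \<inter> down f x) \<ge> 1"
  proof (rule ccontr)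
    assume "\<not> ?thesis"
    then have e: "nb z \<inter> down f x = {}" by (simp add: card_eq_0_iff not_le)
    show False using eq z u unfolding e by (simp add: down_def)
  qed
qed

text \<open>
  Summing the identities of \<open>card_level\<close> over \<open>down f u\<close> and, symmetrically, over \<open>down f x\<close>
  leaves no room for a vertex with more than one partner.
\<close>

lemma level_match_card:
  assumes m: "locmax f x" and u: "u \<in> nb x" "f u = f x" and z: "z \<in> down f u"
  shows "card (nb z \<inter> down f x) = 1"
proof -
  have m': "locmax f u" by (rule level_locmax[OF m u])
  have u': "x \<in> nb u" "f x = f u" using u adj_sym by auto
  let ?a = "\<lambda>y. f x - f y"
  let ?j = "\<lambda>z. real (card (nb z \<inter> down f x))" and ?j' = "\<lambda>y. real (card (nb y \<inter> down f u))"
  define S where "S = 2 * f x"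
  have S: "(\<Sum>y\<in>down f x. ?a y) = S" "(\<Sum>z\<in>down f u. ?a z) = S"
    using sum_down[OF m] sum_down[OF m'] u by (simp_all add: S_def)
  have sw: "(\<Sum>z\<in>down f u. \<Sum>y\<in>nb z \<inter> down f x. ?a y) = (\<Sum>y\<in>down f x. ?j' y * ?a y)"
   and sw': "(\<Sum>y\<in>down f x. \<Sum>z\<in>nb y \<inter> down f u. ?a z) = (\<Sum>z\<in>down f u. ?j z * ?a z)"
  proof -
    have *: "(\<Sum>z\<in>A. \<Sum>y\<in>nb z \<inter> B. ?a y) = (\<Sum>y\<in>B. card (nb y \<inter> A) * ?a y)"
      if "finite A" "finite B" for A B
    proof -
      have 1: "nb z \<inter> B = {y \<in> B. y \<in> nb z}" for z by auto
      have 2: "{z \<in> A. y \<in> nb z} = nb y \<inter> A" for y by (auto dest: adj_sym)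
      show ?thesis unfolding 1 by (subst sum.swap_restrict) (use that in \<open>simp_all add: 2\<close>)
    qed
    show "(\<Sum>z\<in>down f u. \<Sum>y\<in>nb z \<inter> down f x. ?a y) = (\<Sum>y\<in>down f x. ?j' y * ?a y)"
      by (rule *) auto
    show "(\<Sum>y\<in>down f x. \<Sum>z\<in>nb y \<inter> down f u. ?a z) = (\<Sum>z\<in>down f u. ?j z * ?a z)"
      by (rule *) auto
  qed
  have "(\<Sum>z\<in>down f u. (1 + ?j z) * ?a z) = (\<Sum>z\<in>down f u. 2 * (\<Sum>y\<in>nb z \<inter> down f x. ?a y))"
    by (intro sum.cong refl) (use card_level(1)[OF m u] in auto)
  then have 1: "S + (\<Sum>z\<in>down f u. ?j z * ?a z) = 2 * (\<Sum>y\<in>down f x. ?j' y * ?a y)"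
    unfolding sum_distrib_left[symmetric] sw distrib_right sum.distrib mult_1 S .
  have "(\<Sum>y\<in>down f x. (1 + ?j' y) * ?a y) = (\<Sum>y\<in>down f x. 2 * (\<Sum>z\<in>nb y \<inter> down f u. ?a z))"
    by (intro sum.cong refl) (use card_level(1)[OF m' u'] u in auto)
  then have 2: "S + (\<Sum>y\<in>down f x. ?j' y * ?a y) = 2 * (\<Sum>z\<in>down f u. ?j z * ?a z)"
    unfolding sum_distrib_left[symmetric] sw' distrib_right sum.distrib mult_1 S .
  \<comment> \<open>The two equations together say that both weighted sums equal
    \<open>S\<close>.\<close>
  have "(\<Sum>z\<in>down f u. (?j z - 1) * ?a z) = 0"
    using 1 2 S(2) by (simp add: left_diff_distrib sum_subtractf)
  moreover have "\<forall>z\<in>down f u. (?j z - 1) * ?a z \<ge> 0"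
  proof
    fix z assume z: "z \<in> down f u"
    show "(?j z - 1) * ?a z \<ge> 0"
      using card_level(2)[OF m u z] down_less[OF z] u(2) by simp
  qed
  ultimately have "(?j z - 1) * ?a z = 0"
    using z by (subst (asm) sum_nonneg_eq_0_iff) auto
  then show ?thesis using z u by (auto simp: down_def)
qed

text \<open>With exactly one partner, \<open>card_level\<close> forces equal drops to
  \<open>z\<close> and to its partner.\<close>

lemma level_match:
  assumes m: "locmax f x" and u: "u \<in> nb x" "f u = f x" and z: "z \<in> down f u"
  obtains y where "nb z \<inter> down f x = {y}" "nb x \<inter> nb z = {u, y}" "u \<noteq> y" "f y = f z"
proof -
  obtain y where y: "nb z \<inter> down f x = {y}"
    using level_match_card[OF assms] card_1_singletonE by metis
  then have "f y = f z"
    using card_level(1)[OF assms] by simp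
  have "y \<in> down f x" using y by blast
  then have "u \<noteq> y" using u(2) down_less[of y f x] by auto
  moreover have "nb x \<inter> nb z = {u, y}"
    unfolding common_level[OF assms] y ..
  ultimately show ?thesis using that[OF y] \<open>f y = f z\<close> by blast
qed

text \<open>Since \<open>x\<close> and \<open>z\<close> have just the two common neighbours
  \<open>u\<close> and \<open>y\<close>, \<open>common_sum\<close> becomes a parallelogram law,
  valid for every element of \<open>E\<close> and not only for \<open>f\<close>.\<close>

lemma level_parallel:
  assumes m: "locmax f x" and u: "u \<in> nb x" "f u = f x" and z: "z \<in> down f u"
    and y: "y \<in> down f x" "y \<in> nb z" and g: "g \<in> E"
  shows "g x + g z = g u + g y"
proof -
  obtain y' where y': "nb z \<inter> down f x = {y'}" "nb x \<inter> nb z = {u, y'}" "u \<noteq> y'"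
    using level_match[OF m u z] by metis
  have "y' = y" using y y'(1) by auto
  moreover have "z \<in> V" "z \<noteq> x" using z u adjV by (auto simp: down_def)
  ultimately show ?thesis
    using common_sum[OF g locmaxD(2)[OF m], of z] y' by simp
qed

lemma level_bij:
  assumes m: "locmax f x" and u: "u \<in> nb x" "f u = f x"
  obtains \<psi> where "bij_betw \<psi> (down f x) (down f u)" "\<And>y. y \<in> down f x \<Longrightarrow> \<psi> y \<in> nb y"
    "\<And>y z. y \<in> down f x \<Longrightarrow> z \<in> down f u \<Longrightarrow> z \<in> nb y \<Longrightarrow> z = \<psi> y"
proof -
  have m': "locmax f u" by (rule level_locmax[OF m u])
  have u': "x \<in> nb u" "f x = f u" using u adj_sym by auto
  have "\<exists>z. nb y \<inter> down f u = {z}" if "y \<in> down f x" for y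
    using level_match_card[OF m' u' that] card_1_singletonE by metis
  then obtain \<psi> where \<psi>: "\<And>y. y \<in> down f x \<Longrightarrow> nb y \<inter> down f u = {\<psi> y}" by metis
  have ex: "\<exists>y. nb z \<inter> down f x = {y}" if "z \<in> down f u" for z
    using level_match_card[OF m u that] card_1_singletonE by metis
  have "bij_betw \<psi> (down f x) (down f u)"
  proof (rule bij_betwI')
    fix y y' assume y: "y \<in> down f x" "y' \<in> down f x"
    show "(\<psi> y = \<psi> y') = (y = y')"
    proof
      assume eq: "\<psi> y = \<psi> y'"
      have "\<psi> y \<in> down f u" "y \<in> nb (\<psi> y)" "y' \<in> nb (\<psi> y)"
        using \<psi>[OF y(1)] \<psi>[OF y(2)] eq adj_sym by blast+
      then obtain v where v: "nb (\<psi> y) \<inter> down f x = {v}" using ex by metis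
      have "y \<in> {v}" "y' \<in> {v}"
        unfolding v[symmetric] using y \<open>y \<in> nb (\<psi> y)\<close> \<open>y' \<in> nb (\<psi> y)\<close> by auto
      then show "y = y'" by simp
    qed simp
  next
    fix y assume "y \<in> down f x"
    then show "\<psi> y \<in> down f u" using \<psi> by blast
  next
    fix z assume z: "z \<in> down f u"
    then obtain y where "nb z \<inter> down f x = {y}" using ex by blast
    then have y: "y \<in> nb z" "y \<in> down f x" by auto
    then have "z \<in> nb y \<inter> down f u" using z adj_sym by blast
    then have "z = \<psi> y" using \<psi>[OF y(2)] by simp
    then show "\<exists>y\<in>down f x. z = \<psi> y" using y by blast
  qed
  then show ?thesis using that[of \<psi>] \<psi> by blast
qed

lemma level_card_down:
  assumes "locmax f x" "u \<in> nb x" "f u = f x"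
  shows "card (down f u) = card (down f x)"
  using level_bij[OF assms] bij_betw_same_card by metis

section \<open>Level components\<close>

definition lev :: "('a \<Rightarrow> real) \<Rightarrow> 'a \<Rightarrow> 'a set" where
  "lev f x = {u. (x, u) \<in> {(a, b). b \<in> nb a \<and> f b = f a}\<^sup>*}"

lemma lev_self [simp]: "x \<in> lev f x"
  by (simp add: lev_def)

lemma lev_step: "u \<in> lev f x \<Longrightarrow> v \<in> nb u \<Longrightarrow> f v = f u \<Longrightarrow> v \<in> lev f x"
  unfolding lev_def by (auto intro: rtrancl_into_rtrancl)

lemma lev_induct [consumes 1, case_names base step]:
  assumes "u \<in> lev f x" "Q x"
    "\<And>u v. u \<in> lev f x \<Longrightarrow> Q u \<Longrightarrow> v \<in> nb u \<Longrightarrow> f v = f u \<Longrightarrow> Q v"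
  shows "Q u"
proof -
  have "(x, u) \<in> {(a, b). b \<in> nb a \<and> f b = f a}\<^sup>*" using assms(1) by (simp add: lev_def)
  then show ?thesis
  proof (induction rule: rtrancl_induct)
    case base
    then show ?case by (rule assms(2))
  next
    case (step y z)
    then show ?case using assms(3)[of y z] by (auto simp: lev_def)
  qed
qed

lemma lev_value: "u \<in> lev f x \<Longrightarrow> f u = f x"
  by (induction rule: lev_induct) auto

lemma lev_locmax:
  assumes m: "locmax f x" and u: "u \<in> lev f x"
  shows "locmax f u"
  using u by (induction rule: lev_induct) (use m level_locmax in auto)

lemma lev_card_down:
  assumes m: "locmax f x" and u: "u \<in> lev f x"
  shows "card (down f u) = card (down f x)"
  using u
proof (induction rule: lev_induct)
  case (step u v)
  then show ?case using level_card_down[OF lev_locmax[OF m step(1)]] by simp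
qed simp

lemma lev_sub: "x \<in> V \<Longrightarrow> lev f x \<subseteq> V"
proof
  fix u assume "x \<in> V" "u \<in> lev f x"
  from this(2,1) show "u \<in> V"
    by (induction rule: lev_induct) (auto dest: adjV)
qed

lemma lev_nb_cases:
  assumes "locmax f x" "u \<in> lev f x" "v \<in> nb u"
  shows "v \<in> down f u \<or> (v \<in> lev f x \<and> f v = f x)"
proof (cases "f v = f u")
  case True
  then show ?thesis using lev_step[OF assms(2,3)] lev_value[OF assms(2)] by simp
next
  case False
  then show ?thesis
    using locmaxD(3)[OF lev_locmax[OF assms(1,2)] assms(3)] assms(3) by (simp add: down_def)
qed

text \<open>
  The test function is 1 at \<open>y\<close>, 0 at the other vertices of the unit ball, and optimal on the
  sphere of radius 2.
\<close>

lemma cd_diag: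
  assumes x: "x \<in> V" and y: "y \<in> nb x" and no: "nb x \<inter> nb y = {}"
  shows "(\<Sum>z\<in>nb y - {x}. 1 / real (card (nb x \<inter> nb z))) \<le> (real d - 1) / 2"
proof -
  define Z where "Z = nb y - {x}"
  define m where "m z = real (card (nb x \<inter> nb z))" for z
  \<comment> \<open>For \<open>z\<close> on the sphere the path through \<open>y\<close> costs
    \<open>(t - 2)^2\<close> and each of the other \<open>m z - 1\<close> common neighbours costs
    \<open>t^2\<close>; the minimum is at \<open>t = 2 / m z\<close>.\<close>
  define g where "g u = (if u = y then 1 else if u \<in> Z then 2 / m u else 0)" for u
  have yx: "y \<noteq> x" "x \<in> nb y" and yZ: "y \<notin> Z" and yV: "y \<in> V"
    using y adj_irr adj_sym adjV by (auto simp: Z_def)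
  have gx: "g x = 0" and gy: "g y = 1" using yx by (auto simp: g_def Z_def)
  have g0: "g u = 0" if "u \<in> nb x" "u \<noteq> y" for u
    using that no by (auto simp: g_def Z_def)
  have gZ: "g z = 2 / m z" if "z \<in> Z" for z
    using that yZ by (auto simp: g_def)
  have finZ: "finite Z" by (simp add: Z_def)
  have yz: "y \<in> nb x \<inter> nb z" if "z \<in> Z" for z
    using that y by (auto simp: Z_def dest: adj_sym)
  have mpos: "m z > 0" if "z \<in> Z" for z
    unfolding m_def of_nat_0_less_iff card_gt_0_iff using yz[OF that] by auto
  have cardZ: "real (card Z) = real d - 1"
  proof -
    have "card (nb y) = Suc (card Z)"
      unfolding Z_def using yx by (subst card_Suc_Diff1) auto
    then show ?thesis using reg[OF yV] by simp
  qed
  have lap: "lap nb g x = 1"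
  proof -
    have "lap nb g x = (\<Sum>u\<in>nb x. if u = y then 1 else 0)"
      unfolding lap_def by (intro sum.cong refl) (auto simp: gx gy g0)
    then show ?thesis using y by (simp add: sum.delta)
  qed
  have gr: "grad nb g g x = 1"
  proof -
    have "grad nb g g x = (\<Sum>u\<in>nb x. if u = y then 1 else 0)"
      unfolding grad_def by (intro sum.cong refl) (auto simp: gx gy g0)
    then show ?thesis using y by (simp add: sum.delta)
  qed
  let ?I = "\<lambda>u. \<Sum>z\<in>nb u. (g z - 2 * g u + g x) * (g z - 2 * g u + g x)"
  have Iy: "?I y = 4 + (\<Sum>z\<in>Z. (2 / m z - 2)^2)"
  proof -
    have "?I y = (g x - 2 * g y + g x) * (g x - 2 * g y + g x)
        + (\<Sum>z\<in>Z. (g z - 2 * g y + g x) * (g z - 2 * g y + g x))"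
      unfolding Z_def using yx by (subst sum.remove[of _ x]) auto
    also have "(\<Sum>z\<in>Z. (g z - 2 * g y + g x) * (g z - 2 * g y + g x)) = (\<Sum>z\<in>Z. (2 / m z - 2)^2)"
      by (intro sum.cong refl) (simp add: gZ gx gy power2_eq_square)
    finally show ?thesis by (simp add: gx gy)
  qed
  have Iu: "?I u = (\<Sum>z\<in>{z \<in> Z. z \<in> nb u}. (2 / m z)^2)" if u: "u \<in> nb x - {y}" for u
  proof -
    have "y \<notin> nb u" using u no y adj_sym by blast
    then have "g z = 0" if "z \<in> nb u - {z \<in> Z. z \<in> nb u}" for z
      using that by (auto simp: g_def)
    then have "?I u = (\<Sum>z\<in>{z \<in> Z. z \<in> nb u}. g z * g z)"
      using u by (intro sum.mono_neutral_cong_right) (auto simp: g0 gx)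
    also have "\<dots> = (\<Sum>z\<in>{z \<in> Z. z \<in> nb u}. (2 / m z)^2)"
      by (intro sum.cong refl) (auto simp: gZ power2_eq_square)
    finally show ?thesis .
  qed
  have "(\<Sum>u\<in>nb x. ?I u) = ?I y + (\<Sum>u\<in>nb x - {y}. ?I u)"
    using y by (subst sum.remove[of _ y]) auto
  also have "(\<Sum>u\<in>nb x - {y}. ?I u) = (\<Sum>u\<in>nb x - {y}. \<Sum>z\<in>{z \<in> Z. z \<in> nb u}. (2 / m z)^2)"
    by (intro sum.cong refl Iu)
  also have "\<dots> = (\<Sum>z\<in>Z. \<Sum>u\<in>{u \<in> nb x - {y}. z \<in> nb u}. (2 / m z)^2)"
    by (subst sum.swap_restrict) (use finZ in auto)
  also have "\<dots> = (\<Sum>z\<in>Z. (m z - 1) * (2 / m z)^2)"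
  proof (intro sum.cong refl)
    fix z assume z: "z \<in> Z"
    have "{u \<in> nb x - {y}. z \<in> nb u} = nb x \<inter> nb z - {y}"
      by (auto dest: adj_sym)
    then have "Suc (card {u \<in> nb x - {y}. z \<in> nb u}) = card (nb x \<inter> nb z)"
      using yz[OF z] by (metis card_Suc_Diff1 fin_nb finite_Int)
    then have "real (card {u \<in> nb x - {y}. z \<in> nb u}) = m z - 1"
      unfolding m_def by linarith
    then show "(\<Sum>u\<in>{u \<in> nb x - {y}. z \<in> nb u}. (2 / m z)^2) = (m z - 1) * (2 / m z)^2"
      by simp
  qed
  finally have "(\<Sum>u\<in>nb x. ?I u) = 4 + (\<Sum>z\<in>Z. (2 / m z - 2)^2 + (m z - 1) * (2 / m z)^2)"
    by (simp add: Iy sum.distrib)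
  also have "(\<Sum>z\<in>Z. (2 / m z - 2)^2 + (m z - 1) * (2 / m z)^2) = (\<Sum>z\<in>Z. 4 - 4 * (1 / m z))"
  proof (intro sum.cong refl)
    fix z assume "z \<in> Z"
    then show "(2 / m z - 2)^2 + (m z - 1) * (2 / m z)^2 = 4 - 4 * (1 / m z)"
      using mpos by (simp add: field_simps power2_eq_square)
  qed
  also have "\<dots> = 4 * (real d - 1) - 4 * (\<Sum>z\<in>Z. 1 / m z)"
    by (simp only: sum_subtractf sum_distrib_left[symmetric] sum_constant cardZ)
  finally have "bform nb d x g g = 4 + (4 * (real d - 1) - 4 * (\<Sum>z\<in>Z. 1 / m z)) + 2 - (2 * d + 4)"
    by (simp add: bform_def lap gr)
  then show ?thesis
    using cd[OF x, of g] by (simp add: Z_def m_def)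
qed

section \<open>Cuts and minimal blocks\<close>

text \<open>The edges of such a cut form a perfect matching, and the function that is 1 on one side
  and -1 on the other then has eigenvalue 2.\<close>

definition is_cut :: "'a set \<Rightarrow> bool" where
  "is_cut S \<longleftrightarrow> (\<forall>x\<in>V. \<exists>y. {y \<in> nb x. (y \<in> S) \<noteq> (x \<in> S)} = {y})"

lemma cut_locmax_aux:
  assumes S: "is_cut S" and x: "x \<in> V" "x \<in> S"
  shows "\<exists>f x. locmax f x \<and> card (down f x) = 1"
proof -
  define f where "f = (\<lambda>x. if x \<in> V then if x \<in> S then 1 else -1 else (0::real))"
  have "lap nb f u = - 2 * f u" if u: "u \<in> V" for u
  proof -
    obtain y where y: "{y \<in> nb u. (y \<in> S) \<noteq> (u \<in> S)} = {y}"
      using S u by (auto simp: is_cut_def)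
    have "lap nb f u = (\<Sum>v\<in>{y \<in> nb u. (y \<in> S) \<noteq> (u \<in> S)}. f v - f u)"
      unfolding lap_def by (rule sum.mono_neutral_right) (use u adjV in \<open>auto simp: f_def\<close>)
    then have l: "lap nb f u = f y - f u" using y by simp
    have "y \<in> nb u" "(y \<in> S) \<noteq> (u \<in> S)" using y by blast+
    then show ?thesis using u adjV[of y u] unfolding l by (auto simp: f_def)
  qed
  then have "f \<in> E" by (auto simp: eig2_def f_def)
  then have "locmax f x" using x by (auto simp: locmax_def f_def)
  moreover have "down f x = {y \<in> nb x. (y \<in> S) \<noteq> (x \<in> S)}"
    using x adjV by (auto simp: down_def f_def split: if_splits)
  then have "card (down f x) = 1" using S x by (auto simp: is_cut_def)
  ultimately show ?thesis by blast
qed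

lemma cut_locmax:
  assumes S: "is_cut S"
  shows "\<exists>f x. locmax f x \<and> card (down f x) = 1"
proof -
  obtain x where x: "x \<in> V" using V_ne by blast
  show ?thesis
  proof (cases "x \<in> S")
    case True
    then show ?thesis using cut_locmax_aux[OF S x] by blast
  next
    case False
    have "is_cut (- S)" using S by (simp add: is_cut_def)
    then show ?thesis using cut_locmax_aux[OF _ x] False by blast
  qed
qed

lemma locmax_down_empty: "locmax f x \<Longrightarrow> down f x = {} \<longleftrightarrow> f = (\<lambda>x. 0)"
proof
  assume m: "locmax f x" and "down f x = {}"
  then have "f y = f x" if "y \<in> nb x" for y
    using that locmaxD(3)[OF m that] by (auto simp: down_def)
  then show "f = (\<lambda>x. 0)" by (rule E_eq_zero_if_flat[OF locmaxD(1,2)[OF m]])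
qed (auto simp: down_def)

lemma ex_locmax:
  assumes "f \<in> E"
  shows "\<exists>x. locmax f x"
proof -
  have "Max (f ` V) \<in> f ` V" using finV V_ne by (intro Max_in) auto
  then obtain x where x: "x \<in> V" "f x = Max (f ` V)" by auto
  have "f y \<le> f x" if "y \<in> nb x" for y
    unfolding x(2) using finV adjV[OF that] by (intro Max_ge) auto
  then show ?thesis using assms x by (auto simp: locmax_def)
qed

text \<open>Add a growing multiple of \<open>g\<close> to \<open>f\<close> until the first block
  vertex climbs to the height of \<open>x\<close>. The sum still has a local maximum at
  \<open>x\<close> and its block is strictly smaller, so by minimality it is zero.\<close>

lemma support_multiple_aux:
  assumes m: "locmax f x"
    and min: "\<And>h. locmax h x \<Longrightarrow> h \<noteq> (\<lambda>x. 0) \<Longrightarrow> down h x \<subset> down f x \<Longrightarrow> False"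
    and g: "g \<in> E" and flat: "\<And>y. y \<in> nb x \<Longrightarrow> y \<notin> down f x \<Longrightarrow> g y = g x"
    and up: "y1 \<in> down f x" "g y1 > g x"
  shows "\<exists>c. g = (\<lambda>x. c * f x)"
proof -
  define A where "A = {y \<in> down f x. g y > g x}"
  \<comment> \<open>The multiple of \<open>g\<close> at which \<open>y\<close> reaches the height of
    \<open>x\<close>; the least one is taken.\<close>
  let ?q = "\<lambda>y. (f x - f y) / (g y - g x)"
  have A: "finite A" "A \<noteq> {}" using up by (auto simp: A_def)
  obtain y0 where y0: "y0 \<in> A" "\<And>y. y \<in> A \<Longrightarrow> ?q y0 \<le> ?q y"
    using arg_min_if_finite[OF A, of ?q] by (meson not_le)
  define \<tau> where "\<tau> = ?q y0"
  have \<tau>: "\<tau> > 0" using y0(1) by (auto simp: \<tau>_def A_def down_def)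
  define h where "h = (\<lambda>x. f x + \<tau> * g x)"
  have hE: "h \<in> E" unfolding h_def by (rule E_add[OF locmaxD(1)[OF m] g])
  have le: "h y \<le> h x" if y: "y \<in> nb x" for y
  proof (cases "y \<in> A")
    case True
    have "\<tau> * (g y - g x) \<le> f x - f y"
      using y0(2)[OF True] True by (simp add: \<tau>_def A_def pos_le_divide_eq)
    then show ?thesis by (simp add: h_def algebra_simps)
  next
    case False
    then have "g y \<le> g x" using flat[OF y] by (force simp: A_def)
    then have "\<tau> * g y \<le> \<tau> * g x" using \<tau> by simp
    then show ?thesis using locmaxD(3)[OF m y] by (simp add: h_def)
  qed
  have mh: "locmax h x" using hE le locmaxD(2)[OF m] by (auto simp: locmax_def)
  have "down h x \<subset> down f x"
  proof
    show "down h x \<subseteq> down f x"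
    proof
      fix y assume y: "y \<in> down h x"
      show "y \<in> down f x"
      proof (rule ccontr)
        assume n: "y \<notin> down f x"
        then have "f y = f x" using locmaxD(3)[OF m down_nb[OF y]] down_nb[OF y]
          by (auto simp: down_def)
        then show False using flat[OF down_nb[OF y] n] down_less[OF y] by (simp add: h_def)
      qed
    qed
    have "g y0 - g x > 0" using y0(1) by (simp add: A_def)
    then have "\<tau> * (g y0 - g x) = f x - f y0" by (simp add: \<tau>_def)
    then have "h y0 = h x" by (simp add: h_def algebra_simps)
    then have "y0 \<notin> down h x" by (simp add: down_def)
    moreover have "y0 \<in> down f x" using y0(1) by (simp add: A_def)
    ultimately show "down h x \<noteq> down f x" by blast
  qed
  then have h0: "h = (\<lambda>x. 0)" using min mh by blast
  have "g u = (- 1 / \<tau>) * f u" for u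
    using fun_cong[OF h0, of u] \<tau> by (simp add: h_def field_simps)
  then show ?thesis by blast
qed

text \<open>If \<open>g\<close> is flat on the block too, it vanishes; otherwise \<open>g\<close> or
  \<open>- g\<close> increases somewhere on the block.\<close>

lemma support_multiple:
  assumes m: "locmax f x"
    and min: "\<And>h. locmax h x \<Longrightarrow> h \<noteq> (\<lambda>x. 0) \<Longrightarrow> down h x \<subset> down f x \<Longrightarrow> False"
    and g: "g \<in> E" and flat: "\<And>y. y \<in> nb x \<Longrightarrow> y \<notin> down f x \<Longrightarrow> g y = g x"
  shows "\<exists>c. g = (\<lambda>x. c * f x)"
proof (cases "\<exists>y\<in>down f x. g y \<noteq> g x")
  case False
  then have "g = (\<lambda>x. 0)"
    using flat by (intro E_eq_zero_if_flat[OF g locmaxD(2)[OF m]]) blast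
  then have "g = (\<lambda>x. 0 * f x)" by simp
  then show ?thesis by blast
next
  case True
  then obtain y where y: "y \<in> down f x" "g y \<noteq> g x" by blast
  show ?thesis
  proof (cases "g y > g x")
    case True
    show ?thesis
      by (rule support_multiple_aux[OF m _ g _ y(1) True], erule (2) min, erule (1) flat)
  next
    case False
    have "\<exists>c. (\<lambda>x. (-1) * g x) = (\<lambda>x. c * f x)"
      by (rule support_multiple_aux[OF m _ E_scale[OF g] _ y(1)], erule (2) min, simp add: flat)
        (use False y in simp)
    then obtain c where c: "(\<lambda>x. (-1) * g x) = (\<lambda>x. c * f x)" by blast
    have "g u = (- c) * f u" for u using fun_cong[OF c, of u] by simp
    then show ?thesis by blast
  qed
qed

text \<open>Only block edges contribute to \<open>tri f a b\<close> at a local maximum, and by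
  \<open>level_parallel\<close> the matching of two adjacent blocks preserves the increments of
  \<open>f\<close>, \<open>a\<close> and \<open>b\<close>.\<close>

lemma tri_level:
  assumes m: "locmax f x" and u: "u \<in> nb x" "f u = f x" and a: "a \<in> E" and b: "b \<in> E"
  shows "tri f a b u = tri f a b x"
proof -
  have *: "tri f a b v = (\<Sum>y\<in>down f v. (f y - f v) * (a y - a v) * (b y - b v))"
    if "locmax f v" for v
    unfolding tri_def
    by (rule sum.mono_neutral_right) (use locmaxD(3)[OF that] in \<open>force simp: down_def\<close>)+
  obtain \<psi> where \<psi>: "bij_betw \<psi> (down f x) (down f u)" "\<And>y. y \<in> down f x \<Longrightarrow> \<psi> y \<in> nb y"
    using level_bij[OF m u] by metis
  have par: "g (\<psi> y) - g u = g y - g x" if g: "g \<in> E" and y: "y \<in> down f x" for g y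
  proof -
    have "\<psi> y \<in> down f u" using \<psi>(1) y by (auto simp: bij_betw_def)
    from level_parallel[OF m u this y adj_sym[OF \<psi>(2)[OF y]] g] show ?thesis by simp
  qed
  have "tri f a b u = (\<Sum>y\<in>down f x. (f (\<psi> y) - f u) * (a (\<psi> y) - a u) * (b (\<psi> y) - b u))"
    unfolding *[OF level_locmax[OF m u]]
    by (rule sum.reindex_bij_betw[OF \<psi>(1), symmetric])
  also have "\<dots> = tri f a b x"
    unfolding *[OF m] by (intro sum.cong refl) (simp add: par locmaxD(1)[OF m] a b)
  finally show ?thesis .
qed

text \<open>A linear form of minimality: \<open>f\<close> spans the elements of \<open>E\<close>
  that are flat at \<open>x\<close> outside the block. By \<open>support_multiple\<close> it follows
  from minimality of the block under inclusion.\<close>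

definition minimal_at :: "('a \<Rightarrow> real) \<Rightarrow> 'a \<Rightarrow> bool" where
  "minimal_at f x \<longleftrightarrow> locmax f x \<and> f \<noteq> (\<lambda>x. 0) \<and>
    (\<forall>g\<in>E. (\<forall>y\<in>nb x. y \<notin> down f x \<longrightarrow> g y = g x) \<longrightarrow> (\<exists>c. g = (\<lambda>x. c * f x)))"

text \<open>
  The triple products \<open>tri f f f\<close>, \<open>tri f f g\<close> and \<open>tri f g g\<close> are all multiples of \<open>f\<close>;
  orthogonality passes from each of them to the next.
\<close>

lemma minimal_orthogonal_flat:
  assumes m: "minimal_at f x" and g: "g \<in> E" and o: "ip f g = 0" and y: "y \<in> down f x"
  shows "g y = g x"
proof -
  have mf: "locmax f x" and f0: "f \<noteq> (\<lambda>x. 0)" using m by (auto simp: minimal_at_def)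
  have f: "f \<in> E" by (rule locmaxD(1)[OF mf])
  have ff: "ip f f > 0" by (rule ip_pos[OF f f0])
  have mult: "\<exists>c. tri f a b = (\<lambda>x. c * f x)" if a: "a \<in> E" and b: "b \<in> E" for a b
  proof -
    have "tri f a b y = tri f a b x" if "y \<in> nb x" "y \<notin> down f x" for y
    proof -
      have "f y = f x" using that locmaxD(3)[OF mf that(1)] by (auto simp: down_def)
      then show ?thesis by (rule tri_level[OF mf that(1) _ a b])
    qed
    then show ?thesis using m tri_E[OF f a b] by (auto simp: minimal_at_def)
  qed
  obtain c1 where c1: "tri f f f = (\<lambda>x. c1 * f x)" using mult[OF f f] by blast
  obtain c2 where c2: "tri f f g = (\<lambda>x. c2 * f x)" using mult[OF f g] by blast
  obtain c3 where c3: "tri f g g = (\<lambda>x. c3 * f x)" using mult[OF g g] by blast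
  have "c2 * ip f f = ip (tri f f g) f" unfolding c2 ip_scale ..
  also have "\<dots> = ip (tri f f f) g" by (rule ip_tri_swap)
  also have "\<dots> = 0" unfolding c1 ip_scale using o by simp
  finally have c20: "c2 = 0" using ff by simp
  have "c3 * ip f f = ip (tri f g g) f" unfolding c3 ip_scale ..
  also have "\<dots> = ip (tri f g f) g" by (rule ip_tri_swap)
  also have "tri f g f = tri f f g" by (auto simp: tri_def fun_eq_iff mult_ac)
  also have "ip (tri f f g) g = 0" unfolding c2 ip_scale c20 by simp
  finally have c30: "c3 = 0" using ff by simp
  \<comment> \<open>At a local maximum of \<open>f\<close> all terms of the resulting sum are
    nonnegative, so each of them is zero.\<close>
  have "0 = - tri f g g x" unfolding c3 c30 by simp
  also have "\<dots> = (\<Sum>y\<in>nb x. (f x - f y) * (g y - g x)^2)"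
    unfolding tri_def sum_negf[symmetric] by (intro sum.cong refl) (simp add: power2_eq_square algebra_simps)
  finally have "(\<Sum>y\<in>nb x. (f x - f y) * (g y - g x)^2) = 0" by simp
  then have "(f x - f y) * (g y - g x)^2 = 0"
    using y locmaxD(3)[OF mf] by (subst (asm) sum_nonneg_eq_0_iff) (auto simp: down_def)
  then show ?thesis using down_less[OF y] by simp
qed

definition min_supp :: "nat \<Rightarrow> bool" where
  "min_supp s \<longleftrightarrow> (\<forall>f x. locmax f x \<longrightarrow> f \<noteq> (\<lambda>x. 0) \<longrightarrow> s \<le> card (down f x))"

lemma min_supp_minimal_at:
  assumes "min_supp s" "locmax f x" "f \<noteq> (\<lambda>x. 0)" "card (down f x) = s"
  shows "minimal_at f x"
  unfolding minimal_at_def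
proof (intro conjI ballI impI assms(2,3))
  fix g assume g: "g \<in> E" "\<forall>y\<in>nb x. y \<notin> down f x \<longrightarrow> g y = g x"
  show "\<exists>c. g = (\<lambda>x. c * f x)"
  proof (rule support_multiple[OF assms(2) _ g(1)])
    fix h assume h: "locmax h x" "h \<noteq> (\<lambda>x. 0)" "down h x \<subset> down f x"
    then have "card (down h x) < card (down f x)" by (intro psubset_card_mono) auto
    moreover have "s \<le> card (down h x)"
      using assms(1) h(1,2) by (simp add: min_supp_def)
    ultimately show False using assms(4) by simp
  qed (use g(2) in auto)
qed

lemma min_supp_lev:
  assumes "min_supp s" "locmax f x" "f \<noteq> (\<lambda>x. 0)" "card (down f x) = s" "u \<in> lev f x"
  shows "minimal_at f u"
  using min_supp_minimal_at[OF assms(1) lev_locmax[OF assms(2,5)] assms(3)]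
    lev_card_down[OF assms(2,5)] assms(4) by simp

lemma ex_min_supp:
  assumes "g \<in> E" "g \<noteq> (\<lambda>x. 0)"
  obtains s f x where "min_supp s" "locmax f x" "f \<noteq> (\<lambda>x. 0)" "card (down f x) = s" "s \<ge> 1"
proof -
  let ?Q = "\<lambda>s. \<exists>f x. locmax f x \<and> f \<noteq> (\<lambda>x. 0) \<and> card (down f x) = s"
  define s where "s = (LEAST s. ?Q s)"
  obtain x0 where "locmax g x0" using ex_locmax[OF assms(1)] by blast
  then have ex: "?Q (card (down g x0))" using assms(2) by blast
  have "?Q s" unfolding s_def by (rule LeastI[of ?Q, OF ex])
  then obtain f x where fx: "locmax f x" "f \<noteq> (\<lambda>x. 0)" "card (down f x) = s" by blast
  moreover have "min_supp s"
    unfolding min_supp_def s_def by (intro allI impI Least_le) blast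
  moreover have "s \<ge> 1"
    using fx locmax_down_empty[OF fx(1)] by (auto simp: Suc_le_eq card_gt_0_iff)
  ultimately show ?thesis using that by blast
qed

lemma card_down_le: "x \<in> V \<Longrightarrow> card (down f x) \<le> d"
  using card_mono[of "nb x" "down f x"] reg by (auto simp: down_def)

text \<open>The \<open>d - card (down f x)\<close> flatness conditions outside the block leave only
  the line through \<open>f\<close>.\<close>

lemma minimal_dim:
  assumes m: "minimal_at f x"
  shows "fun_space.dim E + card (down f x) \<le> d + 1"
proof -
  have mf: "locmax f x" using m by (auto simp: minimal_at_def)
  have x: "x \<in> V" by (rule locmaxD(2)[OF mf])
  let ?J = "nb x - down f x"
  have "spans_le {h \<in> E. \<forall>y\<in>?J. h y = h x} 1"
    by (rule spans_single[of _ f]) (use m in \<open>auto simp: minimal_at_def\<close>)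
  then have "fun_space.dim E \<le> 1 + card ?J"
    using spans_le_dim spans_E_flat[OF x] by blast
  moreover have "card ?J = d - card (down f x)"
    using reg[OF x] by (subst card_Diff_subset) (auto simp: down_def)
  ultimately show ?thesis using card_down_le[OF x, of f] by simp
qed

lemma orthogonal_part:
  assumes "f \<in> E" "f \<noteq> (\<lambda>x. 0)" "h \<in> E"
  obtains c g where "g \<in> E" "ip f g = 0" "h = (\<lambda>x. c * f x + g x)"
proof -
  define c where "c = ip f h / ip f f"
  define g where "g = (\<lambda>x. h x + (- c) * f x)"
  have "g \<in> E" unfolding g_def by (rule E_add[OF assms(3,1)])
  moreover have "ip f g = ip f h - c * ip f f"
    by (simp add: ip_def g_def sum_distrib_left flip: sum_subtractf)
      (intro sum.cong refl, simp add: algebra_simps)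
  then have "ip f g = 0" using ip_pos[OF assms(1,2)] by (simp add: c_def)
  moreover have "h = (\<lambda>x. c * f x + g x)" by (auto simp: g_def)
  ultimately show ?thesis using that by blast
qed

text \<open>A function orthogonal to \<open>f\<close> is flat on all blocks along the level
  component. Where it is largest on that component it therefore has a local maximum in the whole
  graph, with a block disjoint from that of \<open>f\<close>. Two disjoint blocks of size at least
  \<open>s\<close> leave at most \<open>d - 2 * s\<close> further conditions.\<close>

lemma min_supp_two_blocks:
  assumes ms: "min_supp s" and mf: "locmax f x" and f0: "f \<noteq> (\<lambda>x. 0)" and s: "card (down f x) = s"
    and dim: "fun_space.dim E \<ge> 2"
  shows "fun_space.dim E + 2 * s \<le> d + 2"
proof -
  have f: "f \<in> E" by (rule locmaxD(1)[OF mf])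
  have "\<exists>g\<in>E. g \<noteq> (\<lambda>x. 0) \<and> ip f g = 0"
  proof (rule ccontr)
    assume no: "\<not> ?thesis"
    have "\<exists>c. h = (\<lambda>x. c * f x)" if hE: "h \<in> E" for h
    proof -
      obtain c g where "g \<in> E" "ip f g = 0" "h = (\<lambda>x. c * f x + g x)"
        by (rule orthogonal_part[OF f f0 hE])
      moreover then have "g = (\<lambda>x. 0)" using no by blast
      ultimately show ?thesis by auto
    qed
    then have "fun_space.dim E \<le> 1" by (intro spans_le_dim spans_single[of _ f])
    then show False using dim by simp
  qed
  then obtain g where g: "g \<in> E" "g \<noteq> (\<lambda>x. 0)" "ip f g = 0" by blast
  have xV: "x \<in> V" by (rule locmaxD(2)[OF mf])
  have finL: "finite (lev f x)" using lev_sub[OF xV] finV finite_subset by blast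
  have "Max (g ` lev f x) \<in> g ` lev f x"
    using finL by (intro Max_in) (auto intro: lev_self)
  then obtain u where u: "u \<in> lev f x" "g u = Max (g ` lev f x)" by auto
  have gu: "g v \<le> g u" if "v \<in> lev f x" for v
    unfolding u(2) using finL that by simp
  have mu: "minimal_at f u" by (rule min_supp_lev[OF ms mf f0 s u(1)])
  have mfu: "locmax f u" by (rule lev_locmax[OF mf u(1)])
  have uV: "u \<in> V" by (rule locmaxD(2)[OF mfu])
  have flat: "h y = h u" if "h \<in> E" "ip f h = 0" "y \<in> down f u" for h y
    by (rule minimal_orthogonal_flat[OF mu that])
  have mg: "locmax g u"
  proof -
    have "g y \<le> g u" if "y \<in> nb u" for y
      using lev_nb_cases[OF mf u(1) that] flat[OF g(1,3)] gu by force
    then show ?thesis using g uV by (auto simp: locmax_def)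
  qed
  \<comment> \<open>The second block is chosen of least size among those disjoint from the first;
    then a function flat outside both is determined by two coefficients.\<close>
  let ?Q = "\<lambda>n. \<exists>h. locmax h u \<and> h \<noteq> (\<lambda>x. 0) \<and> down h u \<inter> down f u = {} \<and> card (down h u) = n"
  have "down g u \<inter> down f u = {}"
    using flat[OF g(1,3)] down_less[of _ g u] by fastforce
  then have ex: "?Q (card (down g u))" using mg g(2) by blast
  define n where "n = (LEAST n. ?Q n)"
  have "?Q n" unfolding n_def by (rule LeastI[of ?Q, OF ex])
  then obtain k where k: "locmax k u" "k \<noteq> (\<lambda>x. 0)" "down k u \<inter> down f u = {}" "card (down k u) = n"
    by blast
  have n: "n \<ge> s" using ms k by (auto simp: min_supp_def)
  have kmult: "\<exists>c. h = (\<lambda>x. c * k x)"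
    if h: "h \<in> E" "\<And>y. y \<in> nb u \<Longrightarrow> y \<notin> down k u \<Longrightarrow> h y = h u" for h
  proof (rule support_multiple[OF k(1) _ h])
    fix l assume l: "locmax l u" "l \<noteq> (\<lambda>x. 0)" "down l u \<subset> down k u"
    then have "?Q (card (down l u))" using k(3) by blast
    then have "n \<le> card (down l u)" unfolding n_def by (rule Least_le)
    moreover have "card (down l u) < card (down k u)" using l(3) by (intro psubset_card_mono) auto
    ultimately show False using k(4) by simp
  qed
  let ?J = "nb u - down f u - down k u"
  have "\<exists>c c'. h = (\<lambda>x. c * f x + c' * k x)" if h: "h \<in> {h \<in> E. \<forall>y\<in>?J. h y = h u}" for h
  proof -
    have hE: "h \<in> E" using h by simp
    obtain c h' where h': "h' \<in> E" "ip f h' = 0" "h = (\<lambda>x. c * f x + h' x)"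
      by (rule orthogonal_part[OF f f0 hE])
    have "h' y = h' u" if y: "y \<in> nb u" "y \<notin> down k u" for y
    proof (cases "y \<in> down f u")
      case True
      then show ?thesis using flat[OF h'(1,2)] by blast
    next
      case False
      then have "h y = h u" using h y by auto
      moreover have "f y = f u" using False y locmaxD(3)[OF mfu y(1)] by (auto simp: down_def)
      ultimately show ?thesis unfolding h'(3) by simp
    qed
    then obtain c' where "h' = (\<lambda>x. c' * k x)" using kmult[OF h'(1)] by blast
    then show ?thesis using h'(3) by blast
  qed
  then have "spans_le {h \<in> E. \<forall>y\<in>?J. h y = h u} 2" by (rule spans_double)
  then have "fun_space.dim E \<le> 2 + card ?J"
    using spans_le_dim spans_E_flat[OF uV, of ?J 2] by blast
  moreover have "card ?J + card (down f u) + card (down k u) = d"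
  proof -
    have "card (nb u) = card (?J \<union> (down f u \<union> down k u))"
      by (rule arg_cong[of _ _ card]) (auto simp: down_def)
    also have "\<dots> = card ?J + card (down f u \<union> down k u)"
      by (rule card_Un_disjoint) auto
    also have "card (down f u \<union> down k u) = card (down f u) + card (down k u)"
      using k(3) by (intro card_Un_disjoint) auto
    finally show ?thesis using reg[OF uV] by simp
  qed
  ultimately show ?thesis
    using n k(4) lev_card_down[OF mf u(1)] s by simp
qed

end

text \<open>The induced subgraph, with empty neighbourhoods outside \<open>W\<close> so that
  \<open>W\<close> can serve as the vertex set of a \<open>regular_graph\<close>.\<close>

definition sub_nb :: "('a \<Rightarrow> 'a set) \<Rightarrow> 'a set \<Rightarrow> 'a \<Rightarrow> 'a set" where
  "sub_nb nb W u = (if u \<in> W then nb u \<inter> W else {})"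

lemma spans_le_dim_self:
  assumes "spans_le W n"
  shows "spans_le W (fun_space.dim W)"
proof (rule finite_basis[OF assms])
  fix B assume "W \<subseteq> fun_space.span B" "finite B" "card B = fun_space.dim W"
  then show ?thesis unfolding spans_le_def by auto
qed

context cd_graph
begin

section \<open>Listing neighbours by counting\<close>

text \<open>The squared gradient has the same value at all vertices, so edges at \<open>u\<close>
  that already account for it leave nothing for the others.\<close>

lemma grad_exhausted:
  assumes f: "f \<in> E" and x: "x \<in> V" and u: "u \<in> V" and A: "A \<subseteq> nb u"
    and sum: "(\<Sum>v\<in>A. (f v - f u)^2) = grad nb f f x" and v: "v \<in> nb u" "v \<notin> A"
  shows "f v = f u"
proof -
  have "(\<Sum>v\<in>nb u. (f v - f u)^2) = grad nb f f x"
    using grad_self_const[OF f u x] by (simp add: grad_def power2_eq_square)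
  moreover have "(\<Sum>v\<in>nb u. (f v - f u)^2) = (\<Sum>v\<in>A. (f v - f u)^2) + (\<Sum>v\<in>nb u - A. (f v - f u)^2)"
    using A by (metis add.commute fin_nb sum.subset_diff)
  ultimately have "(\<Sum>v\<in>nb u - A. (f v - f u)^2) = 0" using sum by simp
  then have "(f v - f u)^2 = 0" using v by (subst (asm) sum_nonneg_eq_0_iff) auto
  then show ?thesis by simp
qed

lemma grad_down:
  assumes m: "locmax f x"
  shows "grad nb f f x = (\<Sum>y\<in>down f x. (f y - f x)^2)"
proof -
  have "grad nb f f x = (\<Sum>y\<in>nb x. (f y - f x)^2)"
    by (simp add: grad_def power2_eq_square)
  also have "\<dots> = (\<Sum>y\<in>down f x. (f y - f x)^2)"
    by (rule sum.mono_neutral_right) (use locmaxD(3)[OF m] in \<open>force simp: down_def\<close>)+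
  finally show ?thesis .
qed

text \<open>The partners of \<open>y\<close> in the blocks of the level neighbours of
  \<open>x\<close>. They number \<open>d - card (down f x)\<close>, so a few further neighbours of
  \<open>y\<close> complete the list of all of them.\<close>

definition matched :: "('a \<Rightarrow> real) \<Rightarrow> 'a \<Rightarrow> 'a \<Rightarrow> 'a set" where
  "matched f x y = {v \<in> nb y. \<exists>u\<in>nb x. f u = f x \<and> v \<in> down f u}"

lemma matched_value:
  assumes m: "locmax f x" and y: "y \<in> down f x" and v: "v \<in> matched f x y"
  shows "f v = f y"
proof -
  obtain u where u: "u \<in> nb x" "f u = f x" "v \<in> down f u" and vy: "v \<in> nb y"
    using v by (auto simp: matched_def)
  have "f x + f v = f u + f y"
    by (rule level_parallel[OF m u y adj_sym[OF vy] locmaxD(1)[OF m]])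
  then show ?thesis using u by simp
qed

lemma matched_bij:
  assumes m: "locmax f x" and y: "y \<in> down f x"
  obtains \<phi> where "bij_betw \<phi> {u \<in> nb x. f u = f x} (matched f x y)"
    "\<And>u. u \<in> nb x \<Longrightarrow> f u = f x \<Longrightarrow> nb y \<inter> down f u = {\<phi> u}"
proof -
  let ?N = "{u \<in> nb x. f u = f x}"
  have "\<exists>z. nb y \<inter> down f u = {z}" if u: "u \<in> nb x" "f u = f x" for u
  proof -
    have "card (nb y \<inter> down f u) = 1"
      by (rule level_match_card[OF level_locmax[OF m u] adj_sym[OF u(1)] u(2)[symmetric] y])
    then show ?thesis using card_1_singletonE by metis
  qed
  then obtain \<phi> where \<phi>: "\<And>u. u \<in> nb x \<Longrightarrow> f u = f x \<Longrightarrow> nb y \<inter> down f u = {\<phi> u}" by metis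
  have \<phi>': "\<phi> u \<in> nb y" "\<phi> u \<in> down f u" if "u \<in> ?N" for u
    using \<phi>[of u] that by blast+
  have "bij_betw \<phi> ?N (matched f x y)"
  proof (rule bij_betwI')
    fix u u' assume u: "u \<in> ?N" "u' \<in> ?N"
    show "(\<phi> u = \<phi> u') = (u = u')"
    proof
      assume eq: "\<phi> u = \<phi> u'"
      have "u' \<in> nb (\<phi> u)"
        unfolding eq using down_nb[OF \<phi>'(2)[OF u(2)]] by (rule adj_sym)
      then have "u' = u"
        using down_unique_up[OF level_locmax[OF m] \<phi>'(2)[OF u(1)]] u by auto
      then show "u = u'" ..
    qed simp
  next
    fix u assume "u \<in> ?N"
    then show "\<phi> u \<in> matched f x y" using \<phi>' by (auto simp: matched_def)
  next
    fix v assume "v \<in> matched f x y"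
    then obtain u where u: "u \<in> ?N" "v \<in> nb y" "v \<in> down f u" by (auto simp: matched_def)
    then have "v \<in> {\<phi> u}" using \<phi>[of u] by blast
    then show "\<exists>u\<in>?N. v = \<phi> u" using u by blast
  qed
  then show ?thesis using that \<phi> by blast
qed

lemma card_level_nb: 
  assumes m: "locmax f x"
  shows "card {u \<in> nb x. f u = f x} + card (down f x) = d"
proof -
  have "f u = f x \<or> f u < f x" if "u \<in> nb x" for u
    using locmaxD(3)[OF m that] by auto
  then have "nb x = {u \<in> nb x. f u = f x} \<union> down f x"
    by (auto simp: down_def)
  then have "card (nb x) = card ({u \<in> nb x. f u = f x} \<union> down f x)" by simp
  also have "\<dots> = card {u \<in> nb x. f u = f x} + card (down f x)"
    by (rule card_Un_disjoint) (auto simp: down_def)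
  finally have "card (nb x) = card {u \<in> nb x. f u = f x} + card (down f x)" .
  then show ?thesis using reg[OF locmaxD(2)[OF m]] by simp
qed

lemma matched_card:
  assumes m: "locmax f x" and y: "y \<in> down f x"
  shows "card (matched f x y) + card (down f x) = d"
proof (rule matched_bij[OF assms])
  fix \<phi> assume "bij_betw \<phi> {u \<in> nb x. f u = f x} (matched f x y)"
  from bij_betw_same_card[OF this] show ?thesis using card_level_nb[OF m] by simp
qed

lemma card_lev_nb:
  assumes "locmax f x" "u \<in> lev f x"
  shows "card (sub_nb nb (lev f x) u) + card (down f x) = d"
proof -
  have "sub_nb nb (lev f x) u = {v \<in> nb u. f v = f u}"
  proof (intro equalityI subsetI)
    fix v assume "v \<in> sub_nb nb (lev f x) u"
    then have "v \<in> nb u" "v \<in> lev f x" using assms(2) by (auto simp: sub_nb_def)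
    then show "v \<in> {v \<in> nb u. f v = f u}"
      using lev_value[of v f x] lev_value[OF assms(2)] by simp
  next
    fix v assume "v \<in> {v \<in> nb u. f v = f u}"
    then show "v \<in> sub_nb nb (lev f x) u"
      using lev_step[OF assms(2), of v] assms(2) by (simp add: sub_nb_def)
  qed
  then show ?thesis
    using card_level_nb[OF lev_locmax[OF assms]] lev_card_down[OF assms] by simp
qed

lemma E_minus: "f \<in> E \<Longrightarrow> (\<lambda>x. - f x) \<in> E"
  using E_scale[of f "-1"] by simp

section \<open>Fibrations\<close>

lemma fibration_sum:
  fixes h :: "'a \<Rightarrow> real"
  assumes "finite N" "card {v \<in> N. \<pi> v = b} = r" "bij_betw \<pi> {v \<in> N. \<pi> v \<noteq> b} B"
  shows "(\<Sum>v\<in>N. h (\<pi> v)) = r * h b + (\<Sum>w\<in>B. h w)"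
proof -
  have "(\<Sum>v\<in>N. h (\<pi> v)) = (\<Sum>v\<in>{v \<in> N. \<pi> v = b}. h (\<pi> v)) + (\<Sum>v\<in>{v \<in> N. \<pi> v \<noteq> b}. h (\<pi> v))"
    using assms(1) by (subst sum.union_disjoint[symmetric]) (auto intro: arg_cong[of _ _ "sum _"])
  also have "(\<Sum>v\<in>{v \<in> N. \<pi> v = b}. h (\<pi> v)) = r * h b"
    using assms(2) by simp
  also have "(\<Sum>v\<in>{v \<in> N. \<pi> v \<noteq> b}. h (\<pi> v)) = (\<Sum>w\<in>B. h w)"
    by (rule sum.reindex_bij_betw[OF assms(3)])
  finally show ?thesis .
qed

text \<open>A retraction onto the induced subgraph on \<open>W\<close> under which each vertex has
  \<open>r\<close> neighbours in its own fibre, while the others correspond bijectively to the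
  neighbours of its image in \<open>W\<close>. Surjectivity of that correspondence comes from the
  count in the last condition.\<close>

definition is_fibration :: "'a set \<Rightarrow> ('a \<Rightarrow> 'a) \<Rightarrow> nat \<Rightarrow> bool" where
  "is_fibration W \<pi> r \<longleftrightarrow> W \<subseteq> V \<and> W \<noteq> {} \<and> (\<forall>u\<in>V. \<pi> u \<in> W) \<and> (\<forall>w\<in>W. \<pi> w = w) \<and>
    (\<forall>u\<in>V. card {v \<in> nb u. \<pi> v = \<pi> u} = r) \<and>
    (\<forall>u\<in>V. \<forall>v\<in>nb u. \<pi> v \<noteq> \<pi> u \<longrightarrow> \<pi> v \<in> nb (\<pi> u)) \<and>
    (\<forall>u\<in>V. inj_on \<pi> {v \<in> nb u. \<pi> v \<noteq> \<pi> u}) \<and>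
    (\<forall>w\<in>W. card (sub_nb nb W w) + r = d)"

text \<open>Functions lifted along \<open>\<pi>\<close> have the same Laplacian and gradient as on
  \<open>W\<close>. In the curvature form the fibre edges contribute \<open>2 * r\<close> times the
  squared gradient, exactly the difference between the coefficients \<open>2 * d + 4\<close> and
  \<open>2 * (d - r) + 4\<close>.\<close>

lemma fibration:
  assumes fib: "is_fibration W \<pi> r"
  shows "cd_graph W (sub_nb nb W) (d - r)"
    and "h \<in> eig2 W (sub_nb nb W) \<Longrightarrow> (\<lambda>u. if u \<in> V then h (\<pi> u) else 0) \<in> E"
proof -
  have WV: "W \<subseteq> V" and Wne: "W \<noteq> {}" and \<pi>W: "\<And>u. u \<in> V \<Longrightarrow> \<pi> u \<in> W"
    and \<pi>id: "\<And>w. w \<in> W \<Longrightarrow> \<pi> w = w"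
    and r: "\<And>u. u \<in> V \<Longrightarrow> card {v \<in> nb u. \<pi> v = \<pi> u} = r"
    and hor: "\<And>u v. u \<in> V \<Longrightarrow> v \<in> nb u \<Longrightarrow> \<pi> v \<noteq> \<pi> u \<Longrightarrow> \<pi> v \<in> nb (\<pi> u)"
    and inj: "\<And>u. u \<in> V \<Longrightarrow> inj_on \<pi> {v \<in> nb u. \<pi> v \<noteq> \<pi> u}"
    and cW: "\<And>w. w \<in> W \<Longrightarrow> card (sub_nb nb W w) + r = d"
    using fib unfolding is_fibration_def by blast+
  let ?n = "sub_nb nb W"
  have bij: "bij_betw \<pi> {v \<in> nb u. \<pi> v \<noteq> \<pi> u} (?n (\<pi> u))" if u: "u \<in> V" for u
  proof -
    have sub: "\<pi> ` {v \<in> nb u. \<pi> v \<noteq> \<pi> u} \<subseteq> ?n (\<pi> u)"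
      using hor[OF u] \<pi>W[OF u] \<pi>W adjV by (auto simp: sub_nb_def)
    have "card {v \<in> nb u. \<pi> v \<noteq> \<pi> u} + r = d"
    proof -
      have "card (nb u) = card {v \<in> nb u. \<pi> v \<noteq> \<pi> u} + card {v \<in> nb u. \<pi> v = \<pi> u}"
        by (subst card_Un_disjoint[symmetric]) (auto intro: arg_cong[of _ _ card])
      then show ?thesis using reg[OF u] r[OF u] by simp
    qed
    then have "card (\<pi> ` {v \<in> nb u. \<pi> v \<noteq> \<pi> u}) = card (?n (\<pi> u))"
      using card_image[OF inj[OF u]] cW[OF \<pi>W[OF u]] by simp
    then have "\<pi> ` {v \<in> nb u. \<pi> v \<noteq> \<pi> u} = ?n (\<pi> u)"
      using sub by (intro card_subset_eq) (auto simp: sub_nb_def)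
    then show ?thesis using inj[OF u] by (simp add: bij_betw_def)
  qed
  have fs: "(\<Sum>v\<in>nb u. h (\<pi> v)) = r * h (\<pi> u) + (\<Sum>w\<in>?n (\<pi> u). h w)" if "u \<in> V" for u and h :: "'a \<Rightarrow> real"
    by (rule fibration_sum[OF fin_nb r[OF that] bij[OF that]])
  have lap: "lap nb (\<lambda>u. h (\<pi> u)) u = lap ?n h (\<pi> u)" if "u \<in> V" for h :: "'a \<Rightarrow> real" and u
    unfolding lap_def using fs[OF that, of "\<lambda>w. h w - h (\<pi> u)"] by simp
  have grad: "grad nb (\<lambda>u. h (\<pi> u)) (\<lambda>u. h (\<pi> u)) u = grad ?n h h (\<pi> u)" if "u \<in> V" for h :: "'a \<Rightarrow> real" and u
    unfolding grad_def using fs[OF that, of "\<lambda>w. (h w - h (\<pi> u)) * (h w - h (\<pi> u))"] by simp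
  have rd: "r \<le> d" using Wne cW by fastforce
  have cd': "bform ?n (d - r) w h h \<ge> 0" if w: "w \<in> W" for w h
  proof -
    have wV: "w \<in> V" using w WV by blast
    define H where "H = (\<lambda>u. h (\<pi> u))"
    let ?t = "\<lambda>a b. (h b - 2 * h a + h w) * (h b - 2 * h a + h w)"
    let ?P = "\<lambda>a. r * ?t a a + (\<Sum>b\<in>?n a. ?t a b)"
    have "(\<Sum>y\<in>nb w. \<Sum>z\<in>nb y. (H z - 2 * H y + H w) * (H z - 2 * H y + H w)) = (\<Sum>y\<in>nb w. ?P (\<pi> y))"
    proof (intro sum.cong refl)
      fix y assume "y \<in> nb w"
      then have y: "y \<in> V" using adjV by blast
      show "(\<Sum>z\<in>nb y. (H z - 2 * H y + H w) * (H z - 2 * H y + H w)) = ?P (\<pi> y)"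
        using fs[OF y, of "\<lambda>b. ?t (\<pi> y) b"] by (simp add: H_def \<pi>id[OF w])
    qed
    also have "\<dots> = r * ?P w + (\<Sum>a\<in>?n w. ?P a)"
      using fs[OF wV, of ?P] by (simp add: \<pi>id[OF w])
    \<comment> \<open>One share of \<open>r\<close> comes from first steps inside the fibre of
      \<open>w\<close>, the other from second steps inside the fibre of \<open>a\<close>.\<close>
    also have "\<dots> = 2 * r * grad ?n h h w + (\<Sum>a\<in>?n w. \<Sum>b\<in>?n a. ?t a b)"
    proof -
      have "?P w = grad ?n h h w" by (simp add: grad_def)
      moreover have "(\<Sum>a\<in>?n w. ?P a) = r * grad ?n h h w + (\<Sum>a\<in>?n w. \<Sum>b\<in>?n a. ?t a b)"
        unfolding grad_def sum.distrib sum_distrib_left by (simp add: algebra_simps)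
      ultimately show ?thesis by simp
    qed
    finally have "bform nb d w H H = 2 * r * grad ?n h h w + (\<Sum>a\<in>?n w. \<Sum>b\<in>?n a. ?t a b)
        + 2 * lap ?n h w * lap ?n h w - (2 * d + 4) * grad ?n h h w"
      unfolding bform_def H_def lap[OF wV] grad[OF wV] \<pi>id[OF w] by simp
    also have "\<dots> = bform ?n (d - r) w h h"
      using rd by (simp add: bform_def of_nat_diff algebra_simps)
    finally show ?thesis using cd[OF wV, of H] by simp
  qed
  show "cd_graph W ?n (d - r)"
  proof
    show "finite W" using WV finV finite_subset by blast
    show "card (?n w) = d - r" if "w \<in> W" for w using cW[OF that] by simp
    show "S = W" if S: "S \<subseteq> W" "S \<noteq> {}" "\<And>a b. a \<in> S \<Longrightarrow> b \<in> ?n a \<Longrightarrow> b \<in> S" for S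
    proof -
      let ?S = "{u \<in> V. \<pi> u \<in> S}"
      have "?S = V"
      proof (rule conn)
        show "?S \<noteq> {}" using S(1,2) WV \<pi>id by fastforce
        fix a b assume a: "a \<in> ?S" and b: "b \<in> nb a"
        show "b \<in> ?S"
        proof (cases "\<pi> b = \<pi> a")
          case False
          have "\<pi> b \<in> ?n (\<pi> a)"
            using hor[OF _ b False] \<pi>W[of a] \<pi>W[of b] a adjV[OF b] by (simp add: sub_nb_def)
          then show ?thesis using S(3)[of "\<pi> a"] a adjV[OF b] by blast
        qed (use a adjV[OF b] in simp)
      qed blast
      then show ?thesis using S(1) WV \<pi>id by (metis (mono_tags, lifting) mem_Collect_eq subsetD subset_antisym subsetI)
    qed
  qed (use Wne cd' adj_irr in \<open>auto simp: sub_nb_def dest: adj_sym split: if_splits\<close>)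
  show "(\<lambda>u. if u \<in> V then h (\<pi> u) else 0) \<in> E" if h: "h \<in> eig2 W ?n"
  proof -
    have "lap nb (\<lambda>u. if u \<in> V then h (\<pi> u) else 0) u = - 2 * h (\<pi> u)" if u: "u \<in> V" for u
    proof -
      have "lap nb (\<lambda>u. if u \<in> V then h (\<pi> u) else 0) u = lap nb (\<lambda>u. h (\<pi> u)) u"
        unfolding lap_def by (intro sum.cong refl) (use u adjV in auto)
      also have "\<dots> = - 2 * h (\<pi> u)" unfolding lap[OF u] using h \<pi>W[OF u] by (simp add: eig2_def)
      finally show ?thesis .
    qed
    then show ?thesis by (simp add: eig2_def)
  qed
qed

section \<open>Splitting off an edge\<close>

text \<open>With a single block vertex the drop from the level of \<open>x\<close> is
  \<open>2 * f x\<close>, so \<open>f\<close> takes only the values \<open>f x\<close> and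
  \<open>- f x\<close>, and \<open>\<tau>\<close> sends each vertex of the level component to its
  block vertex.\<close>

lemma one_block:
  assumes m: "locmax f x" and c: "card (down f x) = 1"
  obtains W \<tau> where "W \<subseteq> V" "cd_graph W (sub_nb nb W) (d - 1)" "d \<ge> 1" "V = W \<union> \<tau> ` W"
    "W \<inter> \<tau> ` W = {}" "inj_on \<tau> W"
    "\<forall>u\<in>W. \<forall>v\<in>W. (\<tau> v \<in> nb (\<tau> u) \<longleftrightarrow> v \<in> nb u) \<and> (\<tau> v \<in> nb u \<longleftrightarrow> v = u)"
    "fun_space.dim E = Suc (fun_space.dim (eig2 W (sub_nb nb W)))"
proof -
  define W where "W = lev f x"
  have f: "f \<in> E" and xV: "x \<in> V" using locmaxD[OF m] by auto
  have WV: "W \<subseteq> V" unfolding W_def by (rule lev_sub[OF xV])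
  have mW: "locmax f u" if "u \<in> W" for u using lev_locmax[OF m] that by (simp add: W_def)
  have fW: "f u = f x" if "u \<in> W" for u using lev_value that by (simp add: W_def)
  have "\<exists>y. down f u = {y}" if "u \<in> W" for u
    using lev_card_down[OF m] that c card_1_singletonE W_def by metis
  then obtain \<tau> where \<tau>: "\<And>u. u \<in> W \<Longrightarrow> down f u = {\<tau> u}" by metis
  have \<tau>nb: "\<tau> u \<in> nb u" "f (\<tau> u) < f x" if "u \<in> W" for u
    using \<tau>[OF that] down_nb[of "\<tau> u" f u] down_less[of "\<tau> u" f u] fW[OF that] by auto
  have f\<tau>: "f (\<tau> u) = - f x" if u: "u \<in> W" for u
    using sum_down[OF mW[OF u]] fW[OF u] by (simp add: \<tau>[OF u])
  have pos: "f x > 0" using f\<tau>[of x] \<tau>nb(2)[of x] by (simp add: W_def)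
  have disj: "W \<inter> \<tau> ` W = {}" using fW \<tau>nb(2) by fastforce
  have up: "w = u" if "u \<in> W" "w \<in> nb (\<tau> u)" "f w = f x" for u w
    using down_unique_up[OF mW[OF that(1)] _ that(2)] \<tau>[OF that(1)] fW[OF that(1)] that(3) by simp
  have inj: "inj_on \<tau> W"
  proof (rule inj_onI)
    fix u v assume "u \<in> W" "v \<in> W" "\<tau> u = \<tau> v"
    then show "u = v" using up[of u v] \<tau>nb(1)[of v] fW[of v] adj_sym by metis
  qed
  have nbW: "v \<in> W" if "u \<in> W" "v \<in> nb u" "f v = f x" for u v
    using lev_step[of u f x v] that fW[OF that(1)] by (simp add: W_def)
  have nbu: "v \<in> W \<or> v = \<tau> u" if u: "u \<in> W" and v: "v \<in> nb u" for u v
    using lev_nb_cases[OF m _ v] u \<tau>[OF u] by (auto simp: W_def)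
  have mat: "matched f u (\<tau> u) = nb (\<tau> u) - {u}" if u: "u \<in> W" for u
  proof (rule card_subset_eq)
    show "matched f u (\<tau> u) \<subseteq> nb (\<tau> u) - {u}"
    proof
      fix v assume v: "v \<in> matched f u (\<tau> u)"
      have "f v = f (\<tau> u)" by (rule matched_value[OF mW[OF u] _ v]) (simp add: \<tau>[OF u])
      then have "v \<noteq> u" using \<tau>nb(2)[OF u] fW[OF u] by auto
      then show "v \<in> nb (\<tau> u) - {u}" using v by (simp add: matched_def)
    qed
    have "card (nb (\<tau> u) - {u}) = d - 1"
      using adj_sym[OF \<tau>nb(1)[OF u]] reg adjV[OF \<tau>nb(1)[OF u]] by simp
    then show "card (matched f u (\<tau> u)) = card (nb (\<tau> u) - {u})"
      using matched_card[OF mW[OF u], of "\<tau> u"] \<tau>[OF u] by simp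
  qed simp
  have nb\<tau>: "\<exists>w\<in>W. w \<in> nb u \<and> v = \<tau> w" if u: "u \<in> W" and v: "v \<in> nb (\<tau> u)" "v \<noteq> u" for u v
  proof -
    obtain w where w: "w \<in> nb u" "f w = f u" "v \<in> down f w"
      using mat[OF u] v by (auto simp: matched_def)
    then have "w \<in> W" using nbW[OF u] fW[OF u] by simp
    then show ?thesis using w \<tau> by auto
  qed
  have VW: "W \<union> \<tau> ` W = V"
  proof (rule conn)
    show "W \<union> \<tau> ` W \<subseteq> V" using WV \<tau>nb(1) adjV by blast
    show "W \<union> \<tau> ` W \<noteq> {}" by (auto simp: W_def intro: lev_self)
    fix a b assume a: "a \<in> W \<union> \<tau> ` W" and b: "b \<in> nb a"
    show "b \<in> W \<union> \<tau> ` W"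
    proof (cases "a \<in> W")
      case True
      then show ?thesis using nbu[OF _ b] by blast
    next
      case False
      then obtain u where "u \<in> W" "a = \<tau> u" using a by blast
      then show ?thesis using nb\<tau>[of u b] b by blast
    qed
  qed
  define \<pi> where "\<pi> v = (if v \<in> W then v else the_inv_into W \<tau> v)" for v
  have \<pi>W: "\<pi> u = u" if "u \<in> W" for u using that by (simp add: \<pi>_def)
  have \<pi>\<tau>: "\<pi> (\<tau> u) = u" if "u \<in> W" for u
    using that disj the_inv_into_f_f[OF inj that] by (auto simp: \<pi>_def)
  have adj\<tau>: "\<tau> v \<in> nb (\<tau> u) \<longleftrightarrow> v \<in> nb u" if u: "u \<in> W" and v: "v \<in> W" for u v
  proof
    assume "\<tau> v \<in> nb (\<tau> u)"
    moreover have "\<tau> v \<noteq> u" using disj u v by blast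
    ultimately obtain w where "w \<in> W" "w \<in> nb u" "\<tau> v = \<tau> w" using nb\<tau>[OF u] by blast
    then show "v \<in> nb u" using inj v by (auto dest: inj_onD)
  next
    assume "v \<in> nb u"
    then have "card (nb (\<tau> v) \<inter> down f u) = 1"
      using fW[OF u] fW[OF v] \<tau>[OF v] by (intro level_match_card[OF mW[OF u], of v]) auto
    then have "nb (\<tau> v) \<inter> down f u \<noteq> {}" by auto
    then have "\<tau> u \<in> nb (\<tau> v)" unfolding \<tau>[OF u] by simp
    then show "\<tau> v \<in> nb (\<tau> u)" by (rule adj_sym)
  qed
  have adjm: "\<tau> v \<in> nb u \<longleftrightarrow> v = u" if u: "u \<in> W" and v: "v \<in> W" for u v
  proof
    assume "\<tau> v \<in> nb u"
    then have "u = v" using up[OF v adj_sym fW[OF u]] by simp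
    then show "v = u" ..
  qed (use \<tau>nb(1)[OF v] in simp)
  have nbW_eq: "nb u = insert (\<tau> u) (nb u \<inter> W)" if "u \<in> W" for u
    using nbu[OF that] \<tau>nb(1)[OF that] by blast
  have nb\<tau>_eq: "nb (\<tau> u) = insert u (\<tau> ` (nb u \<inter> W))" if "u \<in> W" for u
    using nb\<tau>[OF that] adj_sym[OF \<tau>nb(1)[OF that]] adj\<tau>[OF that] by blast
  have fib: "{v \<in> nb u. \<pi> v = \<pi> u} = {\<tau> u} \<and> {v \<in> nb u. \<pi> v \<noteq> \<pi> u} = nb u \<inter> W" if u: "u \<in> W" for u
  proof -
    have \<tau>W: "\<tau> u \<notin> W" using disj u by blast
    have key: "(\<pi> v = u \<longleftrightarrow> v = \<tau> u) \<and> (v \<in> W \<longleftrightarrow> v \<noteq> \<tau> u)" if v: "v \<in> nb u" for v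
    proof (cases "v = \<tau> u")
      case False
      then have "v \<in> W" using nbu[OF u v] by simp
      moreover have "v \<noteq> u" using adj_irr v by blast
      ultimately show ?thesis using False by (simp add: \<pi>W)
    qed (use \<tau>W u in \<open>simp add: \<pi>\<tau>\<close>)
    show ?thesis unfolding \<pi>W[OF u] using key \<tau>nb(1)[OF u] by auto
  qed
  have fib\<tau>: "{v \<in> nb (\<tau> u). \<pi> v = \<pi> (\<tau> u)} = {u} \<and> {v \<in> nb (\<tau> u). \<pi> v \<noteq> \<pi> (\<tau> u)} = \<tau> ` (nb u \<inter> W)"
    if u: "u \<in> W" for u
  proof -
    have "u \<notin> nb u" by (rule adj_irr)
    then show ?thesis
      unfolding nb\<tau>_eq[OF u] using u by (auto simp: \<pi>W \<pi>\<tau>)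
  qed
  have cases: "(\<exists>w\<in>W. u = w \<or> u = \<tau> w)" if "u \<in> V" for u using VW that by blast
  have F1: "W \<noteq> {}" by (auto simp: W_def intro: lev_self)
  have F2: "\<pi> u \<in> W" if "u \<in> V" for u using cases[OF that] \<pi>W \<pi>\<tau> by auto
  have F3: "card {v \<in> nb u. \<pi> v = \<pi> u} = 1" if "u \<in> V" for u
    using cases[OF that] fib fib\<tau> by force
  have F4: "\<pi> v \<in> nb (\<pi> u)" if uv: "u \<in> V" "v \<in> nb u" "\<pi> v \<noteq> \<pi> u" for u v
  proof -
    obtain w where w: "w \<in> W" "u = w \<or> u = \<tau> w" using cases[OF uv(1)] by blast
    from w(2) show ?thesis
    proof
      assume "u = w"
      then have "v \<in> nb w \<inter> W" using fib[OF w(1)] uv by blast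
      then show ?thesis using \<open>u = w\<close> w by (simp add: \<pi>W)
    next
      assume "u = \<tau> w"
      then have "v \<in> \<tau> ` (nb w \<inter> W)" using fib\<tau>[OF w(1)] uv by blast
      then show ?thesis using \<open>u = \<tau> w\<close> w by (auto simp: \<pi>\<tau>)
    qed
  qed
  have F5: "inj_on \<pi> {v \<in> nb u. \<pi> v \<noteq> \<pi> u}" if uV: "u \<in> V" for u
  proof -
    obtain w where w: "w \<in> W" "u = w \<or> u = \<tau> w" using cases[OF uV] by blast
    from w(2) show ?thesis
    proof
      assume "u = w"
      then have "{v \<in> nb u. \<pi> v \<noteq> \<pi> u} = nb w \<inter> W" using fib[OF w(1)] by blast
      then show ?thesis by (auto simp: inj_on_def \<pi>W)
    next
      assume "u = \<tau> w"
      then have "{v \<in> nb u. \<pi> v \<noteq> \<pi> u} = \<tau> ` (nb w \<inter> W)" using fib\<tau>[OF w(1)] by blast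
      then show ?thesis by (auto simp: inj_on_def \<pi>\<tau>)
    qed
  qed
  have F6: "card (sub_nb nb W w) + 1 = d" if "w \<in> W" for w
    using card_lev_nb[OF m] that c by (simp add: W_def)
  have "is_fibration W \<pi> 1"
    unfolding is_fibration_def using WV F1 F2 \<pi>W F3 F4 F5 F6 by blast
  note F = fibration[OF this]
  interpret W: cd_graph W "sub_nb nb W" "d - 1" by (rule F(1))
  have d1: "d \<ge> 1" using F6 F1 by fastforce
  define \<phi> where "\<phi> h = (\<lambda>u. if u \<in> V then h (\<pi> u) else (0::real))" for h :: "'a \<Rightarrow> real"
  have lm: "lin_map \<phi>" by (auto simp: lin_map_def \<phi>_def fun_eq_iff)
  have \<phi>E: "\<phi> h \<in> E" if "h \<in> W.E" for h using F(2)[OF that] by (simp add: \<phi>_def)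
  have \<phi>0: "h = (\<lambda>x. 0)" if h: "h \<in> W.E" and 0: "\<phi> h = (\<lambda>x. 0)" for h
  proof
    fix u show "h u = 0"
    proof (cases "u \<in> W")
      case True
      then show ?thesis using fun_cong[OF 0, of u] WV by (auto simp: \<phi>_def \<pi>W split: if_splits)
    qed (use h in \<open>simp add: eig2_def\<close>)
  qed
  \<comment> \<open>The increment along one split edge. Inside \<open>E\<close> its kernel consists
    of the functions constant along all split edges, which correspond to the eigenfunctions on
    \<open>W\<close>; \<open>f\<close> lies outside it.\<close>
  define l where "l h = h (\<tau> x) - h x" for h :: "'a \<Rightarrow> real"
  have l: "lin_fun l" by (auto simp: lin_fun_def l_def algebra_simps)
  have xW: "x \<in> W" by (simp add: W_def)
  have l\<phi>: "l (\<phi> h) = 0" for h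
    using xW xV VW by (auto simp: l_def \<phi>_def \<pi>W \<pi>\<tau>)
  have lf: "l f \<noteq> 0" using f\<tau>[OF xW] pos by (simp add: l_def)
  have ge: "Suc (fun_space.dim W.E) \<le> fun_space.dim E"
    by (rule dim_Suc_le_inj[OF lm W.E_closed \<phi>0 \<phi>E W.spans_E spans_E l l\<phi> f lf])
  have le: "fun_space.dim E \<le> Suc (fun_space.dim W.E)"
  proof -
    let ?K = "{h \<in> E. l h = 0}"
    define \<rho> where "\<rho> h = (\<lambda>u. if u \<in> W then h u else (0::real))" for h :: "'a \<Rightarrow> real"
    have l0: "l (\<lambda>x. 0) = 0" by (simp add: l_def)
    have Kc: "lin_closed ?K"
      using E_closed l l0 by (auto simp: lin_closed_def lin_fun_def)
    have flat: "h (\<tau> u) = h u" if h: "h \<in> ?K" and u: "u \<in> W" for h u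
    proof -
      have "u \<in> lev f x" using u by (simp add: W_def)
      then show ?thesis
      proof (induction rule: lev_induct)
        case base
        then show ?case using h by (simp add: l_def)
      next
        case (step u v)
        have uv: "u \<in> W" "v \<in> W" using step.hyps lev_step[of u f x v] by (auto simp: W_def)
        have "h u + h (\<tau> v) = h v + h (\<tau> u)"
          by (rule level_parallel[OF mW[OF uv(1)] step.hyps(2,3)])
            (use \<tau>[OF uv(1)] \<tau>[OF uv(2)] adj\<tau>[OF uv] step.hyps(2) h adj_comm in auto)
        then show ?case using step.IH by simp
      qed
    qed
    have \<rho>E: "\<rho> h \<in> W.E" if h: "h \<in> ?K" for h
    proof -
      have "lap (sub_nb nb W) (\<rho> h) u = - 2 * \<rho> h u" if u: "u \<in> W" for u
      proof -
        have "lap nb h u = (\<Sum>v\<in>nb u \<inter> W. h v - h u)"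
          unfolding lap_def
          by (subst nbW_eq[OF u], subst sum.insert) (use disj u flat[OF h u] in auto)
        also have "\<dots> = lap (sub_nb nb W) (\<rho> h) u"
          unfolding lap_def by (rule sum.cong) (use u in \<open>auto simp: sub_nb_def \<rho>_def\<close>)
        finally show ?thesis using E_lap[of h u] h u WV by (auto simp: \<rho>_def)
      qed
      then show ?thesis by (simp add: eig2_def \<rho>_def)
    qed
    have \<rho>0: "h = (\<lambda>x. 0)" if h: "h \<in> ?K" and 0: "\<rho> h = (\<lambda>x. 0)" for h
    proof (rule E_eq_zero_if_flat[OF _ xV])
      show "h \<in> E" using h by simp
      fix y assume y: "y \<in> nb x"
      have "h u = 0" if "u \<in> W" for u using fun_cong[OF 0, of u] that by (simp add: \<rho>_def)
      then show "h y = h x" using nbu[OF xW y] flat[OF h xW] xW by auto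
    qed
    have "spans_le ?K d" by (rule spans_le_mono[OF _ spans_E]) auto
    have "lin_map \<rho>" by (auto simp: lin_map_def \<rho>_def fun_eq_iff)
    have "fun_space.dim ?K \<le> fun_space.dim W.E"
      by (rule dim_le_inj[OF \<open>lin_map \<rho>\<close> Kc \<rho>0 \<rho>E \<open>spans_le ?K d\<close> W.spans_E])
    moreover have "spans_le ?K (fun_space.dim ?K)"
      by (rule spans_le_dim_self) fact
    then have "spans_le E (Suc (fun_space.dim ?K))"
      by (rule spans_le_kernel[OF E_closed l])
    then have "fun_space.dim E \<le> Suc (fun_space.dim ?K)" by (rule spans_le_dim)
    ultimately show ?thesis by simp
  qed
  show ?thesis
  proof (rule that[OF WV F(1) d1 VW[symmetric] disj inj])
    show "\<forall>u\<in>W. \<forall>v\<in>W. (\<tau> v \<in> nb (\<tau> u) \<longleftrightarrow> v \<in> nb u) \<and> (\<tau> v \<in> nb u \<longleftrightarrow> v = u)"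
      by (intro ballI conjI adj\<tau> adjm)
  qed (use ge le in simp)
qed

section \<open>Blocks of size two\<close>

text \<open>Both block vertices lie below \<open>x\<close>, so by \<open>common_sum\<close> they
  have another common neighbour \<open>z\<close>, which completes a square. Their values are
  opposite, whence \<open>f z = - f x\<close>, and the two edges from \<open>z\<close> to the block
  exhaust the squared gradient there.\<close>

lemma two_bottom:
  assumes m: "locmax f x" and c: "card (down f x) = 2"
  shows "\<exists>z. z \<in> V \<and> f z = - f x \<and> down f x \<subseteq> nb z \<and> (\<forall>v\<in>nb z. v \<notin> down f x \<longrightarrow> f v = f z) \<and>
    (\<forall>y\<in>down f x. nb y = insert x (insert z (matched f x y)) \<and> - f x < f y \<and> f y < f x)"
proof -
  have f: "f \<in> E" and xV: "x \<in> V" using locmaxD[OF m] by auto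
  obtain y1 y2 where Y: "down f x = {y1, y2}" and ne: "y1 \<noteq> y2" using c card_2_iff by metis
  have y: "y1 \<in> nb x" "y2 \<in> nb x" "f y1 < f x" "f y2 < f x"
    using Y down_nb[of _ f x] down_less[of _ f x] by auto
  have yV: "y1 \<in> V" "y2 \<in> V" using y adjV by auto
  have s: "f y1 + f y2 = 0" using sum_down[OF m] ne by (simp add: Y)
  have xc: "x \<in> nb y1 \<inter> nb y2" using y adj_sym by blast
  have "nb y1 \<inter> nb y2 \<noteq> {x}"
    using common_sum[OF f yV(1) yV(2)] ne s y by auto
  then obtain z where z: "z \<in> nb y1" "z \<in> nb y2" "z \<noteq> x" using xc by blast
  have zV: "z \<in> V" using z adjV by blast
  have zless: "f z < f x"
    using locmax_le2(2)[OF m y(1) z(1) _ z(3)] Y by simp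
  have yz: "y1 \<in> nb z" "y2 \<in> nb z" using adj_sym[OF z(1)] adj_sym[OF z(2)] by auto
  have com: "nb x \<inter> nb z = {y1, y2}"
  proof (intro equalityI subsetI)
    fix u assume u: "u \<in> nb x \<inter> nb z"
    show "u \<in> {y1, y2}"
    proof (rule ccontr)
      assume "u \<notin> {y1, y2}"
      then have "u \<notin> down f x" using Y by simp
      then have "f u = f x" using locmaxD(3)[OF m, of u] u by (simp add: down_def)
      moreover have "z \<in> nb u" using u adj_comm[of z u] by simp
      ultimately have "card (nb z \<inter> down f x) = 1"
        using u zless by (intro level_match_card[OF m, of u]) (auto simp: down_def)
      moreover have "nb z \<inter> down f x = {y1, y2}" unfolding Y using yz by auto
      ultimately show False using ne by simp
    qed
  qed (use y yz in auto)
  have fz: "f z = - f x"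
    using card_common[OF f xV zV z(3)] ne s by (simp add: com)
  have g0: "grad nb f f x = (f y1 - f x)^2 + (f y2 - f x)^2"
    using grad_down[OF m] ne by (simp add: Y)
  have flatz: "f v = f z" if v: "v \<in> nb z" "v \<notin> down f x" for v
  proof (rule grad_exhausted[OF f xV zV _ _ v])
    show "down f x \<subseteq> nb z" using Y yz by simp
    have "f y2 = - f y1" using s by simp
    then show "(\<Sum>v\<in>down f x. (f v - f z)^2) = grad nb f f x"
      unfolding g0 Y using ne by (simp add: fz power2_eq_square algebra_simps)
  qed
  have nby: "nb y = insert x (insert z (matched f x y)) \<and> - f x < f y \<and> f y < f x"
    if yd: "y \<in> down f x" and y': "y' \<in> down f x" "y \<noteq> y'" for y y'
  proof -
    have yy: "{y, y'} = {y1, y2}" using yd y' Y by auto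
    then have s': "f y + f y' = 0" using s y'(2) by (auto simp: doubleton_eq_iff)
    have b: "- f x < f y" "f y < f x"
      using s' down_less[OF yd] down_less[OF y'(1)] by auto
    have "x \<in> nb y" "z \<in> nb y"
      using xc z yy by (auto simp: doubleton_eq_iff)
    then have sub: "{x, z} \<union> matched f x y \<subseteq> nb y"
      by (auto simp: matched_def)
    have "x \<notin> matched f x y" "z \<notin> matched f x y"
      using matched_value[OF m yd, of x] matched_value[OF m yd, of z] b fz by auto
    moreover have "finite (matched f x y)" by (simp add: matched_def)
    ultimately have "card ({x, z} \<union> matched f x y) = 2 + card (matched f x y)"
      using z(3) by simp
    then have "card ({x, z} \<union> matched f x y) = card (nb y)"
      using matched_card[OF m yd] c reg[of y] adjV[OF down_nb[OF yd]] by simp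
    then have "{x, z} \<union> matched f x y = nb y"
      using sub by (intro card_subset_eq) auto
    then show ?thesis using b by auto
  qed
  have "\<forall>y\<in>down f x. nb y = insert x (insert z (matched f x y)) \<and> - f x < f y \<and> f y < f x"
    using nby[of y1 y2] nby[of y2 y1] Y ne by auto
  then show ?thesis
    using zV fz flatz yz by (intro exI[of _ z]) (simp add: Y)
qed

end

section \<open>The bundle of squares over a level component\<close>

locale two_block = cd_graph +
  fixes f :: "'a \<Rightarrow> real" and x :: 'a
  assumes lm: "locmax f x" and two: "card (down f x) = 2"
begin

text \<open>Every vertex \<open>u\<close> of \<open>L\<close> carries a square: \<open>u\<close> on
  top, its two block vertices in the middle, \<open>bottom u\<close> below. \<open>Y\<close>
  collects the middle vertices.\<close>

definition L where "L = lev f x"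
definition Y where "Y = (\<Union>u\<in>L. down f u)"
definition bottom where "bottom u = (SOME z. z \<in> V \<and> f z = - f x \<and> down f u \<subseteq> nb z \<and>
    (\<forall>v\<in>nb z. v \<notin> down f u \<longrightarrow> f v = f z) \<and>
    (\<forall>y\<in>down f u. nb y = insert u (insert z (matched f u y)) \<and> - f x < f y \<and> f y < f x))"

lemma LV: "L \<subseteq> V"
  unfolding L_def by (rule lev_sub[OF locmaxD(2)[OF lm]])

lemma xL: "x \<in> L" by (simp add: L_def)

lemma fE: "f \<in> E" by (rule locmaxD(1)[OF lm])

lemma lmL: "u \<in> L \<Longrightarrow> locmax f u"
  unfolding L_def by (rule lev_locmax[OF lm])

lemma fL: "u \<in> L \<Longrightarrow> f u = f x"
  unfolding L_def by (rule lev_value)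

lemma twoL: "u \<in> L \<Longrightarrow> card (down f u) = 2"
  using lev_card_down[OF lm] two by (simp add: L_def)

lemma bottom:
  assumes "u \<in> L"
  shows "bottom u \<in> V" "f (bottom u) = - f x" "down f u \<subseteq> nb (bottom u)"
    "v \<in> nb (bottom u) \<Longrightarrow> v \<notin> down f u \<Longrightarrow> f v = - f x"
    "y \<in> down f u \<Longrightarrow> nb y = insert u (insert (bottom u) (matched f u y))"
    "y \<in> down f u \<Longrightarrow> - f x < f y" "y \<in> down f u \<Longrightarrow> f y < f x"
proof -
  have "bottom u \<in> V \<and> f (bottom u) = - f x \<and> down f u \<subseteq> nb (bottom u) \<and>
    (\<forall>v\<in>nb (bottom u). v \<notin> down f u \<longrightarrow> f v = f (bottom u)) \<and>
    (\<forall>y\<in>down f u. nb y = insert u (insert (bottom u) (matched f u y)) \<and> - f x < f y \<and> f y < f x)"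
    unfolding bottom_def
    by (rule someI_ex, rule two_bottom[OF lmL[OF assms] twoL[OF assms], unfolded fL[OF assms]])
  then show "bottom u \<in> V" "f (bottom u) = - f x" "down f u \<subseteq> nb (bottom u)"
    "v \<in> nb (bottom u) \<Longrightarrow> v \<notin> down f u \<Longrightarrow> f v = - f x"
    "y \<in> down f u \<Longrightarrow> nb y = insert u (insert (bottom u) (matched f u y))"
    "y \<in> down f u \<Longrightarrow> - f x < f y" "y \<in> down f u \<Longrightarrow> f y < f x"
    by auto
qed

lemma down_inj: "u \<in> L \<Longrightarrow> u' \<in> L \<Longrightarrow> y \<in> down f u \<Longrightarrow> y \<in> down f u' \<Longrightarrow> u' = u"
  using down_unique_up[OF lmL, of u y u'] fL adj_sym[OF down_nb] by metis

lemma down_ne: "u \<in> L \<Longrightarrow> \<exists>y. y \<in> down f u"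
  using twoL[of u] by (metis all_not_in_conv card.empty zero_neq_numeral)

lemma bottom_nonflat: "u \<in> L \<Longrightarrow> v \<in> nb (bottom u) \<Longrightarrow> f v \<noteq> - f x \<Longrightarrow> v \<in> down f u"
  using bottom(4) by blast

lemma bottom_inj:
  assumes "u \<in> L" "u' \<in> L" "bottom u = bottom u'"
  shows "u = u'"
proof -
  obtain y where y: "y \<in> down f u" using down_ne assms by blast
  then have "y \<in> nb (bottom u')" using bottom(3)[OF assms(1)] assms(3) by auto
  moreover have "f y \<noteq> - f x" using bottom(6)[OF assms(1) y] by simp
  ultimately have "y \<in> down f u'" by (rule bottom_nonflat[OF assms(2)])
  then show ?thesis using down_inj[OF assms(2,1)] y by blast
qed

lemma matched_down:
  assumes "u \<in> L" "y \<in> down f u" "v \<in> matched f u y"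
  obtains w where "w \<in> L" "w \<in> nb u" "v \<in> down f w" "f v = f y"
proof -
  obtain w where w: "w \<in> nb u" "f w = f u" "v \<in> down f w"
    using assms(3) by (auto simp: matched_def)
  have "w \<in> L" using lev_step[of u f x w] assms(1) w by (simp add: L_def)
  then show ?thesis using that w matched_value[OF lmL[OF assms(1)] assms(2,3)] by blast
qed

lemma nb_flat_matched:
  assumes "u \<in> L" "y \<in> down f u" "v \<in> nb y" "f v = f y"
  shows "v \<in> matched f u y"
  using assms bottom(5)[OF assms(1,2)] bottom(2,6,7)[OF assms(1)] fL[OF assms(1)]
  by (metis insert_iff less_irrefl)

text \<open>Seen from below, \<open>bottom u\<close> is a local maximum of \<open>- f\<close> with
  the same block as \<open>u\<close>, so the matching along levels applies to
  \<open>- f\<close>.\<close>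

lemma bottom_nb:
  assumes u: "u \<in> L" and v: "v \<in> nb (bottom u)" "v \<notin> down f u"
  obtains w where "w \<in> L" "w \<in> nb u" "v = bottom w"
proof -
  define g where "g = (\<lambda>v. - f v)"
  have gE: "g \<in> E" unfolding g_def by (rule E_minus[OF fE])
  have gb: "locmax g (bottom u)"
  proof -
    have "g w \<le> g (bottom u)" if w: "w \<in> nb (bottom u)" for w
    proof (cases "w \<in> down f u")
      case True
      then show ?thesis using bottom(6)[OF u True] bottom(2)[OF u] by (simp add: g_def)
    next
      case False
      then show ?thesis using bottom(4)[OF u w] bottom(2)[OF u] by (simp add: g_def)
    qed
    then show ?thesis using gE bottom(1)[OF u] by (auto simp: locmax_def)
  qed
  have lv: "g v = g (bottom u)" using bottom(4)[OF u v] bottom(2)[OF u] by (simp add: g_def)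
  obtain y where y: "y \<in> down f u" using down_ne u by blast
  have yd: "y \<in> down g (bottom u)"
    using y bottom(2,3)[OF u] bottom(6)[OF u y] by (auto simp: down_def g_def)
  have gv: "locmax g v" by (rule level_locmax[OF gb v(1) lv])
  obtain t where t: "nb y \<inter> down g v = {t}" "f t = f y"
    using level_match[OF gv adj_sym[OF v(1)] lv[symmetric] yd] by (metis (no_types) g_def neg_equal_iff_equal)
  have tn: "t \<in> nb y" and td: "t \<in> down g v" using t(1) by blast+
  have "t \<in> matched f u y" by (rule nb_flat_matched[OF u y tn t(2)])
  then obtain w where w: "w \<in> L" "w \<in> nb u" "t \<in> down f w"
    using matched_down[OF u y] by metis
  have "v \<in> nb t" by (rule adj_sym[OF down_nb[OF td]])
  then have "v = w \<or> v = bottom w \<or> v \<in> matched f w t" using bottom(5)[OF w(1,3)] by blast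
  moreover have fv: "f v = - f x" using bottom(4)[OF u v] .
  moreover have "v \<noteq> w" using fL[OF w(1)] fv bottom(6,7)[OF u y] by auto
  moreover have "v \<notin> matched f w t"
    using matched_value[OF lmL[OF w(1)] w(3), of v] fv bottom(6)[OF w(1,3)] by auto
  ultimately show ?thesis using that w by blast
qed

lemma V_cases: "V = L \<union> Y \<union> bottom ` L"
proof (rule sym, rule conn)
  show "L \<union> Y \<union> bottom ` L \<subseteq> V"
    using LV bottom(1) adjV[OF down_nb] by (auto simp: Y_def)
  show "L \<union> Y \<union> bottom ` L \<noteq> {}" using xL by blast
  fix a b assume a: "a \<in> L \<union> Y \<union> bottom ` L" and b: "b \<in> nb a"
  from a consider "a \<in> L" | u where "u \<in> L" "a \<in> down f u" | u where "u \<in> L" "a = bottom u"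
    by (auto simp: Y_def)
  then show "b \<in> L \<union> Y \<union> bottom ` L"
  proof cases
    case 1
    then show ?thesis
      using lev_nb_cases[OF lm _ b] by (auto simp: L_def Y_def)
  next
    case 2
    have "b = u \<or> b = bottom u \<or> b \<in> matched f u a" using b bottom(5)[OF 2] by blast
    then show ?thesis
      using 2 matched_down[OF 2, of b] by (auto simp: Y_def)
  next
    case 3
    show ?thesis
    proof (cases "b \<in> down f u")
      case False
      then show ?thesis using bottom_nb[OF 3(1), of b] b 3(2) by blast
    qed (use 3 in \<open>auto simp: Y_def\<close>)
  qed
qed

lemma V_elim:
  assumes "v \<in> V"
  obtains "v \<in> L" | u where "u \<in> L" "v \<in> down f u" | u where "u \<in> L" "v = bottom u"
proof -
  have "v \<in> L \<union> Y \<union> bottom ` L" using assms V_cases by blast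
  then show ?thesis using that by (auto simp: Y_def)
qed

text \<open>Collapses each square onto its top vertex.\<close>

definition base where
  "base v = (if v \<in> L then v else if v \<in> Y then (SOME u. u \<in> L \<and> v \<in> down f u)
    else (SOME u. u \<in> L \<and> v = bottom u))"

lemma Y_not_L: "u \<in> L \<Longrightarrow> y \<in> down f u \<Longrightarrow> y \<notin> L"
  using down_less[of y f u] fL[of u] fL[of y] by force

lemma base_L: "u \<in> L \<Longrightarrow> base u = u"
  by (simp add: base_def)

lemma base_down: 
  assumes "u \<in> L" "y \<in> down f u"
  shows "base y = u"
proof -
  have "y \<in> Y" using assms by (auto simp: Y_def)
  moreover have "(SOME u. u \<in> L \<and> y \<in> down f u) = u"
    by (rule some_equality) (use assms down_inj in auto)
  ultimately show ?thesis using Y_not_L[OF assms] by (simp add: base_def)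
qed

lemma bottom_not: 
  assumes "u \<in> L"
  shows "bottom u \<notin> L" "bottom u \<notin> Y"
proof -
  obtain y where y: "y \<in> down f u" using down_ne assms by blast
  then show "bottom u \<notin> L"
    using bottom(2)[OF assms] bottom(6,7)[OF assms y] fL[of "bottom u"] by auto
  show "bottom u \<notin> Y"
  proof
    assume "bottom u \<in> Y"
    then obtain w where "w \<in> L" "bottom u \<in> down f w" by (auto simp: Y_def)
    then show False using bottom(6)[of w "bottom u"] bottom(2)[OF assms] by simp
  qed
qed

lemma base_bottom:
  assumes "u \<in> L"
  shows "base (bottom u) = u"
proof -
  have "(SOME w. w \<in> L \<and> bottom u = bottom w) = u"
    by (rule some_equality) (use assms bottom_inj in auto)
  then show ?thesis using bottom_not[OF assms] by (simp add: base_def)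
qed

lemma base_matched:
  assumes "u \<in> L" "y \<in> down f u" "v \<in> matched f u y"
  shows "base v \<in> L" "base v \<in> nb u" "base v \<noteq> u" "v \<in> down f (base v)" "f v = f y"
proof -
  obtain w where w: "w \<in> L" "w \<in> nb u" "v \<in> down f w" "f v = f y"
    using matched_down[OF assms] .
  moreover have "w \<noteq> u" using w(2) adj_irr by blast
  ultimately show "base v \<in> L" "base v \<in> nb u" "base v \<noteq> u" "v \<in> down f (base v)" "f v = f y"
    using base_down[OF w(1,3)] by auto
qed

lemma partner_unique:
  assumes "u \<in> L" "w \<in> L" "w \<in> nb u" "y \<in> down f u" "v \<in> nb y \<inter> down f w" "v' \<in> nb y \<inter> down f w"
  shows "v = v'"
proof -
  have "card (nb y \<inter> down f w) = 1"
    by (rule level_match_card[OF lmL[OF assms(2)] adj_sym[OF assms(3)] _ assms(4)])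
      (simp add: fL assms)
  then obtain t where t: "nb y \<inter> down f w = {t}" by (rule card_1_singletonE)
  show ?thesis using assms(5,6) unfolding t by simp
qed

text \<open>Within its square each vertex has two neighbours. An edge between different squares
  joins two tops, two matched middle vertices or two bottoms, and in each case it lies over an edge
  of \<open>L\<close>.\<close>

lemma fiber:
  assumes v: "v \<in> V"
  shows "card {w \<in> nb v. base w = base v} = 2"
    and "\<And>w. w \<in> nb v \<Longrightarrow> base w \<noteq> base v \<Longrightarrow> base w \<in> nb (base v)"
    and "inj_on base {w \<in> nb v. base w \<noteq> base v}"
    and "base v \<in> L"
proof -
  have "card {w \<in> nb v. base w = base v} = 2 \<and> (\<forall>w\<in>nb v. base w \<noteq> base v \<longrightarrow> base w \<in> nb (base v)) \<and>
    inj_on base {w \<in> nb v. base w \<noteq> base v} \<and> base v \<in> L"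
  proof -
    from v show ?thesis
    proof (cases rule: V_elim)
      case 1
      have key: "(base w = v \<longleftrightarrow> w \<in> down f v) \<and> (w \<notin> down f v \<longrightarrow> base w = w)" if w: "w \<in> nb v" for w
      proof (cases "w \<in> down f v")
        case False
        then have "w \<in> L" using lev_nb_cases[OF lm _ w] 1 by (simp add: L_def)
        moreover have "w \<noteq> v" using w adj_irr by blast
        ultimately show ?thesis using False base_L by simp
      qed (use base_down[OF 1] in simp)
      have "w \<in> {w \<in> nb v. base w = v} \<longleftrightarrow> w \<in> down f v" for w
        using key[of w] down_nb[of w f v] by auto
      then have "{w \<in> nb v. base w = v} = down f v" by (rule set_eqI)
      moreover have k1: "base w = w" if "w \<in> nb v" "base w \<noteq> v" for w
        using key[of w] that by simp
      have "inj_on base {w \<in> nb v. base w \<noteq> v}"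
      proof (rule inj_onI)
        fix a b assume "a \<in> {w \<in> nb v. base w \<noteq> v}" "b \<in> {w \<in> nb v. base w \<noteq> v}" "base a = base b"
        then show "a = b" using k1[of a] k1[of b] by simp
      qed
      moreover have "base w \<in> nb v" if "w \<in> nb v" "base w \<noteq> v" for w
        using k1[OF that] that(1) by simp
      ultimately show ?thesis using twoL[OF 1] 1 by (simp add: base_L)
    next
      case (2 u)
      have ne: "u \<noteq> bottom u" using bottom_not(1)[OF 2(1)] 2(1) by auto
      have nbv: "nb v = insert u (insert (bottom u) (matched f u v))" by (rule bottom(5)[OF 2])
      have "{w \<in> nb v. base w = u} = {u, bottom u}"
        unfolding nbv using base_matched(3)[OF 2] base_L[OF 2(1)] base_bottom[OF 2(1)] by auto
      moreover have N: "{w \<in> nb v. base w \<noteq> u} = matched f u v"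
        unfolding nbv using base_matched(3)[OF 2] base_L[OF 2(1)] base_bottom[OF 2(1)] by auto
      moreover have "inj_on base (matched f u v)"
      proof (rule inj_onI)
        fix a b assume ab: "a \<in> matched f u v" "b \<in> matched f u v" "base a = base b"
        have "a \<in> nb v" "b \<in> nb v" using ab by (auto simp: matched_def)
        then show "a = b"
          using base_matched[OF 2 ab(1)] base_matched[OF 2 ab(2)] ab(3)
          by (intro partner_unique[OF 2(1), of "base a" v]) (use 2 in auto)
      qed
      moreover have "\<forall>w\<in>nb v. base w \<noteq> u \<longrightarrow> base w \<in> nb u"
        using N base_matched(2)[OF 2] by blast
      ultimately show ?thesis using base_down[OF 2] 2(1) ne by simp
    next
      case (3 u)
      have key: "(base w = u \<longleftrightarrow> w \<in> down f u) \<and> (w \<notin> down f u \<longrightarrow> base w \<in> nb u \<and> w = bottom (base w))"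
        if w: "w \<in> nb (bottom u)" for w
      proof (cases "w \<in> down f u")
        case False
        then obtain a where a: "a \<in> L" "a \<in> nb u" "w = bottom a" using bottom_nb[OF 3(1) w] by blast
        moreover have "a \<noteq> u" using a(2) adj_irr by blast
        ultimately show ?thesis using False base_bottom by simp
      qed (use base_down[OF 3(1)] in simp)
      have "w \<in> {w \<in> nb (bottom u). base w = u} \<longleftrightarrow> w \<in> down f u" for w
        using key[of w] bottom(3)[OF 3(1)] by auto
      then have "{w \<in> nb (bottom u). base w = u} = down f u" by (rule set_eqI)
      moreover have k2: "base w \<in> nb u" "w = bottom (base w)" if "w \<in> nb (bottom u)" "base w \<noteq> u" for w
        using key[of w] that by simp_all
      have "inj_on base {w \<in> nb (bottom u). base w \<noteq> u}"
      proof (rule inj_onI)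
        fix a b assume "a \<in> {w \<in> nb (bottom u). base w \<noteq> u}" "b \<in> {w \<in> nb (bottom u). base w \<noteq> u}" "base a = base b"
        then show "a = b" using k2(2)[of a] k2(2)[of b] by simp
      qed
      moreover have "\<forall>w\<in>nb (bottom u). base w \<noteq> u \<longrightarrow> base w \<in> nb u" using k2(1) by blast
      ultimately show ?thesis using twoL[OF 3(1)] 3 base_bottom[OF 3(1)] by simp
    qed
  qed
  then show "card {w \<in> nb v. base w = base v} = 2"
    and "\<And>w. w \<in> nb v \<Longrightarrow> base w \<noteq> base v \<Longrightarrow> base w \<in> nb (base v)"
    and "inj_on base {w \<in> nb v. base w \<noteq> base v}"
    and "base v \<in> L" by blast+
qed

lemma cardL: "u \<in> L \<Longrightarrow> card (sub_nb nb L u) + 2 = d"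
  using card_lev_nb[OF lm] two by (simp add: L_def)

lemma L_fibration: "is_fibration L base 2"
  unfolding is_fibration_def using LV xL fiber base_L cardL by blast

lemma L_graph: "cd_graph L (sub_nb nb L) (d - 2)"
  by (rule fibration(1)[OF L_fibration])

lemma bij_base:
  assumes v: "v \<in> V"
  shows "bij_betw base {w \<in> nb v. base w \<noteq> base v} (sub_nb nb L (base v))"
proof -
  have "base ` {w \<in> nb v. base w \<noteq> base v} \<subseteq> sub_nb nb L (base v)"
    using fiber(2)[OF v] fiber(4)[OF v] fiber(4) adjV by (auto simp: sub_nb_def)
  moreover have "card {w \<in> nb v. base w \<noteq> base v} + 2 = d"
  proof -
    have "card (nb v) = card {w \<in> nb v. base w \<noteq> base v} + card {w \<in> nb v. base w = base v}"
      by (subst card_Un_disjoint[symmetric]) (auto intro: arg_cong[of _ _ card])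
    then show ?thesis using reg[OF v] fiber(1)[OF v] by simp
  qed
  then have "card (base ` {w \<in> nb v. base w \<noteq> base v}) = card (sub_nb nb L (base v))"
    using card_image[OF fiber(3)[OF v]] cardL[OF fiber(4)[OF v]] by simp
  moreover have "finite (sub_nb nb L (base v))" by (simp add: sub_nb_def)
  ultimately have "base ` {w \<in> nb v. base w \<noteq> base v} = sub_nb nb L (base v)"
    by (intro card_subset_eq)
  then show ?thesis using fiber(3)[OF v] by (simp add: bij_betw_def)
qed

lemma base_sum:
  fixes h :: "'a \<Rightarrow> real"
  assumes "v \<in> V"
  shows "(\<Sum>w\<in>nb v. h (base w)) = 2 * h (base v) + (\<Sum>a\<in>sub_nb nb L (base v). h a)"
  using fibration_sum[OF fin_nb fiber(1)[OF assms] bij_base[OF assms], of h] by simp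

lemma nbY:
  assumes "u \<in> L" "y \<in> down f u"
  shows "sub_nb nb Y y = matched f u y" "{w \<in> nb y. base w \<noteq> base y} = matched f u y"
proof -
  have yY: "y \<in> Y" using assms by (auto simp: Y_def)
  have "u \<notin> Y" using Y_not_L assms by (auto simp: Y_def)
  moreover have "v \<in> Y" if "v \<in> matched f u y" for v
    using base_matched[OF assms that] by (auto simp: Y_def)
  ultimately show "sub_nb nb Y y = matched f u y"
    unfolding sub_nb_def bottom(5)[OF assms] using bottom_not(2)[OF assms(1)] yY by auto
  show "{w \<in> nb y. base w \<noteq> base y} = matched f u y"
    unfolding bottom(5)[OF assms] base_down[OF assms]
    using base_matched(3)[OF assms] base_L[OF assms(1)] base_bottom[OF assms(1)] by auto
qed

text \<open>
  The test function extends \<open>h\<close> from \<open>Y\<close>: each of the fibres over the neighbours of \<open>base y\<close>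
  gets, away from \<open>Y\<close>, the value of \<open>h\<close> at the neighbour of \<open>y\<close> in that fibre.
\<close>

lemma Y_cd:
  assumes y: "y \<in> Y"
  shows "bform (sub_nb nb Y) (d - 2) y h h \<ge> 0"
proof -
  obtain u where u: "u \<in> L" and yu: "y \<in> down f u" using y by (auto simp: Y_def)
  let ?n = "sub_nb nb Y"
  let ?N = "matched f u y"
  note nby = bottom(5)[OF u yu]
  have nN: "?n y = ?N" by (rule nbY(1)[OF u yu])
  have yV: "y \<in> V" and uV: "u \<in> V" using adjV[OF down_nb[OF yu]] by auto
  have byu: "base y = u" by (rule base_down[OF u yu])
  have bN: "bij_betw base ?N (sub_nb nb L u)"
    using bij_base[OF yV] nbY(2)[OF u yu] by (simp add: byu)
  define q where "q w = (if w = u then h y else h (the_inv_into ?N base w))" for w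
  have qu: "q u = h y" by (simp add: q_def)
  have qN: "q (base v) = h v" if "v \<in> ?N" for v
    using base_matched(3)[OF u yu that] the_inv_into_f_f[of base ?N v] bN that
    by (simp add: q_def bij_betw_def)
  define H where "H v = (if v \<in> Y \<and> v \<notin> down f u then h v else q (base v))" for v
  have Hy: "H y = h y" using yu by (simp add: H_def byu qu)
  have Hu: "H u = h y" using Y_not_L u by (auto simp: H_def base_L qu Y_def)
  have Hb: "H (bottom u) = h y" using bottom_not[OF u] u by (simp add: H_def base_bottom qu)
  have HN: "H v = h v" if v: "v \<in> ?N" for v
  proof -
    have "v \<in> Y" using base_matched(1,4)[OF u yu v] by (auto simp: Y_def)
    moreover have "v \<notin> down f u"
      using base_down[OF u, of v] base_matched(3)[OF u yu v] by blast
    ultimately show ?thesis by (simp add: H_def)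
  qed
  have ne: "u \<noteq> bottom u" "u \<notin> ?N" "bottom u \<notin> ?N"
    using base_matched(3)[OF u yu] base_L[OF u] base_bottom[OF u] bottom_not[OF u] u by auto
  have finN: "finite ?N" by (simp add: matched_def)
  have sum3: "(\<Sum>v\<in>nb y. F v) = F u + F (bottom u) + (\<Sum>v\<in>?N. F v)" for F :: "'a \<Rightarrow> real"
    unfolding nby using ne finN by simp
  have lap: "lap nb H y = lap ?n h y"
    unfolding lap_def sum3 nN using HN by (simp add: Hu Hb Hy)
  have grad: "grad nb H H y = grad ?n h h y"
    unfolding grad_def sum3 nN using HN by (simp add: Hu Hb Hy)
  let ?t = "\<lambda>a b. (H b - 2 * H a + H y) * (H b - 2 * H a + H y)"
  have G: "grad ?n h h y = (\<Sum>w\<in>sub_nb nb L u. (q w - h y) * (q w - h y))"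
  proof -
    have "(\<Sum>w\<in>sub_nb nb L u. (q w - h y) * (q w - h y)) = (\<Sum>v\<in>?N. (q (base v) - h y) * (q (base v) - h y))"
      by (rule sum.reindex_bij_betw[OF bN, symmetric])
    then show ?thesis unfolding grad_def nN using qN by simp
  qed
  have Iu: "(\<Sum>b\<in>nb u. ?t u b) = grad ?n h h y"
  proof -
    have "H b = q (base b)" if b: "b \<in> nb u" for b
    proof (cases "b \<in> down f u")
      case False
      then have "b \<in> L" using lev_nb_cases[OF lm _ b] u by (simp add: L_def)
      then show ?thesis using Y_not_L by (auto simp: H_def Y_def)
    qed (simp add: H_def)
    then have "(\<Sum>b\<in>nb u. ?t u b) = (\<Sum>b\<in>nb u. (q (base b) - h y) * (q (base b) - h y))"
      by (intro sum.cong refl) (simp add: Hu Hy)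
    also have "\<dots> = grad ?n h h y"
      using base_sum[OF uV, of "\<lambda>w. (q w - h y) * (q w - h y)"] by (simp add: base_L[OF u] qu G)
    finally show ?thesis .
  qed
  have Ib: "(\<Sum>b\<in>nb (bottom u). ?t (bottom u) b) = grad ?n h h y"
  proof -
    have "H b = q (base b)" if b: "b \<in> nb (bottom u)" for b
    proof (cases "b \<in> down f u")
      case False
      then obtain w where "w \<in> L" "b = bottom w" using bottom_nb[OF u b] by blast
      then show ?thesis using bottom_not by (auto simp: H_def)
    qed (simp add: H_def)
    then have "(\<Sum>b\<in>nb (bottom u). ?t (bottom u) b) = (\<Sum>b\<in>nb (bottom u). (q (base b) - h y) * (q (base b) - h y))"
      by (intro sum.cong refl) (simp add: Hb Hy)
    also have "\<dots> = grad ?n h h y"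
      using base_sum[OF bottom(1)[OF u], of "\<lambda>w. (q w - h y) * (q w - h y)"]
      by (simp add: base_bottom[OF u] qu G)
    finally show ?thesis .
  qed
  have IN: "(\<Sum>b\<in>nb v. ?t v b) = 2 * ((h v - h y) * (h v - h y))
      + (\<Sum>b\<in>?n v. (h b - 2 * h v + h y) * (h b - 2 * h v + h y))" if v: "v \<in> ?N" for v
  proof -
    define w where "w = base v"
    note vw = base_matched[OF u yu v, folded w_def]
    have nv: "?n v = matched f w v" by (rule nbY(1)[OF vw(1,4)])
    have qw: "q w = h v" using qN[OF v] by (simp add: w_def)
    have "w \<notin> Y"
    proof
      assume "w \<in> Y"
      then obtain a where "a \<in> L" "w \<in> down f a" unfolding Y_def by blast
      then show False using Y_not_L[of a w] vw(1) by simp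
    qed
    then have Hw: "H w = h v" by (simp add: H_def base_L[OF vw(1)] qw)
    have Hbw: "H (bottom w) = h v"
      using bottom_not(2)[OF vw(1)] by (simp add: H_def base_bottom[OF vw(1)] qw)
    have Hm: "H b = h b" if b: "b \<in> matched f w v" for b
    proof (cases "b \<in> down f u")
      case True
      have "b = y"
      proof (rule partner_unique[OF vw(1) u adj_sym[OF vw(2)] vw(4)])
        show "b \<in> nb v \<inter> down f u" using b True by (simp add: matched_def)
        show "y \<in> nb v \<inter> down f u" using v yu by (auto simp: matched_def dest: adj_sym)
      qed
      then show ?thesis using Hy by simp
    next
      case False
      have "b \<in> Y" using base_matched(1,4)[OF vw(1,4) b] by (auto simp: Y_def)
      then show ?thesis using False by (simp add: H_def)
    qed
    have new: "w \<noteq> bottom w" "w \<notin> matched f w v" "bottom w \<notin> matched f w v"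
      using base_matched(3)[OF vw(1,4)] base_L[OF vw(1)] base_bottom[OF vw(1)] bottom_not[OF vw(1)] vw(1)
      by auto
    have "finite (matched f w v)" by (simp add: matched_def)
    then have "(\<Sum>b\<in>nb v. ?t v b) = ?t v w + ?t v (bottom w) + (\<Sum>b\<in>matched f w v. ?t v b)"
      unfolding bottom(5)[OF vw(1,4)] using new by simp
    also have "(\<Sum>b\<in>matched f w v. ?t v b) = (\<Sum>b\<in>?n v. (h b - 2 * h v + h y) * (h b - 2 * h v + h y))"
      unfolding nv by (intro sum.cong refl) (simp add: Hm HN[OF v] Hy)
    also have "?t v w = (h v - h y) * (h v - h y)" by (simp add: Hw HN[OF v] Hy algebra_simps)
    also have "?t v (bottom w) = (h v - h y) * (h v - h y)" by (simp add: Hbw HN[OF v] Hy algebra_simps)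
    finally show ?thesis by simp
  qed
  \<comment> \<open>The top and the bottom of the square of \<open>y\<close> contribute one squared
    gradient each, and the steps from the partners of \<open>y\<close> to the tops and bottoms of
    their own squares contribute two more. These four are the difference between degree
    \<open>d\<close> and degree \<open>d - 2\<close>.\<close>
  have "(\<Sum>a\<in>nb y. \<Sum>b\<in>nb a. ?t a b) = 2 * grad ?n h h y
      + (\<Sum>v\<in>?N. 2 * ((h v - h y) * (h v - h y))
      + (\<Sum>b\<in>?n v. (h b - 2 * h v + h y) * (h b - 2 * h v + h y)))"
    unfolding sum3 Iu Ib using IN by simp
  also have "\<dots> = 4 * grad ?n h h y
      + (\<Sum>v\<in>?n y. (\<Sum>b\<in>?n v. (h b - 2 * h v + h y) * (h b - 2 * h v + h y)))"
    unfolding sum.distrib sum_distrib_left[symmetric] nN[symmetric] by (simp add: grad_def)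
  finally have "bform nb d y H H = 4 * grad ?n h h y
      + (\<Sum>v\<in>?n y. (\<Sum>b\<in>?n v. (h b - 2 * h v + h y) * (h b - 2 * h v + h y)))
      + 2 * lap ?n h y * lap ?n h y - (2 * d + 4) * grad ?n h h y"
    by (simp add: bform_def lap grad)
  also have "\<dots> = bform ?n (d - 2) y h h"
    using cardL[OF u] by (simp add: bform_def of_nat_diff algebra_simps)
  finally show ?thesis using cd[OF yV, of H] by simp
qed

text \<open>Functions orthogonal to \<open>f\<close> are flat on every block, so they restrict to
  eigenfunctions on \<open>L\<close>, and the restriction is injective. Orthogonality to
  \<open>f\<close> costs one dimension.\<close>

lemma L_dim:
  assumes min: "\<And>u. u \<in> L \<Longrightarrow> minimal_at f u"
  shows "fun_space.dim E \<le> Suc (fun_space.dim (eig2 L (sub_nb nb L)))"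
proof -
  interpret L: cd_graph L "sub_nb nb L" "d - 2" by (rule L_graph)
  let ?K = "{h \<in> E. ip f h = 0}"
  have lip: "lin_fun (ip f)"
    unfolding lin_fun_def ip_def sum_distrib_left sum.distrib[symmetric]
    by (intro allI sum.cong refl) (simp add: algebra_simps)
  have ip0: "ip f (\<lambda>x. 0) = 0" by (simp add: ip_def)
  have Kc: "lin_closed ?K"
    using E_closed lip ip0 by (auto simp: lin_closed_def lin_fun_def)
  define \<rho> where "\<rho> h = (\<lambda>u. if u \<in> L then h u else (0::real))" for h :: "'a \<Rightarrow> real"
  have flat: "h y = h u" if "h \<in> ?K" "u \<in> L" "y \<in> down f u" for h u y
    using minimal_orthogonal_flat[OF min[OF that(2)] _ _ that(3)] that(1) by simp
  have \<rho>E: "\<rho> h \<in> L.E" if h: "h \<in> ?K" for h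
  proof -
    have "lap (sub_nb nb L) (\<rho> h) u = - 2 * \<rho> h u" if u: "u \<in> L" for u
    proof -
      have "lap nb h u = (\<Sum>v\<in>nb u \<inter> L. h v - h u)"
        unfolding lap_def
      proof (rule sum.mono_neutral_right)
        show "\<forall>v\<in>nb u - nb u \<inter> L. h v - h u = 0"
        proof
          fix v assume v: "v \<in> nb u - nb u \<inter> L"
          then have "v \<in> down f u"
            using lev_nb_cases[OF lm, of u v] u by (auto simp: L_def)
          then show "h v - h u = 0" using flat[OF h u] by simp
        qed
      qed auto
      also have "\<dots> = lap (sub_nb nb L) (\<rho> h) u"
        unfolding lap_def by (rule sum.cong) (use u in \<open>auto simp: sub_nb_def \<rho>_def\<close>)
      finally show ?thesis using E_lap[of h u] h u LV by (auto simp: \<rho>_def)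
    qed
    then show ?thesis by (simp add: eig2_def \<rho>_def)
  qed
  have \<rho>0: "h = (\<lambda>x. 0)" if h: "h \<in> ?K" and 0: "\<rho> h = (\<lambda>x. 0)" for h
  proof (rule E_eq_zero_if_flat[OF _ locmaxD(2)[OF lm]])
    show "h \<in> E" using h by simp
    fix y assume y: "y \<in> nb x"
    have z: "h u = 0" if "u \<in> L" for u using fun_cong[OF 0, of u] that by (simp add: \<rho>_def)
    show "h y = h x"
    proof (cases "y \<in> down f x")
      case True
      then show ?thesis by (rule flat[OF h xL])
    next
      case False
      then have "y \<in> L" using lev_nb_cases[OF lm _ y] xL by (simp add: L_def)
      then show ?thesis using z xL by simp
    qed
  qed
  have K: "spans_le ?K d" by (rule spans_le_mono[OF _ spans_E]) auto
  have "lin_map \<rho>" by (auto simp: lin_map_def \<rho>_def fun_eq_iff)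
  then have "fun_space.dim ?K \<le> fun_space.dim L.E"
    by (rule dim_le_inj[OF _ Kc \<rho>0 \<rho>E K L.spans_E])
  moreover have "spans_le E (Suc (fun_space.dim ?K))"
    by (rule spans_le_kernel[OF E_closed lip spans_le_dim_self[OF K]])
  then have "fun_space.dim E \<le> Suc (fun_space.dim ?K)" by (rule spans_le_dim)
  ultimately show ?thesis by simp
qed

lemma baseY: "v \<in> Y \<Longrightarrow> base v \<in> L \<and> v \<in> down f (base v)"
  using base_down by (auto simp: Y_def)

lemma cardY: "card Y = 2 * card L"
proof -
  have finL: "finite L" using LV finV finite_subset by blast
  have "card Y = (\<Sum>u\<in>L. card (down f u))"
    unfolding Y_def
  proof (rule card_UN_disjoint[OF finL])
    show "\<forall>i\<in>L. \<forall>j\<in>L. i \<noteq> j \<longrightarrow> down f i \<inter> down f j = {}"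
      using down_inj by blast
  qed simp
  then show ?thesis using twoL by simp
qed

text \<open>The inclusion supplies connectivity: edges at vertices of \<open>Y\<close> along which
  \<open>f\<close> is constant stay in \<open>Y\<close>.\<close>

lemma Y_graph:
  assumes y1: "y1 \<in> Y" and Y: "Y \<subseteq> lev f y1"
  shows "cd_graph Y (sub_nb nb Y) (d - 2)"
proof
  have "Y \<subseteq> V" using adjV[OF down_nb] by (auto simp: Y_def)
  then show "finite Y" using finV finite_subset by blast
  show "Y \<noteq> {}" using y1 by blast
  show "card (sub_nb nb Y y) = d - 2" if y: "y \<in> Y" for y
  proof -
    have b: "base y \<in> L" "y \<in> down f (base y)" using baseY[OF y] by auto
    show ?thesis
      using matched_card[OF lmL[OF b(1)] b(2)] twoL[OF b(1)] nbY(1)[OF b] by simp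
  qed
  show "0 \<le> bform (sub_nb nb Y) (d - 2) y h h" if "y \<in> Y" for y h by (rule Y_cd[OF that])
  show "S = Y" if S: "S \<subseteq> Y" "S \<noteq> {}" "\<And>a b. a \<in> S \<Longrightarrow> b \<in> sub_nb nb Y a \<Longrightarrow> b \<in> S" for S
  proof -
    have flat: "b \<in> Y" if "a \<in> Y" "b \<in> nb a" "f b = f a" for a b
    proof -
      have ba: "base a \<in> L" "a \<in> down f (base a)" using baseY[OF that(1)] by auto
      have "b \<in> matched f (base a) a" by (rule nb_flat_matched[OF ba that(2,3)])
      then show ?thesis using nbY(1)[OF ba] by (auto simp: sub_nb_def split: if_splits)
    qed
    have key: "v \<in> Y \<and> (v \<in> S \<longleftrightarrow> y1 \<in> S)" if "v \<in> lev f y1" for v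
      using that
    proof (induction rule: lev_induct)
      case base
      then show ?case using y1 by simp
    next
      case (step u v)
      have vY: "v \<in> Y" using flat step by blast
      have "v \<in> sub_nb nb Y u" "u \<in> sub_nb nb Y v"
        using step vY adj_sym[OF step.hyps(2)] by (simp_all add: sub_nb_def)
      then have "u \<in> S \<longleftrightarrow> v \<in> S" using S(3) by blast
      then show ?case using vY step.IH by simp
    qed
    obtain s where "s \<in> S" using S(2) by blast
    then have "y1 \<in> S" using key[of s] S(1) Y by blast
    then show ?thesis using key S(1) Y by blast
  qed
  show "y \<notin> sub_nb nb Y y" for y using adj_irr by (simp add: sub_nb_def)
  show "y \<in> sub_nb nb Y v" if "v \<in> sub_nb nb Y y" for v y
    using that adj_comm[of v y] by (simp add: sub_nb_def split: if_splits)
  show "y \<in> Y \<and> v \<in> Y" if "v \<in> sub_nb nb Y y" for v y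
    using that by (simp add: sub_nb_def split: if_splits)
qed

text \<open>Eigenfunctions on \<open>L\<close> are lifted along the two-fold covering of
  \<open>L\<close> by \<open>Y\<close>, which is bijective on neighbourhoods.\<close>

lemma Y_dim:
  assumes Yg: "cd_graph Y (sub_nb nb Y) (d - 2)"
  shows "fun_space.dim (eig2 L (sub_nb nb L)) \<le> fun_space.dim (eig2 Y (sub_nb nb Y))"
proof -
  interpret L: cd_graph L "sub_nb nb L" "d - 2" by (rule L_graph)
  interpret Y: cd_graph Y "sub_nb nb Y" "d - 2" by (rule Yg)
  define \<phi> where "\<phi> h = (\<lambda>v. if v \<in> Y then h (base v) else (0::real))" for h :: "'a \<Rightarrow> real"
  have lmap: "lin_map \<phi>" by (auto simp: lin_map_def \<phi>_def fun_eq_iff)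
  have \<phi>E: "\<phi> h \<in> Y.E" if h: "h \<in> L.E" for h
  proof -
    have "lap (sub_nb nb Y) (\<phi> h) y = - 2 * \<phi> h y" if y: "y \<in> Y" for y
    proof -
      have b: "base y \<in> L" "y \<in> down f (base y)" using baseY[OF y] by auto
      have yV: "y \<in> V" using adjV[OF down_nb[OF b(2)]] by simp
      have "lap (sub_nb nb Y) (\<phi> h) y = (\<Sum>v\<in>sub_nb nb Y y. h (base v) - h (base y))"
        unfolding lap_def by (rule sum.cong) (use y in \<open>auto simp: sub_nb_def \<phi>_def\<close>)
      also have "\<dots> = (\<Sum>v\<in>{w \<in> nb y. base w \<noteq> base y}. h (base v) - h (base y))"
        using nbY[OF b] by simp
      also have "\<dots> = (\<Sum>w\<in>sub_nb nb L (base y). h w - h (base y))"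
        by (rule sum.reindex_bij_betw[OF bij_base[OF yV]])
      also have "\<dots> = - 2 * h (base y)"
        using L.E_lap[OF h b(1)] by (simp add: lap_def)
      finally show ?thesis using y by (simp add: \<phi>_def)
    qed
    then show ?thesis by (simp add: eig2_def \<phi>_def)
  qed
  have \<phi>0: "h = (\<lambda>x. 0)" if h: "h \<in> L.E" and 0: "\<phi> h = (\<lambda>x. 0)" for h
  proof
    fix u show "h u = 0"
    proof (cases "u \<in> L")
      case True
      then obtain y where y: "y \<in> down f u" using down_ne by blast
      then have "y \<in> Y" using True by (auto simp: Y_def)
      then show ?thesis using fun_cong[OF 0, of y] base_down[OF True y] by (simp add: \<phi>_def)
    qed (use h in \<open>simp add: eig2_def\<close>)
  qed
  show ?thesis by (rule dim_le_inj[OF lmap L.E_closed \<phi>0 \<phi>E L.spans_E Y.spans_E])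
qed

text \<open>The level component of a middle vertex meets every block in the same number of vertices.
  If this number is one, the covering of \<open>L\<close> by \<open>Y\<close> splits, and the two
  sheets, being distinguishable, yield a cut. If it is two, \<open>Y\<close> is connected and is a
  graph with twice as many vertices as \<open>L\<close>.\<close>

lemma monodromy:
  assumes min: "\<And>u. u \<in> L \<Longrightarrow> minimal_at f u"
  shows "(\<exists>S. is_cut S) \<or> (\<exists>W Y. cd_graph W (sub_nb nb W) (d - 2) \<and> cd_graph Y (sub_nb nb Y) (d - 2)
    \<and> card Y = 2 * card W \<and> fun_space.dim E \<le> Suc (fun_space.dim (eig2 W (sub_nb nb W)))
    \<and> fun_space.dim (eig2 W (sub_nb nb W)) \<le> fun_space.dim (eig2 Y (sub_nb nb Y)))"
proof -
  obtain y1 where y1: "y1 \<in> down f x" using down_ne[OF xL] by blast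
  define A where "A = lev f y1"
  have y1Y: "y1 \<in> Y" using y1 xL by (auto simp: Y_def)
  have AY: "A \<subseteq> Y"
  proof
    fix v assume "v \<in> A"
    then show "v \<in> Y" unfolding A_def
    proof (induction rule: lev_induct)
      case base
      then show ?case by (rule y1Y)
    next
      case (step u v)
      have b: "base u \<in> L" "u \<in> down f (base u)" using baseY[OF step.IH] by auto
      have "v \<in> matched f (base u) u" by (rule nb_flat_matched[OF b step.hyps(2,3)])
      then show ?case using nbY(1)[OF b] by (auto simp: sub_nb_def split: if_splits)
    qed
  qed
  have Astep: "a \<in> A \<longleftrightarrow> b \<in> A" if "b \<in> nb a" "f b = f a" for a b
    using lev_step[of a f y1 b] lev_step[of b f y1 a] that adj_sym[OF that(1)] by (auto simp: A_def)
  have cA: "card (down f u \<inter> A) = card (down f x \<inter> A)" if "u \<in> L" for u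
    using that unfolding L_def
  proof (induction rule: lev_induct)
    case (step u v)
    have u: "u \<in> L" using step.hyps by (simp add: L_def)
    obtain \<psi> where \<psi>: "bij_betw \<psi> (down f u) (down f v)" "\<And>y. y \<in> down f u \<Longrightarrow> \<psi> y \<in> nb y"
      using level_bij[OF lmL[OF u] step.hyps(2,3)] by metis
    have "\<psi> y \<in> A \<longleftrightarrow> y \<in> A" if y: "y \<in> down f u" for y
    proof -
      have "\<psi> y \<in> down f v" using \<psi>(1) y by (auto simp: bij_betw_def)
      then have "f (\<psi> y) = f y"
        using level_parallel[OF lmL[OF u] step.hyps(2,3) _ y adj_sym[OF \<psi>(2)[OF y]] fE] step.hyps(3)
        by simp
      then show ?thesis using Astep[OF \<psi>(2)[OF y]] by simp
    qed
    then have "\<psi> ` (down f u \<inter> A) = (\<psi> ` down f u) \<inter> A" by auto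
    then have "\<psi> ` (down f u \<inter> A) = down f v \<inter> A"
      using \<psi>(1) by (simp add: bij_betw_def)
    moreover have "inj_on \<psi> (down f u \<inter> A)"
      using \<psi>(1) by (auto simp: bij_betw_def inj_on_def)
    ultimately have "card (down f v \<inter> A) = card (down f u \<inter> A)"
      using card_image by metis
    then show ?case using step.IH by simp
  qed simp
  have "y1 \<in> down f x \<inter> A" using y1 by (simp add: A_def)
  then have "card (down f x \<inter> A) \<ge> 1" by (metis Suc_leI card_gt_0_iff empty_iff fin_down finite_Int One_nat_def)
  moreover have "card (down f x \<inter> A) \<le> 2"
    using two card_mono[of "down f x" "down f x \<inter> A"] by simp
  ultimately consider "card (down f x \<inter> A) = 1" | "card (down f x \<inter> A) = 2" by linarith
  then show ?thesis
  proof cases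
    case 2
    have "Y \<subseteq> A"
    proof
      fix v assume "v \<in> Y"
      then have b: "base v \<in> L" "v \<in> down f (base v)" using baseY by auto
      have "down f (base v) \<inter> A = down f (base v)"
        by (rule card_subset_eq) (use cA[OF b(1)] 2 twoL[OF b(1)] in auto)
      then show "v \<in> A" using b(2) by blast
    qed
    then have "cd_graph Y (sub_nb nb Y) (d - 2)" using Y_graph[OF y1Y] by (simp add: A_def)
    then show ?thesis using L_graph cardY L_dim[OF min] Y_dim by blast
  next
    case 1
    \<comment> \<open>In each square the cut separates two opposite edges: the top and the middle
      vertex outside \<open>A\<close> from the middle vertex in \<open>A\<close> and the
      bottom.\<close>
    define S where "S = L \<union> (Y - A)"
    have LA: "u \<notin> A" if "u \<in> L" for u using AY that Y_not_L by (auto simp: Y_def)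
    have bS: "bottom u \<notin> S" if "u \<in> L" for u using bottom_not[OF that] by (simp add: S_def)
    have YS: "y \<in> S \<longleftrightarrow> y \<notin> A" if "u \<in> L" "y \<in> down f u" for u y
      using Y_not_L[OF that] that by (auto simp: S_def Y_def)
    have "\<exists>w. {w \<in> nb v. (w \<in> S) \<noteq> (v \<in> S)} = {w}" if vV: "v \<in> V" for v
      using vV
    proof (cases rule: V_elim)
      case 1
      have "(w \<in> nb v \<and> (w \<in> S) \<noteq> (v \<in> S)) \<longleftrightarrow> w \<in> down f v \<inter> A" for w
        using lev_nb_cases[OF lm, of v w] 1 YS[OF 1, of w] down_nb[of w f v] LA[of w]
        by (auto simp: S_def L_def)
      then have "{w \<in> nb v. (w \<in> S) \<noteq> (v \<in> S)} = down f v \<inter> A" by blast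
      moreover have "card (down f v \<inter> A) = 1" using cA[OF 1] \<open>card (down f x \<inter> A) = 1\<close> by simp
      ultimately show ?thesis by (metis card_1_singletonE)
    next
      case (2 u)
      have uS: "u \<in> S" using 2(1) by (simp add: S_def)
      have m: "w \<in> S \<longleftrightarrow> v \<in> S" if w: "w \<in> matched f u v" for w
      proof -
        note bw = base_matched[OF 2 w]
        have "w \<in> nb v" using w by (simp add: matched_def)
        then show ?thesis using Astep[of w v] bw(5) YS[OF 2] YS[OF bw(1,4)] by simp
      qed
      show ?thesis
      proof (cases "v \<in> S")
        case True
        then have "{w \<in> nb v. (w \<in> S) \<noteq> (v \<in> S)} = {bottom u}"
          unfolding bottom(5)[OF 2] using m uS bS[OF 2(1)] by auto
        then show ?thesis by blast
      next
        case False
        then have "{w \<in> nb v. (w \<in> S) \<noteq> (v \<in> S)} = {u}"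
          unfolding bottom(5)[OF 2] using m uS bS[OF 2(1)] by auto
        then show ?thesis by blast
      qed
    next
      case (3 u)
      have "(w \<in> nb v \<and> (w \<in> S) \<noteq> (v \<in> S)) \<longleftrightarrow> w \<in> down f u - A" for w
      proof (cases "w \<in> down f u")
        case True
        then show ?thesis using YS[OF 3(1) True] bS[OF 3(1)] bottom(3)[OF 3(1)] 3(2) by auto
      next
        case False
        have "w \<notin> S" if "w \<in> nb v"
          using bottom_nb[OF 3(1), of w] that 3(2) False bS by metis
        then show ?thesis using False bS[OF 3(1)] 3(2) by auto
      qed
      then have "{w \<in> nb v. (w \<in> S) \<noteq> (v \<in> S)} = down f u - A" by blast
      moreover have "card (down f u - A) = 1"
        using cA[OF 3(1)] \<open>card (down f x \<inter> A) = 1\<close> twoL[OF 3(1)]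
        by (simp add: card_Diff_subset_Int)
      ultimately show ?thesis by (metis card_1_singletonE)
    qed
    then have "is_cut S" by (simp add: is_cut_def)
    then show ?thesis by blast
  qed
qed

end

section \<open>Blocks of size three and four\<close>

context cd_graph
begin

text \<open>Both block vertices lie below \<open>x\<close>, so the term of \<open>x\<close> in
  \<open>common_sum\<close> is nonzero and has to be balanced by another one.\<close>

lemma pair_common:
  assumes m: "locmax f x" and y: "y1 \<in> down f x" "y2 \<in> down f x" "y1 \<noteq> y2"
  obtains z where "z \<noteq> x" "z \<in> nb y1" "z \<in> nb y2"
proof -
  have yV: "y1 \<in> V" "y2 \<in> V" using y down_nb adjV by blast+
  have xc: "x \<in> nb y1 \<inter> nb y2" using adj_sym[OF down_nb[OF y(1)]] adj_sym[OF down_nb[OF y(2)]] by simp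
  have "f y1 + f y2 < 2 * f x" using down_less[OF y(1)] down_less[OF y(2)] by simp
  then have "nb y1 \<inter> nb y2 \<noteq> {x}"
    using common_sum[OF locmaxD(1)[OF m] yV] y(3) by auto
  then show ?thesis using xc that by blast
qed

text \<open>A vertex in the block of a level neighbour of \<open>x\<close> is adjacent to only one
  vertex of the block of \<open>x\<close>, whereas \<open>z\<close> is adjacent to two.\<close>

lemma pair_top:
  assumes m: "locmax f x" and y: "y1 \<in> down f x" "y2 \<in> down f x" "y1 \<noteq> y2"
    and z: "z \<noteq> x" "y1 \<in> nb z" "y2 \<in> nb z"
  shows "nb x \<inter> nb z = nb z \<inter> down f x" "z \<notin> matched f x y" "f z < f x"
proof -
  have fz: "f z < f x"
    by (rule locmax_le2(2)[OF m down_nb[OF y(1)] adj_sym[OF z(2)] y(1) z(1)])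
  show "f z < f x" by (rule fz)
  have no: False if u: "u \<in> nb x" "f u = f x" "z \<in> down f u" for u
  proof -
    have "card (nb z \<inter> down f x) = 1" by (rule level_match_card[OF m u])
    then obtain t where t: "nb z \<inter> down f x = {t}" by (rule card_1_singletonE)
    have "y1 \<in> {t}" "y2 \<in> {t}" unfolding t[symmetric] using y z by auto
    then show False using y(3) by simp
  qed
  then show "z \<notin> matched f x y" by (auto simp: matched_def)
  show "nb x \<inter> nb z = nb z \<inter> down f x"
  proof (intro equalityI subsetI)
    fix u assume u: "u \<in> nb x \<inter> nb z"
    have "u \<in> down f x"
    proof (rule ccontr)
      assume "u \<notin> down f x"
      then have "f u = f x" using u locmaxD(3)[OF m, of u] by (simp add: down_def)
      moreover have "z \<in> nb u" using u adj_comm[of z u] by simp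
      ultimately show False using no[of u] u fz by (simp add: down_def)
    qed
    then show "u \<in> nb z \<inter> down f x" using u by simp
  qed (auto simp: down_def)
qed

lemma pair_value:
  assumes m: "locmax f x" and z: "z \<noteq> x" and c: "nb z \<inter> down f x = {y1, y2}" "y1 \<noteq> y2"
  shows "f z = f y1 + f y2 - f x"
proof -
  have y: "y1 \<in> down f x" "y2 \<in> down f x" "y1 \<in> nb z" "y2 \<in> nb z" using c(1) by blast+
  have zV: "z \<in> V" using adjV[OF y(3)] by simp
  have com: "nb x \<inter> nb z = {y1, y2}"
    using pair_top(1)[OF m y(1,2) c(2) z y(3,4)] c(1) by simp
  show ?thesis
    using card_common[OF locmaxD(1,2)[OF m] zV z] c(2) unfolding com by simp
qed

text \<open>Counting common neighbours gives \<open>f x - f z\<close> as \<open>4 * f x\<close>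
  divided by the block size; with this value the edges to the block exhaust the squared gradient at
  \<open>z\<close>. The eigenvalue equation at \<open>z\<close> then gives
  \<open>f z = - f x\<close>, which belongs to block size two.\<close>

lemma no_full:
  assumes m: "locmax f x" and z: "z \<noteq> x" "down f x \<subseteq> nb z" and c: "card (down f x) \<ge> 3"
  shows False
proof -
  let ?P = "down f x"
  have f: "f \<in> E" and xV: "x \<in> V" using locmaxD[OF m] by auto
  have "\<not> card ?P \<le> Suc 0" using c by simp
  then obtain y1 y2 where y: "y1 \<in> ?P" "y2 \<in> ?P" "y1 \<noteq> y2"
    using card_le_Suc0_iff_eq[OF fin_down[of f x]] by blast
  have com: "nb x \<inter> nb z = ?P"
    using pair_top(1)[OF m y z(1)] y z(2) by blast
  have zV: "z \<in> V" using adjV y z(2) by blast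
  define s where "s = real (card ?P)"
  have s: "s \<ge> 3" using c by (simp add: s_def)
  define b where "b = f x - f z"
  have sa: "(\<Sum>y\<in>?P. f x - f y) = 2 * f x" by (rule sum_down[OF m])
  have sb: "s * b = 4 * f x"
    using card_common[OF f xV zV z(1)] sa by (simp add: com s_def b_def)
  have flat: "f v = f z" if v: "v \<in> nb z" "v \<notin> ?P" for v
  proof (rule grad_exhausted[OF f xV zV z(2) _ v])
    have "(\<Sum>v\<in>?P. (f v - f z)^2) = (\<Sum>v\<in>?P. (f v - f x)^2 + (b^2 - 2 * b * (f x - f v)))"
      by (intro sum.cong refl) (simp add: b_def power2_eq_square algebra_simps)
    also have "\<dots> = grad nb f f x + (s * b^2 - 2 * b * (2 * f x))"
      unfolding sum.distrib sum_subtractf[of "\<lambda>_. b^2"] sum_distrib_left[symmetric] sa grad_down[OF m] s_def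
      by simp
    also have "s * b^2 - 2 * b * (2 * f x) = 0"
      using sb by (simp add: power2_eq_square)
    finally show "(\<Sum>v\<in>?P. (f v - f z)^2) = grad nb f f x" by simp
  qed
  have "lap nb f z = (\<Sum>v\<in>?P. f v - f z)"
    unfolding lap_def by (rule sum.mono_neutral_right) (use z flat in auto)
  also have "\<dots> = (\<Sum>v\<in>?P. b - (f x - f v))"
    by (intro sum.cong refl) (simp add: b_def)
  also have "\<dots> = s * b - 2 * f x"
    unfolding sum_subtractf[of "\<lambda>_. b"] sa s_def by simp
  finally have "b = 2 * f x" using E_lap[OF f zV] sb by (simp add: b_def)
  moreover have "f x > 0"
  proof -
    have "(\<Sum>y\<in>?P. f x - f y) > 0"
      by (rule sum_pos2[OF _ y(1)]) (use down_less[of _ f x] y(1) in \<open>auto intro: less_imp_le\<close>)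
    then show ?thesis using sa by simp
  qed
  ultimately show False using sb s by simp
qed

lemma nb_third:
  assumes "card (nb z) = 3" "a \<in> nb z" "b \<in> nb z" "a \<noteq> b"
  obtains t where "nb z = {a, b, t}" "t \<noteq> a" "t \<noteq> b"
proof -
  have "card (nb z - {a, b}) = 1"
    using assms by (subst card_Diff_subset) auto
  then obtain t where t: "nb z - {a, b} = {t}" by (rule card_1_singletonE)
  then have "t \<in> nb z - {a, b}" by simp
  moreover have "nb z = {a, b} \<union> (nb z - {a, b})" using assms(2,3) by blast
  then have "nb z = {a, b, t}" unfolding t by auto
  ultimately show ?thesis using that by blast
qed

section \<open>Closing up a 3-cube in degree three\<close>

text \<open>For degree three the bound of \<open>cd_diag\<close> is 1 and the sum has two positive
  terms, so neither of them equals 1: every path of length two that starts with the edge from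
  \<open>x\<close> to \<open>y\<close> lies in a square.\<close>

lemma cubic_square:
  assumes d: "d = 3" and y: "y \<in> nb x" and no: "nb x \<inter> nb y = {}" and p: "p \<in> nb y" "p \<noteq> x"
  obtains v where "v \<in> nb x" "v \<noteq> y" "v \<in> nb p"
proof -
  have xV: "x \<in> V" and yV: "y \<in> V" using adjV[OF y] by auto
  have xy: "x \<in> nb y" by (rule adj_sym[OF y])
  obtain q where q: "nb y = {x, p, q}" "q \<noteq> x" "q \<noteq> p"
    using nb_third[OF _ xy p(1)] p(2) reg[OF yV] d by metis
  have e: "nb y - {x} = {p, q}" using q p(2) by auto
  have "(\<Sum>v\<in>nb y - {x}. 1 / real (card (nb x \<inter> nb v))) \<le> 1"
    using cd_diag[OF xV y no] d by simp
  then have s: "1 / real (card (nb x \<inter> nb p)) + 1 / real (card (nb x \<inter> nb q)) \<le> 1"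
    unfolding e using q(3) by simp
  have yp: "y \<in> nb x \<inter> nb p" "y \<in> nb x \<inter> nb q"
    using y p(1) adj_sym[of p y] adj_sym[of q y] q(1) by auto
  have "card (nb x \<inter> nb q) > 0" using yp(2) by (auto simp: card_gt_0_iff)
  then have "card (nb x \<inter> nb p) \<noteq> 1" using s by auto
  then have "nb x \<inter> nb p \<noteq> {y}" by auto
  then show ?thesis using that yp(1) by blast
qed

text \<open>A 3-cube with its last vertex still unknown: each \<open>z\<close> is opposite to the
  \<open>y\<close> of the same index.\<close>

definition hexagon :: "'a \<Rightarrow> 'a \<Rightarrow> 'a \<Rightarrow> 'a \<Rightarrow> 'a \<Rightarrow> 'a \<Rightarrow> 'a \<Rightarrow> bool" where
  "hexagon x y1 y2 y3 z1 z2 z3 \<longleftrightarrow> distinct [x, y1, y2, y3, z1, z2, z3] \<and> nb x = {y1, y2, y3} \<and>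
    nb y1 = {x, z2, z3} \<and> nb y2 = {x, z3, z1} \<and> nb y3 = {x, z1, z2}"

lemma hexagon_rot: "hexagon x y1 y2 y3 z1 z2 z3 \<Longrightarrow> hexagon x y2 y3 y1 z2 z3 z1"
  unfolding hexagon_def by (auto simp: insert_commute)

lemma hexagon_third:
  assumes d: "d = 3" and h: "hexagon x y1 y2 y3 z1 z2 z3"
  obtains t where "nb z1 = {y2, y3, t}" "t \<noteq> x" "t \<noteq> y1" "t \<noteq> y2" "t \<noteq> y3" "t \<noteq> z1"
proof -
  have z: "y2 \<in> nb z1" "y3 \<in> nb z1" "y2 \<noteq> y3"
    using h adj_sym[of z1 y2] adj_sym[of z1 y3] by (auto simp: hexagon_def)
  have "card (nb z1) = 3" using reg[of z1] adjV[OF z(1)] d by simp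
  then obtain t where t: "nb z1 = {y2, y3, t}" "t \<noteq> y2" "t \<noteq> y3"
    using nb_third[OF _ z] by metis
  have zt: "z1 \<in> nb t" using adj_sym[of t z1] t(1) by simp
  have "t \<noteq> x" "t \<noteq> y1" using zt h by (auto simp: hexagon_def)
  moreover have "t \<noteq> z1" using zt adj_irr by blast
  ultimately show ?thesis using that t by blast
qed

text \<open>A chord would fill up \<open>z1\<close> and \<open>z2\<close> and leave
  \<open>z3\<close> with a neighbour \<open>t\<close> outside. Another neighbour of \<open>t\<close>
  must close a square with \<open>z3\<close>, so it is adjacent to \<open>y1\<close> or
  \<open>y2\<close>, but their neighbours other than \<open>z3\<close> are not adjacent to
  \<open>t\<close>.\<close>

lemma hexagon_no_chord:
  assumes d: "d = 3" and h: "hexagon x y1 y2 y3 z1 z2 z3"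
  shows "z2 \<notin> nb z1"
proof
  assume c: "z2 \<in> nb z1"
  have c': "z1 \<in> nb z2" by (rule adj_sym[OF c])
  have H: "distinct [x, y1, y2, y3, z1, z2, z3]" "nb x = {y1, y2, y3}" "nb y1 = {x, z2, z3}"
    "nb y2 = {x, z3, z1}" "nb y3 = {x, z1, z2}"
    using h unfolding hexagon_def by blast+
  obtain t1 where t1: "nb z1 = {y2, y3, t1}" by (rule hexagon_third[OF d h])
  then have n1: "nb z1 = {y2, y3, z2}" using c H(1) by auto
  obtain t2 where t2: "nb z2 = {y3, y1, t2}" by (rule hexagon_third[OF d hexagon_rot[OF h]])
  then have n2: "nb z2 = {y3, y1, z1}" using c' H(1) by auto
  obtain t where t: "nb z3 = {y1, y2, t}" "t \<noteq> x" "t \<noteq> y3" "t \<noteq> y1" "t \<noteq> y2" "t \<noteq> z3"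
    by (rule hexagon_third[OF d hexagon_rot[OF hexagon_rot[OF h]]])
  have tn: "t \<in> nb z3" "z3 \<in> nb t" using t(1) adj_sym[of t z3] by auto
  have "z3 \<notin> nb z1" unfolding n1 using H(1) by auto
  then have tz1: "t \<noteq> z1" using tn(2) by blast
  have "z3 \<notin> nb z2" unfolding n2 using H(1) by auto
  then have tz2: "t \<noteq> z2" using tn(2) by blast
  have far: "t \<notin> nb y1" unfolding H(3) using t tz2 by simp
  have far2: "t \<notin> nb y2" unfolding H(4) using t tz1 by simp
  have far3: "t \<notin> nb x" unfolding H(2) using t by simp
  have far4: "t \<notin> nb z1" unfolding n1 using t tz2 by simp
  have far5: "t \<notin> nb z2" unfolding n2 using t tz1 by simp
  have no: "nb z3 \<inter> nb t = {}"
    unfolding t(1) using far far2 adj_comm[of y1 t] adj_comm[of y2 t] adj_irr[of t] by simp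
  have "card (nb t) = 3" using reg[of t] adjV[OF tn(1)] d by simp
  then have "nb t \<noteq> {z3}" by auto
  then obtain p where p: "p \<in> nb t" "p \<noteq> z3" using tn(2) by blast
  obtain v where v: "v \<in> nb z3" "v \<noteq> t" "v \<in> nb p"
    by (rule cubic_square[OF d tn(1) no p])
  have "p \<in> nb v" by (rule adj_sym[OF v(3)])
  moreover have "v = y1 \<or> v = y2" using v(1,2) unfolding t(1) by simp
  ultimately have "p \<in> nb y1 \<or> p \<in> nb y2" by blast
  then have "p = x \<or> p = z1 \<or> p = z2" unfolding H(3,4) using p(2) by blast
  moreover have "t \<in> nb p" by (rule adj_sym[OF p(1)])
  ultimately show False using far3 far4 far5 by blast
qed

text \<open>The path from \<open>y3\<close> over \<open>z1\<close> to \<open>t1\<close> closes to a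
  square through \<open>x\<close> or \<open>z2\<close>, and all edges at \<open>x\<close> are
  already used.\<close>

lemma hexagon_meet:
  assumes d: "d = 3" and h: "hexagon x y1 y2 y3 z1 z2 z3"
    and t1: "nb z1 = {y2, y3, t1}" and t2: "nb z2 = {y3, y1, t2}"
    and ne: "t1 \<noteq> x" "t1 \<noteq> y1" "t1 \<noteq> y2" "t1 \<noteq> y3"
  shows "t1 = t2"
proof -
  have H: "distinct [x, y1, y2, y3, z1, z2, z3]" "nb x = {y1, y2, y3}" "nb y1 = {x, z2, z3}"
    "nb y2 = {x, z3, z1}" "nb y3 = {x, z1, z2}"
    using h unfolding hexagon_def by blast+
  have "z2 \<notin> nb z1" by (rule hexagon_no_chord[OF d h])
  moreover have "x \<notin> nb z1" unfolding t1 using H(1) ne by auto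
  ultimately have no: "nb y3 \<inter> nb z1 = {}" unfolding H(5) using adj_irr[of z1] by simp
  have z: "z1 \<in> nb y3" "t1 \<in> nb z1" unfolding H(5) t1 by simp_all
  obtain v where v: "v \<in> nb y3" "v \<noteq> z1" "v \<in> nb t1"
    by (rule cubic_square[OF d z(1) no z(2)]) (use ne in auto)
  have "t1 \<in> nb v" by (rule adj_sym[OF v(3)])
  moreover have "v = x \<or> v = z2" using v(1,2) unfolding H(5) by simp
  moreover have "t1 \<notin> nb x" unfolding H(2) using ne by simp
  ultimately have "t1 \<in> nb z2" by blast
  then show ?thesis unfolding t2 using ne by simp
qed

lemma closed_list:
  assumes "S \<subseteq> V" "S \<noteq> {}" "\<And>v. v \<in> S \<Longrightarrow> nb v \<subseteq> S"
  shows "V = S"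
  using conn[OF assms(1,2)] assms(3) by blast

text \<open>The third neighbours of the three \<open>z\<close> coincide, so the graph is the 3-cube,
  and a pair of opposite faces gives the cut.\<close>

lemma hexagon_cut:
  assumes d: "d = 3" and h: "hexagon x y1 y2 y3 z1 z2 z3"
  shows "\<exists>S. is_cut S"
proof -
  have H: "distinct [x, y1, y2, y3, z1, z2, z3]" "nb x = {y1, y2, y3}" "nb y1 = {x, z2, z3}"
    "nb y2 = {x, z3, z1}" "nb y3 = {x, z1, z2}"
    using h unfolding hexagon_def by blast+
  note h' = hexagon_rot[OF h] and h'' = hexagon_rot[OF hexagon_rot[OF h]]
  obtain w where w: "nb z1 = {y2, y3, w}" "w \<noteq> x" "w \<noteq> y1" "w \<noteq> y2" "w \<noteq> y3" "w \<noteq> z1"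
    by (rule hexagon_third[OF d h])
  obtain w2 where w2: "nb z2 = {y3, y1, w2}" "w2 \<noteq> x" "w2 \<noteq> y2" "w2 \<noteq> y3" "w2 \<noteq> y1" "w2 \<noteq> z2"
    by (rule hexagon_third[OF d h'])
  obtain w3 where w3: "nb z3 = {y1, y2, w3}" "w3 \<noteq> x" "w3 \<noteq> y3" "w3 \<noteq> y1" "w3 \<noteq> y2" "w3 \<noteq> z3"
    by (rule hexagon_third[OF d h''])
  have "w = w2" by (rule hexagon_meet[OF d h w(1) w2(1) w(2-5)])
  moreover have "w2 = w3" by (rule hexagon_meet[OF d h' w2(1) w3(1) w2(2-5)])
  ultimately have N: "nb z1 = {y2, y3, w}" "nb z2 = {y3, y1, w}" "nb z3 = {y1, y2, w}" "w \<noteq> z2" "w \<noteq> z3"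
    using w w2 w3 by auto
  have wz: "z1 \<in> nb w" "z2 \<in> nb w" "z3 \<in> nb w"
    using adj_sym[of w z1] adj_sym[of w z2] adj_sym[of w z3] N by auto
  have "card (nb w) = 3" using reg[of w] adjV[OF wz(1)] d by simp
  then obtain t where "nb w = {z1, z2, t}" using nb_third[OF _ wz(1,2)] H(1) by auto
  then have Nw: "nb w = {z1, z2, z3}" using wz(3) H(1) by auto
  let ?U = "{x, y1, y2, y3, z1, z2, z3, w}"
  have "V = ?U"
  proof (rule closed_list)
    show "?U \<subseteq> V" using adjV[of y1 x] adjV[of y2 x] adjV[of y3 x] adjV[of z1 w] adjV[of z2 w] adjV[of z3 w]
      H(2) Nw by auto
    show "nb v \<subseteq> ?U" if "v \<in> ?U" for v using that H N Nw by auto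
  qed simp
  \<comment> \<open>The set is the face through \<open>y1\<close> that avoids
    \<open>x\<close>.\<close>
  moreover have "\<exists>u. {u \<in> nb v. (u \<in> {y1, z2, z3, w}) \<noteq> (v \<in> {y1, z2, z3, w})} = {u}"
    if "v \<in> ?U" for v
  proof -
    have f: "x \<notin> {y1, z2, z3, w}" "y2 \<notin> {y1, z2, z3, w}" "y3 \<notin> {y1, z2, z3, w}" "z1 \<notin> {y1, z2, z3, w}"
      using H(1) w N by auto
    have "{u \<in> nb x. (u \<in> {y1, z2, z3, w}) \<noteq> (x \<in> {y1, z2, z3, w})} = {y1}"
      "{u \<in> nb y1. (u \<in> {y1, z2, z3, w}) \<noteq> (y1 \<in> {y1, z2, z3, w})} = {x}"
      "{u \<in> nb y2. (u \<in> {y1, z2, z3, w}) \<noteq> (y2 \<in> {y1, z2, z3, w})} = {z3}"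
      "{u \<in> nb y3. (u \<in> {y1, z2, z3, w}) \<noteq> (y3 \<in> {y1, z2, z3, w})} = {z2}"
      "{u \<in> nb z1. (u \<in> {y1, z2, z3, w}) \<noteq> (z1 \<in> {y1, z2, z3, w})} = {w}"
      "{u \<in> nb z2. (u \<in> {y1, z2, z3, w}) \<noteq> (z2 \<in> {y1, z2, z3, w})} = {y3}"
      "{u \<in> nb z3. (u \<in> {y1, z2, z3, w}) \<noteq> (z3 \<in> {y1, z2, z3, w})} = {y2}"
      "{u \<in> nb w. (u \<in> {y1, z2, z3, w}) \<noteq> (w \<in> {y1, z2, z3, w})} = {z1}"
      unfolding H N Nw using f by auto
    then show ?thesis using that by blast
  qed
  ultimately have "is_cut {y1, z2, z3, w}" unfolding is_cut_def by blast
  then show ?thesis by blast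
qed

section \<open>Blocks with three vertices\<close>

definition block3 :: "('a \<Rightarrow> real) \<Rightarrow> 'a \<Rightarrow> 'a \<Rightarrow> 'a \<Rightarrow> 'a \<Rightarrow> 'a \<Rightarrow> 'a \<Rightarrow> 'a \<Rightarrow> bool" where
  "block3 f x y1 y2 y3 z1 z2 z3 \<longleftrightarrow> locmax f x \<and> down f x = {y1, y2, y3} \<and>
    y1 \<noteq> y2 \<and> y2 \<noteq> y3 \<and> y3 \<noteq> y1 \<and> z1 \<noteq> x \<and> z2 \<noteq> x \<and> z3 \<noteq> x \<and>
    nb z1 \<inter> down f x = {y2, y3} \<and> nb z2 \<inter> down f x = {y3, y1} \<and> nb z3 \<inter> down f x = {y1, y2}"

lemma block3_rot: "block3 f x y1 y2 y3 z1 z2 z3 \<Longrightarrow> block3 f x y2 y3 y1 z2 z3 z1"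
  unfolding block3_def by (auto simp: insert_commute)

text \<open>Each pair of block vertices has a common neighbour besides \<open>x\<close>, and by
  \<open>no_full\<close> it misses the third block vertex.\<close>

lemma block3_exists:
  assumes m: "locmax f x" and c: "card (down f x) = 3"
  obtains y1 y2 y3 z1 z2 z3 where "block3 f x y1 y2 y3 z1 z2 z3"
proof -
  obtain y1 y2 y3 where y: "down f x = {y1, y2, y3}" "y1 \<noteq> y2" "y2 \<noteq> y3" "y3 \<noteq> y1"
    using c by (auto simp: card_3_iff)
  have ex: "\<exists>z. z \<noteq> x \<and> nb z \<inter> down f x = {a, b}"
    if abc: "down f x = {a, b, c}" "a \<noteq> b" for a b c
  proof -
    have ab: "a \<in> down f x" "b \<in> down f x" using abc by auto
    obtain z where z: "z \<noteq> x" "z \<in> nb a" "z \<in> nb b" by (rule pair_common[OF m ab abc(2)])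
    have zab: "a \<in> nb z" "b \<in> nb z" using adj_sym z by blast+
    have "c \<notin> nb z"
    proof
      assume "c \<in> nb z"
      then have "down f x \<subseteq> nb z" using zab abc(1) by simp
      from no_full[OF m z(1) this] c show False by simp
    qed
    then have "nb z \<inter> down f x = {a, b}" unfolding abc(1) using zab by auto
    then show ?thesis using z(1) by blast
  qed
  obtain z1 where z1: "z1 \<noteq> x" "nb z1 \<inter> down f x = {y2, y3}"
    using ex[of y2 y3 y1] y by (auto simp: insert_commute)
  obtain z2 where z2: "z2 \<noteq> x" "nb z2 \<inter> down f x = {y3, y1}"
    using ex[of y3 y1 y2] y by (auto simp: insert_commute)
  obtain z3 where z3: "z3 \<noteq> x" "nb z3 \<inter> down f x = {y1, y2}"
    using ex[of y1 y2 y3] y by (auto simp: insert_commute)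
  have "block3 f x y1 y2 y3 z1 z2 z3" unfolding block3_def using m y z1 z2 z3 by blast
  then show ?thesis by (rule that)
qed

lemma block3_values:
  assumes b: "block3 f x y1 y2 y3 z1 z2 z3"
  shows "f y1 + f y2 + f y3 = f x" "f z1 = - f y1" "f y1 < f x" "f y2 < f x" "f y3 < f x" "z1 \<noteq> z2"
    "y2 \<in> nb z1" "y3 \<in> nb z1" "y1 \<notin> nb z1" "z1 \<notin> matched f x y2" "z1 \<notin> matched f x y3" "z1 \<in> V"
proof -
  have B: "locmax f x" "down f x = {y1, y2, y3}" "y1 \<noteq> y2" "y2 \<noteq> y3" "y3 \<noteq> y1" "z1 \<noteq> x"
    "nb z1 \<inter> down f x = {y2, y3}" "nb z2 \<inter> down f x = {y3, y1}"
    using b unfolding block3_def by blast+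
  have s: "3 * f x - f y1 - f y2 - f y3 = 2 * f x"
    using sum_down[OF B(1)] B(3-5) unfolding B(2) by simp
  then show "f y1 + f y2 + f y3 = f x" by simp
  show "f z1 = - f y1" using pair_value[OF B(1,6,7,4)] s by simp
  show "f y1 < f x" "f y2 < f x" "f y3 < f x" using down_less[of _ f x] unfolding B(2) by simp_all
  show "z1 \<noteq> z2" using B(3-5,7,8) by (metis doubleton_eq_iff)
  show z: "y2 \<in> nb z1" "y3 \<in> nb z1" using B(7) by blast+
  show "y1 \<notin> nb z1"
  proof
    assume "y1 \<in> nb z1"
    then have "y1 \<in> {y2, y3}" using B(7)[symmetric] B(2) by blast
    then show False using B(3,5) by blast
  qed
  have d: "y2 \<in> down f x" "y3 \<in> down f x" using B(2) by auto
  show "z1 \<notin> matched f x y2" "z1 \<notin> matched f x y3"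
    using pair_top(2)[OF B(1) d B(4,6) z] by auto
  show "z1 \<in> V" using adjV[OF z(1)] by simp
qed

lemma block3_nb_y:
  assumes b: "block3 f x y1 y2 y3 z1 z2 z3"
  shows "nb y1 = {x, z2, z3} \<union> matched f x y1" "card (matched f x y1) + 3 = d"
proof -
  have B: "locmax f x" "down f x = {y1, y2, y3}" "y1 \<noteq> y2" "y2 \<noteq> y3" "y3 \<noteq> y1" "z2 \<noteq> x" "z3 \<noteq> x"
    using b unfolding block3_def by blast+
  note b2 = block3_values[OF block3_rot[OF b]] and b3 = block3_values[OF block3_rot[OF block3_rot[OF b]]]
  have y1: "y1 \<in> down f x" using B(2) by simp
  show m: "card (matched f x y1) + 3 = d" using matched_card[OF B(1) y1] B(3-5) unfolding B(2) by simp
  have xy: "x \<in> nb y1" by (rule adj_sym[OF down_nb[OF y1]])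
  have sub: "{x, z2, z3} \<union> matched f x y1 \<subseteq> nb y1"
    using xy adj_sym[OF b2(8)] adj_sym[OF b3(7)] by (auto simp: matched_def)
  have "x \<notin> matched f x y1"
    using matched_value[OF B(1) y1, of x] down_less[OF y1] by auto
  moreover have "finite (matched f x y1)" by (simp add: matched_def)
  ultimately have "card ({x, z2, z3} \<union> matched f x y1) = 3 + card (matched f x y1)"
    using B(6,7) b2(6,11) b3(10) by (simp add: eq_commute)
  then have "card ({x, z2, z3} \<union> matched f x y1) = card (nb y1)"
    using m reg[of y1] adjV[OF xy] by simp
  then show "nb y1 = {x, z2, z3} \<union> matched f x y1"
    using sub by (metis card_subset_eq fin_nb)
qed

lemma three_block_cubic:
  assumes m: "locmax f x" and c: "card (down f x) = 3" and d: "d = 3"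
  shows "\<exists>S. is_cut S"
proof -
  obtain y1 y2 y3 z1 z2 z3 where b: "block3 f x y1 y2 y3 z1 z2 z3"
    by (rule block3_exists[OF m c])
  note b' = block3_rot[OF b] note b'' = block3_rot[OF b']
  have B: "down f x = {y1, y2, y3}" "y1 \<noteq> y2" "y2 \<noteq> y3" "y3 \<noteq> y1" "z1 \<noteq> x" "z2 \<noteq> x" "z3 \<noteq> x"
    using b unfolding block3_def by blast+
  have mt: "matched f x y = {}" if "card (matched f x y) + 3 = d" for y
  proof -
    have "finite (matched f x y)" by (simp add: matched_def)
    then show ?thesis using that d by simp
  qed
  have N: "nb y1 = {x, z2, z3}" "nb y2 = {x, z3, z1}" "nb y3 = {x, z1, z2}"
    using block3_nb_y(1)[OF b] block3_nb_y(1)[OF b'] block3_nb_y(1)[OF b'']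
    unfolding mt[OF block3_nb_y(2)[OF b]] mt[OF block3_nb_y(2)[OF b']] mt[OF block3_nb_y(2)[OF b'']]
    by auto
  have nx: "nb x = {y1, y2, y3}"
  proof -
    have "card (down f x) = card (nb x)" using c d reg[OF locmaxD(2)[OF m]] by simp
    then have "down f x = nb x" by (intro card_subset_eq) (auto simp: down_def)
    then show ?thesis using B(1) by simp
  qed
  have T: "nb x \<inter> nb y1 = {}" "nb x \<inter> nb y2 = {}" using down_no_common[OF m] B(1) by auto
  have zx: "z1 \<notin> nb x" "z2 \<notin> nb x" "z3 \<notin> nb x"
    using T unfolding N by blast+
  have "x \<notin> nb x" by (rule adj_irr)
  then have "hexagon x y1 y2 y3 z1 z2 z3"
    unfolding hexagon_def using N nx zx B block3_values(6)[OF b] block3_values(6)[OF b']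
      block3_values(6)[OF b''] by auto
  then show ?thesis by (rule hexagon_cut[OF d])
qed

section \<open>Pairs of 3-cubes in degree four\<close>

text \<open>A 3-cube with top \<open>x\<close>, middle layers \<open>down f x\<close> and
  \<open>Z\<close>, and bottom \<open>w\<close>. Each vertex of the middle layers and the bottom has
  one edge beyond the cube, and \<open>f\<close> is constant along it. The inequalities allow
  vertices to be told apart by their values.\<close>

definition cube_block :: "('a \<Rightarrow> real) \<Rightarrow> 'a \<Rightarrow> 'a set \<Rightarrow> 'a \<Rightarrow> bool" where
  "cube_block f x Z w \<longleftrightarrow>
    (\<forall>y\<in>down f x. \<exists>z z' p. z \<in> Z \<and> z' \<in> Z \<and> nb y = {x, z, z', p} \<and> f z < f y \<and> f z' < f y \<and> matched f x y = {p}) \<and>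
    (\<forall>z\<in>Z. \<exists>y y' p. y \<in> down f x \<and> y' \<in> down f x \<and> nb z = {y, y', w, p} \<and> f p = f z \<and> f z < f y \<and> f z < f y') \<and>
    (\<exists>q. nb w = insert q Z \<and> f q = f w) \<and> Z \<noteq> {} \<and>
    f w = - f x \<and> (\<forall>v\<in>down f x \<union> Z. - f x < f v \<and> f v < f x)"

text \<open>The two unknown increments at \<open>z1\<close> have sum \<open>- a\<close> and sum of
  squares \<open>a^2\<close>, so their product is zero: one of them is 0 and the other leads down to
  \<open>- f x\<close>.\<close>

lemma block3_nb_z:
  assumes b: "block3 f x y1 y2 y3 z1 z2 z3" and d: "d = 4"
  obtains w p where "nb z1 = {y2, y3, w, p}" "f p = f z1" "f w = - f x"
proof -
  have B: "locmax f x" "down f x = {y1, y2, y3}" "y1 \<noteq> y2" "y2 \<noteq> y3" "y3 \<noteq> y1"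
    using b unfolding block3_def by blast+
  note v = block3_values[OF b]
  have f: "f \<in> E" by (rule locmaxD(1)[OF B(1)])
  have "card (nb z1 - {y2, y3}) = 2"
    using v(7,8) B(4) reg[OF v(12)] d by (subst card_Diff_subset) auto
  then obtain p q where pq: "nb z1 - {y2, y3} = {p, q}" "p \<noteq> q" by (auto simp: card_2_iff)
  have N: "nb z1 = {y2, y3} \<union> {p, q}" using pq(1) v(7,8) by blast
  have dis: "p \<noteq> y2" "p \<noteq> y3" "q \<noteq> y2" "q \<noteq> y3" using pq(1) by blast+
  \<comment> \<open>The drop from \<open>x\<close> to the block vertex opposite to
    \<open>z1\<close>.\<close>
  define a where "a = f x - f y1"
  have f3: "f y3 = f x - f y1 - f y2" using v(1) by simp
  have "lap nb f z1 = (f y2 - f z1) + (f y3 - f z1) + (f p - f z1) + (f q - f z1)"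
    unfolding lap_def N using B(4) dis pq(2) by simp
  then have s1: "(f p - f z1) + (f q - f z1) = - a"
    using E_lap[OF f v(12)] v(2) f3 by (simp add: a_def)
  have "grad nb f f z1 = (f y2 - f z1)^2 + (f y3 - f z1)^2 + (f p - f z1)^2 + (f q - f z1)^2"
    unfolding grad_def N using B(4) dis pq(2) by (simp add: power2_eq_square)
  moreover have "grad nb f f z1 = (f y1 - f x)^2 + (f y2 - f x)^2 + (f y3 - f x)^2"
    using grad_self_const[OF f v(12) locmaxD(2)[OF B(1)]] grad_down[OF B(1)] B(3-5) unfolding B(2) by simp
  ultimately have s2: "(f p - f z1)^2 + (f q - f z1)^2 = a^2"
    unfolding v(2) f3 a_def by (simp add: power2_eq_square algebra_simps)
  have "((f p - f z1) + (f q - f z1))^2 = a^2" unfolding s1 by simp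
  then have "2 * ((f p - f z1) * (f q - f z1)) = 0"
    using s2 by (simp add: power2_eq_square algebra_simps)
  then consider "f p = f z1" "f q = - f x" | "f q = f z1" "f p = - f x"
    using s1 v(2) by (auto simp: a_def)
  then show ?thesis
    by cases (use that[of q p] that[of p q] N in auto)
qed

text \<open>If \<open>w\<close> and \<open>w'\<close> were different, \<open>z1\<close> and
  \<open>z2\<close> would have no common neighbours other than \<open>y3\<close> and possibly
  \<open>p\<close>, and the sum in \<open>common_sum\<close> would be negative.\<close>

lemma block3_meet:
  assumes b: "block3 f x y1 y2 y3 z1 z2 z3" and d: "d = 4"
    and n1: "nb z1 = {y2, y3, w, p}" "f p = f z1" "f w = - f x"
    and n2: "nb z2 = {y3, y1, w', p'}" "f p' = f z2" "f w' = - f x"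
  shows "w = w'"
proof (rule ccontr)
  assume ne: "w \<noteq> w'"
  have B: "locmax f x" "down f x = {y1, y2, y3}" "y1 \<noteq> y2" "y2 \<noteq> y3" "y3 \<noteq> y1"
    using b unfolding block3_def by blast+
  note v = block3_values[OF b] and v2 = block3_values[OF block3_rot[OF b]]
  have f: "f \<in> E" by (rule locmaxD(1)[OF B(1)])
  have fx: "f y1 > - f x" "f y2 > - f x" "f y3 > - f x" using v(1,3-5) by linarith+
  have "f p' > - f x" using n2(2) v2(2) v(4) by simp
  then have "w \<noteq> y3" "w \<noteq> y1" "w \<noteq> p'" using n1(3) fx by auto
  then have wn: "w \<notin> nb z2" unfolding n2(1) using ne by simp
  have sub: "nb z1 \<inter> nb z2 \<subseteq> {y3, p}" using n1(1) v2(9) wn by auto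
  have y3: "y3 \<in> nb z1 \<inter> nb z2" using n1 n2 by simp
  have "p \<noteq> y3" using n1(2) v(1-5) fx by auto
  have "(\<Sum>c\<in>nb z1 \<inter> nb z2. f z2 - 2 * f c + f z1) < 0"
  proof (cases "p \<in> nb z2")
    case True
    then have "nb z1 \<inter> nb z2 = {y3, p}" using sub y3 n1 by auto
    then show ?thesis using \<open>p \<noteq> y3\<close> n1(2) v(1-5) v2(2) fx by simp
  next
    case False
    then have "nb z1 \<inter> nb z2 = {y3}" using sub y3 by auto
    then show ?thesis using v(1-5) v2(2) fx by simp
  qed
  then show False using common_sum[OF f v(12) v2(12)] v(6) by simp
qed

lemma cube_block_exists:
  assumes m: "locmax f x" and c: "card (down f x) = 3" and d: "d = 4"
  shows "\<exists>Z w. cube_block f x Z w"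
proof -
  obtain y1 y2 y3 z1 z2 z3 where b: "block3 f x y1 y2 y3 z1 z2 z3"
    by (rule block3_exists[OF m c])
  note b' = block3_rot[OF b] note b'' = block3_rot[OF b']
  note v = block3_values[OF b] and v' = block3_values[OF b'] and v'' = block3_values[OF b'']
  have B: "down f x = {y1, y2, y3}" "y1 \<noteq> y2" "y2 \<noteq> y3" "y3 \<noteq> y1"
    using b unfolding block3_def by blast+
  have f: "f \<in> E" by (rule locmaxD(1)[OF m])
  obtain w p1 where n1: "nb z1 = {y2, y3, w, p1}" "f p1 = f z1" "f w = - f x"
    by (rule block3_nb_z[OF b d])
  obtain w2 p2 where n2: "nb z2 = {y3, y1, w2, p2}" "f p2 = f z2" "f w2 = - f x"
    by (rule block3_nb_z[OF b' d])
  obtain w3 p3 where n3: "nb z3 = {y1, y2, w3, p3}" "f p3 = f z3" "f w3 = - f x"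
    by (rule block3_nb_z[OF b'' d])
  have w2: "w2 = w" using block3_meet[OF b d n1 n2] by simp
  have w3: "w3 = w" using block3_meet[OF b' d n2 n3] w2 by simp
  note n2 = n2[unfolded w2] note n3 = n3[unfolded w3]
  have zw: "z1 \<in> nb w" "z2 \<in> nb w" "z3 \<in> nb w"
    using adj_sym[of w z1] adj_sym[of w z2] adj_sym[of w z3] n1 n2 n3 by auto
  have wV: "w \<in> V" using adjV[OF zw(1)] by simp
  have zd: "z1 \<noteq> z2" "z2 \<noteq> z3" "z3 \<noteq> z1" using v(6) v'(6) v''(6) by auto
  let ?Z = "{z1, z2, z3}"
  have "card (nb w - ?Z) = 1"
    using zw zd reg[OF wV] d by (subst card_Diff_subset) auto
  then obtain q where q: "nb w - ?Z = {q}" by (rule card_1_singletonE)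
  have Nw: "nb w = insert q ?Z" using q zw by blast
  \<comment> \<open>The increments from \<open>w\<close> up to the three \<open>z\<close> are the
    drops at \<open>x\<close>, so they exhaust the squared gradient.\<close>
  have fq: "f q = f w"
  proof (rule grad_exhausted[OF f locmaxD(2)[OF m] wV, of ?Z])
    show "?Z \<subseteq> nb w" using zw by simp
    show "q \<in> nb w" "q \<notin> ?Z" using q by blast+
    have "(\<Sum>v\<in>?Z. (f v - f w)^2) = (f z1 - f w)^2 + (f z2 - f w)^2 + (f z3 - f w)^2"
      using zd by simp
    also have "\<dots> = (f y1 - f x)^2 + (f y2 - f x)^2 + (f y3 - f x)^2"
      unfolding v(2) v'(2) v''(2) n1(3) by (simp add: power2_eq_square algebra_simps)
    also have "\<dots> = grad nb f f x"
      unfolding grad_down[OF m] B(1) using B by simp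
    finally show "(\<Sum>v\<in>?Z. (f v - f w)^2) = grad nb f f x" .
  qed
  have fx: "f y1 > - f x" "f y2 > - f x" "f y3 > - f x" using v(1,3-5) by linarith+
  have M: "\<exists>p. matched f x y = {p}" if "card (matched f x y) + 3 = d" for y
    using that d card_1_singletonE[of "matched f x y"] by force
  obtain r1 where r1: "matched f x y1 = {r1}" using M[OF block3_nb_y(2)[OF b]] by blast
  obtain r2 where r2: "matched f x y2 = {r2}" using M[OF block3_nb_y(2)[OF b']] by blast
  obtain r3 where r3: "matched f x y3 = {r3}" using M[OF block3_nb_y(2)[OF b'']] by blast
  have ny: "nb y1 = {x, z2, z3, r1}" "nb y2 = {x, z3, z1, r2}" "nb y3 = {x, z1, z2, r3}"
    using block3_nb_y(1)[OF b] block3_nb_y(1)[OF b'] block3_nb_y(1)[OF b''] r1 r2 r3 by auto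
  have lt: "f z1 < f y2" "f z1 < f y3" "f z2 < f y3" "f z2 < f y1" "f z3 < f y1" "f z3 < f y2"
    using v(1-5) v'(2) v''(2) by linarith+
  have "cube_block f x ?Z w"
    unfolding cube_block_def
  proof (intro conjI)
    have "\<exists>z z' p. z \<in> ?Z \<and> z' \<in> ?Z \<and> nb y1 = {x, z, z', p} \<and> f z < f y1 \<and> f z' < f y1 \<and> matched f x y1 = {p}"
      using ny(1) lt(4,5) r1 by blast
    moreover have "\<exists>z z' p. z \<in> ?Z \<and> z' \<in> ?Z \<and> nb y2 = {x, z, z', p} \<and> f z < f y2 \<and> f z' < f y2 \<and> matched f x y2 = {p}"
      using ny(2) lt(6,1) r2 by blast
    moreover have "\<exists>z z' p. z \<in> ?Z \<and> z' \<in> ?Z \<and> nb y3 = {x, z, z', p} \<and> f z < f y3 \<and> f z' < f y3 \<and> matched f x y3 = {p}"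
      using ny(3) lt(2,3) r3 by blast
    ultimately show "\<forall>y\<in>down f x. \<exists>z z' p. z \<in> ?Z \<and> z' \<in> ?Z \<and> nb y = {x, z, z', p} \<and> f z < f y \<and> f z' < f y \<and> matched f x y = {p}"
      unfolding B(1) by simp
    have D: "y1 \<in> down f x" "y2 \<in> down f x" "y3 \<in> down f x" using B(1) by auto
    have "\<exists>y y' p. y \<in> down f x \<and> y' \<in> down f x \<and> nb z1 = {y, y', w, p} \<and> f p = f z1 \<and> f z1 < f y \<and> f z1 < f y'"
      using D n1 lt by blast
    moreover have "\<exists>y y' p. y \<in> down f x \<and> y' \<in> down f x \<and> nb z2 = {y, y', w, p} \<and> f p = f z2 \<and> f z2 < f y \<and> f z2 < f y'"
      using D n2 lt by blast
    moreover have "\<exists>y y' p. y \<in> down f x \<and> y' \<in> down f x \<and> nb z3 = {y, y', w, p} \<and> f p = f z3 \<and> f z3 < f y \<and> f z3 < f y'"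
      using D n3 lt by blast
    ultimately show "\<forall>z\<in>?Z. \<exists>y y' p. y \<in> down f x \<and> y' \<in> down f x \<and> nb z = {y, y', w, p} \<and> f p = f z \<and> f z < f y \<and> f z < f y'"
      by simp
    show "\<exists>q. nb w = insert q ?Z \<and> f q = f w" using Nw fq by blast
    show "f w = - f x" by (rule n1(3))
    show "\<forall>v\<in>down f x \<union> ?Z. - f x < f v \<and> f v < f x"
      unfolding B(1) using v(2-5) v'(2) v''(2) fx by simp
  qed simp
  then show ?thesis by blast
qed

definition block_verts :: "('a \<Rightarrow> real) \<Rightarrow> 'a \<Rightarrow> 'a set \<Rightarrow> 'a \<Rightarrow> 'a set" where
  "block_verts f x Z w = {x, w} \<union> down f x \<union> Z"

lemma cube_blockD:
  assumes "cube_block f x Z w"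
  shows "y \<in> down f x \<Longrightarrow>
      \<exists>z z' p. z \<in> Z \<and> z' \<in> Z \<and> nb y = {x, z, z', p} \<and> f z < f y \<and> f z' < f y \<and> matched f x y = {p}"
    "z \<in> Z \<Longrightarrow>
      \<exists>y y' p. y \<in> down f x \<and> y' \<in> down f x \<and> nb z = {y, y', w, p} \<and> f p = f z \<and> f z < f y \<and> f z < f y'"
    "\<exists>q. nb w = insert q Z \<and> f q = f w" "Z \<noteq> {}" "f w = - f x"
    "v \<in> down f x \<Longrightarrow> - f x < f v \<and> f v < f x" "v \<in> Z \<Longrightarrow> - f x < f v \<and> f v < f x"
  using assms unfolding cube_block_def by (blast, blast, blast, blast, blast, blast, blast)

text \<open>The edge that leaves the cube of \<open>x\<close> at \<open>v\<close> ends in the cube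
  of the level neighbour \<open>u\<close>. This passes from the top down: where the square between
  an edge of one cube and its partner failed to close, \<open>common_sum\<close> would be left with
  a single nonzero term.\<close>

lemma cube_block_partner:
  assumes m: "locmax f x" and u: "{v \<in> nb x. f v = f x} = {u}"
    and b: "cube_block f x Z w" and b': "cube_block f u Z' w'"
    and v: "v \<in> block_verts f x Z w"
  shows "\<exists>p\<in>block_verts f u Z' w'. p \<in> nb v \<and> nb v \<subseteq> insert p (block_verts f x Z w)"
proof -
  have f: "f \<in> E" by (rule locmaxD(1)[OF m])
  have ux: "u \<in> nb x" "f u = f x" using u by blast+
  note B = cube_blockD[OF b] and B' = cube_blockD[OF b', unfolded ux(2)]
  have low: "f s < f x" if h: "z \<in> Z'" "s \<in> nb z" for z s
  proof -
    obtain y y' p where y: "y \<in> down f u" "y' \<in> down f u" "nb z = {y, y', w', p}" "f p = f z" "f z < f y"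
      using B'(2)[OF h(1)] by blast
    have "f y < f x" "f y' < f x" using down_less[OF y(1)] down_less[OF y(2)] ux(2) by auto
    moreover have "f z < f x" "f w' < f x" using B'(7)[OF that(1)] B'(5) by auto
    ultimately show ?thesis using that(2) y(4) unfolding y(3) by auto
  qed
  have yZ': "y \<notin> Z'" if "y \<in> down f x" for y
    using low[of y x] adj_sym[OF down_nb[OF that]] by auto
  have up: "- f x < f s" if h: "y \<in> down f u" "s \<in> nb y" for y s
  proof -
    obtain z z' p where z: "z \<in> Z'" "z' \<in> Z'" "nb y = {u, z, z', p}" "matched f u y = {p}"
      using B'(1)[OF h(1)] by blast
    have "f p = f y" by (rule matched_value[OF level_locmax[OF m ux] that(1)]) (simp add: z(4))
    moreover have "f u > - f x" using B'(6)[OF that(1)] ux by simp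
    ultimately show ?thesis
      using that(2) B'(6)[OF that(1)] B'(7)[OF z(1)] B'(7)[OF z(2)] unfolding z(3) by auto
  qed
  have P: "\<exists>p. p \<in> down f u \<and> p \<in> nb y \<and> f p = f y \<and> nb y \<subseteq> insert p ({x} \<union> Z)" if y: "y \<in> down f x" for y
  proof -
    obtain z z' p where z: "z \<in> Z" "z' \<in> Z" "nb y = {x, z, z', p}" "matched f x y = {p}"
      using B(1)[OF y] by blast
    have pm: "p \<in> matched f x y" using z(4) by simp
    then have "p \<in> down f u" using u by (auto simp: matched_def)
    moreover have "f p = f y" by (rule matched_value[OF m y pm])
    moreover have "p \<in> nb y" "nb y \<subseteq> insert p ({x} \<union> Z)"
      unfolding z(3) using z(1,2) by auto
    ultimately show ?thesis by blast
  qed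
  have ZP: "\<exists>p. p \<in> Z' \<and> p \<in> nb z \<and> f p = f z \<and> nb z \<subseteq> insert p (insert w (down f x))" if z: "z \<in> Z" for z
  proof -
    obtain y y' p where y: "y \<in> down f x" "y' \<in> down f x" "nb z = {y, y', w, p}" "f p = f z" "f z < f y" "f z < f y'"
      using B(2)[OF z] by blast
    obtain t where t: "t \<in> down f u" "t \<in> nb y" "f t = f y" using P[OF y(1)] by blast
    have tV: "t \<in> V" and zV: "z \<in> V" using adjV[OF t(2)] adjV[of y z] y(3) by auto
    have yt: "y \<in> nb t" by (rule adj_sym[OF t(2)])
    have tz: "z \<noteq> t" using t(3) y(5) by auto
    obtain a a' r where a: "a \<in> Z'" "a' \<in> Z'" "nb t = {u, a, a', r}" "matched f u t = {r}"
      using B'(1)[OF t(1)] by blast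
    have in_t: "c = r" if "c \<in> nb t" "c \<in> down f x" for c
    proof -
      have "c \<noteq> u" using that(2) ux(2) by (auto simp: down_def)
      moreover have "c \<noteq> a" "c \<noteq> a'" using yZ'[OF that(2)] a by auto
      ultimately show ?thesis using that(1) unfolding a(3) by simp
    qed
    have yr: "y = r" by (rule in_t[OF yt y(1)])
    \<comment> \<open>The vertices \<open>t\<close> and \<open>z\<close> share the neighbour
      \<open>y\<close>, whose term in \<open>common_sum\<close> is nonzero. Among the other
      neighbours of \<open>z\<close> only \<open>p\<close> can balance it.\<close>
    have "p \<in> nb t"
    proof (rule ccontr)
      assume pn: "p \<notin> nb t"
      have "w \<notin> nb t" using up[OF t(1), of w] B(5) by auto
      then have "nb t \<inter> nb z \<subseteq> {y}" unfolding y(3) using pn in_t[OF _ y(2)] yr by blast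
      moreover have "y \<in> nb t \<inter> nb z" using yt y(3) by simp
      ultimately have "nb t \<inter> nb z = {y}" by blast
      then show False using common_sum[OF f tV zV tz] t(3) y(5) by simp
    qed
    moreover have "p \<noteq> u" using y(4,5) ux(2) down_less[OF y(1)] by auto
    moreover have "p \<noteq> r" using y(4,5) yr by auto
    ultimately have "p \<in> Z'" using a by auto
    moreover have "p \<in> nb z" "nb z \<subseteq> insert p (insert w (down f x))"
      unfolding y(3) using y(1,2) by auto
    ultimately show ?thesis using y(4) by blast
  qed
  have W: "w' \<in> nb w \<and> nb w \<subseteq> insert w' Z"
  proof -
    obtain q where q: "nb w = insert q Z" "f q = f w" using B(3) by blast
    obtain z where z: "z \<in> Z" using B(4) by blast
    have fz: "f z > - f x" and fw: "f w = - f x" and fw': "f w' = - f x" using B(5) B(7)[OF z] B'(5) by auto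
    obtain p where p: "p \<in> Z'" "p \<in> nb z" "f p = f z" using ZP[OF z] by blast
    obtain s s' r where s: "s \<in> down f u" "s' \<in> down f u" "nb p = {s, s', w', r}" "f p < f s" "f p < f s'"
      using B'(2)[OF p(1)] by blast
    have zp: "z \<in> nb p" by (rule adj_sym[OF p(2)])
    have "z \<noteq> s" "z \<noteq> s'" "z \<noteq> w'" using p(3) s(4,5) fz fw' by auto
    then have zr: "z = r" using zp unfolding s(3) by simp
    have zw: "z \<in> nb w" using q z by simp
    have lowZ: "f c < f x" if h: "z \<in> Z" "c \<in> nb z" for z c
    proof -
      obtain y y' p where y: "y \<in> down f x" "y' \<in> down f x" "nb z = {y, y', w, p}" "f p = f z" "f z < f y"
        using B(2)[OF h(1)] by blast
      have "f w < f x" using fw B(7)[OF that(1)] by linarith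
      then show ?thesis
        using that(2) down_less[OF y(1)] down_less[OF y(2)] y(4) B(7)[OF that(1)] unfolding y(3) by auto
    qed
    have nZ: "c \<notin> Z" "c \<noteq> q" if "c \<in> down f u" "f p < f c" for c
    proof -
      have "u \<in> nb c" by (rule adj_sym[OF down_nb[OF that(1)]])
      then show "c \<notin> Z" using lowZ[of c u] ux(2) by auto
      show "c \<noteq> q" using that(2) q(2) p(3) fz fw by auto
    qed
    have "w' = q"
    proof (rule ccontr)
      assume ne: "w' \<noteq> q"
      have "w' \<notin> Z" using B(7)[of w'] fw' by auto
      then have "nb p \<inter> nb w \<subseteq> {z}"
        unfolding s(3) q(1) using nZ[OF s(1,4)] nZ[OF s(2,5)] ne zr by auto
      then have "nb p \<inter> nb w = {z}" using zp zw by blast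
      moreover have "p \<in> V" "w \<in> V" "w \<noteq> p" using adjV[OF p(2)] adjV[OF zw] fz fw p(3) by auto
      ultimately show False using common_sum[OF f, of p w] fz fw p(3) by simp
    qed
    then show ?thesis using q(1) by simp
  qed
  have X: "u \<in> nb x \<and> nb x \<subseteq> insert u (down f x)"
  proof -
    have "c = u" if "c \<in> nb x" "c \<notin> down f x" for c
      using that locmaxD(3)[OF m that(1)] u by (auto simp: down_def)
    then show ?thesis using ux by blast
  qed
  from v consider "v = x" | "v = w" | "v \<in> down f x" | "v \<in> Z"
    by (auto simp: block_verts_def)
  then show ?thesis
  proof cases
    case 1
    then show ?thesis using X by (intro bexI[of _ u]) (auto simp: block_verts_def)
  next
    case 2
    then show ?thesis using W by (intro bexI[of _ w']) (auto simp: block_verts_def)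
  next
    case 3
    obtain p where "p \<in> down f u" "p \<in> nb v" "nb v \<subseteq> insert p ({x} \<union> Z)" using P[OF 3] by blast
    then show ?thesis by (intro bexI[of _ p]) (auto simp: block_verts_def)
  next
    case 4
    obtain p where "p \<in> Z'" "p \<in> nb v" "nb v \<subseteq> insert p (insert w (down f x))" using ZP[OF 4] by blast
    then show ?thesis by (intro bexI[of _ p]) (auto simp: block_verts_def)
  qed
qed

text \<open>Each of \<open>x\<close> and \<open>u\<close> is the only level neighbour of the other.
  Their cubes are disjoint, every vertex of one has exactly one neighbour in the other, and together
  they exhaust the graph.\<close>

lemma three_block_quartic:
  assumes m: "locmax f x" and c: "card (down f x) = 3" and d: "d = 4"
  shows "\<exists>S. is_cut S"
proof -
  have "card {v \<in> nb x. f v = f x} = 1" using card_level_nb[OF m] c d by simp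
  then obtain u where u: "{v \<in> nb x. f v = f x} = {u}" by (rule card_1_singletonE)
  have ux: "u \<in> nb x" "f u = f x" using u by blast+
  have mu: "locmax f u" by (rule level_locmax[OF m ux])
  have cu: "card (down f u) = 3" using level_card_down[OF m ux] c by simp
  have "card {v \<in> nb u. f v = f u} = 1" using card_level_nb[OF mu] cu d by simp
  then obtain u' where u': "{v \<in> nb u. f v = f u} = {u'}" by (rule card_1_singletonE)
  have "x \<in> {v \<in> nb u. f v = f u}" using ux adj_sym[OF ux(1)] by simp
  then have xu: "{v \<in> nb u. f v = f u} = {x}" unfolding u' by simp
  obtain Z w where b: "cube_block f x Z w" using cube_block_exists[OF m c d] by blast
  obtain Z' w' where b': "cube_block f u Z' w'" using cube_block_exists[OF mu cu d] by blast
  define B where "B = block_verts f x Z w"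
  define B' where "B' = block_verts f u Z' w'"
  have p: "\<exists>p\<in>B'. p \<in> nb v \<and> nb v \<subseteq> insert p B" if "v \<in> B" for v
    using cube_block_partner[OF m u b b'] that by (simp add: B_def B'_def)
  have p': "\<exists>p\<in>B. p \<in> nb v \<and> nb v \<subseteq> insert p B'" if "v \<in> B'" for v
    using cube_block_partner[OF mu xu b' b] that by (simp add: B_def B'_def)
  have "B \<union> B' = V"
  proof (rule conn)
    show "B \<union> B' \<subseteq> V"
    proof
      fix v assume "v \<in> B \<union> B'"
      then obtain p where "p \<in> nb v" using p p' by blast
      then show "v \<in> V" using adjV by blast
    qed
    show "B \<union> B' \<noteq> {}" by (simp add: B_def block_verts_def)
    show "t \<in> B \<union> B'" if "v \<in> B \<union> B'" "t \<in> nb v" for v t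
      using that p[of v] p'[of v] by blast
  qed
  note C = cube_blockD[OF b] and C' = cube_blockD[OF b', unfolded ux(2)]
  have xnu: "x \<noteq> u" using ux adj_irr by blast
  have PP: "y \<notin> down f u" if "y \<in> down f x" for y
    using down_unique_up[OF m that, of u] adj_sym[OF down_nb[of y f u]] ux(2) xnu by blast
  have PZ: "y \<notin> Z'" if y: "y \<in> down f x" for y
  proof
    assume "y \<in> Z'"
    then obtain s s' r where s: "s \<in> down f u" "s' \<in> down f u" "nb y = {s, s', w', r}" "f r = f y"
      using C'(2) by blast
    have "x \<in> nb y" by (rule adj_sym[OF down_nb[OF y]])
    then have "f x < f x"
      unfolding s(3) using down_less[OF s(1)] down_less[OF s(2)] ux(2) s(4) down_less[OF y] C'(5) C(6)[OF y]
      by auto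
    then show False by simp
  qed
  have PZ': "y \<notin> Z" if y: "y \<in> down f u" for y
  proof
    assume "y \<in> Z"
    then obtain s s' r where s: "s \<in> down f x" "s' \<in> down f x" "nb y = {s, s', w, r}" "f r = f y"
      using C(2) by blast
    have "u \<in> nb y" by (rule adj_sym[OF down_nb[OF y]])
    then have "f x < f x"
      unfolding s(3) using down_less[OF s(1)] down_less[OF s(2)] ux(2) s(4) down_less[OF y] C(5) C'(6)[OF y]
      by auto
    then show False by simp
  qed
  have ZZ: "z \<notin> Z'" if z: "z \<in> Z" for z
  proof
    assume "z \<in> Z'"
    then obtain s s' r where s: "s \<in> down f u" "nb z = {s, s', w', r}" "f z < f s" using C'(2) by blast
    obtain y y' q where y: "y \<in> down f x" "y' \<in> down f x" "nb z = {y, y', w, q}" "f q = f z"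
      using C(2)[OF z] by blast
    have "s \<in> {y, y', w, q}" using s(2) y(3) by auto
    moreover have "s \<noteq> w" "s \<noteq> q" using s(3) C(5) C(7)[OF z] y(4) by auto
    ultimately show False using PP s(1) y by blast
  qed
  have disj: "B \<inter> B' = {}"
  proof -
    have ww: "w \<noteq> w'"
    proof
      assume e: "w = w'"
      obtain q where q: "nb w = insert q Z" using C(3) by blast
      obtain q' where q': "nb w' = insert q' Z'" "f q' = f w'" using C'(3) by blast
      obtain z where z: "z \<in> Z" using C(4) by blast
      have "z \<noteq> q'" using C(7)[OF z] C'(5) q'(2) by auto
      moreover have "z \<in> insert q' Z'" using q q'(1) e z by blast
      ultimately show False using ZZ[OF z] by blast
    qed
    obtain z where "z \<in> Z" using C(4) by blast
    then have "- f x < f x" using C(7) by fastforce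
    then have nx: "x \<notin> down f u" "x \<notin> Z'" "x \<noteq> w'" "w \<noteq> u" "w \<notin> down f u" "w \<notin> Z'"
      using C(5) C'(5) C'(6)[of x] C'(7)[of x] C'(6)[of w] C'(7)[of w] ux(2) by auto
    have nu: "u \<notin> down f x" "u \<notin> Z" "w' \<notin> down f x" "w' \<notin> Z"
      using C'(5) C(6)[of u] C(7)[of u] C(6)[of w'] C(7)[of w'] ux(2) by auto
    show ?thesis
      unfolding B_def B'_def block_verts_def using nx nu ww xnu PP PZ PZ' ZZ by blast
  qed
  have "\<exists>t. {t \<in> nb v. (t \<in> B) \<noteq> (v \<in> B)} = {t}" if "v \<in> V" for v
  proof (cases "v \<in> B")
    case True
    then obtain q where q: "q \<in> B'" "q \<in> nb v" "nb v \<subseteq> insert q B" using p by blast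
    then have "{t \<in> nb v. (t \<in> B) \<noteq> (v \<in> B)} = {q}" using True disj by blast
    then show ?thesis by blast
  next
    case False
    then have "v \<in> B'" using \<open>B \<union> B' = V\<close> that by blast
    then obtain q where q: "q \<in> B" "q \<in> nb v" "nb v \<subseteq> insert q B'" using p' by blast
    then have "{t \<in> nb v. (t \<in> B) \<noteq> (v \<in> B)} = {q}" using False disj by blast
    then show ?thesis by blast
  qed
  then show ?thesis unfolding is_cut_def by blast
qed

end

section \<open>Rebuilding the 4-cube from a full block\<close>

text \<open>The block is the whole neighbourhood of \<open>x\<close>. The assumption on
  \<open>tri f f f\<close> fixes the values of \<open>f\<close>; the graph then unfolds as a 4-cube
  with layers of 1, 4, 6, 4 and 1 vertices.\<close>

locale four_block = cd_graph +
  fixes f :: "'a \<Rightarrow> real" and x :: 'a and \<kappa> :: real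
  assumes lm: "locmax f x" and four: "card (down f x) = 4" and d4: "d = 4"
    and tri: "tri f f f = (\<lambda>x. \<kappa> * f x)"
begin

abbreviation "P \<equiv> down f x"

lemma fE: "f \<in> E" and xV: "x \<in> V"
  using locmaxD[OF lm] by auto

lemma card_nb4: "v \<in> V \<Longrightarrow> card (nb v) = 4"
  using reg d4 by simp

lemma nbx: "nb x = P"
proof -
  have "P = nb x" by (rule card_subset_eq) (use four card_nb4[OF xV] in \<open>auto simp: down_def\<close>)
  then show ?thesis ..
qed

lemma rest:
  assumes "a \<in> P" "b \<in> P" "a \<noteq> b"
  obtains e g where "P = {a, b, e, g}" "distinct [a, b, e, g]"
proof -
  have "card (P - {a, b}) = 2"
    using assms four by (subst card_Diff_subset) auto
  then obtain e g where eg: "P - {a, b} = {e, g}" "e \<noteq> g" by (auto simp: card_2_iff)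
  then have "e \<notin> {a, b}" "g \<notin> {a, b}" by blast+
  moreover have "P = {a, b} \<union> (P - {a, b})" using assms by blast
  then have "P = {a, b, e, g}" unfolding eg(1) by auto
  ultimately show ?thesis using that[of e g] assms(3) eg(2) by auto
qed

lemma sum4: "distinct [a, b, e, g] \<Longrightarrow> (\<Sum>v\<in>{a, b, e, g}. h v) = h a + h b + h e + h g"
  for h :: "'a \<Rightarrow> real"
  by simp

text \<open>With \<open>u\<close> the drop from \<open>x\<close> to \<open>z\<close>, Laplacian and
  squared gradient at \<open>z\<close> determine the increment to the fourth neighbour in two ways;
  comparison gives \<open>u * (u + 2 * (f x - f g)) = 0\<close>, although both factors are
  positive.\<close>

lemma no_three:
  assumes P: "P = {a, b, e, g}" "distinct [a, b, e, g]" and z: "z \<noteq> x" "nb z \<inter> P = {a, b, e}"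
  shows False
proof -
  have in_z: "a \<in> nb z" "b \<in> nb z" "e \<in> nb z" using z(2) by blast+
  have zV: "z \<in> V" using adjV[OF in_z(1)] by simp
  have aP: "a \<in> P" "b \<in> P" using P(1) by auto
  have ab: "a \<noteq> b" using P(2) by simp
  have com: "nb x \<inter> nb z = {a, b, e}"
    using pair_top(1)[OF lm aP ab z(1) in_z(1,2)] z(2) by simp
  have "card (nb z - {a, b, e}) = 1"
    using in_z card_nb4[OF zV] P(2) by (subst card_Diff_subset) auto
  then obtain r where r: "nb z - {a, b, e} = {r}" by (rule card_1_singletonE)
  then have N: "nb z = {a, b, e, r}" and rd: "r \<notin> {a, b, e}" using in_z by blast+
  have dis: "distinct [a, b, e, r]" using P(2) rd by auto
  define u where "u = f x - f z"
  have sP: "(f x - f a) + (f x - f b) + (f x - f e) + (f x - f g) = 2 * f x"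
    using sum_down[OF lm] unfolding P(1) sum4[OF P(2)] .
  have u: "3 * u = 2 * ((f x - f a) + (f x - f b) + (f x - f e))"
    using card_common[OF fE xV zV z(1)] P(2) unfolding com by (simp add: u_def)
  have "lap nb f z = (f a - f z) + (f b - f z) + (f e - f z) + (f r - f z)"
    unfolding lap_def N sum4[OF dis] by simp
  then have 1: "f r - f z = - u - (f x - f g)"
    using E_lap[OF fE zV] sP u by (simp add: u_def)
  have "grad nb f f z = (f a - f z)^2 + (f b - f z)^2 + (f e - f z)^2 + (f r - f z)^2"
    unfolding grad_def N sum4[OF dis] by (simp add: power2_eq_square)
  moreover have "grad nb f f z = (f a - f x)^2 + (f b - f x)^2 + (f e - f x)^2 + (f g - f x)^2"
    unfolding grad_self_const[OF fE zV xV] grad_down[OF lm] unfolding P(1) sum4[OF P(2)] by simp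
  moreover have "(f a - f z)^2 + (f b - f z)^2 + (f e - f z)^2
      = (f a - f x)^2 + (f b - f x)^2 + (f e - f x)^2 + u * (3 * u - 2 * ((f x - f a) + (f x - f b) + (f x - f e)))"
    by (simp add: u_def power2_eq_square algebra_simps)
  ultimately have "(f r - f z)^2 = (f g - f x)^2" using u by simp
  then have zero: "u * (u + 2 * (f x - f g)) = 0"
    unfolding 1 by (simp add: power2_eq_square algebra_simps)
  have "f x - f a > 0" "f x - f b > 0" "f x - f e > 0" "f x - f g > 0"
    using down_less[of _ f x] P(1) by auto
  note pos = this
  have "3 * u > 0" unfolding u using pos by simp
  then have "u > 0" by simp
  moreover have "f x - f g > 0" by (rule pos(4))
  ultimately have "u * (u + 2 * (f x - f g)) > 0" by simp
  then show False unfolding zero by simp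
qed

text \<open>Plays the part of the vertex of the middle layer with exactly the coordinates
  \<open>a\<close> and \<open>b\<close>.\<close>

definition zt :: "'a \<Rightarrow> 'a \<Rightarrow> 'a" where
  "zt a b = (SOME z. z \<noteq> x \<and> nb z \<inter> P = {a, b})"

lemma zt_comm: "zt a b = zt b a"
  by (simp add: zt_def insert_commute)

lemma zt:
  assumes ab: "a \<in> P" "b \<in> P" "a \<noteq> b"
  shows "zt a b \<noteq> x" "nb (zt a b) \<inter> P = {a, b}" "zt a b \<in> V" "a \<in> nb (zt a b)" "b \<in> nb (zt a b)"
    "zt a b \<in> nb a"
proof -
  obtain z where z: "z \<noteq> x" "z \<in> nb a" "z \<in> nb b" by (rule pair_common[OF lm ab])
  have zn: "a \<in> nb z" "b \<in> nb z" using adj_sym z by blast+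
  obtain e g where P: "P = {a, b, e, g}" "distinct [a, b, e, g]" by (rule rest[OF ab])
  have nf: "\<not> P \<subseteq> nb z" using no_full[OF lm z(1)] four by auto
  have "e \<notin> nb z"
  proof
    assume e: "e \<in> nb z"
    then have "nb z \<inter> P = {a, b, e}" using nf zn unfolding P(1) by auto
    then show False by (rule no_three[OF P z(1)])
  qed
  moreover have "g \<notin> nb z"
  proof
    assume g: "g \<in> nb z"
    have P': "P = {a, b, g, e}" "distinct [a, b, g, e]" using P by auto
    have "nb z \<inter> P = {a, b, g}" using nf zn g unfolding P(1) by auto
    then show False by (rule no_three[OF P' z(1)])
  qed
  ultimately have "nb z \<inter> P = {a, b}" unfolding P(1) using zn by auto
  then have "zt a b \<noteq> x \<and> nb (zt a b) \<inter> P = {a, b}"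
    unfolding zt_def using z(1) by (intro someI[of "\<lambda>z. z \<noteq> x \<and> nb z \<inter> P = {a, b}"]) simp
  then show "zt a b \<noteq> x" "nb (zt a b) \<inter> P = {a, b}" "a \<in> nb (zt a b)" "b \<in> nb (zt a b)" by blast+
  then show "zt a b \<in> V" "zt a b \<in> nb a" using adjV[of a "zt a b"] adj_sym[of a "zt a b"] by auto
qed

lemma zt_eq: 
  assumes "a \<in> P" "b \<in> P" "a \<noteq> b" "a' \<in> P" "b' \<in> P" "a' \<noteq> b'" "zt a b = zt a' b'"
  shows "{a, b} = {a', b'}"
  using zt(2)[OF assms(1-3)] zt(2)[OF assms(4-6)] assms(7) by simp

lemma zt_nb:
  assumes "a \<in> P" "b \<in> P" "a \<noteq> b" "c \<in> P"
  shows "c \<in> nb (zt a b) \<longleftrightarrow> c = a \<or> c = b"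
  using zt(2)[OF assms(1-3)] assms(4) by blast

lemma zt_value:
  assumes "a \<in> P" "b \<in> P" "a \<noteq> b"
  shows "f (zt a b) = f a + f b - f x"
  by (rule pair_value[OF lm zt(1,2)[OF assms] assms(3)])

lemma nb_a:
  assumes P: "P = {a, b, e, g}" "distinct [a, b, e, g]"
  shows "nb a = {x, zt a b, zt a e, zt a g}" "distinct [x, zt a b, zt a e, zt a g]"
proof -
  have I: "a \<in> P" "b \<in> P" "e \<in> P" "g \<in> P" using P(1) by auto
  have ne: "a \<noteq> b" "a \<noteq> e" "a \<noteq> g" using P(2) by auto
  have "zt a b \<noteq> zt a e"
    using zt_eq[OF I(1,2) ne(1) I(1,3) ne(2)] P(2) by (auto simp: doubleton_eq_iff)
  moreover have "zt a b \<noteq> zt a g"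
    using zt_eq[OF I(1,2) ne(1) I(1,4) ne(3)] P(2) by (auto simp: doubleton_eq_iff)
  moreover have "zt a e \<noteq> zt a g"
    using zt_eq[OF I(1,3) ne(2) I(1,4) ne(3)] P(2) by (auto simp: doubleton_eq_iff)
  ultimately show dis: "distinct [x, zt a b, zt a e, zt a g]"
    using zt(1)[OF I(1,2) ne(1)] zt(1)[OF I(1,3) ne(2)] zt(1)[OF I(1,4) ne(3)] by auto
  have aV: "a \<in> V" using adjV[OF down_nb[OF I(1)]] by simp
  have "{x, zt a b, zt a e, zt a g} = nb a"
  proof (rule card_subset_eq)
    show "{x, zt a b, zt a e, zt a g} \<subseteq> nb a"
      using adj_sym[OF down_nb[OF I(1)]] zt(6)[OF I(1,2) ne(1)] zt(6)[OF I(1,3) ne(2)]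
        zt(6)[OF I(1,4) ne(3)] by simp
    show "card {x, zt a b, zt a e, zt a g} = card (nb a)" using dis card_nb4[OF aV] by simp
  qed simp
  then show "nb a = {x, zt a b, zt a e, zt a g}" ..
qed

definition \<alpha> where "\<alpha> = f x / 2"

text \<open>The equation \<open>tri f f f = \<kappa> * f\<close> is compared at \<open>x\<close> and
  at \<open>a\<close>: seen from \<open>a\<close>, the three edges to the middle layer have the
  increments of the other three edges at \<open>x\<close>. The difference gives
  \<open>(f x - f a)^2 = - \<kappa> / 2\<close>, so all four drops are equal, with common value
  \<open>\<alpha>\<close>.\<close>

lemma level_vals: "f x = 2 * \<alpha>" "a \<in> P \<Longrightarrow> f a = \<alpha>" "\<alpha> > 0"
proof -
  have key: "(f x - f a)^2 = - \<kappa> / 2" if "a \<in> P" for a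
  proof -
    have "P \<noteq> {a}" using four by auto
    then obtain b where b: "b \<in> P" "a \<noteq> b" using \<open>a \<in> P\<close> by blast
    obtain e g where P: "P = {a, b, e, g}" "distinct [a, b, e, g]"
      by (rule rest[OF \<open>a \<in> P\<close> b])
    have I: "a \<in> P" "b \<in> P" "e \<in> P" "g \<in> P" using P(1) by auto
    have ne: "a \<noteq> b" "a \<noteq> e" "a \<noteq> g" using P(2) by auto
    have 1: "\<kappa> * f x = (f a - f x)^3 + (f b - f x)^3 + (f e - f x)^3 + (f g - f x)^3"
      using fun_cong[OF tri, of x] unfolding tri_def nbx unfolding P(1) sum4[OF P(2)]
      by (simp add: power3_eq_cube)
    have 2: "\<kappa> * f a = (f x - f a)^3 + (f (zt a b) - f a)^3 + (f (zt a e) - f a)^3 + (f (zt a g) - f a)^3"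
      using fun_cong[OF tri, of a] unfolding tri_def nb_a(1)[OF P] sum4[OF nb_a(2)[OF P]]
      by (simp add: power3_eq_cube)
    then have "\<kappa> * f a = (f x - f a)^3 + (f b - f x)^3 + (f e - f x)^3 + (f g - f x)^3"
      unfolding zt_value[OF I(1,2) ne(1)] zt_value[OF I(1,3) ne(2)] zt_value[OF I(1,4) ne(3)] by simp
    then have "\<kappa> * (f x - f a) = (f a - f x)^3 - (f x - f a)^3"
      using 1 by (simp add: algebra_simps)
    then have "(f x - f a) * (2 * (f x - f a)^2 + \<kappa>) = 0"
      by (simp add: power3_eq_cube power2_eq_square algebra_simps)
    moreover have "f x - f a > 0" using down_less[OF \<open>a \<in> P\<close>] by simp
    ultimately show ?thesis by simp
  qed
  have same: "f a = f b" if "a \<in> P" "b \<in> P" for a b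
  proof -
    have "(f x - f a)^2 = (f x - f b)^2" using key[OF that(1)] key[OF that(2)] by simp
    then show ?thesis using down_less[OF that(1)] down_less[OF that(2)]
      by (simp add: power2_eq_iff)
  qed
  have ne: "P \<noteq> {}" using four by auto
  have val: "f a = \<alpha>" if a: "a \<in> P" for a
  proof -
    have "(\<Sum>y\<in>P. f x - f y) = (\<Sum>y\<in>P. f x - f a)"
      by (intro sum.cong refl) (use same[OF a] in simp)
    then have "4 * (f x - f a) = 2 * f x" using sum_down[OF lm] four by simp
    then show ?thesis by (simp add: \<alpha>_def)
  qed
  show "f x = 2 * \<alpha>" by (simp add: \<alpha>_def)
  show "a \<in> P \<Longrightarrow> f a = \<alpha>" by (rule val)
  obtain a where "a \<in> P" using ne by blast
  then show "\<alpha> > 0" using down_less[of a f x] val by (simp add: \<alpha>_def)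
qed

lemma zt_zero: "a \<in> P \<Longrightarrow> b \<in> P \<Longrightarrow> a \<noteq> b \<Longrightarrow> f (zt a b) = 0"
  using zt_value level_vals by simp

text \<open>The two unknown values have sum \<open>- 2 * \<alpha>\<close> and sum of squares
  \<open>2 * \<alpha>^2\<close>, which forces them to be equal.\<close>

lemma nb_zt:
  assumes ab: "a \<in> P" "b \<in> P" "a \<noteq> b"
  obtains p q where "nb (zt a b) = {a, b, p, q}" "distinct [a, b, p, q]" "f p = - \<alpha>" "f q = - \<alpha>"
proof -
  let ?z = "zt a b"
  note z = zt[OF ab]
  have "card (nb ?z - {a, b}) = 2"
    using z ab(3) card_nb4[OF z(3)] by (subst card_Diff_subset) auto
  then obtain p q where pq: "nb ?z - {a, b} = {p, q}" "p \<noteq> q" by (auto simp: card_2_iff)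
  then have N: "nb ?z = {a, b, p, q}" and "p \<notin> {a, b}" "q \<notin> {a, b}" using z(4,5) by blast+
  then have dis: "distinct [a, b, p, q]" using ab(3) pq(2) by auto
  have "lap nb f ?z = f a + f b + f p + f q"
    unfolding lap_def N sum4[OF dis] zt_zero[OF ab] by simp
  then have s: "f p + f q = - 2 * \<alpha>" using E_lap[OF fE z(3)] zt_zero[OF ab] level_vals(2) ab by simp
  have "grad nb f f ?z = (f a)^2 + (f b)^2 + (f p)^2 + (f q)^2"
    unfolding grad_def N sum4[OF dis] zt_zero[OF ab] by (simp add: power2_eq_square)
  moreover have "grad nb f f ?z = 4 * \<alpha>^2"
  proof -
    have "grad nb f f x = (\<Sum>y\<in>P. \<alpha>^2)"
      unfolding grad_down[OF lm] by (intro sum.cong refl) (simp add: level_vals)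
    then show ?thesis unfolding grad_self_const[OF fE z(3) xV] using four by simp
  qed
  ultimately have "(f p)^2 + (f q)^2 = 2 * \<alpha>^2" using level_vals(2) ab by simp
  moreover have "f q = - 2 * \<alpha> - f p" using s by simp
  ultimately have "(f p + \<alpha>)^2 = 0" by (simp add: power2_eq_square algebra_simps)
  then have "f p = - \<alpha>" by simp
  then show ?thesis using that[OF N dis] s by simp
qed

lemma nb_zt_low:
  assumes ab: "a \<in> P" "b \<in> P" "a \<noteq> b" and v: "v \<in> nb (zt a b)"
  shows "v = a \<or> v = b \<or> f v = - \<alpha>"
proof -
  obtain p q where "nb (zt a b) = {a, b, p, q}" "f p = - \<alpha>" "f q = - \<alpha>"
    using nb_zt[OF ab] by metis
  then show ?thesis using v by auto
qed

text \<open>For the edge from \<open>a\<close> to \<open>zt a b\<close> the bound of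
  \<open>cd_diag\<close> is 3/2. The vertex \<open>b\<close> contributes 1/2 and the second lower
  vertex a positive amount, so \<open>p\<close> contributes less than 1 and shares another middle
  vertex with \<open>a\<close>.\<close>

lemma low_next:
  assumes P: "P = {a, b, e, g}" "distinct [a, b, e, g]" and p: "p \<in> nb (zt a b)" "f p = - \<alpha>"
  shows "p \<in> nb (zt a e) \<or> p \<in> nb (zt a g)"
proof (rule ccontr)
  assume no: "\<not> ?thesis"
  have I: "a \<in> P" "b \<in> P" "e \<in> P" "g \<in> P" using P(1) by auto
  have ne: "a \<noteq> b" "a \<noteq> e" "a \<noteq> g" "b \<noteq> e" "b \<noteq> g" using P(2) by auto
  let ?z = "zt a b"
  note z = zt[OF I(1,2) ne(1)]
  note na = nb_a(1)[OF P]
  have aV: "a \<in> V" using adjV[OF down_nb[OF I(1)]] by simp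
  obtain p' q' where pq: "nb ?z = {a, b, p', q'}" "distinct [a, b, p', q']" "f p' = - \<alpha>" "f q' = - \<alpha>"
    by (rule nb_zt[OF I(1,2) ne(1)])
  have "p \<noteq> a" "p \<noteq> b" using p(2) level_vals(2)[OF I(1)] level_vals(2)[OF I(2)] level_vals(3) by auto
  then have "p = p' \<or> p = q'" using p(1) pq(1) by auto
  then obtain q where q: "nb ?z = {a, b, p, q}" "distinct [a, b, p, q]" "f q = - \<alpha>"
    using pq by (auto simp: insert_commute)
  have fa: "f v = 2 * \<alpha> \<or> f v = 0" if "v \<in> nb a" for v
    using that zt_zero[OF I(1,2) ne(1)] zt_zero[OF I(1,3) ne(2)] zt_zero[OF I(1,4) ne(3)] level_vals(1)
    unfolding na by auto
  have fz: "f v = \<alpha> \<or> f v = - \<alpha>" if "v \<in> nb ?z" for v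
    using that p(2) q(3) level_vals(2)[OF I(1)] level_vals(2)[OF I(2)] unfolding q(1) by auto
  have dj: "nb a \<inter> nb ?z = {}" using fa fz level_vals(3) by fastforce
  have e: "nb ?z - {a} = {b, p, q}" unfolding q(1) using q(2) by auto
  have "(\<Sum>v\<in>nb ?z - {a}. 1 / real (card (nb a \<inter> nb v))) \<le> 3 / 2"
    using cd_diag[OF aV z(6) dj] d4 by simp
  then have s: "1 / real (card (nb a \<inter> nb b)) + 1 / real (card (nb a \<inter> nb p))
      + 1 / real (card (nb a \<inter> nb q)) \<le> 3 / 2"
    unfolding e using q(2) by simp
  have zp: "?z \<in> nb p" "?z \<in> nb q" "?z \<in> nb b" using adj_sym[of p ?z] adj_sym[of q ?z] adj_sym[OF z(5)] q(1) by auto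
  have "zt a e \<notin> nb b" "zt a g \<notin> nb b"
    using zt_nb[OF I(1,3) ne(2) I(2)] zt_nb[OF I(1,4) ne(3) I(2)] ne
      adj_comm[of "zt a e" b] adj_comm[of "zt a g" b] by auto
  moreover have "x \<in> nb b" by (rule adj_sym[OF down_nb[OF I(2)]])
  ultimately have "nb a \<inter> nb b = {x, ?z}" unfolding na using zp(3) by auto
  then have 1: "card (nb a \<inter> nb b) = 2" using z(1) by simp
  have "x \<notin> nb p"
  proof
    assume "x \<in> nb p"
    then have "p \<in> P" using adj_sym[of x p] nbx by simp
    then show False using level_vals(2,3) p(2) by simp
  qed
  moreover have "zt a e \<notin> nb p" "zt a g \<notin> nb p"
    using no adj_comm[of "zt a e" p] adj_comm[of "zt a g" p] by auto
  ultimately have "nb a \<inter> nb p = {?z}" unfolding na using zp(1) by auto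
  then have 2: "card (nb a \<inter> nb p) = 1" by simp
  have "?z \<in> nb a \<inter> nb q" using z(6) zp(2) by simp
  then have "card (nb a \<inter> nb q) > 0" by (auto simp: card_gt_0_iff)
  then show False using s 1 2 by simp
qed

text \<open>As \<open>f\<close> vanishes at both middle vertices, the term of \<open>a\<close> in
  \<open>common_sum\<close> is \<open>- 2 * \<alpha>\<close> and every other common neighbour gives
  \<open>2 * \<alpha>\<close>; hence there is exactly one other.\<close>

lemma zt_common:
  assumes P: "P = {a, b, e, g}" "distinct [a, b, e, g]"
  obtains w where "nb (zt a b) \<inter> nb (zt a e) = {a, w}" "f w = - \<alpha>"
proof -
  have I: "a \<in> P" "b \<in> P" "e \<in> P" "g \<in> P" using P(1) by auto
  have ne: "a \<noteq> b" "a \<noteq> e" "b \<noteq> e" using P(2) by auto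
  let ?C = "nb (zt a b) \<inter> nb (zt a e)"
  note z = zt[OF I(1,2) ne(1)] and z' = zt[OF I(1,3) ne(2)]
  have "zt a b \<noteq> zt a e" using nb_a(2)[OF P] by simp
  then have s: "(\<Sum>v\<in>?C. - 2 * f v) = 0"
    using common_sum[OF fE z(3) z'(3)] zt_zero[OF I(1,2) ne(1)] zt_zero[OF I(1,3) ne(2)] by simp
  have aC: "a \<in> ?C" using z z' by simp
  have low: "f v = - \<alpha>" if v: "v \<in> ?C - {a}" for v
  proof -
    have "v \<noteq> b" using v zt_nb[OF I(1,3) ne(2) I(2)] ne by auto
    then show ?thesis using nb_zt_low[OF I(1,2) ne(1), of v] v by auto
  qed
  have "(\<Sum>v\<in>?C. - 2 * f v) = - 2 * \<alpha> + (\<Sum>v\<in>?C - {a}. - 2 * f v)"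
    using aC level_vals(2)[OF I(1)] by (subst sum.remove[of _ a]) auto
  also have "(\<Sum>v\<in>?C - {a}. - 2 * f v) = (\<Sum>v\<in>?C - {a}. 2 * \<alpha>)"
    by (intro sum.cong refl) (use low in auto)
  finally have "real (card (?C - {a})) * (2 * \<alpha>) = 2 * \<alpha>" using s by simp
  then have "card (?C - {a}) = 1" using level_vals(3) by simp
  then obtain w where w: "?C - {a} = {w}" by (rule card_1_singletonE)
  then have "?C = {a, w}" using aC by blast
  moreover have "f w = - \<alpha>" using low[of w] unfolding w by simp
  ultimately show ?thesis by (rule that)
qed

text \<open>A common neighbour could lie only in the lower layer, so all terms of
  \<open>common_sum\<close> would have the same sign.\<close>

lemma zt_disjoint:
  assumes P: "P = {a, b, e, g}" "distinct [a, b, e, g]"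
  shows "nb (zt a b) \<inter> nb (zt e g) = {}"
proof (rule ccontr)
  assume C: "nb (zt a b) \<inter> nb (zt e g) \<noteq> {}"
  have I: "a \<in> P" "b \<in> P" "e \<in> P" "g \<in> P" using P(1) by auto
  have ne: "a \<noteq> b" "e \<noteq> g" using P(2) by auto
  let ?C = "nb (zt a b) \<inter> nb (zt e g)"
  note z = zt[OF I(1,2) ne(1)] and z' = zt[OF I(3,4) ne(2)]
  have "zt a b \<noteq> zt e g"
    using zt_eq[OF I(1,2) ne(1) I(3,4) ne(2)] P(2) by (auto simp: doubleton_eq_iff)
  then have s: "(\<Sum>v\<in>?C. - 2 * f v) = 0"
    using common_sum[OF fE z(3) z'(3)] zt_zero[OF I(1,2) ne(1)] zt_zero[OF I(3,4) ne(2)] by simp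
  have "f v = - \<alpha>" if v: "v \<in> ?C" for v
  proof -
    have "v \<noteq> a" "v \<noteq> b"
      using v zt_nb[OF I(3,4) ne(2) I(1)] zt_nb[OF I(3,4) ne(2) I(2)] P(2) by auto
    then show ?thesis using nb_zt_low[OF I(1,2) ne(1), of v] v by auto
  qed
  then have "(\<Sum>v\<in>?C. - 2 * f v) = (\<Sum>v\<in>?C. 2 * \<alpha>)" by (intro sum.cong refl) auto
  then have "real (card ?C) * (2 * \<alpha>) = 0" using s by simp
  then have "card ?C = 0" using level_vals(3) by simp
  then show False using C by simp
qed

text \<open>The vertex opposite to \<open>e\<close> in the 4-cube, with the three coordinates other
  than \<open>e\<close>.\<close>

definition om :: "'a \<Rightarrow> 'a" where
  "om e = (SOME w. f w = - \<alpha> \<and> (\<forall>a\<in>P - {e}. \<forall>b\<in>P - {e}. a \<noteq> b \<longrightarrow> w \<in> nb (zt a b)))"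

text \<open>The lower vertex shared by two of the three middle vertices that avoid \<open>e\<close>
  is adjacent to a further one by \<open>low_next\<close>, and \<open>zt_disjoint\<close> excludes
  the wrong candidate.\<close>

lemma om:
  assumes e: "e \<in> P"
  shows "f (om e) = - \<alpha>" "a \<in> P \<Longrightarrow> b \<in> P \<Longrightarrow> a \<noteq> e \<Longrightarrow> b \<noteq> e \<Longrightarrow> a \<noteq> b \<Longrightarrow> om e \<in> nb (zt a b)"
proof -
  have "P \<noteq> {e}" using four by auto
  then obtain a where a: "a \<in> P" "a \<noteq> e" using e by blast
  obtain b c where Q: "P = {a, e, b, c}" "distinct [a, e, b, c]" by (rule rest[OF a(1) e a(2)])
  have P: "P = {a, b, c, e}" "distinct [a, b, c, e]" using Q by auto
  have P2: "P = {b, a, c, e}" "distinct [b, a, c, e]" using Q by auto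
  have P3: "P = {a, c, b, e}" "distinct [a, c, b, e]" using Q by auto
  obtain w where w: "nb (zt a b) \<inter> nb (zt a c) = {a, w}" "f w = - \<alpha>" by (rule zt_common[OF P])
  have wab: "w \<in> nb (zt a b)" "w \<in> nb (zt a c)" using w(1) by blast+
  have "w \<in> nb (zt b a)" using wab(1) by (simp add: zt_comm)
  then have "w \<in> nb (zt b c) \<or> w \<in> nb (zt b e)" by (rule low_next[OF P2 _ w(2)])
  moreover have "w \<notin> nb (zt b e)" using zt_disjoint[OF P3] wab(2) by blast
  ultimately have wbc: "w \<in> nb (zt b c)" by blast
  have "P - {e} = {a, b, c}" using P by auto
  then have "\<forall>u\<in>P - {e}. \<forall>v\<in>P - {e}. u \<noteq> v \<longrightarrow> w \<in> nb (zt u v)"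
    using wab wbc by (auto simp: zt_comm)
  then have "f (om e) = - \<alpha> \<and> (\<forall>a\<in>P - {e}. \<forall>b\<in>P - {e}. a \<noteq> b \<longrightarrow> om e \<in> nb (zt a b))"
    unfolding om_def using w(2)
    by (intro someI[of "\<lambda>w. f w = - \<alpha> \<and> (\<forall>a\<in>P - {e}. \<forall>b\<in>P - {e}. a \<noteq> b \<longrightarrow> w \<in> nb (zt a b))"]) simp
  then show "f (om e) = - \<alpha>" "a \<in> P \<Longrightarrow> b \<in> P \<Longrightarrow> a \<noteq> e \<Longrightarrow> b \<noteq> e \<Longrightarrow> a \<noteq> b \<Longrightarrow> om e \<in> nb (zt a b)" for a b
    by blast+
qed

lemma om_inj:
  assumes "e \<in> P" "g \<in> P" "e \<noteq> g"
  shows "om e \<noteq> om g"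
proof
  assume eq: "om e = om g"
  obtain a b where P: "P = {e, g, a, b}" "distinct [e, g, a, b]" by (rule rest[OF assms])
  have I: "a \<in> P" "b \<in> P" using P(1) by auto
  have P': "P = {g, a, e, b}" "distinct [g, a, e, b]" using P by auto
  have "om e \<in> nb (zt g a)" by (rule om(2)[OF assms(1,2) I(1)]) (use P(2) in auto)
  moreover have "om g \<in> nb (zt e b)" by (rule om(2)[OF assms(2,1) I(2)]) (use P(2) in auto)
  ultimately show False using zt_disjoint[OF P'] eq by auto
qed

lemma nb_zt_om:
  assumes P: "P = {a, b, e, g}" "distinct [a, b, e, g]"
  shows "nb (zt a b) = {a, b, om e, om g}"
proof -
  have I: "a \<in> P" "b \<in> P" "e \<in> P" "g \<in> P" using P(1) by auto
  have ab: "a \<noteq> b" using P(2) by simp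
  have "f (om e) \<noteq> f a" "f (om e) \<noteq> f b" "f (om g) \<noteq> f a" "f (om g) \<noteq> f b"
    using om(1)[OF I(3)] om(1)[OF I(4)] level_vals(2)[OF I(1)] level_vals(2)[OF I(2)] level_vals(3) by auto
  then have dis: "distinct [a, b, om e, om g]" using ab om_inj[OF I(3,4)] P(2) by auto
  have "om e \<in> nb (zt a b)" "om g \<in> nb (zt a b)"
    using om(2)[OF I(3,1,2)] om(2)[OF I(4,1,2)] P(2) by auto
  then have "{a, b, om e, om g} \<subseteq> nb (zt a b)" using zt[OF I(1,2) ab] by simp
  then have "{a, b, om e, om g} = nb (zt a b)"
    using dis card_nb4[OF zt(3)[OF I(1,2) ab]] by (intro card_subset_eq) auto
  then show ?thesis ..
qed

lemma nb_om:
  assumes P: "P = {a, b, e, g}" "distinct [a, b, e, g]"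
  shows "\<exists>v. nb (om g) = {zt a b, zt a e, zt b e, v} \<and> f v = - 2 * \<alpha>"
proof -
  have I: "a \<in> P" "b \<in> P" "e \<in> P" "g \<in> P" using P(1) by auto
  have ne: "a \<noteq> b" "a \<noteq> e" "b \<noteq> e" using P(2) by auto
  let ?z = "{zt a b, zt a e, zt b e}"
  have zn: "om g \<in> nb (zt a b)" "om g \<in> nb (zt a e)" "om g \<in> nb (zt b e)"
    using om(2)[OF I(4,1,2)] om(2)[OF I(4,1,3)] om(2)[OF I(4,2,3)] P(2) by auto
  have sub: "zt a b \<in> nb (om g)" "zt a e \<in> nb (om g)" "zt b e \<in> nb (om g)" using zn adj_sym by blast+
  have oV: "om g \<in> V" using adjV[OF zn(1)] by simp
  have zd: "zt a b \<noteq> zt a e" "zt a b \<noteq> zt b e" "zt a e \<noteq> zt b e"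
    using zt_eq[OF I(1,2) ne(1) I(1,3) ne(2)] zt_eq[OF I(1,2) ne(1) I(2,3) ne(3)]
      zt_eq[OF I(1,3) ne(2) I(2,3) ne(3)] ne by (auto simp: doubleton_eq_iff)
  have "card (nb (om g) - ?z) = 1"
    using sub zd card_nb4[OF oV] by (subst card_Diff_subset) auto
  then obtain v where v: "nb (om g) - ?z = {v}" by (rule card_1_singletonE)
  then have N: "nb (om g) = {zt a b, zt a e, zt b e, v}" and "v \<notin> ?z" using sub by blast+
  then have dis: "distinct [zt a b, zt a e, zt b e, v]" using zd by auto
  have "lap nb f (om g) = 4 * \<alpha> + f v"
    unfolding lap_def N sum4[OF dis] om(1)[OF I(4)] zt_zero[OF I(1,2) ne(1)]
      zt_zero[OF I(1,3) ne(2)] zt_zero[OF I(2,3) ne(3)] by simp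
  then have "f v = - 2 * \<alpha>" using E_lap[OF fE oV] om(1)[OF I(4)] by simp
  then show ?thesis using N by blast
qed

text \<open>If two lower vertices led to different bottoms, all their common neighbours would be
  middle vertices, where \<open>f\<close> is 0, and \<open>common_sum\<close> would have only
  negative terms.\<close>

lemma bottom_exists:
  obtains v where "f v = - 2 * \<alpha>" "nb v = om ` P"
    "\<And>a b e g. P = {a, b, e, g} \<Longrightarrow> distinct [a, b, e, g] \<Longrightarrow> nb (om g) = {zt a b, zt a e, zt b e, v}"
proof -
  have ex: "\<exists>v. v \<in> nb (om g) \<and> f v = - 2 * \<alpha> \<and>
    (\<forall>a b e. P = {a, b, e, g} \<and> distinct [a, b, e, g] \<longrightarrow> nb (om g) = {zt a b, zt a e, zt b e, v})"
    if g: "g \<in> P" for g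
  proof -
    have "P \<noteq> {g}" using four by auto
    then obtain a where a: "a \<in> P" "a \<noteq> g" using g by blast
    obtain b e where Q: "P = {a, g, b, e}" "distinct [a, g, b, e]" by (rule rest[OF a(1) g a(2)])
    have P: "P = {a, b, e, g}" "distinct [a, b, e, g]" using Q by auto
    obtain v where v: "nb (om g) = {zt a b, zt a e, zt b e, v}" "f v = - 2 * \<alpha>" using nb_om[OF P] by blast
    have "nb (om g) = {zt a' b', zt a' e', zt b' e', v}"
      if P': "P = {a', b', e', g}" "distinct [a', b', e', g]" for a' b' e'
    proof -
      obtain v' where v': "nb (om g) = {zt a' b', zt a' e', zt b' e', v'}" "f v' = - 2 * \<alpha>"
        using nb_om[OF P'] by blast
      have I: "a' \<in> P" "b' \<in> P" "e' \<in> P" using P'(1) by auto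
      have "v \<in> nb (om g)" using v(1) by simp
      then have "v = v'"
        unfolding v'(1) using v(2) level_vals(3) zt_zero[OF I(1,2)] zt_zero[OF I(1,3)] zt_zero[OF I(2,3)] P'(2)
        by auto
      then show ?thesis using v'(1) by simp
    qed
    then show ?thesis using v by (intro exI[of _ v]) auto
  qed
  define bt where "bt g = (SOME v. v \<in> nb (om g) \<and> f v = - 2 * \<alpha> \<and>
    (\<forall>a b e. P = {a, b, e, g} \<and> distinct [a, b, e, g] \<longrightarrow> nb (om g) = {zt a b, zt a e, zt b e, v}))" for g
  have bt_all: "bt g \<in> nb (om g) \<and> f (bt g) = - 2 * \<alpha> \<and>
    (\<forall>a b e. P = {a, b, e, g} \<and> distinct [a, b, e, g] \<longrightarrow> nb (om g) = {zt a b, zt a e, zt b e, bt g})"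
    if "g \<in> P" for g
    unfolding bt_def by (rule someI_ex[OF ex[OF that]])
  have bt: "bt g \<in> nb (om g)" "f (bt g) = - 2 * \<alpha>" if "g \<in> P" for g
    using bt_all[OF that] by auto
  have bt3: "nb (om g) = {zt a b, zt a e, zt b e, bt g}"
    if "g \<in> P" "P = {a, b, e, g}" "distinct [a, b, e, g]" for g a b e
    using bt_all[OF that(1)] that(2,3) by blast
  have same: "bt g = bt e" if eg: "e \<in> P" "g \<in> P" "e \<noteq> g" for e g
  proof (rule ccontr)
    assume ne: "bt g \<noteq> bt e"
    obtain a b where Q: "P = {e, g, a, b}" "distinct [e, g, a, b]" by (rule rest[OF eg])
    have P1: "P = {a, b, e, g}" "distinct [a, b, e, g]" and P2: "P = {a, b, g, e}" "distinct [a, b, g, e]"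
      using Q by auto
    have I: "a \<in> P" "b \<in> P" using Q(1) by auto
    note n1 = bt3[OF eg(2) P1] and n2 = bt3[OF eg(1) P2]
    have z0: "f (zt a b) = 0" "f (zt a e) = 0" "f (zt b e) = 0" "f (zt a g) = 0" "f (zt b g) = 0"
      using zt_zero I eg P1(2) by auto
    have "f c = 0" if "c \<in> nb (om g) \<inter> nb (om e)" for c
    proof -
      have "c \<noteq> bt g"
      proof
        assume c: "c = bt g"
        then have "bt g \<in> nb (om e)" using that by simp
        then show False unfolding n2 using ne z0 bt(2)[OF eg(2)] level_vals(3) by auto
      qed
      then show ?thesis using that z0 unfolding n1 by auto
    qed
    then have "(\<Sum>c\<in>nb (om g) \<inter> nb (om e). f (om e) - 2 * f c + f (om g)) = (\<Sum>c\<in>nb (om g) \<inter> nb (om e). - 2 * \<alpha>)"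
      by (intro sum.cong refl) (simp add: om(1)[OF eg(1)] om(1)[OF eg(2)])
    moreover have "om g \<in> V" "om e \<in> V" using adjV[OF bt(1)[OF eg(2)]] adjV[OF bt(1)[OF eg(1)]] by auto
    ultimately have "card (nb (om g) \<inter> nb (om e)) = 0"
      using common_sum[OF fE, of "om g" "om e"] om_inj[OF eg] level_vals(3) by simp
    then have "nb (om g) \<inter> nb (om e) = {}" by simp
    moreover have "zt a b \<in> nb (om g) \<inter> nb (om e)" unfolding n1 n2 by simp
    ultimately show False by blast
  qed
  obtain a where a: "a \<in> P" using four by fastforce
  define v where "v = bt a"
  have bv: "bt g = v" if "g \<in> P" for g
    using same[OF a that] by (cases "g = a") (auto simp: v_def)
  have "om ` P \<subseteq> nb v"
  proof
    fix w assume "w \<in> om ` P"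
    then obtain g where g: "g \<in> P" "w = om g" by blast
    then show "w \<in> nb v" using adj_sym[OF bt(1)[OF g(1)]] bv[OF g(1)] by simp
  qed
  moreover have "card (om ` P) = 4"
    using four om_inj by (subst card_image) (auto simp: inj_on_def)
  moreover have "v \<in> V" unfolding v_def using adjV[OF bt(1)[OF a]] by simp
  ultimately have "om ` P = nb v" using card_nb4[of v] by (intro card_subset_eq) auto
  moreover have "f v = - 2 * \<alpha>" unfolding v_def by (rule bt(2)[OF a])
  moreover have "nb (om g) = {zt a b, zt a e, zt b e, v}" if "P = {a, b, e, g}" "distinct [a, b, e, g]" for a b e g
    using bt3[OF _ that] bv[of g] that(1) by auto
  ultimately show ?thesis using that[of v] by metis
qed

lemma cut: "\<exists>S. is_cut S"
proof -
  obtain v where v: "f v = - 2 * \<alpha>" "nb v = om ` P"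
    "\<And>a b e g. P = {a, b, e, g} \<Longrightarrow> distinct [a, b, e, g] \<Longrightarrow> nb (om g) = {zt a b, zt a e, zt b e, v}"
    using bottom_exists by metis
  obtain a0 where a0: "a0 \<in> P" using four by fastforce
  \<comment> \<open>The facet of the 4-cube on which the coordinate \<open>a0\<close> is
    present.\<close>
  define C where "C = {a0} \<union> zt a0 ` (P - {a0}) \<union> om ` (P - {a0}) \<union> {v}"
  have fo: "f (om e) = - \<alpha>" if "e \<in> P" for e by (rule om(1)[OF that])
  have z0: "f (zt a0 b) = 0" if "b \<in> P - {a0}" for b using zt_zero[OF a0, of b] that by auto
  have C_cases: "u = a0 \<or> (u \<in> zt a0 ` (P - {a0}) \<and> f u = 0) \<or> (u \<in> om ` (P - {a0}) \<and> f u = - \<alpha>) \<or> f u = - 2 * \<alpha>"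
    if "u \<in> C" for u
  proof -
    from that consider "u = a0" | b where "b \<in> P - {a0}" "u = zt a0 b" | e where "e \<in> P - {a0}" "u = om e" | "u = v"
      unfolding C_def by blast
    then show ?thesis
      by cases (use z0 fo v(1) in auto)
  qed
  have "f u < f x" if "u \<in> C" for u
    using C_cases[OF that] level_vals(1,3) level_vals(2)[OF a0] by auto
  then have xC: "x \<notin> C" by blast
  have aC: "a \<in> C \<longleftrightarrow> a = a0" if "a \<in> P" for a
  proof
    assume "a \<in> C"
    then show "a = a0" using C_cases[of a] level_vals(2)[OF that] level_vals(3) by auto
  qed (simp add: C_def)
  have zC: "zt a b \<in> C \<longleftrightarrow> a = a0 \<or> b = a0" if "a \<in> P" "b \<in> P" "a \<noteq> b" for a b
  proof
    assume "zt a b \<in> C"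
    then have "zt a b \<in> zt a0 ` (P - {a0})"
      using C_cases[of "zt a b"] zt_zero[OF that] level_vals(2)[OF a0] level_vals(3) by auto
    then obtain c where c: "c \<in> P" "c \<noteq> a0" "zt a b = zt a0 c" by blast
    then have "{a, b} = {a0, c}" using zt_eq[OF that a0 c(1)] by simp
    then show "a = a0 \<or> b = a0" by blast
  next
    assume "a = a0 \<or> b = a0"
    then show "zt a b \<in> C"
    proof
      assume "a = a0"
      then have "zt a b \<in> zt a0 ` (P - {a0})" using that by blast
      then show ?thesis by (simp add: C_def)
    next
      assume "b = a0"
      then have "zt b a \<in> zt a0 ` (P - {a0})" using that by blast
      then show ?thesis unfolding zt_comm[of a b] by (simp add: C_def)
    qed
  qed
  have oC: "om e \<in> C \<longleftrightarrow> e \<noteq> a0" if "e \<in> P" for e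
  proof
    assume "om e \<in> C"
    then have "om e \<in> om ` (P - {a0})"
      using C_cases[of "om e"] fo[OF that] level_vals(2)[OF a0] level_vals(3) by auto
    then show "e \<noteq> a0" using om_inj[OF that] a0 by blast
  qed (use that in \<open>auto simp: C_def\<close>)
  have vC: "v \<in> C" by (simp add: C_def)
  define U where "U = {x} \<union> P \<union> {zt a b | a b. a \<in> P \<and> b \<in> P \<and> a \<noteq> b} \<union> om ` P \<union> {v}"
  let ?R = "\<lambda>u. nb u \<subseteq> U \<and> (\<exists>t. {t \<in> nb u. (t \<in> C) \<noteq> (u \<in> C)} = {t})"
  have xR: "?R x"
  proof -
    have "{t \<in> nb x. (t \<in> C) \<noteq> (x \<in> C)} = {a0}" unfolding nbx using aC xC a0 by auto
    then show ?thesis by (auto simp: nbx U_def)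
  qed
  have aR: "?R a" if a: "a \<in> P" for a
  proof -
    have "\<exists>b\<in>P. b \<noteq> a \<and> (a \<noteq> a0 \<longrightarrow> b = a0)"
    proof (cases "a = a0")
      case True
      have "P \<noteq> {a}" using four by auto
      then show ?thesis using True a by blast
    qed (use a0 in auto)
    then obtain b where b: "b \<in> P" "a \<noteq> b" "a \<noteq> a0 \<longrightarrow> b = a0" by metis
    obtain e g where P: "P = {a, b, e, g}" "distinct [a, b, e, g]" by (rule rest[OF a b(1,2)])
    have I: "b \<in> P" "e \<in> P" "g \<in> P" using P(1) by auto
    have mem: "zt a b \<in> C" "zt a e \<in> C \<longleftrightarrow> a = a0" "zt a g \<in> C \<longleftrightarrow> a = a0"
      using zC[OF a I(1)] zC[OF a I(2)] zC[OF a I(3)] P(2) b(3) by auto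
    have "\<exists>t. {t \<in> nb a. (t \<in> C) \<noteq> (a \<in> C)} = {t}"
    proof (cases "a = a0")
      case True
      then have "{t \<in> nb a. (t \<in> C) \<noteq> (a \<in> C)} = {x}"
        unfolding nb_a(1)[OF P] aC[OF a] using mem xC by auto
      then show ?thesis by blast
    next
      case False
      then have "{t \<in> nb a. (t \<in> C) \<noteq> (a \<in> C)} = {zt a b}"
        unfolding nb_a(1)[OF P] aC[OF a] using mem xC by auto
      then show ?thesis by blast
    qed
    moreover have "nb a \<subseteq> U"
      unfolding nb_a(1)[OF P] U_def using a I P(2) by auto
    ultimately show ?thesis by blast
  qed
  have zR: "?R (zt a b)" if ab: "a \<in> P" "b \<in> P" "a \<noteq> b" for a b
  proof -
    have main: "?R (zt a b)" if ab: "a \<in> P" "b \<in> P" "a \<noteq> b" "b \<noteq> a0" for a b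
    proof -
      obtain e g where P: "P = {a, b, e, g}" "distinct [a, b, e, g]" by (rule rest[OF ab(1-3)])
      have I: "e \<in> P" "g \<in> P" using P(1) by auto
      have a0': "a0 = a \<or> a0 = e \<or> a0 = g" using a0 ab(4) unfolding P(1) by auto
      have N: "nb (zt a b) = {a, b, om e, om g}" by (rule nb_zt_om[OF P])
      have mem: "a \<in> C \<longleftrightarrow> a = a0" "b \<notin> C" "om e \<in> C \<longleftrightarrow> e \<noteq> a0" "om g \<in> C \<longleftrightarrow> g \<noteq> a0" "zt a b \<in> C \<longleftrightarrow> a = a0"
        using aC ab oC[OF I(1)] oC[OF I(2)] zC[OF ab(1-3)] by auto
      have "\<exists>t. {t \<in> nb (zt a b). (t \<in> C) \<noteq> (zt a b \<in> C)} = {t}"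
      proof -
        from a0' consider "a0 = a" | "a0 = e" | "a0 = g" by blast
        then show ?thesis
        proof cases
          case 1
          then have "{t \<in> nb (zt a b). (t \<in> C) \<noteq> (zt a b \<in> C)} = {b}"
            unfolding N mem(5) using mem P(2) by auto
          then show ?thesis by blast
        next
          case 2
          then have "{t \<in> nb (zt a b). (t \<in> C) \<noteq> (zt a b \<in> C)} = {om g}"
            unfolding N mem(5) using mem P(2) by auto
          then show ?thesis by blast
        next
          case 3
          then have "{t \<in> nb (zt a b). (t \<in> C) \<noteq> (zt a b \<in> C)} = {om e}"
            unfolding N mem(5) using mem P(2) by auto
          then show ?thesis by blast
        qed
      qed
      moreover have "nb (zt a b) \<subseteq> U" unfolding N U_def using ab I by auto
      ultimately show ?thesis by blast
    qed
    show ?thesis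
    proof (cases "b = a0")
      case True
      then show ?thesis using main[OF ab(2,1)] ab(3) zt_comm[of a b] by simp
    qed (rule main[OF ab])
  qed
  have oR: "?R (om g)" if g: "g \<in> P" for g
  proof -
    have "\<exists>a\<in>P. a \<noteq> g \<and> (g \<noteq> a0 \<longrightarrow> a = a0)"
    proof (cases "g = a0")
      case True
      have "P \<noteq> {g}" using four by auto
      then show ?thesis using True g by blast
    qed (use a0 in auto)
    then obtain a where a: "a \<in> P" "a \<noteq> g" "g \<noteq> a0 \<longrightarrow> a = a0" by metis
    obtain b e where Q: "P = {a, g, b, e}" "distinct [a, g, b, e]" by (rule rest[OF a(1) g a(2)])
    have P: "P = {a, b, e, g}" "distinct [a, b, e, g]" using Q by auto
    have I: "b \<in> P" "e \<in> P" using P(1) by auto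
    have N: "nb (om g) = {zt a b, zt a e, zt b e, v}" by (rule v(3)[OF P])
    have mem: "zt a b \<in> C \<longleftrightarrow> g \<noteq> a0" "zt a e \<in> C \<longleftrightarrow> g \<noteq> a0" "zt b e \<notin> C"
      using zC[OF a(1) I(1)] zC[OF a(1) I(2)] zC[OF I] P(2) a(3) a0 P(1) by auto
    have "\<exists>t. {t \<in> nb (om g). (t \<in> C) \<noteq> (om g \<in> C)} = {t}"
    proof (cases "g = a0")
      case True
      then have "{t \<in> nb (om g). (t \<in> C) \<noteq> (om g \<in> C)} = {v}"
        unfolding N oC[OF g] using mem vC by auto
      then show ?thesis by blast
    next
      case False
      then have "{t \<in> nb (om g). (t \<in> C) \<noteq> (om g \<in> C)} = {zt b e}"
        unfolding N oC[OF g] using mem vC by auto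
      then show ?thesis by blast
    qed
    moreover have "nb (om g) \<subseteq> U" unfolding N U_def using a(1) I P(2) by auto
    ultimately show ?thesis by blast
  qed
  have vR: "?R v"
  proof -
    have "{t \<in> nb v. (t \<in> C) \<noteq> (v \<in> C)} = {om a0}" unfolding v(2) using oC vC a0 by auto
    then show ?thesis by (auto simp: v(2) U_def)
  qed
  have R: "?R u" if "u \<in> U" for u
  proof -
    from that consider "u = x" | "u \<in> P" | a b where "u = zt a b" "a \<in> P" "b \<in> P" "a \<noteq> b"
      | g where "g \<in> P" "u = om g" | "u = v"
      unfolding U_def by blast
    then show ?thesis
    proof cases
      case 1
      show ?thesis unfolding 1 by (rule xR)
    next
      case 2
      then show ?thesis by (rule aR)
    next
      case (3 a b)
      show ?thesis unfolding 3(1) by (rule zR[OF 3(2-4)])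
    next
      case (4 g)
      show ?thesis unfolding 4(2) by (rule oR[OF 4(1)])
    next
      case 5
      show ?thesis unfolding 5 by (rule vR)
    qed
  qed
  have "V = U"
  proof (rule closed_list)
    show "U \<subseteq> V"
    proof
      fix u assume "u \<in> U"
      then obtain t where "{t \<in> nb u. (t \<in> C) \<noteq> (u \<in> C)} = {t}" using R by blast
      then have "t \<in> nb u" by blast
      then show "u \<in> V" using adjV by blast
    qed
    show "U \<noteq> {}" by (simp add: U_def)
    show "\<And>u. u \<in> U \<Longrightarrow> nb u \<subseteq> U" using R by blast
  qed
  then have "is_cut C" unfolding is_cut_def using R by blast
  then show ?thesis by blast
qed

end

section \<open>Graphs of degree at most three\<close>

context cd_graph
begin

lemma cut_list:
  assumes "U \<noteq> {}" "U \<subseteq> V" "\<And>u. u \<in> U \<Longrightarrow> nb u \<subseteq> U"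
    "\<And>u. u \<in> U \<Longrightarrow> \<exists>t. {t \<in> nb u. (t \<in> S) \<noteq> (u \<in> S)} = {t}"
  shows "is_cut S"
  unfolding is_cut_def using closed_list[OF assms(2,1,3)] assms(4) by blast

lemma degree_0: "d = 0 \<Longrightarrow> \<exists>x. V = {x}"
proof -
  assume d: "d = 0"
  obtain x where x: "x \<in> V" using V_ne by blast
  have "nb x = {}" using reg[OF x] d by simp
  then have "V = {x}" using x by (intro closed_list) auto
  then show ?thesis by blast
qed

lemma degree_1: 
  assumes d: "d = 1"
  shows "\<exists>S. is_cut S"
proof -
  obtain x where x: "x \<in> V" using V_ne by blast
  then obtain y where y: "nb x = {y}" using reg[OF x] d card_1_singletonE by metis
  have yV: "y \<in> V" and xy: "x \<in> nb y" using adjV[of y x] adj_sym[of y x] y by auto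
  obtain t where "nb y = {t}" using reg[OF yV] d card_1_singletonE by metis
  then have ny: "nb y = {x}" using xy by auto
  have "x \<noteq> y" using adj_irr[of x] y by auto
  then have C: "{t \<in> nb x. (t \<in> {x}) \<noteq> (x \<in> {x})} = {y}" "{t \<in> nb y. (t \<in> {x}) \<noteq> (y \<in> {x})} = {x}"
    unfolding y ny by auto
  have "is_cut {x}"
    proof (rule cut_list[of "{x, y}"])
      show "{x, y} \<subseteq> V" using x yV by simp
      show "\<And>u. u \<in> {x, y} \<Longrightarrow> nb u \<subseteq> {x, y}"
        by (elim insertE emptyE; hypsubst) (simp_all add: y ny)
      show "\<And>u. u \<in> {x, y} \<Longrightarrow> \<exists>t. {t \<in> nb u. (t \<in> {x}) \<noteq> (u \<in> {x})} = {t}"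
        by (elim insertE emptyE; hypsubst) (rule exI, rule C)+
    qed simp
  then show ?thesis by blast
qed

text \<open>By \<open>cd_diag\<close> an edge in no triangle lies in a square, so the cycle has
  length three or four.\<close>

lemma degree_2:
  assumes d: "d = 2"
  shows "(card V = 3 \<and> (\<forall>v\<in>V. nb v = V - {v})) \<or> (\<exists>S. is_cut S)"
proof -
  have two: "\<exists>t. nb v = {a, t} \<and> t \<noteq> a \<and> t \<noteq> v" if "a \<in> nb v" for v a
  proof -
    have "card (nb v - {a}) = 1" using reg[of v] adjV[OF that] d that by simp
    then obtain t where "nb v - {a} = {t}" by (rule card_1_singletonE)
    then have "nb v = {a, t}" "t \<noteq> a" using that by blast+
    then show ?thesis using adj_irr[of v] by auto
  qed
  obtain x where x: "x \<in> V" using V_ne by blast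
  have "nb x \<noteq> {}" using reg[OF x] d by auto
  then obtain a where a: "a \<in> nb x" by blast
  obtain b where b: "nb x = {a, b}" "b \<noteq> a" "b \<noteq> x" using two[OF a] by blast
  have xa: "x \<in> nb a" and xb: "x \<in> nb b" using adj_sym[of a x] adj_sym[of b x] b(1) by auto
  have ax: "a \<noteq> x" using a adj_irr by blast
  obtain z where z: "nb a = {x, z}" "z \<noteq> x" "z \<noteq> a" using two[OF xa] by blast
  obtain z' where z': "nb b = {x, z'}" "z' \<noteq> x" "z' \<noteq> b" using two[OF xb] by blast
  show ?thesis
  proof (cases "z = b")
    case True
    then have "a \<in> nb b" using adj_sym[of b a] z(1) by simp
    then have "z' = a" using z' ax by auto
    then have N: "nb a = {x, b}" "nb b = {x, a}" using z z' True by auto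
    have "V = {x, a, b}"
      by (rule closed_list, use x adjV[OF xa] adjV[OF xb] in simp, simp,
        elim insertE emptyE; hypsubst) (simp_all add: b(1) N)
    then have "card V = 3 \<and> (\<forall>v\<in>V. nb v = V - {v})" using b N ax by auto
    then show ?thesis ..
  next
    case False
    have no: "nb x \<inter> nb a = {}" using b z False ax by auto
    have aV: "a \<in> V" and zV: "z \<in> V" using adjV[OF xa] adjV[of z a] z(1) by auto
    have "nb a - {x} = {z}" using z by auto
    then have s: "1 / real (card (nb x \<inter> nb z)) \<le> 1 / 2"
      using cd_diag[OF x a no] d by simp
    have az: "a \<in> nb z" using adj_sym[of z a] z(1) by simp
    have "b \<in> nb z"
    proof (rule ccontr)
      assume "b \<notin> nb z"
      then have "nb x \<inter> nb z = {a}" using b(1) az by auto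
      then show False using s by simp
    qed
    then have zb: "z = z'" using adj_sym[of b z] z'(1) z(2) by auto
    obtain t where "nb z = {a, t}" using two[OF az] by blast
    then have nz: "nb z = {a, b}" using \<open>b \<in> nb z\<close> b(2) by auto
    note N = b(1) z(1) z'(1)[folded zb] nz
    let ?S = "{x, a}"
    have C: "{t \<in> nb x. (t \<in> ?S) \<noteq> (x \<in> ?S)} = {b}" "{t \<in> nb a. (t \<in> ?S) \<noteq> (a \<in> ?S)} = {z}"
      "{t \<in> nb b. (t \<in> ?S) \<noteq> (b \<in> ?S)} = {x}" "{t \<in> nb z. (t \<in> ?S) \<noteq> (z \<in> ?S)} = {a}"
      unfolding N using b z False ax by auto
    have "is_cut ?S"
    proof (rule cut_list[of "{x, a, b, z}"])
      show "{x, a, b, z} \<subseteq> V" using x aV zV adjV[OF xb] by simp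
      show "\<And>u. u \<in> {x, a, b, z} \<Longrightarrow> nb u \<subseteq> {x, a, b, z}"
        by (elim insertE emptyE; hypsubst) (simp_all add: N)
      show "\<And>u. u \<in> {x, a, b, z} \<Longrightarrow> \<exists>t. {t \<in> nb u. (t \<in> ?S) \<noteq> (u \<in> ?S)} = {t}"
        by (elim insertE emptyE; hypsubst) (rule exI, rule C)+
    qed simp
    then show ?thesis by blast
  qed
qed

text \<open>By \<open>cubic_square\<close> every path of length two from \<open>x\<close> lies in a
  square. If some other vertex is adjacent to all three neighbours of \<open>x\<close>, the graph
  closes up to the complete bipartite graph; otherwise each vertex at distance two is adjacent to
  exactly two of them, which gives the hexagon of a 3-cube.\<close>

lemma cubic_triangle_free:
  assumes d: "d = 3" and x: "x \<in> V" and tf: "\<And>u v. u \<in> V \<Longrightarrow> v \<in> nb u \<Longrightarrow> nb u \<inter> nb v = {}"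
  shows "(\<exists>X Y. V = X \<union> Y \<and> X \<inter> Y = {} \<and> card X = 3 \<and> card Y = 3 \<and>
      (\<forall>v\<in>X. nb v = Y) \<and> (\<forall>v\<in>Y. nb v = X)) \<or> (\<exists>S. is_cut S)"
proof -
  have c3: "card (nb v) = 3" if "v \<in> V" for v using reg[OF that] d by simp
  obtain y1 y2 y3 where y: "nb x = {y1, y2, y3}" "y1 \<noteq> y2" "y2 \<noteq> y3" "y3 \<noteq> y1"
    using c3[OF x] by (auto simp: card_3_iff)
  have yn: "y1 \<in> nb x" "y2 \<in> nb x" "y3 \<in> nb x" using y(1) by auto
  have xy: "x \<in> nb y" "y \<in> V" if "y \<in> nb x" for y using that adj_sym adjV by blast+
  have next_y: "\<exists>v\<in>nb x. v \<noteq> y \<and> p \<in> nb v" if yp: "y \<in> nb x" "p \<in> nb y" "p \<noteq> x" for y p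
  proof -
    have no: "nb x \<inter> nb y = {}" by (rule tf[OF x yp(1)])
    obtain v where "v \<in> nb x" "v \<noteq> y" "v \<in> nb p"
      by (rule cubic_square[OF d yp(1) no yp(2,3)])
    then show ?thesis using adj_sym by blast
  qed
  have ny: "p \<notin> nb x" if "y \<in> nb x" "p \<in> nb y" for y p
    using tf[OF x that(1)] that(2) by blast
  show ?thesis
  proof (cases "\<exists>z. z \<noteq> x \<and> y1 \<in> nb z \<and> y2 \<in> nb z \<and> y3 \<in> nb z")
    case True
    then obtain z where z: "z \<noteq> x" "y1 \<in> nb z" "y2 \<in> nb z" "y3 \<in> nb z" by blast
    have th: "\<exists>t. nb y = {x, z, t} \<and> t \<noteq> x \<and> t \<noteq> z" if "y \<in> nb x" "y \<in> nb z" for y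
    proof -
      have "x \<in> nb y" "z \<in> nb y" "y \<in> V" using that adj_sym adjV by blast+
      then show ?thesis using nb_third[OF c3, of y x z] z(1) by metis
    qed
    obtain t1 where t1: "nb y1 = {x, z, t1}" "t1 \<noteq> x" "t1 \<noteq> z" using th[OF yn(1) z(2)] by blast
    obtain t2 where t2: "nb y2 = {x, z, t2}" "t2 \<noteq> x" "t2 \<noteq> z" using th[OF yn(2) z(3)] by blast
    obtain t3 where t3: "nb y3 = {x, z, t3}" "t3 \<noteq> x" "t3 \<noteq> z" using th[OF yn(3) z(4)] by blast
    have "t1 = t2 \<or> t1 = t3"
      using next_y[OF yn(1), of t1] t1 t2 t3 unfolding y(1) by auto
    moreover have "t2 = t1 \<or> t2 = t3"
      using next_y[OF yn(2), of t2] t1 t2 t3 unfolding y(1) by auto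
    moreover have "t3 = t1 \<or> t3 = t2"
      using next_y[OF yn(3), of t3] t1 t2 t3 unfolding y(1) by auto
    ultimately have te: "t2 = t1" "t3 = t1" by auto
    note N = t1(1) t2(1)[unfolded te] t3(1)[unfolded te]
    have zV: "z \<in> V" using adjV[OF z(2)] by simp
    have tn: "y1 \<in> nb t1" "y2 \<in> nb t1" "y3 \<in> nb t1"
      using adj_sym[of t1 y1] adj_sym[of t1 y2] adj_sym[of t1 y3] N by auto
    have tV: "t1 \<in> V" using adjV[OF tn(1)] by simp
    have full: "nb v = {y1, y2, y3}" if "v \<in> V" "y1 \<in> nb v" "y2 \<in> nb v" "y3 \<in> nb v" for v
    proof -
      have "{y1, y2, y3} = nb v"
        by (rule card_subset_eq) (use that y c3[OF that(1)] in auto)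
      then show ?thesis ..
    qed
    have nz: "nb z = {y1, y2, y3}" by (rule full[OF zV z(2-4)])
    have nt: "nb t1 = {y1, y2, y3}" by (rule full[OF tV tn])
    have "V = {x, z, t1} \<union> {y1, y2, y3}"
      by (rule closed_list, use x zV tV xy(2)[OF yn(1)] xy(2)[OF yn(2)] xy(2)[OF yn(3)] in simp, simp,
        elim UnE insertE emptyE; hypsubst) (simp_all add: y(1) N nz nt)
    moreover have "{x, z, t1} \<inter> {y1, y2, y3} = {}"
    proof -
      have "v \<notin> {y1, y2, y3}" if "v \<in> {x, z, t1}" for v
        using that adj_irr[of v] y(1) nz nt by auto
      then show ?thesis by blast
    qed
    moreover have "card {x, z, t1} = 3" "card {y1, y2, y3} = 3" using z(1) t1 y by auto
    moreover have "\<forall>v\<in>{x, z, t1}. nb v = {y1, y2, y3}" using y(1) nz nt by auto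
    moreover have "\<forall>v\<in>{y1, y2, y3}. nb v = {x, z, t1}" using N by auto
    ultimately show ?thesis by blast
  next
    case False
    have noall: "\<not> (p \<in> nb y1 \<and> p \<in> nb y2 \<and> p \<in> nb y3)" if "p \<noteq> x" for p
      using False that adj_sym by blast
    obtain p q where pq: "nb y1 = {x, p, q}" "p \<noteq> x" "q \<noteq> x" "p \<noteq> q"
    proof -
      have "card (nb y1 - {x}) = 2" using c3[OF xy(2)[OF yn(1)]] xy(1)[OF yn(1)] by simp
      then obtain p q where pq: "nb y1 - {x} = {p, q}" "p \<noteq> q" by (auto simp: card_2_iff)
      then have "nb y1 = {x, p, q}" "p \<noteq> x" "q \<noteq> x" using xy(1)[OF yn(1)] by blast+
      then show ?thesis using that pq(2) by blast
    qed
    have P: "(p \<in> nb y2) \<noteq> (p \<in> nb y3)" "(q \<in> nb y2) \<noteq> (q \<in> nb y3)"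
      using next_y[OF yn(1), of p] next_y[OF yn(1), of q] noall[of p] noall[of q] pq unfolding y(1) by auto
    \<comment> \<open>If \<open>y1\<close> and \<open>b\<close> had the same neighbourhood, a vertex
      other than \<open>x\<close> next to \<open>c\<close> would be adjacent to all three neighbours
      of \<open>x\<close>.\<close>
    have notboth: False
      if h: "nb y1 = {x, p, q}" "p \<noteq> x" "q \<noteq> x" "p \<noteq> q" "p \<in> nb b" "q \<in> nb b" "{y1, b, c} = nb x" "b \<noteq> y1" "c \<noteq> y1" "c \<noteq> b"
      for p q b c
    proof -
      have bc: "b \<in> nb x" "c \<in> nb x" using h(7) by blast+
      have "{x, p, q} = nb b"
        by (rule card_subset_eq) (use h xy[OF bc(1)] c3 in auto)
      then have nb: "nb b = {x, p, q}" ..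
      have "card (nb c - {x}) = 2" using c3[OF xy(2)[OF bc(2)]] xy(1)[OF bc(2)] by simp
      then have "nb c - {x} \<noteq> {}" by (metis card.empty zero_neq_numeral)
      then obtain r where r: "r \<in> nb c" "r \<noteq> x" by blast
      obtain v where v: "v \<in> nb x" "v \<noteq> c" "r \<in> nb v" using next_y[OF bc(2) r] by blast
      have "v = y1 \<or> v = b" using v(1,2) unfolding h(7)[symmetric] by blast
      then have "r \<in> {x, p, q}" using v(3) h(1) nb by auto
      then have "r \<in> nb y1" "r \<in> nb b" using h(1) nb by auto
      moreover have "{y1, b, c} = {y1, y2, y3}" using h(7) y(1) by simp
      then have "r \<in> nb y1 \<and> r \<in> nb y2 \<and> r \<in> nb y3"
        using calculation r(1) by (metis insertE insertI1 insert_commute singletonD)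
      ultimately show False using noall[OF r(2)] by blast
    qed
    have "\<not> (p \<in> nb y2 \<and> q \<in> nb y2)"
      using notboth[OF pq, of y2 y3] y by auto
    moreover have "\<not> (p \<in> nb y3 \<and> q \<in> nb y3)"
      using notboth[OF pq, of y3 y2] y by (auto simp: insert_commute)
    ultimately obtain z2 z3 where z: "nb y1 = {x, z2, z3}" "z2 \<noteq> x" "z3 \<noteq> x" "z2 \<noteq> z3"
      "z3 \<in> nb y2" "z3 \<notin> nb y3" "z2 \<in> nb y3" "z2 \<notin> nb y2"
    proof (cases "p \<in> nb y2")
      case True
      then show ?thesis using that[of q p] P pq \<open>\<not> (p \<in> nb y2 \<and> q \<in> nb y2)\<close> by (auto simp: insert_commute)
    next
      case False
      then show ?thesis using that[of p q] P pq \<open>\<not> (p \<in> nb y3 \<and> q \<in> nb y3)\<close> by auto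
    qed
    obtain r where r: "nb y2 = {x, z3, r}" "r \<noteq> x" "r \<noteq> z3"
      using nb_third[OF c3[OF xy(2)[OF yn(2)]] xy(1)[OF yn(2)] z(5)] z(3) by metis
    have "r \<in> nb y1 \<or> r \<in> nb y3"
      using next_y[OF yn(2), of r] r unfolding y(1) by auto
    moreover have "r \<notin> nb y1"
    proof
      assume "r \<in> nb y1"
      then have "r = z2" using z(1) r by auto
      then show False using z(8) r(1) by auto
    qed
    ultimately have r3: "r \<in> nb y3" by blast
    have rz: "r \<noteq> z2" using z(8) r(1) by auto
    have "{x, r, z2} = nb y3"
      by (rule card_subset_eq) (use xy[OF yn(3)] r3 z(7) rz r(2) z(2) c3 in auto)
    then have n3: "nb y3 = {x, r, z2}" ..
    have notx: "z2 \<notin> nb x" "z3 \<notin> nb x" "r \<notin> nb x"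
      using ny[OF yn(1), of z2] ny[OF yn(1), of z3] ny[OF yn(2), of r] z(1) r(1) by auto
    have "u \<noteq> v" if "u \<in> nb x" "v \<notin> nb x" for u v using that by blast
    note ne = this[OF yn(1)] this[OF yn(2)] this[OF yn(3)]
    have "distinct [x, y1, y2, y3, r, z2, z3]"
      using y(2-4) r(2,3) rz z(2-4) ne[OF adj_irr] ne[OF notx(1)] ne[OF notx(2)] ne[OF notx(3)]
      by simp
    then have "hexagon x y1 y2 y3 r z2 z3"
      unfolding hexagon_def by (intro conjI y(1) z(1) r(1) n3)
    then show ?thesis by (rule disjI2[OF hexagon_cut[OF d]])
  qed
qed

text \<open>The third neighbours \<open>c\<close>, \<open>p\<close>, \<open>q\<close> of the
  vertices of the triangle decide. If all are equal, the graph is complete; if all differ, it is the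
  prism, cut between its two triangles; if just two coincide, some vertex has too few possible
  neighbours.\<close>

lemma cubic_triangle:
  assumes d: "d = 3" and x: "x \<in> V" and ab: "a \<in> nb x" "b \<in> nb x" "b \<in> nb a"
  shows "(card V = 4 \<and> (\<forall>v\<in>V. nb v = V - {v})) \<or> (\<exists>S. is_cut S)"
proof -
  have c3: "card (nb v) = 3" if "v \<in> V" for v using reg[OF that] d by simp
  have aV: "a \<in> V" and bV: "b \<in> V" using ab adjV by blast+
  have sy: "x \<in> nb a" "x \<in> nb b" "a \<in> nb b" using ab adj_sym by blast+
  have ne: "a \<noteq> b" "a \<noteq> x" "b \<noteq> x" using ab adj_irr by blast+
  obtain c where c: "nb x = {a, b, c}" "c \<noteq> a" "c \<noteq> b" using nb_third[OF c3[OF x] ab(1,2) ne(1)] .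
  have cx: "c \<noteq> x" using c(1) adj_irr[of x] by auto
  have xc: "x \<in> nb c" using adj_sym[of c x] c(1) by simp
  have cV: "c \<in> V" using adjV[OF xc] by simp
  obtain p where p: "nb a = {x, b, p}" "p \<noteq> x" "p \<noteq> b" using nb_third[OF c3[OF aV] sy(1) ab(3)] ne by metis
  obtain q where q: "nb b = {x, a, q}" "q \<noteq> x" "q \<noteq> a" using nb_third[OF c3[OF bV] sy(2,3)] ne by metis
  have pa: "p \<noteq> a" "q \<noteq> b" using p(1) q(1) adj_irr[of a] adj_irr[of b] by auto
  have one_side: False
    if h: "nb x = {a, b, c}" "nb a = {x, b, c}" "nb b = {x, a, q}" "q \<noteq> x" "q \<noteq> a" "q \<noteq> b" "q \<noteq> c" "a \<noteq> x"
    for a b c q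
  proof -
    have qb: "q \<in> nb b" using h(3) by simp
    have qV: "q \<in> V" using adjV[OF qb] by simp
    have xq: "x \<notin> nb q" "a \<notin> nb q" using adj_comm[of x q] adj_comm[of a q] h by auto
    have no: "nb b \<inter> nb q = {}" unfolding h(3) using xq adj_irr[of q] by simp
    have "r = b \<or> r = c" if r: "r \<in> nb q" for r
    proof (rule ccontr)
      assume n: "\<not> ?thesis"
      then have "r \<noteq> b" by simp
      obtain v where v: "v \<in> nb b" "v \<noteq> q" "v \<in> nb r"
        by (rule cubic_square[OF d qb no r \<open>r \<noteq> b\<close>])
      have "v = x \<or> v = a" using v(1,2) unfolding h(3) by blast
      moreover have "r \<in> nb v" by (rule adj_sym[OF v(3)])
      ultimately have "r \<in> {a, b, c, x}" using h(1,2) by auto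
      then show False using n r xq by auto
    qed
    then have "nb q \<subseteq> {b, c}" by blast
    then have "card (nb q) \<le> card {b, c}" by (intro card_mono) auto
    also have "\<dots> \<le> 2" by (simp add: card_insert_if)
    finally show False using c3[OF qV] by simp
  qed
  consider "p = c" "q = c" | "p = c" "q \<noteq> c" | "p \<noteq> c" "q = c" | "p \<noteq> c" "q \<noteq> c" by blast
  then show ?thesis
  proof cases
    case 1
    have "{x, a, b} = nb c"
      by (rule card_subset_eq)
        (use xc adj_sym[of c a] adj_sym[of c b] p(1) q(1) 1 c3[OF cV] ne in auto)
    then have nc: "nb c = {x, a, b}" ..
    note N = c(1) p(1)[unfolded 1(1)] q(1)[unfolded 1(2)] nc
    have "V = {x, a, b, c}"
      by (rule closed_list, use x aV bV cV in simp, simp,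
        elim insertE emptyE; hypsubst) (simp_all add: N)
    then have "card V = 4 \<and> (\<forall>v\<in>V. nb v = V - {v})" using N ne c cx by auto
    then show ?thesis ..
  next
    case 2
    then show ?thesis using one_side[of a b c q] c(1) p(1) q pa ne by auto
  next
    case 3
    then show ?thesis using one_side[of b a c p] c(1) p q(1) pa ne by (auto simp: insert_commute)
  next
    case 4
    have "c \<notin> nb a" "c \<notin> nb b" using p(1) q(1) 4 cx c by auto
    then have acb: "a \<notin> nb c" "b \<notin> nb c" using adj_sym by blast+
    have no: "nb x \<inter> nb c = {}" unfolding c(1) using acb adj_irr[of c] by simp
    have cn: "c \<in> nb x" using c(1) by simp
    have up: "r = p \<or> r = q" if r: "r \<in> nb c" "r \<noteq> x" for r
    proof -
      obtain v where v: "v \<in> nb x" "v \<noteq> c" "v \<in> nb r" by (rule cubic_square[OF d cn no r])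
      have "v = a \<or> v = b" using v(1,2) unfolding c(1) by blast
      moreover have "r \<in> nb v" by (rule adj_sym[OF v(3)])
      moreover have "r \<noteq> a" "r \<noteq> b" using acb r(1) by auto
      ultimately show ?thesis using p(1) q(1) r(2) by auto
    qed
    have "nb c \<subseteq> {x, p, q}" using up by blast
    moreover have "card {x, p, q} \<le> card (nb c)" unfolding c3[OF cV] by (simp add: card_insert_if)
    ultimately have nc: "nb c = {x, p, q}" by (intro card_seteq) auto
    then have pq: "p \<noteq> q" using c3[OF cV] by (auto simp: card_insert_if split: if_splits)
    have pn: "a \<in> nb p" "c \<in> nb p" "b \<in> nb q" "c \<in> nb q"
      using adj_sym[of p a] adj_sym[of p c] adj_sym[of q b] adj_sym[of q c] p(1) q(1) nc by auto
    have pV: "p \<in> V" and qV: "q \<in> V" using adjV pn by blast+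
    obtain s where s: "nb p = {a, c, s}" "s \<noteq> a" "s \<noteq> c" using nb_third[OF c3[OF pV] pn(1,2)] c(2) by metis
    have xp: "x \<notin> nb p" "b \<notin> nb p"
      using adj_comm[of x p] adj_comm[of b p] c(1) q(1) p 4 pa pq by auto
    have nop: "nb a \<inter> nb p = {}" unfolding p(1) using xp adj_irr[of p] by simp
    have pa': "p \<in> nb a" and sp: "s \<in> nb p" using p(1) s(1) by auto
    obtain v where v: "v \<in> nb a" "v \<noteq> p" "v \<in> nb s" by (rule cubic_square[OF d pa' nop sp s(2)])
    have "v = x \<or> v = b" using v(1,2) unfolding p(1) by blast
    moreover have "s \<in> nb v" by (rule adj_sym[OF v(3)])
    moreover have "s \<noteq> x" "s \<noteq> b" using sp xp by auto
    ultimately have "s = q" using c(1) q(1) s by auto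
    then have np: "nb p = {a, c, q}" using s by simp
    have "{b, c, p} = nb q"
      by (rule card_subset_eq) (use pn adj_sym[of q p] np c3[OF qV] c p 4 pa in auto)
    then have nq: "nb q = {b, c, p}" ..
    note N = c(1) p(1) q(1) nc np nq
    have out: "c \<notin> {x, a, b}" "p \<notin> {x, a, b}" "q \<notin> {x, a, b}" using c cx p q pa by auto
    have C: "{t \<in> nb x. (t \<in> {x, a, b}) \<noteq> (x \<in> {x, a, b})} = {c}"
      "{t \<in> nb a. (t \<in> {x, a, b}) \<noteq> (a \<in> {x, a, b})} = {p}"
      "{t \<in> nb b. (t \<in> {x, a, b}) \<noteq> (b \<in> {x, a, b})} = {q}"
      "{t \<in> nb c. (t \<in> {x, a, b}) \<noteq> (c \<in> {x, a, b})} = {x}"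
      "{t \<in> nb p. (t \<in> {x, a, b}) \<noteq> (p \<in> {x, a, b})} = {a}"
      "{t \<in> nb q. (t \<in> {x, a, b}) \<noteq> (q \<in> {x, a, b})} = {b}"
      unfolding N using out by auto
    have "is_cut {x, a, b}"
    proof (rule cut_list[of "{x, a, b, c, p, q}"])
      show "{x, a, b, c, p, q} \<subseteq> V" using x aV bV cV pV qV by simp
      show "\<And>u. u \<in> {x, a, b, c, p, q} \<Longrightarrow> nb u \<subseteq> {x, a, b, c, p, q}"
        by (elim insertE emptyE; hypsubst) (simp_all add: N)
      show "\<And>u. u \<in> {x, a, b, c, p, q} \<Longrightarrow> \<exists>t. {t \<in> nb u. (t \<in> {x, a, b}) \<noteq> (u \<in> {x, a, b})} = {t}"
        by (elim insertE emptyE; hypsubst) (rule exI, rule C)+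
    qed simp
    then show ?thesis by blast
  qed
qed

lemma degree_3:
  assumes d: "d = 3"
  shows "(card V = 4 \<and> (\<forall>v\<in>V. nb v = V - {v})) \<or>
    (\<exists>X Y. V = X \<union> Y \<and> X \<inter> Y = {} \<and> card X = 3 \<and> card Y = 3 \<and>
      (\<forall>v\<in>X. nb v = Y) \<and> (\<forall>v\<in>Y. nb v = X)) \<or> (\<exists>S. is_cut S)"
proof (cases "\<exists>u\<in>V. \<exists>v\<in>nb u. nb u \<inter> nb v \<noteq> {}")
  case True
  then obtain u v w where u: "u \<in> V" "v \<in> nb u" "w \<in> nb u" "w \<in> nb v" by blast
  show ?thesis
    using cubic_triangle[OF d u]
    by (elim disjE) (rule disjI1, assumption, rule disjI2, rule disjI2, assumption)
next
  case False
  obtain x where x: "x \<in> V" using V_ne by blast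
  have tf: "nb u \<inter> nb v = {}" if "u \<in> V" "v \<in> nb u" for u v using False that by blast
  show ?thesis by (rule disjI2, rule cubic_triangle_free[OF d x tf])
qed

lemma dim_E_zero: "fun_space.dim E = 0 \<longleftrightarrow> E = {\<lambda>x. 0}"
proof
  assume 0: "fun_space.dim E = 0"
  obtain B where "E \<subseteq> fun_space.span B" "finite B" "card B = fun_space.dim E"
    using finite_basis[OF spans_E] by metis
  then have "E \<subseteq> {0}" using 0 by simp
  then show "E = {\<lambda>x. 0}" using E_0 by (auto simp: zero_fun_def)
next
  assume "E = {\<lambda>x. 0}"
  then have "spans_le E 0" using spans_zero spans_le_mono[of E "{f. f = (\<lambda>x. 0)}"] by simp
  then show "fun_space.dim E = 0" using spans_le_dim by blast
qed

lemma cut_dim: "is_cut S \<Longrightarrow> fun_space.dim E \<noteq> 0"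
proof
  assume "is_cut S" "fun_space.dim E = 0"
  then obtain f x where "locmax f x" "card (down f x) = 1" "f \<in> {\<lambda>x. 0}"
    using cut_locmax dim_E_zero locmaxD(1) by metis
  then show False using locmax_down_empty[of f x] by auto
qed

section \<open>Existence of a block of size one\<close>

text \<open>The induction hypothesis enters only through sizes. Passing to degree
  \<open>d - 2\<close> reduces the deficit, degree minus dimension, from at most 3 to at most 2.
  This matters: at deficit 3 a complete graph on four vertices may remain, half as large as the cube
  of the same degree, and a doubling of sizes would no longer be contradictory.\<close>

lemma ex_one_block:
  assumes E: "fun_space.dim E \<noteq> 0" and k: "d \<le> fun_space.dim E + 3"
    and IH: "\<And>W. cd_graph W (sub_nb nb W) (d - 2) \<Longrightarrow> d - 2 \<le> fun_space.dim (eig2 W (sub_nb nb W)) + 2 \<Longrightarrow>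
      card W = 2 ^ (d - 2) \<or> 4 * card W = 3 * 2 ^ (d - 2)"
  shows "\<exists>f x. locmax f x \<and> card (down f x) = 1"
proof -
  obtain g where "g \<in> E" "g \<noteq> (\<lambda>x. 0)" using E dim_E_zero E_0 by auto
  then obtain s f x where ms: "min_supp s" and m: "locmax f x" and f0: "f \<noteq> (\<lambda>x. 0)"
    and s: "card (down f x) = s" and s1: "s \<ge> 1"
    using ex_min_supp by metis
  have min: "minimal_at f u" if "u \<in> lev f x" for u by (rule min_supp_lev[OF ms m f0 s that])
  consider "s = 1" | "s = 2" | "s \<ge> 3" using s1 by linarith
  then show ?thesis
  proof cases
    case 1
    then show ?thesis using m s by blast
  next
    case 2
    interpret B: two_block V nb d f x by unfold_locales (use m s 2 in auto)
    have "(\<exists>S. is_cut S) \<or> (\<exists>W Y. cd_graph W (sub_nb nb W) (d - 2) \<and> cd_graph Y (sub_nb nb Y) (d - 2)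
      \<and> card Y = 2 * card W \<and> fun_space.dim E \<le> Suc (fun_space.dim (eig2 W (sub_nb nb W)))
      \<and> fun_space.dim (eig2 W (sub_nb nb W)) \<le> fun_space.dim (eig2 Y (sub_nb nb Y)))"
      by (rule B.monodromy) (simp add: B.L_def min)
    then show ?thesis
    proof
      assume "\<exists>S. is_cut S"
      then show ?thesis using cut_locmax by blast
    next
      assume "\<exists>W Y. cd_graph W (sub_nb nb W) (d - 2) \<and> cd_graph Y (sub_nb nb Y) (d - 2)
      \<and> card Y = 2 * card W \<and> fun_space.dim E \<le> Suc (fun_space.dim (eig2 W (sub_nb nb W)))
      \<and> fun_space.dim (eig2 W (sub_nb nb W)) \<le> fun_space.dim (eig2 Y (sub_nb nb Y))"
      then obtain W Y where WY: "cd_graph W (sub_nb nb W) (d - 2)" "cd_graph Y (sub_nb nb Y) (d - 2)"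
        "card Y = 2 * card W" "fun_space.dim E \<le> Suc (fun_space.dim (eig2 W (sub_nb nb W)))"
        "fun_space.dim (eig2 W (sub_nb nb W)) \<le> fun_space.dim (eig2 Y (sub_nb nb Y))" by blast
      \<comment> \<open>None of the two admissible sizes is twice itself or twice the other.\<close>
      have "card W = 2 ^ (d - 2) \<or> 4 * card W = 3 * 2 ^ (d - 2)"
        by (rule IH[OF WY(1)]) (use WY(4) k in linarith)
      moreover have "card Y = 2 ^ (d - 2) \<or> 4 * card Y = 3 * 2 ^ (d - 2)"
        by (rule IH[OF WY(2)]) (use WY(4,5) k in linarith)
      moreover have "(2::nat) ^ (d - 2) > 0" by simp
      ultimately show ?thesis using WY(3) by linarith
    qed
  next
    case 3
    have "fun_space.dim E = 1"
    proof (rule ccontr)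
      assume "fun_space.dim E \<noteq> 1"
      then have "fun_space.dim E \<ge> 2" using E by linarith
      from min_supp_two_blocks[OF ms m f0 s this] show False using k 3 by linarith
    qed
    moreover have mx: "minimal_at f x" by (rule min) simp
    ultimately have "s \<le> d" "d \<le> 4" using minimal_dim[OF mx] s k by linarith+
    then consider "s = 3" "d = 3" | "s = 3" "d = 4" | "s = 4" "d = 4" using 3 by linarith
    then have "\<exists>S. is_cut S"
    proof cases
      case 1
      then show ?thesis using three_block_cubic[OF m] s by simp
    next
      case 2
      then show ?thesis using three_block_quartic[OF m] s by simp
    next
      case 3
      have xV: "x \<in> V" by (rule locmaxD(2)[OF m])
      \<comment> \<open>No neighbour lies outside the block, so the flatness condition in
        \<open>minimal_at\<close> is vacuous and can be applied to \<open>tri f f f\<close>.\<close>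
      have "down f x = nb x"
        by (rule card_subset_eq) (use s 3 reg[OF xV] in \<open>auto simp: down_def\<close>)
      then obtain c where c: "tri f f f = (\<lambda>x. c * f x)"
        using mx tri_E[of f f f] locmaxD(1)[OF m] unfolding minimal_at_def by blast
      interpret B: four_block V nb d f x c by unfold_locales (use m s 3 c in auto)
      show ?thesis by (rule B.cut)
    qed
    then show ?thesis using cut_locmax by blast
  qed
qed

end

section \<open>Splitting off a hypercube\<close>

definition cube :: "nat \<Rightarrow> (nat \<Rightarrow> bit) set" where
  "cube m = {..<m} \<rightarrow>\<^sub>E UNIV"

definition cube_step :: "nat \<Rightarrow> (nat \<Rightarrow> bit) \<Rightarrow> (nat \<Rightarrow> bit) \<Rightarrow> bool" where
  "cube_step m a a' \<longleftrightarrow> card {i. i < m \<and> a i \<noteq> a' i} = 1"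

text \<open>The factor \<open>B\<close> is a set of vertices with the adjacency given by
  \<open>nb\<close>, so a splitting found inside a subgraph can be extended to the whole
  graph.\<close>

definition cube_iso :: "'a set \<Rightarrow> ('a \<Rightarrow> 'a set) \<Rightarrow> 'a set \<Rightarrow> nat \<Rightarrow> ((nat \<Rightarrow> bit) \<times> 'a \<Rightarrow> 'a) \<Rightarrow> bool" where
  "cube_iso V nb B m \<phi> \<longleftrightarrow> bij_betw \<phi> (cube m \<times> B) V \<and>
    (\<forall>a\<in>cube m. \<forall>b\<in>B. \<forall>a'\<in>cube m. \<forall>b'\<in>B.
      \<phi> (a', b') \<in> nb (\<phi> (a, b)) \<longleftrightarrow> a = a' \<and> b' \<in> nb b \<or> cube_step m a a' \<and> b = b')"

lemma cube_0: "cube 0 = {\<lambda>_. undefined}" and cube_step_0: "\<not> cube_step 0 a a'"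
  by (simp_all add: cube_def cube_step_def)

lemma card_cube: "card (cube m) = 2 ^ m"
proof -
  have "(UNIV :: bit set) = {0, 1}" by (auto intro: bit.exhaust)
  then have "card (UNIV :: bit set) = 2"
    unfolding card_2_iff by (intro exI[of _ 0] exI[of _ 1] conjI) simp_all
  then show ?thesis by (simp add: cube_def card_PiE)
qed

lemma cube_eqI: "a \<in> cube m \<Longrightarrow> a' \<in> cube m \<Longrightarrow> (\<And>i. i < m \<Longrightarrow> a i = a' i) \<Longrightarrow> a = a'"
  unfolding cube_def by (rule PiE_ext) auto

lemma cube_restrict: "restrict a {..<m} \<in> cube m"
  by (simp add: cube_def)

lemma cube_Suc_eq:
  assumes "a \<in> cube (Suc m)" "a' \<in> cube (Suc m)"
  shows "a = a' \<longleftrightarrow> restrict a {..<m} = restrict a' {..<m} \<and> a m = a' m"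
proof
  assume h: "restrict a {..<m} = restrict a' {..<m} \<and> a m = a' m"
  have "a i = a' i" if "i < Suc m" for i
  proof (cases "i = m")
    case False
    then have "restrict a {..<m} i = restrict a' {..<m} i" using h by simp
    then show ?thesis using False that by simp
  qed (use h in simp)
  then show "a = a'" by (rule cube_eqI[OF assms])
qed simp

lemma cube_step_Suc:
  "cube_step (Suc m) a a' \<longleftrightarrow>
    restrict a {..<m} = restrict a' {..<m} \<and> a m \<noteq> a' m \<or>
    cube_step m (restrict a {..<m}) (restrict a' {..<m}) \<and> a m = a' m"
proof -
  let ?D = "{i. i < m \<and> a i \<noteq> a' i}"
  have D: "{i. i < m \<and> restrict a {..<m} i \<noteq> restrict a' {..<m} i} = ?D" by auto
  have e: "?D = {} \<longleftrightarrow> restrict a {..<m} = restrict a' {..<m}"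
    by (auto simp: restrict_def fun_eq_iff)
  have fin: "finite ?D" "m \<notin> ?D" by auto
  show ?thesis
  proof (cases "a m = a' m")
    case True
    then have "{i. i < Suc m \<and> a i \<noteq> a' i} = ?D" by (auto simp: less_Suc_eq)
    then show ?thesis using True unfolding cube_step_def D by simp
  next
    case False
    then have "{i. i < Suc m \<and> a i \<noteq> a' i} = insert m ?D" by (auto simp: less_Suc_eq)
    then have "card {i. i < Suc m \<and> a i \<noteq> a' i} = Suc (card ?D)" using fin by simp
    then have "cube_step (Suc m) a a' \<longleftrightarrow> ?D = {}" using fin unfolding cube_step_def by simp
    then show ?thesis using False e by simp
  qed
qed

lemma cube_Suc_ex:
  assumes "c \<in> cube m"
  obtains a where "a \<in> cube (Suc m)" "restrict a {..<m} = c" "a m = v"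
proof (rule that[of "c(m := v)"])
  show "c(m := v) \<in> cube (Suc m)"
    using assms by (auto simp: cube_def PiE_iff extensional_def)
  show "restrict (c(m := v)) {..<m} = c"
    using assms by (auto simp: cube_def PiE_iff extensional_def restrict_def fun_eq_iff)
qed simp

text \<open>The new last coordinate decides between \<open>W\<close> and its copy under
  \<open>\<tau>\<close>.\<close>

lemma cube_iso_double:
  assumes iso: "cube_iso W nb B m \<phi>"
    and V: "V = W \<union> \<tau> ` W" "W \<inter> \<tau> ` W = {}" and inj: "inj_on \<tau> W"
    and nb\<tau>: "\<forall>u\<in>W. \<forall>v\<in>W. (\<tau> v \<in> nb (\<tau> u) \<longleftrightarrow> v \<in> nb u) \<and> (\<tau> v \<in> nb u \<longleftrightarrow> v = u)"
    and comm: "\<And>u v. u \<in> nb v \<longleftrightarrow> v \<in> nb u"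
  shows "\<exists>\<psi>. cube_iso V nb B (Suc m) \<psi>"
proof -
  define \<sigma> where "\<sigma> c u = (if c = (0::bit) then u else \<tau> u)" for c u
  let ?r = "\<lambda>a :: nat \<Rightarrow> bit. restrict a {..<m}"
  define \<psi> where "\<psi> = (\<lambda>(a, b). \<sigma> (a m) (\<phi> (?r a, b)))"
  have \<phi>i: "inj_on \<phi> (cube m \<times> B)" and \<phi>W: "\<phi> ` (cube m \<times> B) = W"
    and \<phi>n: "\<And>a b a' b'. a \<in> cube m \<Longrightarrow> b \<in> B \<Longrightarrow> a' \<in> cube m \<Longrightarrow> b' \<in> B \<Longrightarrow>
      \<phi> (a', b') \<in> nb (\<phi> (a, b)) \<longleftrightarrow> a = a' \<and> b' \<in> nb b \<or> cube_step m a a' \<and> b = b'"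
    using iso unfolding cube_iso_def bij_betw_def by blast+
  have \<phi>in: "\<phi> (?r a, b) \<in> W" if "b \<in> B" for a b
    using \<phi>W cube_restrict that by blast
  have \<phi>eq: "\<phi> (?r a, b) = \<phi> (?r a', b') \<longleftrightarrow> ?r a = ?r a' \<and> b = b'" if "b \<in> B" "b' \<in> B" for a b a' b'
    using inj_on_eq_iff[OF \<phi>i, of "(?r a, b)" "(?r a', b')"] cube_restrict that by simp
  have \<sigma>eq: "\<sigma> c u = \<sigma> c' u' \<longleftrightarrow> c = c' \<and> u = u'" if "u \<in> W" "u' \<in> W" for c c' u u'
  proof -
    have "\<tau> u = \<tau> u' \<longleftrightarrow> u = u'" using inj_on_eq_iff[OF inj that] .
    moreover have "\<tau> u \<noteq> u'" "\<tau> u' \<noteq> u" using V(2) that by blast+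
    ultimately show ?thesis by (cases c; cases c') (auto simp: \<sigma>_def)
  qed
  have \<sigma>n: "\<sigma> c' u' \<in> nb (\<sigma> c u) \<longleftrightarrow> (if c = c' then u' \<in> nb u else u' = u)"
    if "u \<in> W" "u' \<in> W" for c c' u u'
  proof -
    have "\<tau> u' \<in> nb (\<tau> u) \<longleftrightarrow> u' \<in> nb u" "\<tau> u' \<in> nb u \<longleftrightarrow> u' = u" "\<tau> u \<in> nb u' \<longleftrightarrow> u = u'"
      using nb\<tau> that by blast+
    then show ?thesis using comm[of u' "\<tau> u"] by (cases c; cases c') (auto simp: \<sigma>_def)
  qed
  have "inj_on \<psi> (cube (Suc m) \<times> B)"
  proof (rule inj_onI, clarify)
    fix a b a' b'
    assume h: "a \<in> cube (Suc m)" "b \<in> B" "a' \<in> cube (Suc m)" "b' \<in> B" "\<psi> (a, b) = \<psi> (a', b')"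
    have "a m = a' m \<and> \<phi> (?r a, b) = \<phi> (?r a', b')"
      using h(5) \<sigma>eq[OF \<phi>in[OF h(2)] \<phi>in[OF h(4)]] by (simp add: \<psi>_def)
    then show "a = a' \<and> b = b'" using \<phi>eq[OF h(2,4)] cube_Suc_eq[OF h(1,3)] by blast
  qed
  moreover have "\<psi> ` (cube (Suc m) \<times> B) = V"
  proof (intro equalityI subsetI)
    fix v assume "v \<in> \<psi> ` (cube (Suc m) \<times> B)"
    then obtain a b where b: "b \<in> B" and v: "v = \<sigma> (a m) (\<phi> (?r a, b))"
      by (auto simp: \<psi>_def)
    show "v \<in> V" using \<phi>in[OF b, of a] unfolding v V(1) \<sigma>_def by simp
  next
    fix v assume "v \<in> V"
    then have "\<exists>c. \<exists>u\<in>W. v = \<sigma> c u"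
    proof (unfold V(1), elim UnE)
      assume "v \<in> W"
      then show ?thesis by (intro exI[of _ 0] bexI[of _ v]) (simp_all add: \<sigma>_def)
    next
      assume "v \<in> \<tau> ` W"
      then obtain u where "u \<in> W" "v = \<tau> u" by blast
      then show ?thesis by (intro exI[of _ 1] bexI[of _ u]) (simp_all add: \<sigma>_def)
    qed
    then obtain c u where u: "u \<in> W" "v = \<sigma> c u" by blast
    then obtain e b where eb: "e \<in> cube m" "b \<in> B" "u = \<phi> (e, b)" unfolding \<phi>W[symmetric] by blast
    obtain a where a: "a \<in> cube (Suc m)" "?r a = e" "a m = c" by (rule cube_Suc_ex[OF eb(1)])
    have "v = \<psi> (a, b)" using u eb a by (simp add: \<psi>_def)
    then show "v \<in> \<psi> ` (cube (Suc m) \<times> B)" using a(1) eb(2) by blast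
  qed
  moreover have "\<psi> (a', b') \<in> nb (\<psi> (a, b)) \<longleftrightarrow> a = a' \<and> b' \<in> nb b \<or> cube_step (Suc m) a a' \<and> b = b'"
    if h: "a \<in> cube (Suc m)" "b \<in> B" "a' \<in> cube (Suc m)" "b' \<in> B" for a b a' b'
  proof -
    have 1: "\<psi> (a', b') \<in> nb (\<psi> (a, b)) \<longleftrightarrow>
      (if a m = a' m then \<phi> (?r a', b') \<in> nb (\<phi> (?r a, b)) else \<phi> (?r a', b') = \<phi> (?r a, b))"
      unfolding \<psi>_def prod.case by (rule \<sigma>n[OF \<phi>in[OF h(2)] \<phi>in[OF h(4)]])
    have 2: "\<phi> (?r a', b') \<in> nb (\<phi> (?r a, b)) \<longleftrightarrow>
      ?r a = ?r a' \<and> b' \<in> nb b \<or> cube_step m (?r a) (?r a') \<and> b = b'"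
      by (rule \<phi>n[OF cube_restrict h(2) cube_restrict h(4)])
    show ?thesis
      unfolding 1 2 \<phi>eq[OF h(4,2)] cube_step_Suc cube_Suc_eq[OF h(1,3)] by auto
  qed
  ultimately have "cube_iso V nb B (Suc m) \<psi>" unfolding cube_iso_def bij_betw_def by blast
  then show ?thesis by (rule exI[of _ \<psi>])
qed

lemma sub_nb_sub: "B \<subseteq> W \<Longrightarrow> sub_nb (sub_nb nb W) B = sub_nb nb B"
  by (auto simp: sub_nb_def fun_eq_iff)

lemma cube_iso_sub:
  assumes iso: "cube_iso W (sub_nb nb W) B m \<phi>" and B: "B \<subseteq> W"
  shows "cube_iso W nb B m \<phi>"
proof -
  have "\<phi> x \<in> W" if "x \<in> cube m \<times> B" for x
    using iso that unfolding cube_iso_def bij_betw_def by blast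
  then have "\<phi> (a', b') \<in> nb (\<phi> (a, b)) \<longleftrightarrow> \<phi> (a', b') \<in> sub_nb nb W (\<phi> (a, b))"
    "b' \<in> nb b \<longleftrightarrow> b' \<in> sub_nb nb W b"
    if "a \<in> cube m" "b \<in> B" "a' \<in> cube m" "b' \<in> B" for a b a' b'
    using that B by (auto simp: sub_nb_def)
  then show ?thesis using iso unfolding cube_iso_def by simp
qed

lemma card_cube_iso: "cube_iso V nb B m \<phi> \<Longrightarrow> card V = 2 ^ m * card B"
  using bij_betw_same_card[of \<phi> "cube m \<times> B" V]
  by (simp add: cube_iso_def card_cube card_cartesian_product)

text \<open>As many edges are split off as the eigenspace has dimensions; the rest \<open>B\<close>
  has the deficit as its degree and no eigenfunctions for 2.\<close>

definition cube_split :: "'a set \<Rightarrow> ('a \<Rightarrow> 'a set) \<Rightarrow> nat \<Rightarrow> 'a set \<Rightarrow> ((nat \<Rightarrow> bit) \<times> 'a \<Rightarrow> 'a) \<Rightarrow> bool" where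
  "cube_split V nb d B \<phi> \<longleftrightarrow> B \<subseteq> V \<and> fun_space.dim (eig2 V nb) \<le> d \<and>
    cd_graph B (sub_nb nb B) (d - fun_space.dim (eig2 V nb)) \<and>
    fun_space.dim (eig2 B (sub_nb nb B)) = 0 \<and> cube_iso V nb B (fun_space.dim (eig2 V nb)) \<phi>"

text \<open>Since its eigenspace is trivial, \<open>B\<close> admits no cut, so in degree at most
  two it is a point or a triangle.\<close>

lemma cube_split_card:
  assumes s: "cube_split V nb d B \<phi>" and d: "d \<le> fun_space.dim (eig2 V nb) + 2"
  shows "card V = 2 ^ d \<or> 4 * card V = 3 * 2 ^ d"
proof -
  define m where "m = fun_space.dim (eig2 V nb)"
  have md: "m \<le> d" and B: "cd_graph B (sub_nb nb B) (d - m)"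
    and 0: "fun_space.dim (eig2 B (sub_nb nb B)) = 0" and iso: "cube_iso V nb B m \<phi>"
    using s by (auto simp: cube_split_def m_def)
  interpret B: cd_graph B "sub_nb nb B" "d - m" by (rule B)
  have cV: "card V = 2 ^ m * card B" by (rule card_cube_iso[OF iso])
  have nocut: "\<not> B.is_cut S" for S using B.cut_dim 0 by blast
  consider "d = m" | "d = m + 1" | "d = m + 2" using md d unfolding m_def by linarith
  then show ?thesis
  proof cases
    case 1
    then have "card B = 1" using B.degree_0 by auto
    then show ?thesis using cV 1 by simp
  next
    case 2
    then show ?thesis using B.degree_1 nocut by simp
  next
    case 3
    then have "card B = 3" using B.degree_2 nocut by auto
    then show ?thesis using cV 3 by simp
  qed
qed

text \<open>The induction is strong because splitting off an edge leads to degree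
  \<open>d - 1\<close>, while the existence of that edge relies on sizes in degree
  \<open>d - 2\<close>.\<close>

theorem cube_splitting:
  assumes "cd_graph V nb d" "d \<le> fun_space.dim (eig2 V nb) + 3"
  shows "\<exists>B \<phi>. cube_split V nb d B \<phi>"
  using assms
proof (induction d arbitrary: V nb rule: less_induct)
  case (less d)
  interpret cd_graph V nb d by (rule less.prems)
  show ?case
  proof (cases "fun_space.dim E = 0")
    case True
    have sub: "sub_nb nb V = nb"
      using adjV by (auto simp: sub_nb_def fun_eq_iff)
    have "cube_iso V nb V 0 snd"
      unfolding cube_iso_def cube_0 by (auto simp: cube_step_0 bij_betw_def inj_on_def)
    then have "cube_split V nb d V snd"
      unfolding cube_split_def True sub using less.prems(1) by (simp add: True)
    then show ?thesis by blast
  next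
    case False
    \<comment> \<open>A nonzero \<open>E\<close> forces \<open>d > 0\<close>.\<close>
    have dd: "d - 2 < d" using False dim_E_le by linarith
    have "\<exists>f x. locmax f x \<and> card (down f x) = 1"
    proof (rule ex_one_block[OF False less.prems(2)])
      fix W assume W: "cd_graph W (sub_nb nb W) (d - 2)"
        "d - 2 \<le> fun_space.dim (eig2 W (sub_nb nb W)) + 2"
      then obtain B \<phi> where "cube_split W (sub_nb nb W) (d - 2) B \<phi>"
        using less.IH[OF dd W(1)] by auto
      then show "card W = 2 ^ (d - 2) \<or> 4 * card W = 3 * 2 ^ (d - 2)"
        using cube_split_card W(2) by blast
    qed
    then obtain f x where fx: "locmax f x" "card (down f x) = 1" by blast
    obtain W \<tau> where W: "W \<subseteq> V" "cd_graph W (sub_nb nb W) (d - 1)" "d \<ge> 1" "V = W \<union> \<tau> ` W"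
      "W \<inter> \<tau> ` W = {}" "inj_on \<tau> W"
      and nb\<tau>: "\<forall>u\<in>W. \<forall>v\<in>W. (\<tau> v \<in> nb (\<tau> u) \<longleftrightarrow> v \<in> nb u) \<and> (\<tau> v \<in> nb u \<longleftrightarrow> v = u)"
      and dim: "fun_space.dim E = Suc (fun_space.dim (eig2 W (sub_nb nb W)))"
      by (rule one_block[OF fx])
    let ?m = "fun_space.dim (eig2 W (sub_nb nb W))"
    have "d - 1 < d" "d - 1 \<le> ?m + 3" using W(3) less.prems(2) dim by linarith+
    then obtain B \<phi> where B: "cube_split W (sub_nb nb W) (d - 1) B \<phi>"
      using less.IH[OF _ W(2)] by blast
    then have BW: "B \<subseteq> W" by (simp add: cube_split_def)
    have md: "?m \<le> d - 1" and cdB: "cd_graph B (sub_nb nb B) (d - 1 - ?m)"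
      and 0: "fun_space.dim (eig2 B (sub_nb nb B)) = 0" and iso: "cube_iso W (sub_nb nb W) B ?m \<phi>"
      using B unfolding cube_split_def sub_nb_sub[OF BW] by simp_all
    obtain \<psi> where "cube_iso V nb B (Suc ?m) \<psi>"
      using cube_iso_double[OF cube_iso_sub[OF iso BW] W(4-6) nb\<tau> adj_comm] by blast
    moreover have "d - Suc ?m = d - 1 - ?m" "Suc ?m \<le> d" "B \<subseteq> V" using md W(1,3) BW by auto
    ultimately have "cube_split V nb d B \<psi>"
      unfolding cube_split_def dim using cdB 0 by simp
    then show ?thesis by blast
  qed
qed

section \<open>Sharp graphs have curvature at least two\<close>

context regular_graph
begin

text \<open>The argument of \<open>bform_E_zero\<close> for eigenvalue \<open>K\<close> and the form
  \<open>4 * \<Gamma>\<^sub>2 - 4 * K * \<Gamma>\<close>, which is \<open>bform\<close> plus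
  \<open>4 - 2 * K\<close> times \<open>grad\<close>.\<close>

lemma sharp_form_zero:
  assumes cd: "\<forall>f. \<forall>x\<in>V. 0 \<le> bform nb d x f f + (4 - 2 * K) * grad nb f f x"
    and f: "\<forall>x\<in>V. lap nb f x = - K * f x" and x: "x \<in> V"
  shows "bform nb d x f g + (4 - 2 * K) * grad nb f g x = 0"
proof -
  define Q where "Q f g = bform nb d x f g + (4 - 2 * K) * grad nb f g x" for f g
  have self: "bform nb d u f f + (4 - 2 * K) * grad nb f f u = lap nb (grad nb f f) u" if u: "u \<in> V" for u
  proof -
    have "grad nb f (lap nb f) u = - K * grad nb f f u"
      unfolding grad_def sum_distrib_left
      using u adjV by (intro sum.cong) (auto simp: f algebra_simps)
    then show ?thesis using bochner[OF u, of f f] by (simp add: algebra_simps)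
  qed
  have const: "grad nb f f u = grad nb f f x" if "u \<in> V" for u
  proof (rule subharmonic_const[where h = "grad nb f f", OF _ that x])
    show "0 \<le> lap nb (grad nb f f) w" if "w \<in> V" for w
      using cd that unfolding self[OF that, symmetric] by blast
  qed
  have "grad nb f f y - grad nb f f x = 0" if "y \<in> nb x" for y
    using const[of y] adjV[OF that] by simp
  then have "lap nb (grad nb f f) x = 0"
    unfolding lap_def by (intro sum.neutral ballI)
  then have Qf: "Q f f = 0" using self[OF x] by (simp add: Q_def)
  have add: "Q (\<lambda>x. f x + t * g x) h = Q f h + t * Q g h" for f g h and t
    by (simp add: Q_def bform_add grad_add algebra_simps)
  have comm: "Q f g = Q g f" for f g
    by (simp add: Q_def bform_comm[of x f g] grad_comm[of f g])
  have "Q f g = 0"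
  proof (rule quadratic_nonneg_linear_zero)
    fix t :: real
    define h where "h = (\<lambda>x. f x + t * g x)"
    have "Q h h = Q f h + t * Q g h" unfolding h_def by (rule add)
    also have "Q f h = Q f f + t * Q g f" unfolding comm[of f h] unfolding h_def by (rule add)
    also have "Q g h = Q f g + t * Q g g" unfolding comm[of g h] unfolding h_def by (rule add)
    finally have "Q h h = 2 * t * Q f g + t^2 * Q g g"
      using Qf comm[of g f] by (simp add: power2_eq_square algebra_simps)
    moreover have "0 \<le> Q h h" unfolding Q_def using cd x by blast
    ultimately show "0 \<le> 2 * t * Q f g + t^2 * Q g g" by simp
  qed
  then show ?thesis by (simp add: Q_def)
qed

text \<open>Test the vanishing form against the distance to \<open>x\<close>, truncated at 2.\<close>

lemma sharp_flow:
  fixes K :: real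
  assumes zero: "\<And>g. bform nb d x f g + (4 - 2 * K) * grad nb f g x = 0" and x: "x \<in> V"
  shows "(\<Sum>y\<in>nb x. (4 + card (nb y \<inter> nb x) - 2 * K) * (f y - f x)) = 0"
proof -
  define g where "g = (\<lambda>y. if y = x then 0 else if y \<in> nb x then 1 else (2::real))"
  define v where "v y = f y - f x" for y
  have gn: "g y = 1" if "y \<in> nb x" for y using that adj_irr by (auto simp: g_def)
  have gx: "g x = 0" by (simp add: g_def)
  have lg: "lap nb g x = d"
    unfolding lap_def using reg[OF x] by (simp add: gn gx)
  have gg: "grad nb f g x = lap nb f x"
    unfolding grad_def lap_def by (rule sum.cong) (simp_all add: gn gx)
  have inner: "(\<Sum>z\<in>nb y. (f z - 2 * f y + f x) * (g z - 2 * g y + g x)) =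
      4 * v y - (\<Sum>z\<in>nb y \<inter> nb x. v z - 2 * v y)" if y: "y \<in> nb x" for y
  proof -
    have "(\<Sum>z\<in>nb y. (f z - 2 * f y + f x) * (g z - 2 * g y + g x)) =
      (\<Sum>z\<in>insert x (nb y \<inter> nb x). (f z - 2 * f y + f x) * (g z - 2 * g y + g x))"
      by (rule sum.mono_neutral_right) (use y adj_sym[OF y] gn[OF y] gx in \<open>auto simp: g_def\<close>)
    also have "\<dots> = 4 * v y + (\<Sum>z\<in>nb y \<inter> nb x. (f z - 2 * f y + f x) * (g z - 2 * g y + g x))"
      by (subst sum.insert) (use adj_irr[of x] gn[OF y] gx in \<open>auto simp: v_def\<close>)
    also have "(\<Sum>z\<in>nb y \<inter> nb x. (f z - 2 * f y + f x) * (g z - 2 * g y + g x)) =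
      (\<Sum>z\<in>nb y \<inter> nb x. - (v z - 2 * v y))"
      by (rule sum.cong) (use gn y gx in \<open>auto simp: v_def\<close>)
    finally show ?thesis by (simp only: sum_negf)
  qed
  have "(\<Sum>y\<in>nb x. \<Sum>z\<in>nb y \<inter> nb x. v z) = (\<Sum>y\<in>nb x. \<Sum>z | z \<in> nb x \<and> z \<in> nb y. v z)"
    by (intro sum.cong) auto
  also have "\<dots> = (\<Sum>z\<in>nb x. \<Sum>y | y \<in> nb x \<and> z \<in> nb y. v z)"
    by (rule sum.swap_restrict) auto
  also have "\<dots> = (\<Sum>z\<in>nb x. card (nb z \<inter> nb x) * v z)"
  proof (rule sum.cong[OF refl])
    fix z
    have "{y. y \<in> nb x \<and> z \<in> nb y} = nb z \<inter> nb x" using adj_comm[of z] by blast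
    then show "(\<Sum>y | y \<in> nb x \<and> z \<in> nb y. v z) = card (nb z \<inter> nb x) * v z" by simp
  qed
  finally have swap: "(\<Sum>y\<in>nb x. \<Sum>z\<in>nb y \<inter> nb x. v z) = (\<Sum>y\<in>nb x. card (nb y \<inter> nb x) * v y)" .
  have lf: "lap nb f x = (\<Sum>y\<in>nb x. v y)" by (simp add: lap_def v_def)
  define D where "D = (\<Sum>y\<in>nb x. \<Sum>z\<in>nb y. (f z - 2 * f y + f x) * (g z - 2 * g y + g x))"
  have "0 = D - 2 * K * (\<Sum>y\<in>nb x. v y)"
    using zero[of g] unfolding bform_def lg gg lf D_def[symmetric] by (simp add: algebra_simps)
  also have "D = (\<Sum>y\<in>nb x. 4 * v y - (\<Sum>z\<in>nb y \<inter> nb x. v z - 2 * v y))"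
    unfolding D_def by (rule sum.cong[OF refl inner])
  also have "\<dots> = (\<Sum>y\<in>nb x. 4 * v y) - (\<Sum>y\<in>nb x. \<Sum>z\<in>nb y \<inter> nb x. v z)
      + 2 * (\<Sum>y\<in>nb x. card (nb y \<inter> nb x) * v y)"
  proof -
    have "(\<Sum>y\<in>nb x. 4 * v y - (\<Sum>z\<in>nb y \<inter> nb x. v z - 2 * v y)) =
      (\<Sum>y\<in>nb x. 4 * v y - (\<Sum>z\<in>nb y \<inter> nb x. v z) + 2 * (card (nb y \<inter> nb x) * v y))"
      by (rule sum.cong) (simp_all add: sum_subtractf)
    then show ?thesis by (simp only: sum.distrib sum_subtractf sum_distrib_left)
  qed
  also have "(\<Sum>y\<in>nb x. 4 * v y) - (\<Sum>y\<in>nb x. \<Sum>z\<in>nb y \<inter> nb x. v z)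
      + 2 * (\<Sum>y\<in>nb x. card (nb y \<inter> nb x) * v y) - 2 * K * (\<Sum>y\<in>nb x. v y) =
      (\<Sum>y\<in>nb x. 4 * v y + card (nb y \<inter> nb x) * v y - 2 * K * v y)"
  proof -
    have "(\<Sum>y\<in>nb x. 4 * v y + card (nb y \<inter> nb x) * v y - 2 * K * v y) =
      (\<Sum>y\<in>nb x. 4 * v y) + (\<Sum>y\<in>nb x. card (nb y \<inter> nb x) * v y) - 2 * K * (\<Sum>y\<in>nb x. v y)"
      by (simp only: sum.distrib sum_subtractf sum_distrib_left)
    then show ?thesis unfolding swap by linarith
  qed
  also have "\<dots> = (\<Sum>y\<in>nb x. (4 + card (nb y \<inter> nb x) - 2 * K) * v y)"
    by (rule sum.cong) (simp_all add: algebra_simps)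
  finally show ?thesis by (simp add: v_def)
qed

text \<open>For \<open>K < 2\<close> all weights in \<open>sharp_flow\<close> are positive, and at a
  maximum all increments have the same sign, so \<open>f\<close> is flat there and the eigenvalue
  equation gives 0.\<close>

lemma sharp_at_max:
  assumes cd: "\<forall>f. \<forall>x\<in>V. 0 \<le> bform nb d x f f + (4 - 2 * K) * grad nb f f x"
    and f: "\<forall>x\<in>V. lap nb f x = - K * f x" and K: "0 < K" "K < 2"
    and x: "x \<in> V" and max: "\<And>y. y \<in> V \<Longrightarrow> f y \<le> f x"
  shows "f x = 0"
proof -
  have "(\<Sum>y\<in>nb x. (4 + card (nb y \<inter> nb x) - 2 * K) * (f y - f x)) = 0"
    by (rule sharp_flow[OF _ x], rule sharp_form_zero[OF cd f x])
  moreover have "(\<Sum>y\<in>nb x. (4 + card (nb y \<inter> nb x) - 2 * K) * (f x - f y)) =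
      (\<Sum>y\<in>nb x. - ((4 + card (nb y \<inter> nb x) - 2 * K) * (f y - f x)))"
    by (rule sum.cong) (simp_all add: algebra_simps)
  ultimately have "(\<Sum>y\<in>nb x. (4 + card (nb y \<inter> nb x) - 2 * K) * (f x - f y)) = 0"
    by (simp only: sum_negf)
  moreover have pos: "4 + real (card (nb y \<inter> nb x)) - 2 * K > 0" for y
    using K(2) of_nat_0_le_iff[of "card (nb y \<inter> nb x)", where 'a = real] by linarith
  moreover have "(4 + card (nb y \<inter> nb x) - 2 * K) * (f x - f y) \<ge> 0" if "y \<in> nb x" for y
    using pos[of y] max[of y] adjV[OF that] by simp
  ultimately have "\<forall>y\<in>nb x. (4 + card (nb y \<inter> nb x) - 2 * K) * (f x - f y) = 0"
    by (subst (asm) sum_nonneg_eq_0_iff) auto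
  then have "f y - f x = 0" if "y \<in> nb x" for y
    using pos[of y] that by auto
  then have "lap nb f x = 0" by (simp add: lap_def)
  then show ?thesis using f x K(1) by simp
qed

text \<open>If \<open>K < 2\<close>, the maxima of \<open>f\<close> and of \<open>- f\<close> are
  both 0, so \<open>f\<close> vanishes.\<close>

lemma sharp_ge_2:
  assumes cd: "\<forall>f. \<forall>x\<in>V. 0 \<le> bform nb d x f f + (4 - 2 * K) * grad nb f f x"
    and f: "\<forall>x\<in>V. lap nb f x = - K * f x" and K: "0 < K" and z: "z \<in> V" "f z \<noteq> 0"
  shows "2 \<le> K"
proof (rule ccontr)
  assume "\<not> 2 \<le> K"
  then have K2: "K < 2" by simp
  have le: "h z \<le> 0" if h: "\<forall>x\<in>V. lap nb h x = - K * h x" for h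
  proof -
    obtain x where x: "x \<in> V" "\<And>y. y \<in> V \<Longrightarrow> h y \<le> h x"
      using obtains_MAX[OF finV V_ne, of h] finV Max_ge by (metis finite_imageI imageI)
    then show ?thesis using sharp_at_max[OF cd h K K2 x] x(2)[OF z(1)] by simp
  qed
  have "lap nb (\<lambda>x. - f x) x = - lap nb f x" for x
    by (simp add: lap_def sum_subtractf sum_negf)
  then have "- f z \<le> 0" using f by (intro le) simp
  moreover have "f z \<le> 0" by (rule le[OF f])
  ultimately show False using z(2) by simp
qed

end

section \<open>From pair graphs to neighbourhood functions\<close>

definition nbh :: "'a pair_pre_digraph \<Rightarrow> 'a \<Rightarrow> 'a set" where
  "nbh G x = {y. (x, y) \<in> parcs G}"

lemma laplacian_lap: "laplacian G = lap (nbh G)"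
  by (simp add: fun_eq_iff laplacian_def lap_def nbh_def)

lemma Gam_grad: "Gam G f g = (\<lambda>x. grad (nbh G) f g x / 2)"
proof
  fix x
  have "grad (nbh G) f g x = (\<Sum>y\<in>nbh G x. (f y * g y - f x * g x) - f x * (g y - g x) - g x * (f y - f x))"
    unfolding grad_def by (rule sum.cong) (simp_all add: algebra_simps)
  then have "grad (nbh G) f g x =
      lap (nbh G) (\<lambda>y. f y * g y) x - f x * lap (nbh G) g x - g x * lap (nbh G) f x"
    unfolding lap_def sum_distrib_left by (simp only: sum_subtractf)
  then show "Gam G f g x = grad (nbh G) f g x / 2" by (simp add: Gam_def laplacian_lap)
qed

lemma (in regular_graph) Gam2_bform:
  assumes nb: "nb = nbh G" and x: "x \<in> V"
  shows "4 * Gam2 G f f x = bform nb d x f f + 4 * grad nb f f x"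
proof -
  have "lap nb (\<lambda>x. grad nb f f x / 2) x = lap nb (grad nb f f) x / 2"
    by (simp add: lap_def sum_divide_distrib diff_divide_distrib)
  then have "4 * Gam2 G f f x = lap nb (grad nb f f) x - grad nb f (lap nb f) x - grad nb f (lap nb f) x"
    unfolding Gam2_def Gam_grad laplacian_lap nb[symmetric] by simp
  then show ?thesis using bochner[OF x, of f f] by simp
qed

lemma regular_graph_of_pair_graph:
  assumes G: "pair_graph G" and con: "Digraph_Component.connected (with_proj G)"
    and deg: "\<forall>x \<in> pverts G. out_degree (with_proj G) x = d"
  shows "regular_graph (pverts G) (nbh G) d"
proof -
  interpret G: pair_graph G by (rule G)
  have sc: "strongly_connected (with_proj G)"
    by (rule G.symmetric_connected_imp_strongly_connected[OF G.sym_arcs con])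
  show ?thesis
  proof
    show "finite (pverts G)" by (rule G.pair_finite_verts)
    show "pverts G \<noteq> {}" using sc by (simp add: strongly_connected_def)
    show "x \<in> pverts G \<and> y \<in> pverts G" if "y \<in> nbh G x" for x y
      using that G.wellformed'[of x y] by (simp add: nbh_def)
    show "x \<in> nbh G y" if "y \<in> nbh G x" for x y
      using that G.sym_arcs unfolding symmetric_def sym_def nbh_def by simp
    show "x \<notin> nbh G x" for x
      using G.pair_no_loops[of "(x, x)"] by (auto simp: nbh_def)
    show "card (nbh G x) = d" if "x \<in> pverts G" for x
    proof -
      have "out_arcs (with_proj G) x = Pair x ` nbh G x"
        by (auto simp: out_arcs_def nbh_def)
      then have "out_degree (with_proj G) x = card (nbh G x)"
        by (simp add: out_degree_def card_image inj_on_def)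
      then show ?thesis using deg that by simp
    qed
    show "S = pverts G"
      if S: "S \<subseteq> pverts G" "S \<noteq> {}" and cl: "\<And>x y. x \<in> S \<Longrightarrow> y \<in> nbh G x \<Longrightarrow> y \<in> S" for S
    proof (intro equalityI S subsetI)
      fix v assume v: "v \<in> pverts G"
      obtain u where u: "u \<in> S" using S(2) by blast
      have "u \<rightarrow>\<^sup>*\<^bsub>with_proj G\<^esub> v"
        using sc u v S(1) by (auto simp: strongly_connected_def)
      then show "v \<in> S"
      proof (induction rule: G.reachable_induct)
        case base
        show ?case by (rule u)
      next
        case (step x y)
        then have "(x, y) \<in> parcs G" by (auto simp: arcs_ends_def arc_to_ends_def)
        then show ?case using cl[OF step.IH] by (simp add: nbh_def)
      qed
    qed
  qed
qed

text \<open>An infinite set of eigenvalues would make the sum in \<open>spectrum\<close> the empty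
  multiset, so that case is trivial.\<close>

lemma spectrum_eigenvalues: "\<mu> \<in> set (spectrum G) \<Longrightarrow> \<mu> \<in> eigenvalues G"
proof (cases "finite (eigenvalues G)")
  case True
  assume "\<mu> \<in> set (spectrum G)"
  then have "\<mu> \<in># (\<Sum>\<mu>\<in>eigenvalues G. replicate_mset (eigenvalue_mult G \<mu>) \<mu>)"
    by (simp add: spectrum_def)
  then show ?thesis using True by (auto simp: set_mset_sum in_replicate_mset split: if_splits)
qed (simp add: spectrum_def)

text \<open>The entry of index 1 of the spectrum is an eigenvalue equal to the curvature constant
  \<open>K\<close>; an eigenfunction for it gives \<open>2 \<le> K\<close>, and lowering the
  constant to 2 preserves the curvature condition.\<close>

lemma cd_graph_of_sharp:
  assumes G: "pair_graph G" and con: "Digraph_Component.connected (with_proj G)"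
    and deg: "\<forall>x \<in> pverts G. out_degree (with_proj G) x = d" and sharp: "lichnerowicz_sharp G"
  shows "cd_graph (pverts G) (nbh G) d"
proof -
  interpret regular_graph "pverts G" "nbh G" d by (rule regular_graph_of_pair_graph[OF G con deg])
  obtain K where K: "K > 0" "CD_inf G K" "1 < length (spectrum G)" "spectrum G ! 1 = K"
    using sharp unfolding lichnerowicz_sharp_def by blast
  have cdK: "0 \<le> bform (nbh G) d x f f + (4 - 2 * K) * grad (nbh G) f f x" if "x \<in> pverts G" for f x
  proof -
    have "K * Gam G f f x \<le> Gam2 G f f x" using K(2) that by (simp add: CD_inf_def)
    then show ?thesis using Gam2_bform[OF refl that, of f] by (simp add: Gam_grad algebra_simps)
  qed
  have "K \<in> eigenvalues G" using spectrum_eigenvalues nth_mem[OF K(3)] K(4) by metis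
  then obtain f where f: "f \<in> eigenspace G K" "f \<noteq> 0" unfolding eigenvalues_def by blast
  then obtain z where z: "f z \<noteq> 0" by (auto simp: fun_eq_iff)
  then have zV: "z \<in> pverts G" using f(1) unfolding eigenspace_def by blast
  have "lap (nbh G) f x = - K * f x" if "x \<in> pverts G" for x
  proof -
    have "- lap (nbh G) f x = K * f x"
      using f(1) that by (simp add: eigenspace_def laplacian_lap)
    then show ?thesis by linarith
  qed
  then have eig: "\<forall>x\<in>pverts G. lap (nbh G) f x = - K * f x" by blast
  have "\<forall>f. \<forall>x\<in>pverts G. 0 \<le> bform (nbh G) d x f f + (4 - 2 * K) * grad (nbh G) f f x"
    using cdK by blast
  then have K2: "2 \<le> K" using sharp_ge_2 eig K(1) zV z by blast
  show ?thesis
  proof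
    fix x f assume x: "x \<in> pverts G"
    have "0 \<le> grad (nbh G) f f x" by (simp add: grad_def sum_nonneg)
    then have "(4 - 2 * K) * grad (nbh G) f f x \<le> 0" using K2 by (intro mult_nonpos_nonneg) auto
    then show "0 \<le> bform (nbh G) d x f f" using cdK[OF x, of f] by linarith
  qed
qed

lemma eigenspace_eig2: "eigenspace G 2 = eig2 (pverts G) (nbh G)"
proof -
  have "- a = 2 * b \<longleftrightarrow> a = - (2 * b)" for a b :: real by linarith
  then show ?thesis by (simp add: eigenspace_def eig2_def laplacian_lap)
qed

section \<open>Identification of the graphs\<close>

lemma pair_graph_wf: "pair_graph G \<Longrightarrow> pair_wf_digraph G"
proof -
  assume "pair_graph G"
  then interpret pair_graph G .
  show ?thesis by unfold_locales
qed

lemma hypercube_cube: "pverts (hypercube m) = cube m"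
  "(a, a') \<in> parcs (hypercube m) \<longleftrightarrow> a \<in> cube m \<and> a' \<in> cube m \<and> cube_step m a a'"
  by (simp_all add: hypercube_def cube_def cube_step_def)

text \<open>Kept apart from \<open>cube_iso_prod\<close> so that no one-vertex factor appears in the
  result.\<close>

lemma cube_iso_point:
  assumes G: "pair_graph G" and iso: "cube_iso (pverts G) (nbh G) {b} m \<phi>"
  shows "G \<cong> hypercube m"
proof -
  define \<psi> where "\<psi> = the_inv_into (cube m \<times> {b}) \<phi>"
  have bij: "bij_betw \<phi> (cube m \<times> {b}) (pverts G)"
    and nb: "\<And>a a'. a \<in> cube m \<Longrightarrow> a' \<in> cube m \<Longrightarrow>
      \<phi> (a', b) \<in> nbh G (\<phi> (a, b)) \<longleftrightarrow> a = a' \<and> b \<in> nbh G b \<or> cube_step m a a'"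
    using iso unfolding cube_iso_def by auto
  interpret G: pair_graph G by (rule G)
  have irr: "b \<notin> nbh G b"
    using G.pair_no_loops[of "(b, b)"] by (auto simp: nbh_def)
  have inv: "bij_betw \<psi> (pverts G) (cube m \<times> {b})"
    unfolding \<psi>_def by (rule bij_betw_the_inv_into[OF bij])
  have \<phi>\<psi>: "\<phi> (\<psi> x) = x" "fst (\<psi> x) \<in> cube m" "\<psi> x = (fst (\<psi> x), b)" if "x \<in> pverts G" for x
  proof -
    show "\<phi> (\<psi> x) = x" unfolding \<psi>_def by (rule f_the_inv_into_f_bij_betw[OF bij]) (use that in simp)
    have "\<psi> x \<in> cube m \<times> {b}" using inv that by (auto simp: bij_betw_def)
    then show "fst (\<psi> x) \<in> cube m" "\<psi> x = (fst (\<psi> x), b)" by auto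
  qed
  have "bij_betw fst (cube m \<times> {b}) (cube m)" by (auto simp: bij_betw_def inj_on_def)
  then have "bij_betw (fst \<circ> \<psi>) (pverts G) (cube m)" by (rule bij_betw_trans[OF inv])
  moreover have "(x, y) \<in> parcs G \<longleftrightarrow> ((fst \<circ> \<psi>) x, (fst \<circ> \<psi>) y) \<in> parcs (hypercube m)"
    if "x \<in> pverts G" "y \<in> pverts G" for x y
    using nb[OF \<phi>\<psi>(2)[OF that(1)] \<phi>\<psi>(2)[OF that(2)]] \<phi>\<psi>[OF that(1)] \<phi>\<psi>[OF that(2)] irr
    by (simp add: hypercube_cube nbh_def)
  ultimately show ?thesis
    unfolding graph_iso_iff[OF pair_graph_wf[OF G] pair_graph_wf[OF pair_graph_hypercube]]
      hypercube_cube(1) by blast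
qed

lemma cube_iso_prod:
  assumes G: "pair_graph G" and H: "pair_graph H" and iso: "cube_iso (pverts G) (nbh G) B m \<phi>"
    and \<beta>: "bij_betw \<beta> B (pverts H)"
    and adj: "\<And>b b'. b \<in> B \<Longrightarrow> b' \<in> B \<Longrightarrow> (\<beta> b, \<beta> b') \<in> parcs H \<longleftrightarrow> b' \<in> nbh G b"
  shows "G \<cong> hypercube m \<box> H"
proof -
  define \<psi> where "\<psi> = the_inv_into (cube m \<times> B) \<phi>"
  have bij: "bij_betw \<phi> (cube m \<times> B) (pverts G)"
    and nb: "\<And>a b a' b'. a \<in> cube m \<Longrightarrow> b \<in> B \<Longrightarrow> a' \<in> cube m \<Longrightarrow> b' \<in> B \<Longrightarrow>
      \<phi> (a', b') \<in> nbh G (\<phi> (a, b)) \<longleftrightarrow> a = a' \<and> b' \<in> nbh G b \<or> cube_step m a a' \<and> b = b'"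
    using iso unfolding cube_iso_def by auto
  have inv: "bij_betw \<psi> (pverts G) (cube m \<times> B)"
    unfolding \<psi>_def by (rule bij_betw_the_inv_into[OF bij])
  have \<psi>in: "fst (\<psi> x) \<in> cube m" "snd (\<psi> x) \<in> B" if "x \<in> pverts G" for x
  proof -
    have "\<psi> x \<in> cube m \<times> B" using inv that by (auto simp: bij_betw_def)
    then show "fst (\<psi> x) \<in> cube m" "snd (\<psi> x) \<in> B" by auto
  qed
  have \<phi>\<psi>: "\<phi> (fst (\<psi> x), snd (\<psi> x)) = x" if "x \<in> pverts G" for x
    using f_the_inv_into_f_bij_betw[OF bij] that by (simp add: \<psi>_def)
  define \<theta> where "\<theta> = map_prod id \<beta> \<circ> \<psi>"
  have "bij_betw (map_prod id \<beta>) (cube m \<times> B) (cube m \<times> pverts H)"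
    by (rule bij_betw_map_prod[OF bij_betw_id \<beta>])
  then have "bij_betw \<theta> (pverts G) (pverts (hypercube m \<box> H))"
    unfolding \<theta>_def by (simp add: cart_prod_def hypercube_cube bij_betw_trans[OF inv])
  moreover have "(x, y) \<in> parcs G \<longleftrightarrow> (\<theta> x, \<theta> y) \<in> parcs (hypercube m \<box> H)"
    if "x \<in> pverts G" "y \<in> pverts G" for x y
  proof -
    let ?a = "fst (\<psi> x)" and ?b = "snd (\<psi> x)" and ?a' = "fst (\<psi> y)" and ?b' = "snd (\<psi> y)"
    note in' = \<psi>in[OF that(1)] \<psi>in[OF that(2)]
    have "(x, y) \<in> parcs G \<longleftrightarrow> y \<in> nbh G x" by (simp add: nbh_def)
    also have "\<dots> \<longleftrightarrow> ?a = ?a' \<and> ?b' \<in> nbh G ?b \<or> cube_step m ?a ?a' \<and> ?b = ?b'"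
      using nb[OF in'(1,2) in'(3,4)] \<phi>\<psi>[OF that(1)] \<phi>\<psi>[OF that(2)] by simp
    also have "\<dots> \<longleftrightarrow> ?a = ?a' \<and> (\<beta> ?b, \<beta> ?b') \<in> parcs H \<or> cube_step m ?a ?a' \<and> \<beta> ?b = \<beta> ?b'"
      using adj[OF in'(2,4)] inj_on_eq_iff[OF bij_betw_imp_inj_on[OF \<beta>] in'(2,4)] by simp
    also have "\<dots> \<longleftrightarrow> (\<theta> x, \<theta> y) \<in> parcs (hypercube m \<box> H)"
    proof -
      have "\<theta> x = (?a, \<beta> ?b)" "\<theta> y = (?a', \<beta> ?b')"
        by (simp_all add: \<theta>_def map_prod_def split_beta)
      moreover have "\<beta> ?b \<in> pverts H" "\<beta> ?b' \<in> pverts H" using \<beta> in' by (auto simp: bij_betw_def)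
      ultimately show ?thesis
        using in' by (auto simp: cart_prod_def hypercube_cube)
    qed
    finally show ?thesis .
  qed
  ultimately show ?thesis
    unfolding graph_iso_iff[OF pair_graph_wf[OF G] pair_graph_wf[OF pair_graph_cart_prod[OF pair_graph_hypercube H]]]
    by blast
qed

lemma pair_graph_complete: "pair_graph (complete_graph n)"
proof
  show "finite (parcs (complete_graph n))"
    by (rule finite_subset[of _ "{..<n} \<times> {..<n}"]) (auto simp: complete_graph_def)
qed (auto simp: complete_graph_def symmetric_def sym_def)

lemma pair_graph_complete_bipartite: "pair_graph (complete_bipartite_graph m n)"
proof
  show "finite (parcs (complete_bipartite_graph m n))"
    by (simp add: complete_bipartite_graph_def)
qed (auto simp: complete_bipartite_graph_def symmetric_def sym_def)

lemma complete_prod: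
  assumes G: "pair_graph G" and iso: "cube_iso (pverts G) (nbh G) B m \<phi>"
    and n: "card B = n" "n \<noteq> 0" and B: "\<And>v. v \<in> B \<Longrightarrow> sub_nb (nbh G) B v = B - {v}"
  shows "G \<cong> hypercube m \<box> complete_graph n"
proof -
  have "finite B" using n by (metis card.infinite)
  then obtain \<beta> where \<beta>: "bij_betw \<beta> B {..<n}"
    using n(1) finite_same_card_bij[of B "{..<n}"] by auto
  show ?thesis
  proof (rule cube_iso_prod[OF G pair_graph_complete iso])
    show "bij_betw \<beta> B (pverts (complete_graph n))" using \<beta> by (simp add: complete_graph_def)
    fix b b' assume b: "b \<in> B" "b' \<in> B"
    have "b' \<in> nbh G b \<longleftrightarrow> b' \<in> sub_nb (nbh G) B b" using b by (simp add: sub_nb_def)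
    also have "\<dots> \<longleftrightarrow> b' \<noteq> b" using B[OF b(1)] b(2) by simp
    also have "\<dots> \<longleftrightarrow> \<beta> b \<noteq> \<beta> b'" using inj_on_eq_iff[OF bij_betw_imp_inj_on[OF \<beta>] b] by auto
    moreover have "\<beta> b < n" "\<beta> b' < n" using \<beta> b by (auto simp: bij_betw_def)
    ultimately show "(\<beta> b, \<beta> b') \<in> parcs (complete_graph n) \<longleftrightarrow> b' \<in> nbh G b"
      by (simp add: complete_graph_def)
  qed
qed

lemma complete_bipartite_prod:
  assumes G: "pair_graph G" and iso: "cube_iso (pverts G) (nbh G) B m \<phi>"
    and XY: "B = X \<union> Y" "X \<inter> Y = {}" "card X = n" "card Y = n" "n \<noteq> 0"
    and X: "\<And>v. v \<in> X \<Longrightarrow> sub_nb (nbh G) B v = Y" and Y: "\<And>v. v \<in> Y \<Longrightarrow> sub_nb (nbh G) B v = X"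
  shows "G \<cong> hypercube m \<box> complete_bipartite_graph n n"
proof -
  have "finite X" "finite Y" using XY by (metis card.infinite)+
  then obtain p q where p: "bij_betw p X {..<n}" and q: "bij_betw q Y {..<n}"
    using XY(3,4) finite_same_card_bij[of X "{..<n}"] finite_same_card_bij[of Y "{..<n}"] by auto
  define \<beta> where "\<beta> b = (if b \<in> X then Inl (p b) else Inr (q b))" for b
  have \<beta>X: "\<beta> b = Inl (p b)" "p b < n" if "b \<in> X" for b
    using that p by (auto simp: \<beta>_def bij_betw_def)
  have \<beta>Y: "\<beta> b = Inr (q b)" "q b < n" if "b \<in> Y" for b
    using that q XY(2) by (auto simp: \<beta>_def bij_betw_def)
  have "bij_betw \<beta> X (Inl ` {..<n})"
    using bij_betw_trans[OF p, of Inl] inj_on_imp_bij_betw[of Inl "{..<n}"]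
    by (subst bij_betw_cong[of _ _ "Inl \<circ> p"]) (simp_all add: \<beta>X)
  moreover have "bij_betw \<beta> Y (Inr ` {..<n})"
    using bij_betw_trans[OF q, of Inr] inj_on_imp_bij_betw[of Inr "{..<n}"]
    by (subst bij_betw_cong[of _ _ "Inr \<circ> q"]) (simp_all add: \<beta>Y)
  ultimately have \<beta>: "bij_betw \<beta> B ({..<n} <+> {..<n})"
    unfolding XY(1) Plus_def by (rule bij_betw_combine) auto
  show ?thesis
  proof (rule cube_iso_prod[OF G pair_graph_complete_bipartite iso])
    show "bij_betw \<beta> B (pverts (complete_bipartite_graph n n))"
      using \<beta> by (simp add: complete_bipartite_graph_def)
    fix b b' assume b: "b \<in> B" "b' \<in> B"
    have nb: "b' \<in> nbh G b \<longleftrightarrow> b' \<in> sub_nb (nbh G) B b" using b by (simp add: sub_nb_def)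
    have "b \<in> X \<or> b \<in> Y" "b' \<in> X \<or> b' \<in> Y" using b XY(1) by auto
    then show "(\<beta> b, \<beta> b') \<in> parcs (complete_bipartite_graph n n) \<longleftrightarrow> b' \<in> nbh G b"
    proof (elim disjE)
      assume c: "b \<in> X" "b' \<in> X"
      then have "b' \<notin> Y" using XY(2) by blast
      then show ?thesis unfolding nb X[OF c(1)] by (auto simp: complete_bipartite_graph_def \<beta>X[OF c(1)] \<beta>X[OF c(2)])
    next
      assume c: "b \<in> X" "b' \<in> Y"
      then show ?thesis unfolding nb X[OF c(1)] by (auto simp: complete_bipartite_graph_def \<beta>X[OF c(1)] \<beta>Y[OF c(2)])
    next
      assume c: "b \<in> Y" "b' \<in> X"
      then show ?thesis unfolding nb Y[OF c(1)] by (auto simp: complete_bipartite_graph_def \<beta>Y[OF c(1)] \<beta>X[OF c(2)])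
    next
      assume c: "b \<in> Y" "b' \<in> Y"
      then have "b' \<notin> X" using XY(2) by blast
      then show ?thesis unfolding nb Y[OF c(1)] by (auto simp: complete_bipartite_graph_def \<beta>Y[OF c(1)] \<beta>Y[OF c(2)])
    qed
  qed
qed

theorem theorem1p4:
  fixes G :: "'a pair_pre_digraph" and d :: nat
  assumes "pair_graph G"
    and "Digraph_Component.connected (with_proj G)"
    and "\<forall>x \<in> pverts G. out_degree (with_proj G) x = d"
    and "lichnerowicz_sharp G"
  shows "(int (eigenvalue_mult G 2) \<ge> int d - 1 \<longrightarrow> G \<cong> hypercube d)
    \<and> (int (eigenvalue_mult G 2) = int d - 2 \<longrightarrow> G \<cong> hypercube (d - 2) \<box> complete_graph 3)
    \<and> (int (eigenvalue_mult G 2) = int d - 3 \<longrightarrow>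
        G \<cong> hypercube (d - 3) \<box> complete_graph 4
        \<or> G \<cong> hypercube (d - 3) \<box> complete_bipartite_graph 3 3)"
proof (cases "d \<le> eigenvalue_mult G 2 + 3")
  case False
  then have "\<not> int (eigenvalue_mult G 2) \<ge> int d - 1" "int (eigenvalue_mult G 2) \<noteq> int d - 2"
    "int (eigenvalue_mult G 2) \<noteq> int d - 3" by linarith+
  then show ?thesis by blast
next
  case True
  interpret cd_graph "pverts G" "nbh G" d by (rule cd_graph_of_sharp[OF assms])
  define m where "m = eigenvalue_mult G 2"
  have mE: "fun_space.dim E = m" by (simp add: m_def eigenvalue_mult_def eigenspace_eig2)
  obtain B \<phi> where "cube_split (pverts G) (nbh G) d B \<phi>"
    using cube_splitting[OF cd_graph_axioms] True mE m_def by auto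
  then have md: "m \<le> d" and cdB: "cd_graph B (sub_nb (nbh G) B) (d - m)"
    and dB: "fun_space.dim (eig2 B (sub_nb (nbh G) B)) = 0" and iso: "cube_iso (pverts G) (nbh G) B m \<phi>"
    unfolding cube_split_def mE by blast+
  interpret B: cd_graph B "sub_nb (nbh G) B" "d - m" by (rule cdB)
  have nocut: "\<not> (\<exists>S. B.is_cut S)" using B.cut_dim dB by blast
  \<comment> \<open>A remaining factor of degree one would be an edge, which has a cut. So
    multiplicity \<open>d - 1\<close> does not occur, and the premise of the first case amounts to
    \<open>d = m\<close>.\<close>
  have k1: "d \<noteq> m + 1" using B.degree_1 nocut by auto
  have k0: "G \<cong> hypercube d" if "d = m"
  proof -
    have "d - m = 0" using that by simp
    then obtain b where "B = {b}" using B.degree_0 by blast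
    then show ?thesis using cube_iso_point[OF assms(1), of b m \<phi>] iso that by simp
  qed
  have k2: "G \<cong> hypercube m \<box> complete_graph 3" if "d = m + 2"
  proof -
    have "card B = 3" "\<forall>v\<in>B. sub_nb (nbh G) B v = B - {v}"
      using B.degree_2 nocut that by auto
    then show ?thesis by (intro complete_prod[OF assms(1) iso]) auto
  qed
  have k3: "G \<cong> hypercube m \<box> complete_graph 4 \<or> G \<cong> hypercube m \<box> complete_bipartite_graph 3 3"
    if "d = m + 3"
  proof -
    have d3: "d - m = 3" using that by simp
    from B.degree_3[OF d3] show ?thesis
    proof (elim disjE)
      assume "card B = 4 \<and> (\<forall>v\<in>B. sub_nb (nbh G) B v = B - {v})"
      then have "G \<cong> hypercube m \<box> complete_graph 4"
        by (intro complete_prod[OF assms(1) iso]) auto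
      then show ?thesis ..
    next
      assume "\<exists>X Y. B = X \<union> Y \<and> X \<inter> Y = {} \<and> card X = 3 \<and> card Y = 3 \<and>
        (\<forall>v\<in>X. sub_nb (nbh G) B v = Y) \<and> (\<forall>v\<in>Y. sub_nb (nbh G) B v = X)"
      then obtain X Y where XY: "B = X \<union> Y" "X \<inter> Y = {}" "card X = 3" "card Y = 3"
        "\<forall>v\<in>X. sub_nb (nbh G) B v = Y" "\<forall>v\<in>Y. sub_nb (nbh G) B v = X" by blast
      have "G \<cong> hypercube m \<box> complete_bipartite_graph 3 3"
        by (rule complete_bipartite_prod[OF assms(1) iso XY(1-4)])
          (simp, erule XY(5)[rule_format], erule XY(6)[rule_format])
      then show ?thesis ..
    next
      assume "\<exists>S. B.is_cut S"
      then show ?thesis using nocut by contradiction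
    qed
  qed
  have "d = m" if "int m \<ge> int d - 1" using that md k1 by linarith
  \<comment> \<open>In the last two cases \<open>d\<close> is at least 2 or 3 because
    \<open>m\<close> is a natural number, so the truncated differences are exact.\<close>
  moreover have "d = m + 2" "d - 2 = m" if "int m = int d - 2" using that by linarith+
  moreover have "d = m + 3" "d - 3 = m" if "int m = int d - 3" using that by linarith+
  ultimately show ?thesis using k0 k2 k3 unfolding m_def[symmetric] by metis
qed

end
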